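(* Let $R$ be a noetherian ring, $I$ an ideal of $R$, $M$ a finitely generated $R$-module, and $f\in I^s\setminus I^{s+1}$. The following two conditions are equivalent: $( * )$ the natural epimorphism $G(M)/\bar f\,G(M)\to G(M/fM)$ is an isomorphism between components of large degree (i.e. there is $n_0$ such that it is an isomorphism in degree $n$ for all $n\ge n_0$); $( ** )$ $\operatorname{Ass}(\mathcal{B}(M)_{(f)^\#})\cap\operatorname{Supp}(\mathcal{E}_I)=\emptyset$.
   Context: For a finitely generated $R$-module $N$, $G(N)=\bigoplus_{n\ge 0} I^nN/I^{n+1}N$, a graded module over $G(R)=\bigoplus_{n\ge 0} I^n/I^{n+1}$. $\bar f$ is the class of $f$ in $I^s/I^{s+1}=G(R)_s$. The natural graded map $G(M)\to G(M/fM)$ is surjective and kills $\bar f\,G(M)$, hence induces the epimorphism $G(M)/\bar f\,G(M)\to G(M/fM)$. $B(R)=R[It]=\bigoplus_{n\ge 0} I^nt^n$ (with $I^0=R$), graded by powers of $t$; $S_I=\operatorname{Proj} B(R)$ is the blowup of $I$ in $\operatorname{Spec} R$. The exceptional divisor $\mathcal{E}_I\subset S_I$ is the closed subscheme defined by the homogeneous ideal $I\cdot B(R)$. $\mathcal{B}(M)$ is the $\mathcal{O}_{S_I}$-module associated to the graded module $B(M)=\bigoplus_{n\ge 0} I^nM\,t^n$. The weak transform $(f)^\#$ is the closed subscheme of $S_I$ defined by the homogeneous ideal $ft^sB(R)$ (equivalently, if $h_0,\dots,h_r$ generate $I$, it is defined by $f/h_i^s$ in the chart $D_+(h_it)\cong\operatorname{Spec}R[I/h_i]$),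 and $\mathcal{B}(M)_{(f)^\#}:=\mathcal{B}(M)\otimes_{\mathcal{O}_{S_I}}\mathcal{O}_{(f)^\#}$. $\operatorname{Ass}$ denotes the set of associated points of a coherent sheaf, and $\operatorname{Supp}$ the underlying set of a subscheme. *)

theory Defs
  imports "HOL-Analysis.Abstract_Topology" "HOL-Algebra.Free_Abelian_Groups" "HOL-Algebra.Ring_Divisibility"
    "HOL-Algebra.Ideal_Product" "HOL-Algebra.Generated_Groups" "HOL-Algebra.UnivPoly"
begin

section \<open>Modules\<close>

text \<open>
  The library record for modules extends the one for rings. For the regular module, and for
  everything built from it below, the inherited fields for multiplication and one are those of the
  ring. For all other modules they carry no meaning.
\<close>

definition reg_module :: "('a, 'r) ring_scheme \<Rightarrow> ('a, 'a) module" where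
  "reg_module R = \<lparr>carrier = carrier R, monoid.mult = monoid.mult R, one = one R,
                   ring.zero = ring.zero R, ring.add = ring.add R, smult = monoid.mult R\<rparr>"

definition finitely_generated_module ::
  "('a, 'r) ring_scheme \<Rightarrow> ('a, 'b, 'm) module_scheme \<Rightarrow> bool" where
  "finitely_generated_module R M \<longleftrightarrow>
     (\<exists>S \<subseteq> carrier M. finite S \<and> (\<forall>N. submodule N R M \<and> S \<subseteq> N \<longrightarrow> N = carrier M))"

definition quot_module :: "('a, 'b, 'm) module_scheme \<Rightarrow> 'b set \<Rightarrow> ('a, 'b set) module" where
  "quot_module M N =
     \<lparr>carrier = a_rcosets\<^bsub>M\<^esub> N,
      monoid.mult = (\<lambda>X Y. \<Union>x\<in>X. \<Union>y\<in>Y. N +>\<^bsub>M\<^esub> (x \<otimes>\<^bsub>M\<^esub> y)),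
      one = N +>\<^bsub>M\<^esub> \<one>\<^bsub>M\<^esub>,
      ring.zero = N,
      ring.add = (\<lambda>X Y. X <+>\<^bsub>M\<^esub> Y),
      smult = (\<lambda>r X. \<Union>x\<in>X. N +>\<^bsub>M\<^esub> (r \<odot>\<^bsub>M\<^esub> x))\<rparr>"

text \<open>The free abelian group on \<open>M \<times> N\<close>, with the scalars acting on the first factor, modulo the
  bilinearity relations.\<close>

definition tensor_free ::
  "('a, 'b, 'm) module_scheme \<Rightarrow> ('a, 'c, 'n) module_scheme \<Rightarrow> ('a, 'b \<times> 'c \<Rightarrow>\<^sub>0 int) module" where
  "tensor_free M N =
     \<lparr>carrier = carrier (free_Abelian_group (carrier M \<times> carrier N)),
      monoid.mult = undefined, one = undefined,
      ring.zero = 0, ring.add = (+),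
      smult = (\<lambda>r. frag_extend (\<lambda>(x, y). frag_of (r \<odot>\<^bsub>M\<^esub> x, y)))\<rparr>"

definition tensor_rel ::
  "('a, 'r) ring_scheme \<Rightarrow> ('a, 'b, 'm) module_scheme \<Rightarrow> ('a, 'c, 'n) module_scheme \<Rightarrow>
     ('b \<times> 'c \<Rightarrow>\<^sub>0 int) set" where
  "tensor_rel R M N = generate (add_monoid (tensor_free M N))
     ({frag_of (x \<oplus>\<^bsub>M\<^esub> x', y) - frag_of (x, y) - frag_of (x', y) | x x' y.
         x \<in> carrier M \<and> x' \<in> carrier M \<and> y \<in> carrier N} \<union>
      {frag_of (x, y \<oplus>\<^bsub>N\<^esub> y') - frag_of (x, y) - frag_of (x, y') | x y y'.
         x \<in> carrier M \<and> y \<in> carrier N \<and> y' \<in> carrier N} \<union>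
      {frag_of (r \<odot>\<^bsub>M\<^esub> x, y) - frag_of (x, r \<odot>\<^bsub>N\<^esub> y) | r x y.
         r \<in> carrier R \<and> x \<in> carrier M \<and> y \<in> carrier N})"

definition tensor_module ::
  "('a, 'r) ring_scheme \<Rightarrow> ('a, 'b, 'm) module_scheme \<Rightarrow> ('a, 'c, 'n) module_scheme \<Rightarrow>
     ('a, ('b \<times> 'c \<Rightarrow>\<^sub>0 int) set) module" where
  "tensor_module R M N = quot_module (tensor_free M N) (tensor_rel R M N)"

definition annihilator ::
  "('a, 'r) ring_scheme \<Rightarrow> ('a, 'b, 'm) module_scheme \<Rightarrow> 'b \<Rightarrow> 'a set" where
  "annihilator R M x = {a \<in> carrier R. a \<odot>\<^bsub>M\<^esub> x = \<zero>\<^bsub>M\<^esub>}"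

definition associated_primes ::
  "('a, 'r) ring_scheme \<Rightarrow> ('a, 'b, 'm) module_scheme \<Rightarrow> 'a set set" where
  "associated_primes R M =
     {P. primeideal P R \<and> (\<exists>x \<in> carrier M. P = annihilator R M x)}"


section \<open>Powers of an ideal and associated graded modules\<close>

abbreviation ideal_power :: "('a, 'r) ring_scheme \<Rightarrow> 'a set \<Rightarrow> nat \<Rightarrow> 'a set" where
  "ideal_power R I n \<equiv> I [^]\<^bsub>ideals_set R\<^esub> n"

text \<open>\<open>I\<^sup>n M\<close>, the additive span of the products \<open>a x\<close>.\<close>

definition power_submodule ::
  "('a, 'r) ring_scheme \<Rightarrow> 'a set \<Rightarrow> ('a, 'b, 'm) module_scheme \<Rightarrow> nat \<Rightarrow> 'b set" where
  "power_submodule R I M n =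
     generate (add_monoid M) {a \<odot>\<^bsub>M\<^esub> x | a x. a \<in> ideal_power R I n \<and> x \<in> carrier M}"

definition gr_component ::
  "('a, 'r) ring_scheme \<Rightarrow> 'a set \<Rightarrow> ('a, 'b, 'm) module_scheme \<Rightarrow> nat \<Rightarrow> ('a, 'b set) module" where
  "gr_component R I M n =
     quot_module (M\<lparr>carrier := power_submodule R I M n\<rparr>) (power_submodule R I M (Suc n))"

text \<open>
  \<open>G(M)\<close> consists of the sequences of components with finite support. Its scalars are the
  sequences in \<open>G(R)\<close>, which is the case \<open>M = reg_module R\<close>; the product of the classes of
  \<open>a \<in> I\<^sup>i\<close> and \<open>x \<in> I\<^sup>jM\<close> is the class of \<open>a x\<close> in degree \<open>i + j\<close>.
\<close>

definition gr_smult ::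
  "('a, 'r) ring_scheme \<Rightarrow> 'a set \<Rightarrow> ('a, 'b, 'm) module_scheme \<Rightarrow>
     (nat \<Rightarrow> 'a set) \<Rightarrow> (nat \<Rightarrow> 'b set) \<Rightarrow> nat \<Rightarrow> 'b set" where
  "gr_smult R I M a y n =
     (\<Oplus>\<^bsub>gr_component R I M n\<^esub>i\<in>{..n}.
        \<Union>r\<in>a i. \<Union>x\<in>y (n - i). power_submodule R I M (Suc n) +>\<^bsub>M\<^esub> (r \<odot>\<^bsub>M\<^esub> x))"

definition gr_module ::
  "('a, 'r) ring_scheme \<Rightarrow> 'a set \<Rightarrow> ('a, 'b, 'm) module_scheme \<Rightarrow>
     (nat \<Rightarrow> 'a set, nat \<Rightarrow> 'b set) module" where
  "gr_module R I M =
     \<lparr>carrier = {y. (\<forall>n. y n \<in> carrier (gr_component R I M n)) \<and>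
                    finite {n. y n \<noteq> \<zero>\<^bsub>gr_component R I M n\<^esub>}},
      monoid.mult = undefined, one = undefined,
      ring.zero = (\<lambda>n. \<zero>\<^bsub>gr_component R I M n\<^esub>),
      ring.add = (\<lambda>y z n. y n \<oplus>\<^bsub>gr_component R I M n\<^esub> z n),
      smult = gr_smult R I M\<rparr>"

definition gr_degree ::
  "('a, 'r) ring_scheme \<Rightarrow> 'a set \<Rightarrow> ('a, 'b, 'm) module_scheme \<Rightarrow> nat \<Rightarrow> (nat \<Rightarrow> 'b set) set" where
  "gr_degree R I M n =
     {y \<in> carrier (gr_module R I M). \<forall>k. k \<noteq> n \<longrightarrow> y k = \<zero>\<^bsub>gr_component R I M k\<^esub>}"

text \<open>The class of \<open>f \<in> I\<^sup>s\<close> in \<open>G(R)\<^sub>s\<close>, as an element of \<open>G(R)\<close>.\<close>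

definition gr_class ::
  "('a, 'r) ring_scheme \<Rightarrow> 'a set \<Rightarrow> nat \<Rightarrow> 'a \<Rightarrow> nat \<Rightarrow> 'a set" where
  "gr_class R I s f =
     (\<lambda>n. if n = s then power_submodule R I (reg_module R) (Suc s) +>\<^bsub>R\<^esub> f
          else \<zero>\<^bsub>gr_component R I (reg_module R) n\<^esub>)"

text \<open>The map \<open>G(M) \<rightarrow> G(M')\<close> induced by a homomorphism \<open>u\<close> from \<open>M\<close> to \<open>M'\<close>.\<close>

definition gr_map ::
  "('a, 'r) ring_scheme \<Rightarrow> 'a set \<Rightarrow> ('a, 'c, 'n) module_scheme \<Rightarrow> ('b \<Rightarrow> 'c) \<Rightarrow>
     (nat \<Rightarrow> 'b set) \<Rightarrow> nat \<Rightarrow> 'c set" where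
  "gr_map R I M' u y = (\<lambda>n. \<Union>x\<in>y n. power_submodule R I M' (Suc n) +>\<^bsub>M'\<^esub> u x)"

definition multiples :: "('a, 'b, 'm) module_scheme \<Rightarrow> 'a \<Rightarrow> 'b set" where
  "multiples M f = (\<lambda>x. f \<odot>\<^bsub>M\<^esub> x) ` carrier M"

abbreviation gr_multiples ::
  "('a, 'r) ring_scheme \<Rightarrow> 'a set \<Rightarrow> ('a, 'b, 'm) module_scheme \<Rightarrow> nat \<Rightarrow> 'a \<Rightarrow> (nat \<Rightarrow> 'b set) set" where
  "gr_multiples R I M s f \<equiv> multiples (gr_module R I M) (gr_class R I s f)"

text \<open>Writing \<open>c\<close> for the class of \<open>f\<close> in \<open>G(R)\<^sub>s\<close>: the degree \<open>n\<close> components of \<open>G(M)/cG(M)\<close> and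
  of \<open>G(M/fM)\<close>, and the natural map between the two modules. It is linear, so it is an isomorphism
  in degree \<open>n\<close> as soon as it is one of the additive groups of the components.\<close>

definition gr_quot_component ::
  "('a, 'r) ring_scheme \<Rightarrow> 'a set \<Rightarrow> ('a, 'b, 'm) module_scheme \<Rightarrow> nat \<Rightarrow> 'a \<Rightarrow> nat \<Rightarrow>
     (nat \<Rightarrow> 'a set, (nat \<Rightarrow> 'b set) set) module" where
  "gr_quot_component R I M s f n =
     (quot_module (gr_module R I M) (gr_multiples R I M s f))
       \<lparr>carrier := (\<lambda>y. gr_multiples R I M s f +>\<^bsub>gr_module R I M\<^esub> y) ` gr_degree R I M n\<rparr>"

definition gr_of_quot_component ::
  "('a, 'r) ring_scheme \<Rightarrow> 'a set \<Rightarrow> ('a, 'b, 'm) module_scheme \<Rightarrow> 'a \<Rightarrow> nat \<Rightarrow>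
     (nat \<Rightarrow> 'a set, nat \<Rightarrow> 'b set set) module" where
  "gr_of_quot_component R I M f n =
     (gr_module R I (quot_module M (multiples M f)))
       \<lparr>carrier := gr_degree R I (quot_module M (multiples M f)) n\<rparr>"

definition gr_natural_map ::
  "('a, 'r) ring_scheme \<Rightarrow> 'a set \<Rightarrow> ('a, 'b, 'm) module_scheme \<Rightarrow> 'a \<Rightarrow>
     (nat \<Rightarrow> 'b set) set \<Rightarrow> nat \<Rightarrow> 'b set set" where
  "gr_natural_map R I M f Y =
     the_elem (gr_map R I (quot_module M (multiples M f)) (\<lambda>x. multiples M f +>\<^bsub>M\<^esub> x) ` Y)"


section \<open>Presheaves of modules\<close>

text \<open>
  A presheaf is given by its sections over open sets and its restriction maps. A presheaf of rings
  is given by the regular modules of its rings of sections; its stalks are then rings as well.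
\<close>

record ('p, 'a, 'b) presheaf =
  sections :: "'p set \<Rightarrow> ('a, 'b) module"
  res :: "'p set \<Rightarrow> 'p set \<Rightarrow> 'b \<Rightarrow> 'b"

definition germ :: "'p topology \<Rightarrow> ('p, 'a, 'b) presheaf \<Rightarrow> 'p \<Rightarrow> 'p set \<Rightarrow> 'b \<Rightarrow> ('p set \<times> 'b) set" where
  "germ T F x U s =
     {(V, t). openin T V \<and> x \<in> V \<and> t \<in> carrier (sections F V) \<and>
        (\<exists>W. openin T W \<and> x \<in> W \<and> W \<subseteq> U \<inter> V \<and> res F U W s = res F V W t)}"

text \<open>The stalk of the \<open>\<O>\<close>-module \<open>F\<close>, a module over the stalk of \<open>\<O>\<close>.\<close>

definition stalk ::
  "'p topology \<Rightarrow> ('p, 'c, 'a) presheaf \<Rightarrow> ('p, 'a, 'b) presheaf \<Rightarrow> 'p \<Rightarrow>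
     (('p set \<times> 'a) set, ('p set \<times> 'b) set) module" where
  "stalk T \<O> F x =
     \<lparr>carrier = {germ T F x U s | U s. openin T U \<and> x \<in> U \<and> s \<in> carrier (sections F U)},
      monoid.mult = (\<lambda>X Y. \<Union>(U, s)\<in>X. \<Union>(V, t)\<in>Y. germ T F x (U \<inter> V)
                (res F U (U \<inter> V) s \<otimes>\<^bsub>sections F (U \<inter> V)\<^esub> res F V (U \<inter> V) t)),
      one = germ T F x (topspace T) \<one>\<^bsub>sections F (topspace T)\<^esub>,
      ring.zero = germ T F x (topspace T) \<zero>\<^bsub>sections F (topspace T)\<^esub>,
      ring.add = (\<lambda>X Y. \<Union>(U, s)\<in>X. \<Union>(V, t)\<in>Y. germ T F x (U \<inter> V)
               (res F U (U \<inter> V) s \<oplus>\<^bsub>sections F (U \<inter> V)\<^esub> res F V (U \<inter> V) t)),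
      smult = (\<lambda>A X. \<Union>(U, a)\<in>A. \<Union>(V, t)\<in>X. germ T F x (U \<inter> V)
                 (res \<O> U (U \<inter> V) a \<odot>\<^bsub>sections F (U \<inter> V)\<^esub> res F V (U \<inter> V) t))\<rparr>"

text \<open>
  Functions on \<open>U\<close> that locally belong to \<open>L\<close>, where \<open>L V\<close> is a set of functions on \<open>V\<close>.
\<close>

definition locally_in ::
  "'p topology \<Rightarrow> ('p set \<Rightarrow> ('p \<Rightarrow> 'b) set) \<Rightarrow> 'p set \<Rightarrow> ('p \<Rightarrow> 'b) set" where
  "locally_in T L U =
     {s \<in> extensional U. \<forall>p\<in>U. \<exists>V. openin T V \<and> p \<in> V \<and> V \<subseteq> U \<and> (\<exists>t \<in> L V. \<forall>q\<in>V. s q = t q)}"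

text \<open>A set \<open>C\<close> of functions \<open>s\<close> on \<open>U\<close> with \<open>s p\<close> in the module \<open>A p\<close>, under the pointwise
  operations. A scalar \<open>a\<close> acts at \<open>p\<close> through its value \<open>ev a p\<close>.\<close>

definition pointwise_module ::
  "'p set \<Rightarrow> ('p \<Rightarrow> ('k, 'b) module) \<Rightarrow> ('a \<Rightarrow> 'p \<Rightarrow> 'k) \<Rightarrow> ('p \<Rightarrow> 'b) set \<Rightarrow> ('a, 'p \<Rightarrow> 'b) module" where
  "pointwise_module U A ev C =
     \<lparr>carrier = C,
      monoid.mult = (\<lambda>s t. \<lambda>p\<in>U. s p \<otimes>\<^bsub>A p\<^esub> t p),
      one = (\<lambda>p\<in>U. \<one>\<^bsub>A p\<^esub>),
      ring.zero = (\<lambda>p\<in>U. \<zero>\<^bsub>A p\<^esub>),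
      ring.add = (\<lambda>s t. \<lambda>p\<in>U. s p \<oplus>\<^bsub>A p\<^esub> t p),
      smult = (\<lambda>a s. \<lambda>p\<in>U. ev a p \<odot>\<^bsub>A p\<^esub> s p)\<rparr>"

definition sheafify ::
  "'p topology \<Rightarrow> ('p, 'c, 'a) presheaf \<Rightarrow> ('p, 'a, 'b) presheaf \<Rightarrow>
     ('p, 'a, 'p \<Rightarrow> ('p set \<times> 'b) set) presheaf" where
  "sheafify T \<O> F =
     \<lparr>sections = (\<lambda>U. pointwise_module U (stalk T \<O> F) (\<lambda>a p. germ T \<O> p U a)
        (locally_in T (\<lambda>V. {\<lambda>q. germ T F q V t | t. t \<in> carrier (sections F V)}) U)),
      res = (\<lambda>U V s. restrict s V)\<rparr>"

definition quot_sheaf ::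
  "'p topology \<Rightarrow> ('p, 'c, 'a) presheaf \<Rightarrow> ('p, 'a, 'b) presheaf \<Rightarrow> ('p set \<Rightarrow> 'b set) \<Rightarrow>
     ('p, 'a, 'p \<Rightarrow> ('p set \<times> 'b set) set) presheaf" where
  "quot_sheaf T \<O> F N = sheafify T \<O>
     \<lparr>sections = (\<lambda>U. quot_module (sections F U) (N U)),
      res = (\<lambda>U V X. \<Union>s\<in>X. N V +>\<^bsub>sections F V\<^esub> res F U V s)\<rparr>"

definition tensor_sheaf ::
  "'p topology \<Rightarrow> ('p, 'a, 'a) presheaf \<Rightarrow> ('p, 'a, 'b) presheaf \<Rightarrow> ('p, 'a, 'c) presheaf \<Rightarrow>
     ('p, 'a, 'p \<Rightarrow> ('p set \<times> ('b \<times> 'c \<Rightarrow>\<^sub>0 int) set) set) presheaf" where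
  "tensor_sheaf T \<O> F G = sheafify T \<O>
     \<lparr>sections = (\<lambda>U. tensor_module (sections \<O> U) (sections F U) (sections G U)),
      res = (\<lambda>U V X. \<Union>c\<in>X.
               tensor_rel (sections \<O> V) (sections F V) (sections G V)
               +>\<^bsub>tensor_free (sections F V) (sections G V)\<^esub>
               frag_extend (\<lambda>(s, t). frag_of (res F U V s, res G U V t)) c)\<rparr>"

text \<open>The points \<open>x\<close> such that the maximal ideal of the local ring at \<open>x\<close>, which is its set of
  nonunits, is an associated prime of the stalk at \<open>x\<close>.\<close>

definition associated_points ::
  "'p topology \<Rightarrow> ('p, 'a, 'a) presheaf \<Rightarrow> ('p, 'a, 'b) presheaf \<Rightarrow> 'p set" where
  "associated_points T \<O> F =
     {x \<in> topspace T. carrier (stalk T \<O> \<O> x) - Units (stalk T \<O> \<O> x)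
                        \<in> associated_primes (stalk T \<O> \<O> x) (stalk T \<O> F x)}"


section \<open>Proj of a graded ring\<close>

text \<open>
  A grading of a ring \<open>B\<close> or a \<open>B\<close>-module \<open>N\<close> is given by the family of its homogeneous
  components, \<open>gr\<close> for \<open>B\<close> and \<open>ngr\<close> for \<open>N\<close>.
\<close>

definition homogeneous_ideal :: "('b, 'r) ring_scheme \<Rightarrow> (nat \<Rightarrow> 'b set) \<Rightarrow> 'b set \<Rightarrow> bool" where
  "homogeneous_ideal B gr J \<longleftrightarrow> ideal J B \<and> J = genideal B (J \<inter> (\<Union>n. gr n))"

definition Proj :: "('b, 'r) ring_scheme \<Rightarrow> (nat \<Rightarrow> 'b set) \<Rightarrow> 'b set set" where
  "Proj B gr = {p. primeideal p B \<and> homogeneous_ideal B gr p \<and> \<not> (\<Union>n\<in>{0<..}. gr n) \<subseteq> p}"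

definition Proj_topology :: "('b, 'r) ring_scheme \<Rightarrow> (nat \<Rightarrow> 'b set) \<Rightarrow> 'b set topology" where
  "Proj_topology B gr =
     topology_generated_by {{p \<in> Proj B gr. h \<notin> p} | h. h \<in> (\<Union>n\<in>{0<..}. gr n)}"

text \<open>The underlying set of the closed subscheme defined by a homogeneous ideal \<open>J\<close>.\<close>

definition Proj_zeros :: "('b, 'r) ring_scheme \<Rightarrow> (nat \<Rightarrow> 'b set) \<Rightarrow> 'b set \<Rightarrow> 'b set set" where
  "Proj_zeros B gr J = {p \<in> Proj B gr. J \<subseteq> p}"

text \<open>The homogeneous localization \<open>N\<^sub>(\<^sub>p\<^sub>)\<close>: fractions \<open>x/h\<close> of homogeneous elements of equal degree
  with \<open>h \<notin> p\<close>. A fraction is the class of all pairs equivalent to it.\<close>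

definition hfracs ::
  "(nat \<Rightarrow> 'b set) \<Rightarrow> (nat \<Rightarrow> 'n set) \<Rightarrow> 'b set \<Rightarrow> ('n \<times> 'b) set" where
  "hfracs gr ngr p = {(x, h). \<exists>d. x \<in> ngr d \<and> h \<in> gr d \<and> h \<notin> p}"

definition hfrac ::
  "(nat \<Rightarrow> 'b set) \<Rightarrow> ('b, 'n, 'm) module_scheme \<Rightarrow> (nat \<Rightarrow> 'n set) \<Rightarrow> 'b set \<Rightarrow>
     'n \<Rightarrow> 'b \<Rightarrow> ('n \<times> 'b) set" where
  "hfrac gr N ngr p x h =
     {(y, k) \<in> hfracs gr ngr p.
        \<exists>e. \<exists>u \<in> gr e - p. u \<odot>\<^bsub>N\<^esub> (k \<odot>\<^bsub>N\<^esub> x) = u \<odot>\<^bsub>N\<^esub> (h \<odot>\<^bsub>N\<^esub> y)}"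

definition hlocalization ::
  "('b, 'r) ring_scheme \<Rightarrow> (nat \<Rightarrow> 'b set) \<Rightarrow> ('b, 'n, 'm) module_scheme \<Rightarrow> (nat \<Rightarrow> 'n set) \<Rightarrow>
     'b set \<Rightarrow> (('b \<times> 'b) set, ('n \<times> 'b) set) module" where
  "hlocalization B gr N ngr p =
     \<lparr>carrier = {hfrac gr N ngr p x h | x h. (x, h) \<in> hfracs gr ngr p},
      monoid.mult = (\<lambda>X Y. \<Union>(x, h)\<in>X. \<Union>(y, k)\<in>Y. hfrac gr N ngr p (x \<otimes>\<^bsub>N\<^esub> y) (h \<otimes>\<^bsub>B\<^esub> k)),
      one = hfrac gr N ngr p \<one>\<^bsub>N\<^esub> \<one>\<^bsub>B\<^esub>,
      ring.zero = hfrac gr N ngr p \<zero>\<^bsub>N\<^esub> \<one>\<^bsub>B\<^esub>,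
      ring.add = (\<lambda>X Y. \<Union>(x, h)\<in>X. \<Union>(y, k)\<in>Y.
               hfrac gr N ngr p (k \<odot>\<^bsub>N\<^esub> x \<oplus>\<^bsub>N\<^esub> h \<odot>\<^bsub>N\<^esub> y) (h \<otimes>\<^bsub>B\<^esub> k)),
      smult = (\<lambda>A X. \<Union>(a, g)\<in>A. \<Union>(x, h)\<in>X. hfrac gr N ngr p (a \<odot>\<^bsub>N\<^esub> x) (g \<otimes>\<^bsub>B\<^esub> h))\<rparr>"

text \<open>The functions that locally are fractions \<open>x/h\<close> with \<open>x\<close> in the graded submodule whose
  components are \<open>num d\<close>.\<close>

definition fraction_sections ::
  "('b, 'r) ring_scheme \<Rightarrow> (nat \<Rightarrow> 'b set) \<Rightarrow> ('b, 'n, 'm) module_scheme \<Rightarrow> (nat \<Rightarrow> 'n set) \<Rightarrow>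
     (nat \<Rightarrow> 'n set) \<Rightarrow> 'b set set \<Rightarrow> ('b set \<Rightarrow> ('n \<times> 'b) set) set" where
  "fraction_sections B gr N ngr num =
     locally_in (Proj_topology B gr)
       (\<lambda>V. {\<lambda>q. hfrac gr N ngr q x h | x h.
               (\<exists>d. x \<in> num d \<and> h \<in> gr d) \<and> (\<forall>q\<in>V. h \<notin> q)})"

text \<open>The sheaf on \<open>Proj B\<close> associated to the graded module \<open>N\<close>.\<close>

definition assoc_sheaf ::
  "('b, 'r) ring_scheme \<Rightarrow> (nat \<Rightarrow> 'b set) \<Rightarrow> ('b, 'n, 'm) module_scheme \<Rightarrow> (nat \<Rightarrow> 'n set) \<Rightarrow>
     ('b set, 'b set \<Rightarrow> ('b \<times> 'b) set, 'b set \<Rightarrow> ('n \<times> 'b) set) presheaf" where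
  "assoc_sheaf B gr N ngr =
     \<lparr>sections = (\<lambda>U. pointwise_module U (hlocalization B gr N ngr) (\<lambda>a p. a p)
                        (fraction_sections B gr N ngr ngr U)),
      res = (\<lambda>U V s. restrict s V)\<rparr>"

definition structure_sheaf ::
  "('b, 'r) ring_scheme \<Rightarrow> (nat \<Rightarrow> 'b set) \<Rightarrow>
     ('b set, 'b set \<Rightarrow> ('b \<times> 'b) set, 'b set \<Rightarrow> ('b \<times> 'b) set) presheaf" where
  "structure_sheaf B gr = assoc_sheaf B gr (reg_module B) gr"

text \<open>The ideal sheaf of the closed subscheme \<open>Z\<close> defined by a homogeneous ideal \<open>J\<close>, the structure
  sheaf of \<open>Z\<close> as a sheaf on \<open>Proj B\<close>, and the restriction of a sheaf \<open>F\<close> to \<open>Z\<close>, also as a sheaf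
  on \<open>Proj B\<close>.\<close>

definition ideal_sheaf ::
  "('b, 'r) ring_scheme \<Rightarrow> (nat \<Rightarrow> 'b set) \<Rightarrow> 'b set \<Rightarrow> 'b set set \<Rightarrow> ('b set \<Rightarrow> ('b \<times> 'b) set) set" where
  "ideal_sheaf B gr J = fraction_sections B gr (reg_module B) gr (\<lambda>d. J \<inter> gr d)"

definition subscheme_sheaf where
  "subscheme_sheaf B gr J =
     quot_sheaf (Proj_topology B gr) (structure_sheaf B gr) (structure_sheaf B gr) (ideal_sheaf B gr J)"

definition restrict_to_subscheme where
  "restrict_to_subscheme B gr F J =
     tensor_sheaf (Proj_topology B gr) (structure_sheaf B gr) F (subscheme_sheaf B gr J)"


section \<open>The blowup\<close>

text \<open>\<open>B(R) = R[It]\<close> as a subring of \<open>R[t]\<close>.\<close>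

definition rees_ring :: "('a, 'r) ring_scheme \<Rightarrow> 'a set \<Rightarrow> ('a, nat \<Rightarrow> 'a) up_ring" where
  "rees_ring R I =
     (UP R)\<lparr>carrier := {p \<in> carrier (UP R). \<forall>n. coeff (UP R) p n \<in> ideal_power R I n}\<rparr>"

definition rees_degree :: "('a, 'r) ring_scheme \<Rightarrow> 'a set \<Rightarrow> nat \<Rightarrow> (nat \<Rightarrow> 'a) set" where
  "rees_degree R I n =
     {p \<in> carrier (rees_ring R I). \<forall>k. k \<noteq> n \<longrightarrow> coeff (UP R) p k = \<zero>\<^bsub>R\<^esub>}"

definition rees_module ::
  "('a, 'r) ring_scheme \<Rightarrow> 'a set \<Rightarrow> ('a, 'b, 'm) module_scheme \<Rightarrow> (nat \<Rightarrow> 'a, nat \<Rightarrow> 'b) module" where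
  "rees_module R I M =
     \<lparr>carrier = {y. (\<forall>n. y n \<in> power_submodule R I M n) \<and> finite {n. y n \<noteq> \<zero>\<^bsub>M\<^esub>}},
      monoid.mult = undefined, one = undefined,
      ring.zero = (\<lambda>n. \<zero>\<^bsub>M\<^esub>),
      ring.add = (\<lambda>y z n. y n \<oplus>\<^bsub>M\<^esub> z n),
      smult = (\<lambda>p y n. \<Oplus>\<^bsub>M\<^esub>i\<in>{..n}. coeff (UP R) p i \<odot>\<^bsub>M\<^esub> y (n - i))\<rparr>"

definition rees_module_degree ::
  "('a, 'r) ring_scheme \<Rightarrow> 'a set \<Rightarrow> ('a, 'b, 'm) module_scheme \<Rightarrow> nat \<Rightarrow> (nat \<Rightarrow> 'b) set" where
  "rees_module_degree R I M n =
     {y \<in> carrier (rees_module R I M). \<forall>k. k \<noteq> n \<longrightarrow> y k = \<zero>\<^bsub>M\<^esub>}"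

abbreviation blowup_topology :: "('a, 'r) ring_scheme \<Rightarrow> 'a set \<Rightarrow> (nat \<Rightarrow> 'a) set topology" where
  "blowup_topology R I \<equiv> Proj_topology (rees_ring R I) (rees_degree R I)"

abbreviation blowup_structure_sheaf where
  "blowup_structure_sheaf R I \<equiv> structure_sheaf (rees_ring R I) (rees_degree R I)"

abbreviation rees_sheaf where
  "rees_sheaf R I M \<equiv>
     assoc_sheaf (rees_ring R I) (rees_degree R I) (rees_module R I M) (rees_module_degree R I M)"

definition exceptional_support :: "('a, 'r) ring_scheme \<Rightarrow> 'a set \<Rightarrow> (nat \<Rightarrow> 'a) set set" where
  "exceptional_support R I =
     Proj_zeros (rees_ring R I) (rees_degree R I)
       (genideal (rees_ring R I) ((\<lambda>a. monom (UP R) a 0) ` I))"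

definition weak_transform_ideal :: "('a, 'r) ring_scheme \<Rightarrow> 'a set \<Rightarrow> nat \<Rightarrow> 'a \<Rightarrow> (nat \<Rightarrow> 'a) set" where
  "weak_transform_ideal R I s f = genideal (rees_ring R I) {monom (UP R) f s}"

definition rees_sheaf_on_weak_transform where
  "rees_sheaf_on_weak_transform R I M s f =
     restrict_to_subscheme (rees_ring R I) (rees_degree R I)
       (rees_sheaf R I M) (weak_transform_ideal R I s f)"

end

theory Submission
  imports Defs
begin

text \<open>
  Write \<open>X n\<close> for \<open>I\<^sup>nM\<close>, and \<open>Z n\<close> for the component \<open>f I\<^sup>n\<^sup>-\<^sup>sM\<close> of degree \<open>n\<close> of the
  submodule \<open>f t\<^sup>s B(M)\<close> of \<open>B(M)\<close>. Both conditions of the theorem are translated into statements about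
  these submodules of \<open>M\<close>.

  The kernel of \<open>G(M) \<rightarrow> G(M/fM)\<close> in degree \<open>n\<close> consists of the classes of the elements of
  \<open>fM \<inter> X n\<close>, and the multiples of the class of \<open>f\<close> are the classes of the elements of \<open>Z n\<close>. Hence the
  natural map is an isomorphism in degree \<open>n\<close> if and only if every element of \<open>fM \<inter> X n\<close> is
  congruent to an element of \<open>Z n\<close> modulo \<open>X (n + 1)\<close> (\<open>gr_natural_map_iso_iff\<close>). For all large
  degrees together, the lemma of Artin and Rees turns this into \<open>fM \<inter> X n \<subseteq> Z n\<close>, or equivalently
  into the absence of jumps, \<open>Z n \<inter> X (n + 1) \<subseteq> Z (n + 1)\<close>.

  On the other side, the stalk at \<open>p\<close> of the restriction of the sheaf of a graded module \<open>N\<close> to the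
  hypersurface \<open>F = 0\<close> is the homogeneous localization of \<open>N / FN\<close> at \<open>p\<close>. For \<open>N = B(M)\<close> and
  \<open>F = f t\<^sup>s\<close> it follows that \<open>p\<close> is an associated point if and only if there is a homogeneous
  \<open>x\<close> such that the homogeneous elements of \<open>p\<close> are exactly those \<open>a\<close> with \<open>u a x \<in> FN\<close> for some
  homogeneous \<open>u\<close> outside \<open>p\<close> (\<open>associated_points_iff\<close>).

  Suppose there are no jumps in large degrees, and that \<open>p\<close> is an associated point on the exceptional
  divisor, with \<open>x\<close> as above. Since \<open>I\<close> is finitely generated, some \<open>u\<close> outside \<open>p\<close> satisfies
  \<open>u b x \<in> FN\<close> for all \<open>b\<close> in the degree zero copy of \<open>I\<close>; replacing \<open>u\<close> by a multiple, the degree \<open>n\<close> of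
  \<open>u x\<close> may be taken large. For \<open>h\<close> in \<open>I\<close> with \<open>h t\<close> outside \<open>p\<close>, the element \<open>h u x\<close> of \<open>M\<close> then
  lies in \<open>Z n \<inter> X (n + 1)\<close>, so in \<open>Z (n + 1)\<close>. Thus \<open>(h t) u x \<in> FN\<close>, which would put \<open>1\<close> into \<open>p\<close>.

  Conversely, suppose there are jumps in arbitrarily large degrees. The elements of \<open>N / FN\<close> that are
  annihilated by the degree zero copy of \<open>I\<close> are then not all torsion with respect to the irrelevant ideal.
  Among the non-torsion ones choose \<open>y\<close> such that the ideal of all \<open>a\<close> with \<open>a y\<close> torsion
  is maximal. This ideal is a homogeneous prime that contains \<open>I\<close>, and \<open>y\<close> shows that it is an
  associated point (\<open>ex_torsion_prime\<close>, \<open>ex_associated_exceptional\<close>).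
\<close>


section \<open>Quotient modules and submodules\<close>

lemma UN_eq_const: "\<lbrakk>A \<noteq> {}; \<And>x. x \<in> A \<Longrightarrow> f x = c\<rbrakk> \<Longrightarrow> (\<Union>x\<in>A. f x) = c"
  by auto

lemma carrier_quot_module: "carrier (quot_module M N) = {N +>\<^bsub>M\<^esub> x | x. x \<in> carrier M}"
  by (auto simp: quot_module_def A_RCOSETS_def')

lemma zero_quot_module [simp]: "\<zero>\<^bsub>quot_module M N\<^esub> = N"
  by (simp add: quot_module_def)

locale subgroup_of_module = abelian_subgroup H G for H and G :: "('r, 'a, 'm) module_scheme" (structure)
begin

lemma coset_eq_iff:
  assumes "x \<in> carrier G" "y \<in> carrier G"
  shows "H +> x = H +> y \<longleftrightarrow> x \<ominus> y \<in> H"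
  by (metis a_minus_def a_rcos_module_imp a_rcos_module_rev a_rcos_self a_repr_independence' assms)

lemma coset_eq_self_iff: "x \<in> carrier G \<Longrightarrow> H +> x = H \<longleftrightarrow> x \<in> H"
  by (metis a_rcos_const a_rcos_self)

lemma quot_module_add:
  "\<lbrakk>x \<in> carrier G; y \<in> carrier G\<rbrakk> \<Longrightarrow> (H +> x) \<oplus>\<^bsub>quot_module G H\<^esub> (H +> y) = H +> (x \<oplus> y)"
  by (simp add: quot_module_def a_rcos_sum)

lemma abelian_group_quot_module: "abelian_group (quot_module G H)"
proof (rule abelian_groupI)
  fix X assume "X \<in> carrier (quot_module G H)"
  then obtain x where x: "x \<in> carrier G" "X = H +> x" by (auto simp: carrier_quot_module)
  have "(H +> \<zero>) \<oplus>\<^bsub>quot_module G H\<^esub> X = X"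
    using x by (simp only: quot_module_add zero_closed l_zero)
  then show "\<zero>\<^bsub>quot_module G H\<^esub> \<oplus>\<^bsub>quot_module G H\<^esub> X = X"
    by (simp add: a_rcos_const)
  have "(H +> \<ominus> x) \<oplus>\<^bsub>quot_module G H\<^esub> X = H"
    using x by (simp add: quot_module_add l_neg a_rcos_const)
  then show "\<exists>Y\<in>carrier (quot_module G H). Y \<oplus>\<^bsub>quot_module G H\<^esub> X = \<zero>\<^bsub>quot_module G H\<^esub>"
    using x by (intro bexI[of _ "H +> \<ominus> x"]) (auto simp: carrier_quot_module)
next
  show "\<zero>\<^bsub>quot_module G H\<^esub> \<in> carrier (quot_module G H)"
    using a_rcos_const[of \<zero>] by (force simp: carrier_quot_module)
next
  fix X Y assume "X \<in> carrier (quot_module G H)" "Y \<in> carrier (quot_module G H)"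
  then obtain x y where xy: "x \<in> carrier G" "X = H +> x" "y \<in> carrier G" "Y = H +> y"
    by (auto simp: carrier_quot_module)
  show "X \<oplus>\<^bsub>quot_module G H\<^esub> Y = Y \<oplus>\<^bsub>quot_module G H\<^esub> X"
    using xy by (simp add: quot_module_add a_comm)
  show "X \<oplus>\<^bsub>quot_module G H\<^esub> Y \<in> carrier (quot_module G H)"
    using xy by (auto simp: quot_module_add carrier_quot_module)
  fix Z assume "Z \<in> carrier (quot_module G H)"
  then obtain z where z: "z \<in> carrier G" "Z = H +> z"
    by (auto simp: carrier_quot_module)
  show "X \<oplus>\<^bsub>quot_module G H\<^esub> Y \<oplus>\<^bsub>quot_module G H\<^esub> Z
    = X \<oplus>\<^bsub>quot_module G H\<^esub> (Y \<oplus>\<^bsub>quot_module G H\<^esub> Z)"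
    using xy z by (simp add: quot_module_add a_assoc)
qed

text \<open>The scalars enter only through the one that acts, so that the lemma also serves for the free group
  behind a tensor product, which carries an action without a module structure being established.\<close>

lemma quot_module_smult:
  assumes x: "x \<in> carrier G"
    and add: "\<And>n. n \<in> H \<Longrightarrow> r \<odot>\<^bsub>G\<^esub> (n \<oplus> x) = r \<odot>\<^bsub>G\<^esub> n \<oplus> r \<odot>\<^bsub>G\<^esub> x"
    and cl: "r \<odot>\<^bsub>G\<^esub> x \<in> carrier G"
    and pres: "\<And>n. n \<in> H \<Longrightarrow> r \<odot>\<^bsub>G\<^esub> n \<in> H"
  shows "r \<odot>\<^bsub>quot_module G H\<^esub> (H +> x) = H +> (r \<odot>\<^bsub>G\<^esub> x)"
proof -
  have "H +> (r \<odot>\<^bsub>G\<^esub> x') = H +> (r \<odot>\<^bsub>G\<^esub> x)" if x': "x' \<in> H +> x" for x'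
  proof -
    obtain n where n: "n \<in> H" "x' = n \<oplus> x"
      using x' by (auto simp: a_r_coset_def')
    have "r \<odot>\<^bsub>G\<^esub> x' \<in> H +> (r \<odot>\<^bsub>G\<^esub> x)"
      using n pres[OF n(1)] add[OF n(1)] by (auto simp: a_r_coset_def')
    then show ?thesis
      using a_repr_independence'[OF _ cl] by metis
  qed
  moreover have "H +> x \<noteq> {}" using a_rcos_self[OF x] by blast
  ultimately have "(\<Union>x'\<in>H +> x. H +> (r \<odot>\<^bsub>G\<^esub> x')) = H +> (r \<odot>\<^bsub>G\<^esub> x)"
    by (intro UN_eq_const)
  then show ?thesis
    by (simp add: quot_module_def)
qed

end

lemma (in module) subgroup_of_module_submodule:
  assumes "submodule N R M" shows "subgroup_of_module N M"
  using assms by (intro subgroup_of_module.intro abelian_subgroupI3 additive_subgroupI M.abelian_group_axioms)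
    (auto simp: submodule_def)

lemma (in module) quot_module_smult_submodule:
  assumes "submodule N R M" "r \<in> carrier R" "x \<in> carrier M"
  shows "r \<odot>\<^bsub>quot_module M N\<^esub> (N +>\<^bsub>M\<^esub> x) = N +>\<^bsub>M\<^esub> (r \<odot>\<^bsub>M\<^esub> x)"
proof -
  interpret N: subgroup_of_module N M by (rule subgroup_of_module_submodule[OF assms(1)])
  show ?thesis
    using assms submoduleE[OF assms(1)] by (intro N.quot_module_smult) (auto simp: smult_r_distr)
qed

lemma (in module) module_quot_module:
  assumes N: "submodule N R M" shows "module R (quot_module M N)"
proof -
  interpret N: subgroup_of_module N M by (rule subgroup_of_module_submodule[OF N])
  show ?thesis
  proof (rule moduleI)
    show "abelian_group (quot_module M N)" by (rule N.abelian_group_quot_module)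
  next
    fix X assume "X \<in> carrier (quot_module M N)"
    then obtain x where x: "x \<in> carrier M" "X = N +>\<^bsub>M\<^esub> x"
      by (auto simp: carrier_quot_module)
    note [simp] = quot_module_smult_submodule[OF N] N.quot_module_add
    show "\<one> \<odot>\<^bsub>quot_module M N\<^esub> X = X" using x by simp
    fix a assume a: "a \<in> carrier R"
    show "a \<odot>\<^bsub>quot_module M N\<^esub> X \<in> carrier (quot_module M N)"
      using x a by (auto simp: carrier_quot_module)
    fix b assume b: "b \<in> carrier R"
    show "(a \<oplus> b) \<odot>\<^bsub>quot_module M N\<^esub> X
        = a \<odot>\<^bsub>quot_module M N\<^esub> X \<oplus>\<^bsub>quot_module M N\<^esub> b \<odot>\<^bsub>quot_module M N\<^esub> X"
      using x a b by (simp add: smult_l_distr)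
    show "a \<otimes> b \<odot>\<^bsub>quot_module M N\<^esub> X
        = a \<odot>\<^bsub>quot_module M N\<^esub> (b \<odot>\<^bsub>quot_module M N\<^esub> X)"
      using x a b by (simp add: smult_assoc1)
  next
    fix a X Y assume a: "a \<in> carrier R"
      and "X \<in> carrier (quot_module M N)" "Y \<in> carrier (quot_module M N)"
    then obtain x y where "x \<in> carrier M" "X = N +>\<^bsub>M\<^esub> x" "y \<in> carrier M" "Y = N +>\<^bsub>M\<^esub> y"
      by (auto simp: carrier_quot_module)
    then show "a \<odot>\<^bsub>quot_module M N\<^esub> (X \<oplus>\<^bsub>quot_module M N\<^esub> Y)
        = a \<odot>\<^bsub>quot_module M N\<^esub> X \<oplus>\<^bsub>quot_module M N\<^esub> a \<odot>\<^bsub>quot_module M N\<^esub> Y"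
      using a by (simp add: smult_r_distr quot_module_smult_submodule[OF N] N.quot_module_add)
  qed (rule R.cring_axioms)
qed

lemma (in cring) module_reg_module: "module R (reg_module R)"
proof (rule moduleI)
  show "abelian_group (reg_module R)"
  proof (rule abelian_groupI)
    fix x assume "x \<in> carrier (reg_module R)"
    then show "\<exists>y\<in>carrier (reg_module R). y \<oplus>\<^bsub>reg_module R\<^esub> x = \<zero>\<^bsub>reg_module R\<^esub>"
      by (auto simp: reg_module_def intro!: bexI[of _ "\<ominus> x"] l_neg)
  qed (simp_all add: reg_module_def a_ac)
qed (simp_all add: reg_module_def cring_axioms l_distr r_distr m_assoc)

lemma (in module) submodule_intro:
  assumes "H \<subseteq> carrier M" "\<zero>\<^bsub>M\<^esub> \<in> H"
    and "\<And>a b. \<lbrakk>a \<in> H; b \<in> H\<rbrakk> \<Longrightarrow> a \<oplus>\<^bsub>M\<^esub> b \<in> H"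
    and "\<And>a x. \<lbrakk>a \<in> carrier R; x \<in> H\<rbrakk> \<Longrightarrow> a \<odot>\<^bsub>M\<^esub> x \<in> H"
  shows "submodule H R M"
proof (rule submoduleI)
  fix a assume a: "a \<in> H"
  have "\<ominus>\<^bsub>M\<^esub> a = (\<ominus> \<one>) \<odot>\<^bsub>M\<^esub> a"
    using a assms(1) by (simp add: subset_iff smult_l_minus)
  then show "\<ominus>\<^bsub>M\<^esub> a \<in> H" using assms(4)[OF _ a, of "\<ominus> \<one>"] by simp
qed (use assms in auto)

lemma (in module) submodule_zero: "submodule N R M \<Longrightarrow> \<zero>\<^bsub>M\<^esub> \<in> N"
  using subgroup.one_closed[of N "add_monoid M"] by (auto simp: submodule_def)

lemma (in module) submodule_minus:
  "submodule N R M \<Longrightarrow> x \<in> N \<Longrightarrow> y \<in> N \<Longrightarrow> x \<ominus>\<^bsub>M\<^esub> y \<in> N"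
  by (simp add: a_minus_def submoduleE)

context module
begin

abbreviation smult_M (infixl "\<bullet>" 70) where "a \<bullet> x \<equiv> a \<odot>\<^bsub>M\<^esub> x"
abbreviation add_M (infixl "\<oplus>\<^sub>M" 65) where "x \<oplus>\<^sub>M y \<equiv> x \<oplus>\<^bsub>M\<^esub> y"
abbreviation minus_M (infixl "\<ominus>\<^sub>M" 65) where "x \<ominus>\<^sub>M y \<equiv> x \<ominus>\<^bsub>M\<^esub> y"
abbreviation uminus_M ("\<ominus>\<^sub>M _" [81] 80) where "\<ominus>\<^sub>M x \<equiv> \<ominus>\<^bsub>M\<^esub> x"
abbreviation zero_M ("\<zero>\<^sub>M") where "\<zero>\<^sub>M \<equiv> \<zero>\<^bsub>M\<^esub>"

lemma submodule_vimage_smult: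
  assumes "submodule H R M" "a \<in> carrier R"
  shows "submodule {x \<in> carrier M. a \<bullet> x \<in> H} R M"
proof (rule submodule_intro)
  fix r x assume "r \<in> carrier R" "x \<in> {x \<in> carrier M. a \<bullet> x \<in> H}"
  then show "r \<bullet> x \<in> {x \<in> carrier M. a \<bullet> x \<in> H}"
    using submoduleE(4)[OF assms(1), of r "a \<bullet> x"] assms(2)
    by (simp add: smult_assoc1[symmetric] R.m_comm)
qed (use assms submodule_zero[OF assms(1)] submoduleE(5)[OF assms(1)] in \<open>auto simp: smult_r_distr\<close>)

lemma ideal_into_submodule:
  assumes H: "submodule H R M" and S: "S \<subseteq> carrier M"
  shows "ideal {a \<in> carrier R. \<forall>x\<in>S. a \<bullet> x \<in> H} R"
proof (rule idealI[OF R.ring_axioms])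
  note [simp] = subsetD[OF S]
  show "subgroup {a \<in> carrier R. \<forall>x\<in>S. a \<bullet> x \<in> H} (add_monoid R)"
    using submodule_zero[OF H] submoduleE[OF H]
    by (intro R.add.subgroupI) (auto simp: smult_l_distr smult_l_minus a_inv_def[symmetric])
  show "x \<otimes> a \<in> {a \<in> carrier R. \<forall>x\<in>S. a \<bullet> x \<in> H}"
    if "a \<in> {a \<in> carrier R. \<forall>x\<in>S. a \<bullet> x \<in> H}" "x \<in> carrier R" for a x
    using that submoduleE(4)[OF H] by (auto simp: smult_assoc1)
  then show "a \<otimes> x \<in> {a \<in> carrier R. \<forall>x\<in>S. a \<bullet> x \<in> H}"
    if "a \<in> {a \<in> carrier R. \<forall>x\<in>S. a \<bullet> x \<in> H}" "x \<in> carrier R" for a x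
    using that R.m_comm[of a x] by auto
qed

end


lemma (in abelian_group) minus_add_add:
  assumes "u \<in> carrier G" "z \<in> carrier G" "z' \<in> carrier G"
  shows "(z \<ominus> z') \<oplus> (u \<oplus> z') = u \<oplus> z"
proof -
  have "(z \<ominus> z') \<oplus> (u \<oplus> z') = (u \<oplus> z) \<oplus> (\<ominus> z' \<oplus> z')"
    using assms by (simp only: a_minus_def a_ac a_closed a_inv_closed)
  then show ?thesis using assms by (simp add: l_neg)
qed

section \<open>Chains of graded families of submodules\<close>

context module
begin

text \<open>For a family \<open>V\<close> of submodules, \<open>leading_part h V j d\<close> is the sum of the submodules
  \<open>h\<^sup>i V (d - i)\<close> over \<open>i < j\<close> with \<open>i \<le> d\<close>. Starting from \<open>M\<close> in degree zero and adding the elements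
  \<open>h\<close> of a list one at a time yields \<open>degree_part\<close>: the span in degree \<open>d\<close> of the multiples \<open>m x\<close>, where \<open>m\<close> is a
  monomial of degree \<open>d\<close> in the list. It is the image of the component of degree \<open>d\<close> of \<open>M[t\<^sub>1, \<dots>, t\<^sub>r]\<close>
  under substitution of the list for the variables, so the ascending chain condition for families in
  \<open>degree_part\<close> is a form of the basis theorem, with the recursion on the list in place of the adjunction of variables.\<close>

primrec leading_part :: "'a \<Rightarrow> (nat \<Rightarrow> 'c set) \<Rightarrow> nat \<Rightarrow> nat \<Rightarrow> 'c set" where
  "leading_part h V 0 d = {\<zero>\<^sub>M}"
| "leading_part h V (Suc j) d =
     (if j \<le> d then {(h [^] j) \<bullet> y \<oplus>\<^sub>M z | y z. y \<in> V (d - j) \<and> z \<in> leading_part h V j d}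
      else leading_part h V j d)"

primrec degree_part :: "'a list \<Rightarrow> nat \<Rightarrow> 'c set" where
  "degree_part [] d = (if d = 0 then carrier M else {\<zero>\<^sub>M})"
| "degree_part (h # hs) d = leading_part h (degree_part hs) (Suc d) d"

definition family_chain :: "'a list \<Rightarrow> (nat \<Rightarrow> 'c set) \<Rightarrow> (nat \<Rightarrow> nat \<Rightarrow> 'c set) \<Rightarrow> bool" where
  "family_chain hs W K \<longleftrightarrow>
     (\<forall>i d. submodule (K i d) R M \<and> K i d \<subseteq> W d \<and> K i d \<subseteq> K (Suc i) d \<and>
        (\<forall>h\<in>set hs. \<forall>x\<in>K i d. h \<bullet> x \<in> K i (Suc d)))"

lemma submodule_singleton_zero: "submodule {\<zero>\<^sub>M} R M"
  by (rule submodule_intro) auto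

lemma leading_part_props:
  assumes h: "h \<in> carrier R" and V': "\<forall>d. submodule (V d) R M"
  shows "submodule (leading_part h V j d) R M"
    and "leading_part h V j d \<subseteq> leading_part h V (Suc j) d"
proof -
  note V = V'[rule_format]
  have Vc: "\<And>d x. x \<in> V d \<Longrightarrow> x \<in> carrier M" using submoduleE(1)[OF V] by blast
  show sub: "submodule (leading_part h V j d) R M" for j
  proof (induction j)
    case 0
    then show ?case by (simp add: submodule_singleton_zero)
  next
    case (Suc j)
    note P = submoduleE[OF Suc.IH]
    have Pc: "\<And>x. x \<in> leading_part h V j d \<Longrightarrow> x \<in> carrier M" using P(1) by blast
    show ?case
    proof (cases "j \<le> d")
      case True
      let ?S = "{(h [^] j) \<bullet> y \<oplus>\<^sub>M z | y z. y \<in> V (d - j) \<and> z \<in> leading_part h V j d}"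
      have "submodule ?S R M"
      proof (rule submodule_intro)
        show "?S \<subseteq> carrier M" using h Vc Pc by auto
        show "\<zero>\<^sub>M \<in> ?S"
        proof -
          have "\<zero>\<^sub>M = (h [^] j) \<bullet> \<zero>\<^sub>M \<oplus>\<^sub>M \<zero>\<^sub>M" using h by simp
          then show ?thesis using submodule_zero[OF V] submodule_zero[OF Suc.IH] by blast
        qed
      next
        fix a b assume "a \<in> ?S" "b \<in> ?S"
        then obtain y z y' z' where yz: "a = (h [^] j) \<bullet> y \<oplus>\<^sub>M z" "y \<in> V (d - j)"
          "z \<in> leading_part h V j d" "b = (h [^] j) \<bullet> y' \<oplus>\<^sub>M z'" "y' \<in> V (d - j)"
          "z' \<in> leading_part h V j d"
          by blast
        have "a \<oplus>\<^sub>M b = (h [^] j) \<bullet> (y \<oplus>\<^sub>M y') \<oplus>\<^sub>M (z \<oplus>\<^sub>M z')"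
          using h yz Vc Pc by (simp add: smult_r_distr M.a_ac)
        then show "a \<oplus>\<^sub>M b \<in> ?S" using yz P(5) submoduleE(5)[OF V] by blast
      next
        fix a x assume a: "a \<in> carrier R" and "x \<in> ?S"
        then obtain y z where yz: "x = (h [^] j) \<bullet> y \<oplus>\<^sub>M z" "y \<in> V (d - j)"
          "z \<in> leading_part h V j d"
          by blast
        have "a \<bullet> x = (h [^] j) \<bullet> (a \<bullet> y) \<oplus>\<^sub>M (a \<bullet> z)"
          using h a yz Vc Pc by (simp add: smult_r_distr smult_assoc1[symmetric] R.m_comm)
        then show "a \<bullet> x \<in> ?S" using yz a P(4) submoduleE(4)[OF V] by blast
      qed
      then show ?thesis using True by simp
    next
      case False
      then show ?thesis using Suc.IH by simp
    qed
  qed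
  show "leading_part h V j d \<subseteq> leading_part h V (Suc j) d"
  proof (cases "j \<le> d")
    case True
    have "z = (h [^] j) \<bullet> \<zero>\<^sub>M \<oplus>\<^sub>M z" if "z \<in> leading_part h V j d" for z
      using h that submoduleE(1)[OF sub, of j] by (auto simp: subset_iff)
    then show ?thesis using True submodule_zero[OF V] by fastforce
  qed simp
qed

lemma leading_part_shift:
  assumes h: "h \<in> carrier R" and V': "\<forall>d. submodule (V d) R M"
    and x: "x \<in> leading_part h V j d"
  shows "h \<bullet> x \<in> leading_part h V (Suc j) (Suc d)"
proof -
  note V = V'[rule_format]
  show ?thesis
  using x
proof (induction j arbitrary: x)
  case 0
  then show ?case
    using h submodule_zero[OF leading_part_props(1)[OF h V'], of "Suc 0" "Suc d"] by simp
next
  case (Suc j)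
  show ?case
  proof (cases "j \<le> d")
    case True
    with Suc.prems obtain y z where yz: "x = (h [^] j) \<bullet> y \<oplus>\<^sub>M z" "y \<in> V (d - j)"
      "z \<in> leading_part h V j d"
      by auto
    have c: "y \<in> carrier M" "z \<in> carrier M"
      using yz submoduleE(1)[OF V] submoduleE(1)[OF leading_part_props(1)[OF h V']] by blast+
    have "h \<bullet> x = (h [^] Suc j) \<bullet> y \<oplus>\<^sub>M h \<bullet> z"
      using h c yz by (simp add: smult_r_distr smult_assoc1[symmetric] R.m_comm)
    then show ?thesis using True yz Suc.IH[OF yz(3)] by auto
  next
    case False
    then have "x \<in> leading_part h V j d" using Suc.prems by simp
    from Suc.IH[OF this] show ?thesis
      using leading_part_props(2)[OF h V'] by blast
  qed
qed
qed

lemma leading_part_old: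
  assumes h: "h \<in> carrier R" and V': "\<forall>d. submodule (V d) R M"
    and g: "g \<in> carrier R" "\<And>d y. y \<in> V d \<Longrightarrow> g \<bullet> y \<in> V (Suc d)"
    and x: "x \<in> leading_part h V j d"
  shows "g \<bullet> x \<in> leading_part h V j (Suc d)"
proof -
  note V = V'[rule_format]
  show ?thesis
  using x
proof (induction j arbitrary: x)
  case 0
  then show ?case using g by simp
next
  case (Suc j)
  show ?case
  proof (cases "j \<le> d")
    case True
    with Suc.prems obtain y z where yz: "x = (h [^] j) \<bullet> y \<oplus>\<^sub>M z" "y \<in> V (d - j)"
      "z \<in> leading_part h V j d"
      by auto
    have c: "y \<in> carrier M" "z \<in> carrier M"
      using yz submoduleE(1)[OF V] submoduleE(1)[OF leading_part_props(1)[OF h V']] by blast+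
    have "g \<bullet> x = (h [^] j) \<bullet> (g \<bullet> y) \<oplus>\<^sub>M g \<bullet> z"
      using h g(1) c yz by (simp add: smult_r_distr smult_assoc1[symmetric] R.m_comm)
    moreover have "g \<bullet> y \<in> V (Suc d - j)"
      using g(2)[OF yz(2)] True by (simp add: Suc_diff_le)
    ultimately show ?thesis using True Suc.IH[OF yz(3)] by auto
  next
    case False
    then have "x \<in> leading_part h V j d" using Suc.prems by simp
    from Suc.IH[OF this] show ?thesis
      using leading_part_props(2)[OF h V'] by blast
  qed
qed
qed

lemma degree_part_props:
  assumes "set hs \<subseteq> carrier R"
  shows "submodule (degree_part hs d) R M"
    and "\<lbrakk>h \<in> set hs; x \<in> degree_part hs d\<rbrakk> \<Longrightarrow> h \<bullet> x \<in> degree_part hs (Suc d)"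
    and "degree_part hs 0 = carrier M"
proof -
  have "(\<forall>d. submodule (degree_part hs d) R M) \<and>
      (\<forall>d. \<forall>h\<in>set hs. \<forall>x\<in>degree_part hs d. h \<bullet> x \<in> degree_part hs (Suc d)) \<and>
      degree_part hs 0 = carrier M"
    using assms
  proof (induction hs)
    case Nil
    then show ?case by (simp add: carrier_is_submodule submodule_singleton_zero)
  next
    case (Cons g hs)
    let ?V = "degree_part hs"
    have g: "g \<in> carrier R" and sub: "\<And>d. submodule (?V d) R M"
      and old: "\<And>d h x. h \<in> set hs \<Longrightarrow> x \<in> ?V d \<Longrightarrow> h \<bullet> x \<in> ?V (Suc d)"
      and hs: "set hs \<subseteq> carrier R" and V0: "?V 0 = carrier M"
      using Cons by auto
    have sub': "\<forall>d. submodule (?V d) R M" using sub by blast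
    have "h \<bullet> x \<in> leading_part g ?V (Suc (Suc d)) (Suc d)"
      if h: "h \<in> set (g # hs)" and x: "x \<in> leading_part g ?V (Suc d) d" for d h x
    proof (cases "h = g")
      case True
      then show ?thesis using leading_part_shift[OF g sub' x] by simp
    next
      case False
      then have "h \<in> set hs" using h by simp
      then have "h \<bullet> x \<in> leading_part g ?V (Suc d) (Suc d)"
        using hs old by (intro leading_part_old[OF g sub' _ _ x]) auto
      then show ?thesis using leading_part_props(2)[OF g sub'] by blast
    qed
    moreover have "leading_part g ?V (Suc 0) 0 = carrier M"
    proof -
      have "x \<in> carrier M \<Longrightarrow> \<exists>y. x = \<one> \<bullet> y \<oplus>\<^sub>M \<zero>\<^sub>M \<and> y \<in> carrier M" for x
        by (intro exI[of _ x]) simp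
      then show ?thesis using g by (auto simp: V0)
    qed
    ultimately show ?case
      using leading_part_props(1)[OF g sub'] by (simp del: leading_part.simps)
  qed
  then show "submodule (degree_part hs d) R M"
    and "\<lbrakk>h \<in> set hs; x \<in> degree_part hs d\<rbrakk> \<Longrightarrow> h \<bullet> x \<in> degree_part hs (Suc d)"
    and "degree_part hs 0 = carrier M"
    by auto
qed

lemma chain_mono:
  assumes "\<And>i. C i \<subseteq> C (Suc i)" "(i::nat) \<le> j" shows "C i \<subseteq> C j"
  using assms lift_Suc_mono_le by metis

text \<open>The step of the basis theorem. The leading coefficients with respect to the powers of \<open>g\<close> form
  families for the shorter list, which stabilize; two nested submodules with the same leading
  coefficients are equal.\<close>

lemma family_chain_Cons_stabilizes:
  assumes g: "g \<in> carrier R" and hs: "set hs \<subseteq> carrier R"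
    and IH: "\<And>K. family_chain hs (degree_part hs) K \<Longrightarrow> \<exists>n. \<forall>i\<ge>n. \<forall>d. K i d = K n d"
    and K: "family_chain (g # hs) (degree_part (g # hs)) K"
  shows "\<exists>n. \<forall>i\<ge>n. \<forall>d. K i d = K n d"
proof -
  let ?V = "degree_part hs" and ?P = "leading_part g (degree_part hs)"
  note V = degree_part_props(1)[OF hs]
  have V': "\<forall>d. submodule (?V d) R M" using V by blast
  note Psub = leading_part_props(1)[OF g V']
  have Ksub: "\<And>i d. submodule (K i d) R M" and Ksuc: "\<And>d i. K i d \<subseteq> K (Suc i) d"
    and KW: "\<And>i d. K i d \<subseteq> ?P (Suc d) d"
    and Kcl: "\<And>i d h x. h \<in> set (g # hs) \<Longrightarrow> x \<in> K i d \<Longrightarrow> h \<bullet> x \<in> K i (Suc d)"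
    using K by (auto simp: family_chain_def simp del: leading_part.simps)
  have Kmono: "K i d \<subseteq> K j d" if "i \<le> j" for i j d
    using chain_mono[of "\<lambda>i. K i d", OF Ksuc that] .
  have Vc: "\<And>d x. x \<in> ?V d \<Longrightarrow> x \<in> carrier M" using submoduleE(1)[OF V] by blast
  have Pc: "\<And>j d x. x \<in> ?P j d \<Longrightarrow> x \<in> carrier M" using submoduleE(1)[OF Psub] by blast
  \<comment> \<open>The coefficients at \<open>g\<^sup>j\<close> of the elements of \<open>K i\<close> of degree at most \<open>j\<close> in \<open>g\<close>; they increase with \<open>i\<close>
    and with \<open>j\<close>.\<close>
  define L where "L j i d = {y \<in> ?V d. \<exists>z\<in>?P j (d + j). (g [^] j) \<bullet> y \<oplus>\<^sub>M z \<in> K i (d + j)}"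
    for j i d
  have Lsub: "submodule (L j i d) R M" for j i d
  proof (rule submodule_intro)
    show "L j i d \<subseteq> carrier M" using Vc by (auto simp: L_def)
    have "(g [^] j) \<bullet> \<zero>\<^sub>M \<oplus>\<^sub>M \<zero>\<^sub>M \<in> K i (d + j)"
      using submodule_zero[OF Ksub] g by simp
    then show "\<zero>\<^sub>M \<in> L j i d" using submodule_zero[OF V] submodule_zero[OF Psub] by (auto simp: L_def)
  next
    fix a b assume "a \<in> L j i d" "b \<in> L j i d"
    then obtain z z' where z: "a \<in> ?V d" "z \<in> ?P j (d + j)" "(g [^] j) \<bullet> a \<oplus>\<^sub>M z \<in> K i (d + j)"
      "b \<in> ?V d" "z' \<in> ?P j (d + j)" "(g [^] j) \<bullet> b \<oplus>\<^sub>M z' \<in> K i (d + j)"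
      by (auto simp: L_def)
    have "(g [^] j) \<bullet> (a \<oplus>\<^sub>M b) \<oplus>\<^sub>M (z \<oplus>\<^sub>M z')
        = ((g [^] j) \<bullet> a \<oplus>\<^sub>M z) \<oplus>\<^sub>M ((g [^] j) \<bullet> b \<oplus>\<^sub>M z')"
      using g z Vc Pc by (simp add: smult_r_distr M.a_ac)
    then have "(g [^] j) \<bullet> (a \<oplus>\<^sub>M b) \<oplus>\<^sub>M (z \<oplus>\<^sub>M z') \<in> K i (d + j)"
      using submoduleE(5)[OF Ksub z(3,6)] by simp
    then show "a \<oplus>\<^sub>M b \<in> L j i d"
      using submoduleE(5)[OF V z(1,4)] submoduleE(5)[OF Psub z(2,5)] by (auto simp: L_def)
  next
    fix r y assume r: "r \<in> carrier R" and "y \<in> L j i d"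
    then obtain z where z: "y \<in> ?V d" "z \<in> ?P j (d + j)" "(g [^] j) \<bullet> y \<oplus>\<^sub>M z \<in> K i (d + j)"
      by (auto simp: L_def)
    have "(g [^] j) \<bullet> (r \<bullet> y) \<oplus>\<^sub>M (r \<bullet> z) = r \<bullet> ((g [^] j) \<bullet> y \<oplus>\<^sub>M z)"
      using g r z Vc Pc by (simp add: smult_r_distr smult_assoc1[symmetric] R.m_comm)
    then have "(g [^] j) \<bullet> (r \<bullet> y) \<oplus>\<^sub>M (r \<bullet> z) \<in> K i (d + j)"
      using submoduleE(4)[OF Ksub r z(3)] by simp
    then show "r \<bullet> y \<in> L j i d"
      using submoduleE(4)[OF V r z(1)] submoduleE(4)[OF Psub r z(2)] by (auto simp: L_def)
  qed
  have Lsuc: "L j i d \<subseteq> L j (Suc i) d" for j i d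
    using Ksuc by (fastforce simp: L_def)
  have Lcl: "h \<bullet> y \<in> L j i (Suc d)" if h: "h \<in> set hs" and y: "y \<in> L j i d" for j i d h y
  proof -
    obtain z where z: "y \<in> ?V d" "z \<in> ?P j (d + j)" "(g [^] j) \<bullet> y \<oplus>\<^sub>M z \<in> K i (d + j)"
      using y by (auto simp: L_def)
    have hc: "h \<in> carrier R" using h hs by blast
    have "(g [^] j) \<bullet> (h \<bullet> y) \<oplus>\<^sub>M (h \<bullet> z) = h \<bullet> ((g [^] j) \<bullet> y \<oplus>\<^sub>M z)"
      using g hc z Vc Pc by (simp add: smult_r_distr smult_assoc1[symmetric] R.m_comm)
    then have "(g [^] j) \<bullet> (h \<bullet> y) \<oplus>\<^sub>M (h \<bullet> z) \<in> K i (Suc d + j)"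
      using Kcl[OF _ z(3), of h] h by simp
    moreover have "h \<bullet> z \<in> ?P j (Suc d + j)"
      using leading_part_old[OF g V' hc degree_part_props(2)[OF hs h] z(2)] by simp
    ultimately show ?thesis
      using degree_part_props(2)[OF hs h z(1)] by (auto simp: L_def)
  qed
  have Lj: "L j i d \<subseteq> L (Suc j) i d" for j i d
  proof
    fix y assume "y \<in> L j i d"
    then obtain z where z: "y \<in> ?V d" "z \<in> ?P j (d + j)" "(g [^] j) \<bullet> y \<oplus>\<^sub>M z \<in> K i (d + j)"
      by (auto simp: L_def)
    have "(g [^] Suc j) \<bullet> y \<oplus>\<^sub>M (g \<bullet> z) = g \<bullet> ((g [^] j) \<bullet> y \<oplus>\<^sub>M z)"
      using g z Vc Pc by (simp add: smult_r_distr smult_assoc1[symmetric] R.m_comm)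
    then have "(g [^] Suc j) \<bullet> y \<oplus>\<^sub>M (g \<bullet> z) \<in> K i (d + Suc j)"
      using Kcl[OF _ z(3), of g] by simp
    moreover have "g \<bullet> z \<in> ?P (Suc j) (d + Suc j)"
      using leading_part_shift[OF g V' z(2)] by simp
    ultimately show "y \<in> L (Suc j) i d"
      using z(1) by (auto simp: L_def simp del: leading_part.simps)
  qed
  have Lmono: "L j i d \<subseteq> L j' i' d" if "j \<le> j'" "i \<le> i'" for j j' i i' d
    using chain_mono[of "\<lambda>i. L j i d", OF Lsuc that(2)] chain_mono[of "\<lambda>j. L j i' d", OF Lj that(1)]
    by blast
  have chain: "family_chain hs ?V (\<lambda>i. L (\<phi> i) i)" if "mono \<phi>" for \<phi>
    unfolding family_chain_def
  proof (intro allI conjI ballI)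
    fix i d show "L (\<phi> i) i d \<subseteq> L (\<phi> (Suc i)) (Suc i) d"
      using that by (intro Lmono) (auto simp: mono_def)
    show "L (\<phi> i) i d \<subseteq> ?V d" by (auto simp: L_def)
  qed (use Lsub Lcl in auto)
  \<comment> \<open>The diagonal settles all \<open>j \<ge> n0\<close> at once; each of the finitely many smaller \<open>j\<close> is settled by
    its own chain.\<close>
  obtain n0 where n0: "\<And>i d. i \<ge> n0 \<Longrightarrow> L i i d = L n0 n0 d"
    using IH[OF chain[of id]] by (auto simp: mono_def)
  have "\<forall>j. \<exists>n. \<forall>i\<ge>n. \<forall>d. L j i d = L j n d"
    using IH[OF chain[of "\<lambda>_. j" for j]] by (auto simp: mono_def)
  then obtain n where n: "\<And>j i d. i \<ge> n j \<Longrightarrow> L j i d = L j (n j) d"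
    by metis
  define N where "N = Max (insert n0 (n ` {..<n0}))"
  have N: "n0 \<le> N" "\<And>j. j < n0 \<Longrightarrow> n j \<le> N" by (auto simp: N_def)
  have LN: "L j i d = L j N d" if i: "i \<ge> N" for j i d
  proof (cases "j < n0")
    case True
    then show ?thesis using n[of j i d] n[of j N d] N(2)[of j] i by simp
  next
    case False
    then have j: "n0 \<le> j" by simp
    have *: "L j i d = L n0 n0 d" if "i \<ge> n0" for i
      using Lmono[of j "max i j" i "max i j" d] Lmono[of n0 j n0 i d] n0[of "max i j" d] that j
      by auto
    show ?thesis using *[of i] *[of N] i N(1) by simp
  qed
  \<comment> \<open>Subtract from \<open>x\<close> an element of \<open>K N\<close> with the same leading coefficient; the difference has
    smaller degree in \<open>g\<close>.\<close>
  have "x \<in> K N d" if "i \<ge> N" "x \<in> K i d" "x \<in> ?P j d" for i d j x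
    using that(2,3)
  proof (induction j arbitrary: x)
    case 0
    then show ?case using submodule_zero[OF Ksub] by simp
  next
    case (Suc j)
    show ?case
    proof (cases "j \<le> d")
      case True
      with Suc.prems(2) obtain y z where yz: "x = (g [^] j) \<bullet> y \<oplus>\<^sub>M z" "y \<in> ?V (d - j)"
        "z \<in> ?P j d"
        by auto
      then have "y \<in> L j i (d - j)" using Suc.prems(1) True by (auto simp: L_def)
      then have "y \<in> L j N (d - j)" using LN[OF that(1)] by simp
      then obtain z' where z': "z' \<in> ?P j d" "(g [^] j) \<bullet> y \<oplus>\<^sub>M z' \<in> K N d"
        using True by (auto simp: L_def)
      have c: "y \<in> carrier M" "z \<in> carrier M" "z' \<in> carrier M"
        using yz z' Vc Pc by auto
      have eq: "z \<ominus>\<^sub>M z' = x \<ominus>\<^sub>M ((g [^] j) \<bullet> y \<oplus>\<^sub>M z')"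
        using c g yz(1) by (simp add: a_minus_def M.minus_add M.a_ac M.r_neg M.r_neg1 M.r_neg2)
      have "z \<ominus>\<^sub>M z' \<in> K i d"
        unfolding eq using Suc.prems(1) z'(2) Kmono[OF that(1)] by (intro submodule_minus[OF Ksub]) auto
      moreover have "z \<ominus>\<^sub>M z' \<in> ?P j d"
        using yz z' by (intro submodule_minus[OF Psub])
      ultimately have "z \<ominus>\<^sub>M z' \<in> K N d" by (rule Suc.IH)
      then have "(z \<ominus>\<^sub>M z') \<oplus>\<^sub>M ((g [^] j) \<bullet> y \<oplus>\<^sub>M z') \<in> K N d"
        by (rule submoduleE(5)[OF Ksub _ z'(2)])
      moreover have "(z \<ominus>\<^sub>M z') \<oplus>\<^sub>M ((g [^] j) \<bullet> y \<oplus>\<^sub>M z') = x"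
        using c g yz(1) by (simp add: M.minus_add_add)
      ultimately show ?thesis by simp
    next
      case False
      then show ?thesis using Suc by simp
    qed
  qed
  then have "\<forall>i\<ge>N. \<forall>d. K i d = K N d"
    using KW Kmono by blast
  then show ?thesis by blast
qed

lemma family_chain_stabilizes:
  assumes noeth: "\<And>C. \<lbrakk>\<And>i. submodule (C i) R M; \<And>i. C i \<subseteq> C (Suc i)\<rbrakk> \<Longrightarrow> \<exists>n. \<forall>i\<ge>n. C i = C n"
    and "set hs \<subseteq> carrier R" and "family_chain hs (degree_part hs) K"
  shows "\<exists>n. \<forall>i\<ge>n. \<forall>d. K i d = K n d"
  using assms(2,3)
proof (induction hs arbitrary: K)
  case Nil
  then obtain n where "\<forall>i\<ge>n. K i 0 = K n 0"
    using noeth[of "\<lambda>i. K i 0"] by (auto simp: family_chain_def)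
  moreover have "K i d = {\<zero>\<^sub>M}" if "d \<noteq> 0" for i d
  proof -
    have "K i d \<subseteq> {\<zero>\<^sub>M}" "submodule (K i d) R M"
      using Nil(2) that unfolding family_chain_def by (metis degree_part.simps(1))+
    then show ?thesis using submodule_zero[of "K i d"] by blast
  qed
  ultimately show ?case by metis
next
  case (Cons g hs)
  show ?case
    by (rule family_chain_Cons_stabilizes[of g hs, OF _ _ _ Cons.prems(2)]) (use Cons in auto)
qed

end

section \<open>Noetherian modules\<close>

lemma (in noetherian_ring) ideal_chain_stabilizes:
  assumes A: "\<And>i::nat. ideal (A i) R" and suc: "\<And>i. A i \<subseteq> A (Suc i)"
  shows "\<exists>n. \<forall>i\<ge>n. A i = A n"
proof -
  have mono: "A i \<subseteq> A j" if "i \<le> j" for i j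
    using suc that lift_Suc_mono_le by metis
  have "A i \<subseteq> A j \<or> A j \<subseteq> A i" for i j
    using mono[of i j] mono[of j i] by linarith
  then have "subset.chain {I. ideal I R} (range A)"
    using A by (auto simp: pred_on.chain_def)
  then have "\<Union>(range A) \<in> range A" by (intro ideal_chain_is_trivial) auto
  then obtain n where n: "A n = (\<Union>i. A i)" by auto
  then have "\<forall>i\<ge>n. A i = A n" using mono by blast
  then show ?thesis by blast
qed

context module
begin

primrec span_list :: "'c list \<Rightarrow> 'c set" where
  "span_list [] = {\<zero>\<^sub>M}"
| "span_list (m # ms) = {r \<bullet> m \<oplus>\<^sub>M z | r z. r \<in> carrier R \<and> z \<in> span_list ms}"

lemma span_list_props:
  assumes "set ms \<subseteq> carrier M"
  shows "submodule (span_list ms) R M" "set ms \<subseteq> span_list ms"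
proof -
  have "submodule (span_list ms) R M \<and> set ms \<subseteq> span_list ms"
    using assms
  proof (induction ms)
    case Nil
    then show ?case by (simp add: submodule_singleton_zero)
  next
    case (Cons m ms)
    then have m: "m \<in> carrier M" and S: "submodule (span_list ms) R M"
      and ms: "set ms \<subseteq> span_list ms" by auto
    note Sp = submoduleE[OF S]
    have Sc: "\<And>x. x \<in> span_list ms \<Longrightarrow> x \<in> carrier M" using Sp(1) by blast
    have z: "z = \<zero> \<bullet> m \<oplus>\<^sub>M z" if "z \<in> span_list ms" for z
      using m Sc[OF that] by simp
    have "submodule (span_list (m # ms)) R M"
    proof (rule submodule_intro)
      show "span_list (m # ms) \<subseteq> carrier M" using m Sc by auto
      show "\<zero>\<^sub>M \<in> span_list (m # ms)" using z[OF submodule_zero[OF S]] submodule_zero[OF S] by auto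
    next
      fix a b assume "a \<in> span_list (m # ms)" "b \<in> span_list (m # ms)"
      then obtain r s u v where *: "a = r \<bullet> m \<oplus>\<^sub>M u" "b = s \<bullet> m \<oplus>\<^sub>M v"
        "r \<in> carrier R" "s \<in> carrier R" "u \<in> span_list ms" "v \<in> span_list ms"
        by auto
      then have "a \<oplus>\<^sub>M b = (r \<oplus> s) \<bullet> m \<oplus>\<^sub>M (u \<oplus>\<^sub>M v)"
        using m Sc by (simp add: smult_l_distr M.a_ac)
      then show "a \<oplus>\<^sub>M b \<in> span_list (m # ms)" using * Sp(5) by auto
    next
      fix a x assume a: "a \<in> carrier R" and "x \<in> span_list (m # ms)"
      then obtain r u where *: "x = r \<bullet> m \<oplus>\<^sub>M u" "r \<in> carrier R" "u \<in> span_list ms"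
        by auto
      then have "a \<bullet> x = (a \<otimes> r) \<bullet> m \<oplus>\<^sub>M (a \<bullet> u)"
        using m a Sc by (simp add: smult_r_distr smult_assoc1)
      then show "a \<bullet> x \<in> span_list (m # ms)" using * a Sp(4) by auto
    qed
    moreover have "m \<in> span_list (m # ms)"
    proof -
      have "m = \<one> \<bullet> m \<oplus>\<^sub>M \<zero>\<^sub>M" using m by simp
      then show ?thesis using submodule_zero[OF S] by auto
    qed
    moreover have "set ms \<subseteq> span_list (m # ms)" using ms z by fastforce
    ultimately show ?case by simp
  qed
  then show "submodule (span_list ms) R M" "set ms \<subseteq> span_list ms" by auto
qed

text \<open>By induction on the generators: a member of the chain is determined by the ideal of the
  coefficients of the first generator and by its intersection with the span of the others.\<close>

lemma submodule_chain_in_span_stabilizes: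
  assumes noeth: "noetherian_ring R"
    and "set ms \<subseteq> carrier M" "\<And>i. submodule (C i) R M" "\<And>i. C i \<subseteq> C (Suc i)" "\<And>i. C i \<subseteq> span_list ms"
  shows "\<exists>n. \<forall>i\<ge>n. C i = C n"
  using assms(2-)
proof (induction ms arbitrary: C)
  case Nil
  then have "C i = {\<zero>\<^sub>M}" for i using submodule_zero[OF Nil.prems(2)] by fastforce
  then show ?case by simp
next
  case (Cons m ms)
  then have m: "m \<in> carrier M" and ms: "set ms \<subseteq> carrier M" by auto
  note S = span_list_props(1)[OF ms] and C = Cons.prems(2)
  have Sc: "\<And>x. x \<in> span_list ms \<Longrightarrow> x \<in> carrier M" using submoduleE(1)[OF S] by blast
  have mono: "C i \<subseteq> C j" if "i \<le> j" for i j
    using chain_mono[of C, OF Cons.prems(3) that] .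
  define A where "A i = {r \<in> carrier R. \<exists>z\<in>span_list ms. r \<bullet> m \<oplus>\<^sub>M z \<in> C i}" for i
  have A: "ideal (A i) R" for i
  proof (rule idealI[OF R.ring_axioms])
    have z0: "\<zero> \<bullet> m \<oplus>\<^sub>M \<zero>\<^sub>M \<in> C i" using m submodule_zero[OF C] by simp
    have cl: "x \<otimes> r \<in> A i" if r: "r \<in> A i" and x: "x \<in> carrier R" for r x
    proof -
      obtain z where z: "r \<in> carrier R" "z \<in> span_list ms" "r \<bullet> m \<oplus>\<^sub>M z \<in> C i"
        using r by (auto simp: A_def)
      have "(x \<otimes> r) \<bullet> m \<oplus>\<^sub>M (x \<bullet> z) = x \<bullet> (r \<bullet> m \<oplus>\<^sub>M z)"
        using z m x Sc by (simp add: smult_r_distr smult_assoc1)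
      then have "(x \<otimes> r) \<bullet> m \<oplus>\<^sub>M (x \<bullet> z) \<in> C i"
        using submoduleE(4)[OF C x z(3)] by simp
      then show ?thesis using z x submoduleE(4)[OF S x z(2)] by (auto simp: A_def)
    qed
    have "\<ominus> r \<in> A i" if "r \<in> A i" for r
    proof -
      have "r \<in> carrier R" using that by (simp add: A_def)
      then show ?thesis using cl[OF that, of "\<ominus> \<one>"] by (simp add: R.l_minus)
    qed
    moreover have "r \<oplus> s \<in> A i" if rs: "r \<in> A i" "s \<in> A i" for r s
    proof -
      obtain z z' where z: "r \<in> carrier R" "z \<in> span_list ms" "r \<bullet> m \<oplus>\<^sub>M z \<in> C i"
        "s \<in> carrier R" "z' \<in> span_list ms" "s \<bullet> m \<oplus>\<^sub>M z' \<in> C i"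
        using rs by (auto simp: A_def)
      have "(r \<oplus> s) \<bullet> m \<oplus>\<^sub>M (z \<oplus>\<^sub>M z') = (r \<bullet> m \<oplus>\<^sub>M z) \<oplus>\<^sub>M (s \<bullet> m \<oplus>\<^sub>M z')"
        using z m Sc by (simp add: smult_l_distr M.a_ac)
      then have "(r \<oplus> s) \<bullet> m \<oplus>\<^sub>M (z \<oplus>\<^sub>M z') \<in> C i"
        using submoduleE(5)[OF C z(3,6)] by simp
      then show ?thesis using z submoduleE(5)[OF S z(2,5)] by (auto simp: A_def)
    qed
    ultimately show "subgroup (A i) (add_monoid R)"
      using z0 submodule_zero[OF S] by (intro R.add.subgroupI) (auto simp: A_def)
    show "\<And>a x. \<lbrakk>a \<in> A i; x \<in> carrier R\<rbrakk> \<Longrightarrow> x \<otimes> a \<in> A i" by (rule cl)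
    show "\<And>a x. \<lbrakk>a \<in> A i; x \<in> carrier R\<rbrakk> \<Longrightarrow> a \<otimes> x \<in> A i"
      using cl by (auto simp: A_def R.m_comm)
  qed
  have "\<exists>n. \<forall>i\<ge>n. A i = A n"
    using Cons.prems(3) by (intro noetherian_ring.ideal_chain_stabilizes[OF noeth] A) (fastforce simp: A_def)
  then obtain n1 where n1: "\<And>i. i \<ge> n1 \<Longrightarrow> A i = A n1" by auto
  have "submodule (C i \<inter> span_list ms) R M" for i
    using submoduleE[OF C] submoduleE[OF S] submodule_zero[OF C] submodule_zero[OF S]
    by (intro submodule_intro) auto
  then obtain n2 where n2: "\<And>i. i \<ge> n2 \<Longrightarrow> C i \<inter> span_list ms = C n2 \<inter> span_list ms"
    using Cons.IH[OF ms, of "\<lambda>i. C i \<inter> span_list ms"] Cons.prems(3) by fastforce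
  let ?N = "max n1 n2"
  have "C i \<subseteq> C ?N" if i: "i \<ge> ?N" for i
  proof
    fix x assume x: "x \<in> C i"
    then obtain r z where rz: "x = r \<bullet> m \<oplus>\<^sub>M z" "r \<in> carrier R" "z \<in> span_list ms"
      using Cons.prems(4) by fastforce
    then have "r \<in> A i" using x by (auto simp: A_def)
    then have "r \<in> A ?N" using n1[of i] n1[of ?N] i by simp
    then obtain z' where z': "z' \<in> span_list ms" "r \<bullet> m \<oplus>\<^sub>M z' \<in> C ?N"
      by (auto simp: A_def)
    have c: "z \<in> carrier M" "z' \<in> carrier M" using rz z' Sc by auto
    have eq: "z \<ominus>\<^sub>M z' = x \<ominus>\<^sub>M (r \<bullet> m \<oplus>\<^sub>M z')"
      using c m rz by (simp add: a_minus_def M.minus_add M.a_ac M.r_neg M.r_neg1 M.r_neg2)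
    have "z \<ominus>\<^sub>M z' \<in> C i"
      unfolding eq using x z'(2) mono[OF i] by (intro submodule_minus[OF C]) auto
    moreover have "z \<ominus>\<^sub>M z' \<in> span_list ms"
      using rz z' by (intro submodule_minus[OF S])
    ultimately have "z \<ominus>\<^sub>M z' \<in> C ?N" using n2[of i] n2[of ?N] i by auto
    then have "(z \<ominus>\<^sub>M z') \<oplus>\<^sub>M (r \<bullet> m \<oplus>\<^sub>M z') \<in> C ?N"
      by (rule submoduleE(5)[OF C _ z'(2)])
    moreover have "(z \<ominus>\<^sub>M z') \<oplus>\<^sub>M (r \<bullet> m \<oplus>\<^sub>M z') = x"
      using c m rz by (simp add: M.minus_add_add)
    ultimately show "x \<in> C ?N" by simp
  qed
  then have "\<forall>i\<ge>?N. C i = C ?N" using mono by blast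
  then show ?case by blast
qed

lemma submodule_chain_stabilizes:
  assumes "noetherian_ring R" "finitely_generated_module R M"
    and "\<And>i. submodule (C i) R M" "\<And>i. C i \<subseteq> C (Suc i)"
  shows "\<exists>n. \<forall>i\<ge>n. C i = C n"
proof -
  obtain S where S: "S \<subseteq> carrier M" "finite S" "\<And>N. submodule N R M \<Longrightarrow> S \<subseteq> N \<Longrightarrow> N = carrier M"
    using assms(2) by (auto simp: finitely_generated_module_def)
  obtain ms where ms: "set ms = S" using finite_list[OF S(2)] by auto
  have "span_list ms = carrier M"
    using S(1) ms span_list_props[of ms] by (intro S(3)) auto
  then have "C i \<subseteq> span_list ms" for i using submoduleE(1)[OF assms(3)] by simp
  then show ?thesis
    using submodule_chain_in_span_stabilizes[of ms C] assms ms S(1) by blast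
qed

end


section \<open>Powers of an ideal acting on a module\<close>

context cring
begin

lemma one_ideals_set [simp]: "\<one>\<^bsub>ideals_set R\<^esub> = carrier R"
  by (simp add: ideals_set_def)

lemma mult_ideals_set [simp]: "I \<otimes>\<^bsub>ideals_set R\<^esub> J = I \<cdot> J"
  by (simp add: ideals_set_def)

lemma ideal_power_Suc: "ideal_power R I (Suc n) = ideal_power R I n \<cdot> I"
  by simp

lemma ideal_ideal_power: "ideal I R \<Longrightarrow> ideal (ideal_power R I n) R"
  by (induction n) (simp_all add: oneideal ideal_power_Suc ideal_prod_is_ideal)

lemma ideal_power_1: "ideal I R \<Longrightarrow> ideal_power R I (Suc 0) = I"
  by (simp add: ideal_power_Suc ideal_prod_commute[of "carrier R"] oneideal ideal_prod_one)

lemma ideal_power_mult: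
  assumes I: "ideal I R" and a: "a \<in> ideal_power R I m" and b: "b \<in> ideal_power R I n"
  shows "a \<otimes> b \<in> ideal_power R I (m + n)"
  using b
proof (induction n arbitrary: b)
  case 0
  then show ?case using ideal.I_r_closed[OF ideal_ideal_power[OF I] a] by simp
next
  case (Suc n)
  have c: "a \<in> carrier R" using ideal.Icarr[OF ideal_ideal_power[OF I] a] .
  note P = ideal_ideal_power[OF I]
  from Suc.prems have "b \<in> ideal_power R I n \<cdot> I" by (simp add: ideal_power_Suc)
  then have "b \<in> carrier R \<and> a \<otimes> b \<in> ideal_power R I (m + n) \<cdot> I"
  proof (induction b rule: ideal_prod.induct)
    case (prod i j)
    then have "i \<in> carrier R" "j \<in> carrier R"
      using ideal.Icarr[OF P] ideal.Icarr[OF I] by auto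
    moreover have "(a \<otimes> i) \<otimes> j \<in> ideal_power R I (m + n) \<cdot> I"
      using Suc.IH prod by (intro ideal_prod.prod)
    ultimately show ?case using c by (simp add: m_assoc)
  next
    case (sum s1 s2)
    then show ?case using c by (simp add: r_distr ideal_prod.sum)
  qed
  then show ?case by (simp add: ideal_power_Suc)
qed

lemma ideal_power_Suc_subset: "ideal I R \<Longrightarrow> ideal_power R I (Suc n) \<subseteq> ideal_power R I n"
  using ideal_prod_inter[OF ideal_ideal_power] by (auto simp: ideal_power_Suc)

end

locale ideal_module = module R M for R (structure) and M :: "('a, 'b, 'm) module_scheme" (structure) +
  fixes I
  assumes I: "ideal I R"
begin

abbreviation X :: "nat \<Rightarrow> 'b set" where "X \<equiv> power_submodule R I M"

abbreviation ipow where "ipow n \<equiv> ideal_power R I n"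

lemma I_carrier: "a \<in> I \<Longrightarrow> a \<in> carrier R"
  using ideal.Icarr[OF I] .

lemma ideal_power_carrier: "a \<in> ipow n \<Longrightarrow> a \<in> carrier R"
  using ideal.Icarr[OF R.ideal_ideal_power[OF I]] .

lemma power_submodule_gen:
  "\<lbrakk>a \<in> ipow n; x \<in> carrier M\<rbrakk> \<Longrightarrow> a \<bullet> x \<in> X n"
  unfolding power_submodule_def by (rule generate.incl) blast

lemma power_submodule_least:
  assumes H: "submodule H R M"
    and gen: "\<And>a x. \<lbrakk>a \<in> ipow n; x \<in> carrier M\<rbrakk> \<Longrightarrow> a \<bullet> x \<in> H"
  shows "X n \<subseteq> H"
  unfolding power_submodule_def
  using H gen by (intro M.add.generate_subgroup_incl) (auto simp: submodule_def)

lemma submodule_X: "submodule (X n) R M"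
proof -
  let ?S = "{a \<bullet> x | a x. a \<in> ipow n \<and> x \<in> carrier M}"
  have S: "?S \<subseteq> carrier M" using ideal_power_carrier by auto
  have sub: "subgroup (X n) (add_monoid M)"
    unfolding power_submodule_def using S by (intro M.add.generate_is_subgroup) simp
  have Xc: "\<And>x. x \<in> X n \<Longrightarrow> x \<in> carrier M" using subgroup.subset[OF sub] by auto
  have "r \<bullet> x \<in> X n" if r: "r \<in> carrier R" and "x \<in> X n" for r x
    using that(2)[unfolded power_submodule_def]
  proof (induction x rule: generate.induct)
    case one
    then show ?case using r subgroup.one_closed[OF sub] by simp
  next
    case (incl h)
    then obtain a x where ax: "h = a \<bullet> x" "a \<in> ipow n" "x \<in> carrier M" by auto
    have "r \<otimes> a \<in> ipow n"
      using r ax by (intro ideal.I_l_closed[OF R.ideal_ideal_power[OF I]])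
    from power_submodule_gen[OF this ax(3)] show ?case
      using ax r ideal_power_carrier by (simp add: smult_assoc1)
  next
    case (inv h)
    then obtain a x where ax: "h = a \<bullet> x" "a \<in> ipow n" "x \<in> carrier M" by auto
    have "(\<ominus> r) \<otimes> a \<in> ipow n"
      using r ax by (intro ideal.I_l_closed[OF R.ideal_ideal_power[OF I]]) auto
    from power_submodule_gen[OF this ax(3)] have "r \<bullet> (\<ominus>\<^sub>M h) \<in> X n"
      using ax r ideal_power_carrier by (simp add: smult_assoc1 smult_l_minus smult_r_minus)
    then show ?case by (simp add: a_inv_def)
  next
    case (eng h1 h2)
    then have "h1 \<in> X n" "h2 \<in> X n" by (auto simp: power_submodule_def)
    with eng r Xc show ?case
      using subgroup.m_closed[OF sub] by (simp add: smult_r_distr)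
  qed
  then show ?thesis using sub by (intro submodule.intro) (auto simp: submodule_axioms_def)
qed

lemmas X_carrier = subsetD[OF submoduleE(1)[OF submodule_X]]
lemmas X_zero = submodule_zero[OF submodule_X]
lemmas X_add = submoduleE(5)[OF submodule_X]
lemmas X_smult = submoduleE(4)[OF submodule_X]
lemmas X_minus = submodule_minus[OF submodule_X]

lemma X_0: "X 0 = carrier M"
proof
  show "carrier M \<subseteq> X 0"
  proof
    fix x assume "x \<in> carrier M"
    then show "x \<in> X 0" using power_submodule_gen[of \<one> 0 x] by simp
  qed
qed (use X_carrier in auto)

lemma X_mult:
  assumes a: "a \<in> ipow m" and x: "x \<in> X n"
  shows "a \<bullet> x \<in> X (m + n)"
proof -
  have ac: "a \<in> carrier R" using a by (rule ideal_power_carrier)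
  have "X n \<subseteq> {x \<in> carrier M. a \<bullet> x \<in> X (m + n)}"
  proof (rule power_submodule_least[OF submodule_vimage_smult[OF submodule_X ac]])
    fix b y assume b: "b \<in> ipow n" and y: "y \<in> carrier M"
    then show "b \<bullet> y \<in> {x \<in> carrier M. a \<bullet> x \<in> X (m + n)}"
      using power_submodule_gen[OF R.ideal_power_mult[OF I a b] y] ac ideal_power_carrier[OF b]
      by (simp add: smult_assoc1)
  qed
  then show ?thesis using x by blast
qed

lemma X_Suc_subset: "X (Suc n) \<subseteq> X n"
  using R.ideal_power_Suc_subset[OF I] power_submodule_gen
  by (intro power_submodule_least submodule_X) blast

lemma X_antimono: "m \<le> n \<Longrightarrow> X n \<subseteq> X m"
  using lift_Suc_antimono_le[of X] X_Suc_subset by blast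

lemma X_mult_I: "\<lbrakk>a \<in> I; x \<in> X n\<rbrakk> \<Longrightarrow> a \<bullet> x \<in> X (Suc n)"
  using X_mult[of a "Suc 0" x n] R.ideal_power_1[OF I] by simp

lemma ideal_power_Suc_least:
  assumes H: "submodule H R M" and S: "S \<subseteq> carrier M"
    and gen: "\<And>a b x. \<lbrakk>a \<in> ipow n; b \<in> I; x \<in> S\<rbrakk> \<Longrightarrow> a \<bullet> (b \<bullet> x) \<in> H"
    and c: "c \<in> ipow (Suc n)" and x: "x \<in> S"
  shows "c \<bullet> x \<in> H"
proof -
  let ?A = "{a \<in> carrier R. \<forall>x\<in>S. a \<bullet> x \<in> H}"
  have A: "ideal ?A R" by (rule ideal_into_submodule[OF H S])
  have "c \<in> ipow n \<cdot> I" using c by (simp add: R.ideal_power_Suc)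
  then have "c \<in> ?A"
  proof (induction c rule: ideal_prod.induct)
    case (prod i j)
    then have "i \<in> carrier R" "j \<in> carrier R" using ideal_power_carrier I_carrier by auto
    then show ?case using gen[OF prod] S by (auto simp: smult_assoc1)
  next
    case (sum s1 s2)
    then show ?case using additive_subgroup.a_closed[OF ideal.axioms(1)[OF A]] by blast
  qed
  then show ?thesis using x by blast
qed

lemma X_Suc_least:
  assumes H: "submodule H R M" and gen: "\<And>a x. \<lbrakk>a \<in> I; x \<in> X n\<rbrakk> \<Longrightarrow> a \<bullet> x \<in> H"
  shows "X (Suc n) \<subseteq> H"
proof (rule power_submodule_least[OF H])
  fix c x assume c: "c \<in> ipow (Suc n)" and x: "x \<in> carrier M"
  show "c \<bullet> x \<in> H"
  proof (rule ideal_power_Suc_least[OF H order_refl _ c x])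
    fix a b x assume a: "a \<in> ipow n" and b: "b \<in> I" and x: "x \<in> carrier M"
    then have "a \<bullet> (b \<bullet> x) = b \<bullet> (a \<bullet> x)"
      using ideal_power_carrier I_carrier by (simp add: smult_assoc1[symmetric] R.m_comm)
    then show "a \<bullet> (b \<bullet> x) \<in> H"
      using gen[OF b power_submodule_gen[OF a x]] by simp
  qed
qed

definition graded_family :: "(nat \<Rightarrow> 'b set) \<Rightarrow> bool" where
  "graded_family K \<longleftrightarrow>
     (\<forall>d. submodule (K d) R M \<and> K d \<subseteq> X d \<and> (\<forall>a\<in>I. \<forall>x\<in>K d. a \<bullet> x \<in> K (Suc d)))"

lemma graded_familyD:
  assumes "graded_family K"
  shows "submodule (K d) R M" "x \<in> K d \<Longrightarrow> x \<in> X d"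
    "\<lbrakk>a \<in> I; x \<in> K d\<rbrakk> \<Longrightarrow> a \<bullet> x \<in> K (Suc d)"
  using assms by (auto simp: graded_family_def)

text \<open>For generators \<open>hs\<close> of \<open>I\<close> the module \<open>I\<^sup>dM\<close> is contained in \<open>degree_part hs d\<close>, so that the basis
  theorem applies to all \<open>d\<close> together. In effect \<open>B(M)\<close> is a noetherian graded module over \<open>B(R)\<close>.\<close>

lemma graded_families_stabilize:
  assumes noeth: "noetherian_ring R" and fg: "finitely_generated_module R M"
    and K: "\<And>i. graded_family (K i)" and suc: "\<And>i d. K i d \<subseteq> K (Suc i) d"
  shows "\<exists>n. \<forall>i\<ge>n. \<forall>d. K i d = K n d"
proof -
  obtain A where A: "A \<subseteq> carrier R" "finite A" "I = Idl A"
    using noetherian_ring.finetely_gen[OF noeth I] by auto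
  obtain hs where hs: "set hs = A" using finite_list[OF A(2)] by auto
  have hsc: "set hs \<subseteq> carrier R" and hsI: "set hs \<subseteq> I"
    using hs A(1) R.genideal_self[OF A(1)] A(3) by auto
  note W = degree_part_props[OF hsc]
  have "X d \<subseteq> degree_part hs d" for d
  proof (induction d)
    case 0
    then show ?case using W(3) X_carrier by auto
  next
    case (Suc d)
    show ?case
    proof (rule X_Suc_least[OF W(1)])
      fix a x assume a: "a \<in> I" and x: "x \<in> X d"
      let ?A = "{a \<in> carrier R. \<forall>x\<in>degree_part hs d. a \<bullet> x \<in> degree_part hs (Suc d)}"
      have "ideal ?A R" using submoduleE(1)[OF W(1)] by (intro ideal_into_submodule W(1))
      moreover have "A \<subseteq> ?A" using hs A(1) W(2) by blast
      ultimately have "I \<subseteq> ?A" using R.genideal_minimal A(3) by simp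
      then show "a \<bullet> x \<in> degree_part hs (Suc d)" using a x Suc by blast
    qed
  qed
  then have "family_chain hs (degree_part hs) K"
    using K suc hsI unfolding family_chain_def graded_family_def by blast
  then show ?thesis
    using submodule_chain_stabilizes[OF noeth fg] by (intro family_chain_stabilizes[OF _ hsc]) auto
qed

definition I_span :: "'b set \<Rightarrow> 'b set" where
  "I_span S = \<Inter>{H. submodule H R M \<and> (\<forall>a\<in>I. \<forall>x\<in>S. a \<bullet> x \<in> H)}"

lemma I_span_least:
  "\<lbrakk>submodule H R M; \<And>a x. \<lbrakk>a \<in> I; x \<in> S\<rbrakk> \<Longrightarrow> a \<bullet> x \<in> H\<rbrakk> \<Longrightarrow> I_span S \<subseteq> H"
  unfolding I_span_def by blast

lemma I_span_gen: "\<lbrakk>a \<in> I; x \<in> S\<rbrakk> \<Longrightarrow> a \<bullet> x \<in> I_span S"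
  unfolding I_span_def by blast

lemma I_span_mono: "S \<subseteq> T \<Longrightarrow> I_span S \<subseteq> I_span T"
  unfolding I_span_def by blast

lemma submodule_I_span:
  assumes "S \<subseteq> carrier M" shows "submodule (I_span S) R M"
proof (rule submodule_intro)
  show "I_span S \<subseteq> carrier M"
    using assms I_carrier by (intro I_span_least carrier_is_submodule) auto
qed (auto simp: I_span_def submodule_zero submoduleE)

text \<open>Generation of a graded family in bounded degree: cut the family off above degree \<open>i\<close>, continue
  by multiplication with \<open>I\<close>, and let \<open>i\<close> grow.\<close>

lemma graded_family_eventually_generated:
  assumes noeth: "noetherian_ring R" and fg: "finitely_generated_module R M"
    and K: "graded_family K"
  shows "\<exists>n. \<forall>d\<ge>n. K (Suc d) = I_span (K d)"
proof -
  define G where "G i = rec_nat (K 0) (\<lambda>d S. if d < i then K (Suc d) else I_span S)" for i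
  have G0: "G i 0 = K 0" and GS: "G i (Suc d) = (if d < i then K (Suc d) else I_span (G i d))" for i d
    by (simp_all add: G_def)
  note Ksub = graded_familyD(1)[OF K]
  have Kc: "K d \<subseteq> carrier M" for d using submoduleE(1)[OF Ksub] .
  have spanK: "I_span S \<subseteq> K (Suc d)" if "S \<subseteq> K d" for S d
    using that graded_familyD(3)[OF K] by (intro I_span_least Ksub) blast
  have GK: "G i d \<subseteq> K d" for i d
    by (induction d) (auto simp: G0 GS dest: spanK)
  have Gc: "G i d \<subseteq> carrier M" for i d using GK Kc by blast
  have Gle: "G i d = K d" if "d \<le> i" for i d
    using that by (cases d) (auto simp: G0 GS)
  have Gfam: "graded_family (G i)" for i
    unfolding graded_family_def
  proof (intro allI conjI ballI)
    fix d
    show "submodule (G i d) R M"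
      using Ksub submodule_I_span[OF Gc] by (cases d) (auto simp: G0 GS)
    show "G i d \<subseteq> X d" using GK graded_familyD(2)[OF K] by blast
    fix a x assume "a \<in> I" "x \<in> G i d"
    then show "a \<bullet> x \<in> G i (Suc d)"
      using subsetD[OF GK, of x i d] graded_familyD(3)[OF K, of a x d] by (simp add: GS I_span_gen)
  qed
  have Gmono: "G i d \<subseteq> G (Suc i) d" for i d
  proof (induction d)
    case (Suc d)
    then show ?case
      using spanK[OF GK, of i d] I_span_mono[OF Suc] by (auto simp: GS)
  qed (simp add: G0)
  obtain n where n: "\<And>i d. i \<ge> n \<Longrightarrow> G i d = G n d"
    using graded_families_stabilize[OF noeth fg, of G] Gfam Gmono by blast
  have Gn: "G n d = K d" for d
    using n[of "max n d" d] Gle[of d "max n d"] by simp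
  have "K (Suc d) = I_span (K d)" if "d \<ge> n" for d
    using GS[of n d] that by (simp add: Gn)
  then show ?thesis by blast
qed

end

lemma (in cring) power_submodule_reg_module:
  assumes I: "ideal I R"
  shows "power_submodule R I (reg_module R) n = ideal_power R I n"
proof -
  interpret reg: ideal_module R "reg_module R" I
    using I by (intro ideal_module.intro module_reg_module ideal_module_axioms.intro)
  note P = ideal_ideal_power[OF I, of n]
  have "submodule (ideal_power R I n) R (reg_module R)"
    using additive_subgroup.a_closed[OF ideal.axioms(1)[OF P]] ideal.I_l_closed[OF P]
      additive_subgroup.zero_closed[OF ideal.axioms(1)[OF P]] ideal.Icarr[OF P]
    by (intro reg.submodule_intro) (auto simp: reg_module_def)
  then have "reg.X n \<subseteq> ideal_power R I n"
    using ideal.I_r_closed[OF P] by (intro reg.power_submodule_least) (auto simp: reg_module_def)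
  moreover have "ideal_power R I n \<subseteq> reg.X n"
    using reg.power_submodule_gen[of _ n \<one>] reg.ideal_power_carrier by (force simp: reg_module_def)
  ultimately show ?thesis by blast
qed

lemma (in cring) finitely_generated_reg_module: "finitely_generated_module R (reg_module R)"
  unfolding finitely_generated_module_def
proof (intro exI[of _ "{\<one>}"] conjI allI impI)
  interpret reg: module R "reg_module R" by (rule module_reg_module)
  fix N assume "submodule N R (reg_module R) \<and> {\<one>} \<subseteq> N"
  then have N: "submodule N R (reg_module R)" and one: "\<one> \<in> N" by auto
  have "a \<in> N" if "a \<in> carrier R" for a
    using reg.submoduleE(4)[OF N that one] that by (simp add: reg_module_def)
  then show "N = carrier (reg_module R)"
    using reg.submoduleE(1)[OF N] by (auto simp: reg_module_def)
qed (auto simp: reg_module_def)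


section \<open>The criterion in terms of graded pieces\<close>

locale form_on_module = ideal_module R M I for R (structure) and M :: "('a, 'b, 'm) module_scheme" (structure) and I +
  fixes f s
  assumes f: "f \<in> ideal_power R I s"
    and noeth: "noetherian_ring R" and fg: "finitely_generated_module R M"
begin

lemma f_carrier: "f \<in> carrier R"
  using f by (rule ideal_power_carrier)

text \<open>The component of degree \<open>d\<close> of \<open>f t\<^sup>s B(M)\<close>.\<close>

definition Z :: "nat \<Rightarrow> 'b set" where
  "Z d = (if s \<le> d then (\<lambda>x. f \<bullet> x) ` X (d - s) else {\<zero>\<^sub>M})"

lemma submodule_image_f: "submodule H R M \<Longrightarrow> submodule ((\<lambda>x. f \<bullet> x) ` H) R M"
proof (rule submodule_intro)
  assume H: "submodule H R M"
  note Hc = subsetD[OF submoduleE(1)[OF H]]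
  show "(\<lambda>x. f \<bullet> x) ` H \<subseteq> carrier M" using Hc f_carrier by auto
  show "\<zero>\<^sub>M \<in> (\<lambda>x. f \<bullet> x) ` H"
    using submodule_zero[OF H] f_carrier by (intro image_eqI[of _ _ "\<zero>\<^sub>M"]) simp_all
  show "a \<oplus>\<^sub>M b \<in> (\<lambda>x. f \<bullet> x) ` H"
    if "a \<in> (\<lambda>x. f \<bullet> x) ` H" "b \<in> (\<lambda>x. f \<bullet> x) ` H" for a b
    using that submoduleE(5)[OF H] Hc f_carrier by (auto simp: smult_r_distr[symmetric])
  show "a \<bullet> x \<in> (\<lambda>x. f \<bullet> x) ` H"
    if a: "a \<in> carrier R" and "x \<in> (\<lambda>x. f \<bullet> x) ` H" for a x
  proof -
    obtain y where "y \<in> H" "x = f \<bullet> y" using \<open>x \<in> _\<close> by auto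
    then have "a \<bullet> x = f \<bullet> (a \<bullet> y)" "a \<bullet> y \<in> H"
      using a Hc f_carrier submoduleE(4)[OF H]
      by (simp_all add: smult_assoc1[symmetric] R.m_comm)
    then show ?thesis by blast
  qed
qed

lemma submodule_Z: "submodule (Z d) R M"
  by (simp add: Z_def submodule_image_f submodule_X submodule_singleton_zero)

lemmas Z_carrier = subsetD[OF submoduleE(1)[OF submodule_Z]]
lemmas Z_zero = submodule_zero[OF submodule_Z]
lemmas Z_add = submoduleE(5)[OF submodule_Z]
lemmas Z_smult = submoduleE(4)[OF submodule_Z]

lemma Z_mult:
  assumes a: "a \<in> ipow e" and z: "z \<in> Z d"
  shows "a \<bullet> z \<in> Z (d + e)"
proof (cases "s \<le> d")
  case True
  then obtain x where x: "x \<in> X (d - s)" "z = f \<bullet> x" using z by (auto simp: Z_def)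
  have "a \<bullet> z = f \<bullet> (a \<bullet> x)"
    using x f_carrier ideal_power_carrier[OF a] X_carrier by (simp add: smult_assoc1[symmetric] R.m_comm)
  moreover have "a \<bullet> x \<in> X (d + e - s)" using X_mult[OF a x(1)] True by (simp add: add.commute)
  ultimately show ?thesis using True by (auto simp: Z_def)
next
  case False
  then show ?thesis using z Z_zero[of "d + e"] ideal_power_carrier[OF a] by (simp add: Z_def)
qed

lemma Z_mult_I: "\<lbrakk>a \<in> I; z \<in> Z d\<rbrakk> \<Longrightarrow> a \<bullet> z \<in> Z (Suc d)"
  using Z_mult[of a "Suc 0" z d] R.ideal_power_1[OF I] by simp

lemma Z_subset_X: "Z d \<subseteq> X d"
  using X_mult[OF f, of _ "d - s"] X_zero by (auto simp: Z_def)

lemma Z_antimono: "\<lbrakk>s \<le> m; m \<le> n\<rbrakk> \<Longrightarrow> Z n \<subseteq> Z m"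
  using X_antimono[of "m - s" "n - s"] by (simp add: Z_def image_mono)

abbreviation fM :: "'b set" where "fM \<equiv> multiples M f"

lemma submodule_fM: "submodule fM R M"
  unfolding multiples_def by (intro submodule_image_f carrier_is_submodule)

lemma Z_subset_fM: "Z d \<subseteq> fM"
  using X_carrier submodule_zero[OF submodule_fM] by (auto simp: Z_def multiples_def)

definition initial_forms_generate :: "nat \<Rightarrow> bool" where
  "initial_forms_generate n \<longleftrightarrow> (\<forall>x\<in>fM \<inter> X n. \<exists>z\<in>Z n. x \<ominus>\<^sub>M z \<in> X (Suc n))"

text \<open>The lemma of Artin and Rees. The families \<open>fM \<inter> X d\<close> are generated in bounded degrees; in such a
  degree \<open>c\<close> an element is \<open>f y\<close> with \<open>y\<close> in \<open>M = X 0\<close>, and in degree \<open>c + k\<close> the factor \<open>y\<close>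
  acquires \<open>k\<close> factors from \<open>I\<close>.\<close>

lemma artin_rees: "\<exists>c. \<forall>k. fM \<inter> X (c + k) \<subseteq> (\<lambda>x. f \<bullet> x) ` X k"
proof -
  have sub: "submodule (fM \<inter> X d) R M" for d
    using submoduleE[OF submodule_fM] submoduleE[OF submodule_X] submodule_zero[OF submodule_fM] X_zero
    by (intro submodule_intro) auto
  have "graded_family (\<lambda>d. fM \<inter> X d)"
    unfolding graded_family_def
    using sub submoduleE(4)[OF submodule_fM] I_carrier X_mult_I by auto
  from graded_family_eventually_generated[OF noeth fg this]
  obtain c where c: "\<And>d. d \<ge> c \<Longrightarrow> fM \<inter> X (Suc d) = I_span (fM \<inter> X d)" by blast
  have "fM \<inter> X (c + k) \<subseteq> (\<lambda>x. f \<bullet> x) ` X k" for k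
  proof (induction k)
    case 0
    then show ?case by (auto simp: X_0 multiples_def)
  next
    case (Suc k)
    have "I_span (fM \<inter> X (c + k)) \<subseteq> (\<lambda>x. f \<bullet> x) ` X (Suc k)"
    proof (rule I_span_least[OF submodule_image_f[OF submodule_X]])
      fix a x assume a: "a \<in> I" and "x \<in> fM \<inter> X (c + k)"
      then obtain y where y: "y \<in> X k" "x = f \<bullet> y" using Suc by blast
      have "a \<bullet> x = f \<bullet> (a \<bullet> y)"
        using y a I_carrier f_carrier X_carrier by (simp add: smult_assoc1[symmetric] R.m_comm)
      then show "a \<bullet> x \<in> (\<lambda>x. f \<bullet> x) ` X (Suc k)" using X_mult_I[OF a y(1)] by blast
    qed
    then show ?case using c[of "c + k"] by simp
  qed
  then show ?thesis by blast
qed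

text \<open>Successive approximation: \<open>x\<close> is corrected by elements of \<open>Z n\<close> until the remainder, which still
  lies in \<open>fM\<close>, is deep enough in the filtration for the lemma of Artin and Rees.\<close>

lemma eventually_Z_if_initial_forms_generate:
  assumes "\<exists>n0. \<forall>n\<ge>n0. initial_forms_generate n"
  shows "\<exists>n1. \<forall>n\<ge>n1. fM \<inter> X n \<subseteq> Z n"
proof -
  obtain n0 where n0: "\<And>n. n \<ge> n0 \<Longrightarrow> initial_forms_generate n" using assms by blast
  obtain c where c: "\<And>k. fM \<inter> X (c + k) \<subseteq> (\<lambda>x. f \<bullet> x) ` X k" using artin_rees by blast
  have "x \<in> Z n" if n: "n \<ge> max n0 s" and x: "x \<in> fM \<inter> X n" for n x
  proof -
    have xc: "x \<in> carrier M" using x X_carrier by blast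
    have "\<exists>z\<in>Z n. x \<ominus>\<^sub>M z \<in> X (n + j)" for j
    proof (induction j)
      case 0
      have "\<ominus>\<^sub>M \<zero>\<^sub>M = \<zero>\<^sub>M" by (rule M.minus_equality) simp_all
      then have "x \<ominus>\<^sub>M \<zero>\<^sub>M = x" using xc by (simp add: a_minus_def)
      then show ?case using x Z_zero by (intro bexI[of _ "\<zero>\<^sub>M"]) auto
    next
      case (Suc j)
      then obtain z where z: "z \<in> Z n" "x \<ominus>\<^sub>M z \<in> X (n + j)" by blast
      moreover have "x \<ominus>\<^sub>M z \<in> fM"
        using x z(1) Z_subset_fM by (intro submodule_minus[OF submodule_fM]) auto
      ultimately obtain z' where z': "z' \<in> Z (n + j)" "(x \<ominus>\<^sub>M z) \<ominus>\<^sub>M z' \<in> X (Suc (n + j))"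
        using n0[of "n + j"] n by (auto simp: initial_forms_generate_def)
      have z'n: "z' \<in> Z n" using z'(1) Z_antimono[of n "n + j"] n by auto
      have "(x \<ominus>\<^sub>M z) \<ominus>\<^sub>M z' = x \<ominus>\<^sub>M (z \<oplus>\<^sub>M z')"
        using xc Z_carrier[OF z(1)] Z_carrier[OF z'n] by (simp add: a_minus_def M.minus_add M.a_ac)
      then show ?case using z'(2) Z_add[OF z(1) z'n] by (intro bexI[of _ "z \<oplus>\<^sub>M z'"]) simp_all
    qed
    then obtain z where z: "z \<in> Z n" "x \<ominus>\<^sub>M z \<in> X (n + c)" by blast
    moreover have "x \<ominus>\<^sub>M z \<in> fM"
      using x z(1) Z_subset_fM by (intro submodule_minus[OF submodule_fM]) auto
    ultimately have "x \<ominus>\<^sub>M z \<in> (\<lambda>x. f \<bullet> x) ` X n"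
      using c[of n] by (auto simp: add.commute)
    then have "x \<ominus>\<^sub>M z \<in> Z n" using X_antimono[of "n - s" n] n by (auto simp: Z_def)
    from Z_add[OF this z(1)] show "x \<in> Z n"
      using xc Z_carrier[OF z(1)] by (simp add: a_minus_def M.a_assoc M.l_neg)
  qed
  then show ?thesis by blast
qed

text \<open>By Artin and Rees, \<open>x\<close> lies in \<open>Z m\<close> for some \<open>m\<close> that is smaller than \<open>n\<close> by at most a constant.
  Without jumps \<open>x\<close> climbs from there to \<open>Z n\<close>, because it lies in \<open>X n\<close>.\<close>

lemma eventually_Z_if_no_jump:
  assumes "\<exists>n0. \<forall>n\<ge>n0. Z n \<inter> X (Suc n) \<subseteq> Z (Suc n)"
  shows "\<exists>n1. \<forall>n\<ge>n1. fM \<inter> X n \<subseteq> Z n"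
proof -
  obtain n0 where n0: "\<And>n. n \<ge> n0 \<Longrightarrow> Z n \<inter> X (Suc n) \<subseteq> Z (Suc n)" using assms by blast
  obtain c where c: "\<And>k. fM \<inter> X (c + k) \<subseteq> (\<lambda>x. f \<bullet> x) ` X k" using artin_rees by blast
  have "x \<in> Z n" if n: "n \<ge> c + n0 + s" and x: "x \<in> fM \<inter> X n" for n x
  proof -
    define k where "k = n - c"
    have k: "n = c + k" "k \<ge> n0 + s" using n by (auto simp: k_def)
    have start: "x \<in> Z (k + s)" using c[of k] x k(1) by (auto simp: Z_def)
    have climb: "k + s + j \<le> n \<Longrightarrow> x \<in> Z (k + s + j)" for j
    proof (induction j)
      case 0
      then show ?case using start by simp
    next
      case (Suc j)
      then have "x \<in> Z (k + s + j)" by simp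
      moreover have "x \<in> X (Suc (k + s + j))" using x X_antimono[of "Suc (k + s + j)" n] Suc.prems by auto
      ultimately show ?case using n0[of "k + s + j"] k(2) by auto
    qed
    show ?thesis
    proof (cases "k + s \<le> n")
      case True
      then show ?thesis using climb[of "n - (k + s)"] by simp
    next
      case False
      then show ?thesis using start Z_antimono[of n "k + s"] n by auto
    qed
  qed
  then show ?thesis by blast
qed

lemma initial_forms_generate_if_Z: "fM \<inter> X n \<subseteq> Z n \<Longrightarrow> initial_forms_generate n"
  unfolding initial_forms_generate_def
proof
  fix x assume "fM \<inter> X n \<subseteq> Z n" "x \<in> fM \<inter> X n"
  then have "x \<in> Z n" by blast
  moreover from this have "x \<ominus>\<^sub>M x \<in> X (Suc n)"
    using Z_carrier X_zero by (simp add: a_minus_def M.r_neg)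
  ultimately show "\<exists>z\<in>Z n. x \<ominus>\<^sub>M z \<in> X (Suc n)" by blast
qed

subsection \<open>Torsion\<close>

text \<open>The class of \<open>x\<close> in degree \<open>d\<close> of \<open>B(M) / f t\<^sup>s B(M)\<close> is annihilated by all products of \<open>k\<close> elements of
  degree one of \<open>B(R)\<close>; it is torsion with respect to the irrelevant ideal if this holds for some \<open>k\<close>.\<close>

definition killed_by :: "nat \<Rightarrow> nat \<Rightarrow> 'b \<Rightarrow> bool" where
  "killed_by k d x \<longleftrightarrow> (\<forall>b\<in>ipow k. b \<bullet> x \<in> Z (d + k))"

definition torsion :: "nat \<Rightarrow> 'b \<Rightarrow> bool" where
  "torsion d x \<longleftrightarrow> (\<exists>k. killed_by k d x)"

lemma killed_by_Suc:
  assumes "killed_by k d x" "x \<in> carrier M" shows "killed_by (Suc k) d x"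
  unfolding killed_by_def
proof
  fix b assume b: "b \<in> ipow (Suc k)"
  show "b \<bullet> x \<in> Z (d + Suc k)"
  proof (rule ideal_power_Suc_least[OF submodule_Z, of "{x}", OF _ _ b])
    fix i j y assume i: "i \<in> ipow k" and j: "j \<in> I" and "y \<in> {x}"
    then have "i \<bullet> (j \<bullet> y) = j \<bullet> (i \<bullet> x)"
      using assms(2) ideal_power_carrier[OF i] I_carrier[OF j]
      by (simp add: smult_assoc1[symmetric] R.m_comm)
    then show "i \<bullet> (j \<bullet> y) \<in> Z (d + Suc k)"
      using assms(1) i Z_mult_I[OF j] by (simp add: killed_by_def)
  qed (use assms(2) in auto)
qed

lemma killed_by_mono:
  assumes "killed_by k d x" "x \<in> carrier M" "k \<le> l" shows "killed_by l d x"
  using assms(3,1) by (induction rule: dec_induct) (auto intro: killed_by_Suc assms(2))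

lemma killed_by_add:
  assumes "killed_by k d x" "killed_by k d y" "x \<in> carrier M" "y \<in> carrier M"
  shows "killed_by k d (x \<oplus>\<^sub>M y)"
  using assms Z_add ideal_power_carrier by (simp add: killed_by_def smult_r_distr)

lemma killed_by_mult:
  assumes "killed_by k d x" "a \<in> ipow e" "x \<in> carrier M"
  shows "killed_by k (d + e) (a \<bullet> x)"
  unfolding killed_by_def
proof
  fix b assume b: "b \<in> ipow k"
  have "b \<bullet> (a \<bullet> x) = a \<bullet> (b \<bullet> x)"
    using assms(3) ideal_power_carrier[OF b] ideal_power_carrier[OF assms(2)]
    by (simp add: smult_assoc1[symmetric] R.m_comm)
  then show "b \<bullet> (a \<bullet> x) \<in> Z (d + e + k)"
    using Z_mult[OF assms(2), of _ "d + k"] assms(1) b by (simp add: killed_by_def ac_simps)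
qed

lemma killed_by_smult:
  "\<lbrakk>killed_by k d x; a \<in> carrier R; x \<in> carrier M\<rbrakk> \<Longrightarrow> killed_by k d (a \<bullet> x)"
  using killed_by_mult[of k d x a 0] by simp

lemma killed_by_zero: "killed_by k d \<zero>\<^sub>M"
  using ideal_power_carrier Z_zero by (simp add: killed_by_def)

lemma torsion_add:
  "\<lbrakk>torsion d x; torsion d y; x \<in> carrier M; y \<in> carrier M\<rbrakk> \<Longrightarrow> torsion d (x \<oplus>\<^sub>M y)"
  unfolding torsion_def by (meson killed_by_add killed_by_mono linear max.cobounded1 max.cobounded2)

lemma torsion_mult:
  "\<lbrakk>torsion d x; a \<in> ipow e; x \<in> carrier M\<rbrakk> \<Longrightarrow> torsion (d + e) (a \<bullet> x)"
  unfolding torsion_def using killed_by_mult by blast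

text \<open>The component of degree \<open>d\<close> of the submodule of \<open>B(M) / f t\<^sup>s B(M)\<close> annihilated by \<open>I B(R)\<close>, the ideal
  of the exceptional divisor.\<close>

definition K :: "nat \<Rightarrow> 'b set" where
  "K d = {x \<in> X d. \<forall>b\<in>I. b \<bullet> x \<in> Z d}"

lemma K_carrier: "x \<in> K d \<Longrightarrow> x \<in> carrier M"
  using X_carrier[of x d] by (simp add: K_def)

lemma K_mult:
  assumes "x \<in> K d" "a \<in> ipow e" shows "a \<bullet> x \<in> K (d + e)"
proof -
  have "b \<bullet> (a \<bullet> x) \<in> Z (d + e)" if b: "b \<in> I" for b
  proof -
    have "b \<bullet> (a \<bullet> x) = a \<bullet> (b \<bullet> x)"
      using K_carrier[OF assms(1)] I_carrier[OF b] ideal_power_carrier[OF assms(2)]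
      by (simp add: smult_assoc1[symmetric] R.m_comm)
    then show ?thesis using Z_mult[OF assms(2), of "b \<bullet> x" d] assms(1) b by (simp add: K_def)
  qed
  then show ?thesis using X_mult[OF assms(2), of x d] assms(1) by (simp add: K_def add.commute)
qed

lemma submodule_K: "submodule (K d) R M"
proof (rule submodule_intro)
  show "K d \<subseteq> carrier M" using K_carrier by blast
  show "\<zero>\<^sub>M \<in> K d" using X_zero Z_zero I_carrier by (simp add: K_def)
  show "a \<oplus>\<^sub>M b \<in> K d" if "a \<in> K d" "b \<in> K d" for a b
    using that K_carrier[OF that(1)] K_carrier[OF that(2)] X_add Z_add I_carrier
    by (simp add: K_def smult_r_distr)
  show "a \<bullet> x \<in> K d" if "a \<in> carrier R" "x \<in> K d" for a x
    using K_mult[OF that(2), of a 0] that(1) by simp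
qed

lemma graded_family_K: "graded_family K"
  unfolding graded_family_def
  using submodule_K K_mult[of _ _ _ "Suc 0"] R.ideal_power_1[OF I] by (auto simp: K_def)

text \<open>The torsion elements of \<open>K\<close> form a noetherian graded module, so one exponent serves for all of them.\<close>

lemma torsion_uniform: "\<exists>k. \<forall>d. \<forall>x\<in>K d. torsion d x \<longrightarrow> killed_by k d x"
proof -
  define T where "T k d = {x \<in> K d. killed_by k d x}" for k d
  have "graded_family (T k)" for k
    unfolding graded_family_def
  proof (intro allI conjI ballI)
    fix d
    show "submodule (T k d) R M"
      using submoduleE[OF submodule_K] submodule_zero[OF submodule_K] K_carrier
        killed_by_add killed_by_zero killed_by_smult
      by (intro submodule_intro) (auto simp: T_def)
    show "T k d \<subseteq> X d" by (auto simp: T_def K_def)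
    show "a \<bullet> x \<in> T k (Suc d)" if "a \<in> I" "x \<in> T k d" for a x
      using that K_mult[of x d a "Suc 0"] killed_by_mult[of k d x a "Suc 0"] K_carrier[of x d]
        R.ideal_power_1[OF I] by (auto simp: T_def)
  qed
  moreover have "T k d \<subseteq> T (Suc k) d" for k d
    using killed_by_Suc K_carrier by (auto simp: T_def)
  ultimately obtain n where n: "\<And>i d. i \<ge> n \<Longrightarrow> T i d = T n d"
    using graded_families_stabilize[OF noeth fg, of T] by blast
  have "killed_by n d x" if x: "x \<in> K d" and "torsion d x" for d x
  proof -
    obtain k where "killed_by k d x" using \<open>torsion d x\<close> by (auto simp: torsion_def)
    then have "killed_by (max n k) d x" using K_carrier[OF x] killed_by_mono by simp
    then show ?thesis using n[of "max n k" d] x by (auto simp: T_def)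
  qed
  then show ?thesis by blast
qed

text \<open>An element \<open>x\<close> of \<open>Z n \<inter> X (n + 1)\<close> is an element of \<open>K (n + 1)\<close>, and it represents zero only if it lies in
  \<open>Z (n + 1)\<close>. If all of \<open>K\<close> is torsion, then \<open>K\<close>, being generated in bounded degrees and killed by a
  fixed power of \<open>I t\<close>, consists of zero classes in large degrees; so there are no jumps.\<close>

lemma ex_nontorsion:
  assumes "\<not> (\<exists>n0. \<forall>n\<ge>n0. Z n \<inter> X (Suc n) \<subseteq> Z (Suc n))"
  shows "\<exists>d y. y \<in> K d \<and> \<not> torsion d y"
proof (rule ccontr)
  assume "\<not> ?thesis"
  then have tor: "\<And>d y. y \<in> K d \<Longrightarrow> torsion d y" by blast
  obtain k where k: "\<And>d x. x \<in> K d \<Longrightarrow> killed_by k d x" using torsion_uniform tor by blast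
  obtain n where n: "\<And>d. d \<ge> n \<Longrightarrow> K (Suc d) = I_span (K d)"
    using graded_family_eventually_generated[OF noeth fg graded_family_K] by blast
  have step: "K (n + j) \<subseteq> {x \<in> carrier M. \<forall>b\<in>ipow i. b \<bullet> x \<in> Z (n + j + i)}"
    if "j + i \<ge> k" for j i
    using that
  proof (induction j arbitrary: i)
    case 0
    then show ?case
      using killed_by_mono[OF k, of _ n i] K_carrier by (auto simp: killed_by_def)
  next
    case (Suc j)
    let ?H = "{x \<in> carrier M. \<forall>b\<in>ipow i. b \<bullet> x \<in> Z (n + Suc j + i)}"
    have "submodule ?H R M"
      using Z_zero Z_add Z_smult ideal_power_carrier
      by (intro submodule_intro) (auto simp: smult_r_distr, metis R.m_comm smult_assoc1)
    moreover have "a \<bullet> x \<in> ?H" if a: "a \<in> I" and x: "x \<in> K (n + j)" for a x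
    proof -
      have "b \<bullet> (a \<bullet> x) \<in> Z (n + Suc j + i)" if b: "b \<in> ipow i" for b
      proof -
        have "b \<otimes> a \<in> ipow (i + Suc 0)"
          using R.ideal_power_mult[OF I b, of a "Suc 0"] a R.ideal_power_1[OF I] by simp
        then have "b \<otimes> a \<in> ipow (Suc i)" by simp
        then have "(b \<otimes> a) \<bullet> x \<in> Z (n + j + Suc i)"
          using Suc.IH[of "Suc i"] Suc.prems x by auto
        then show ?thesis
          using K_carrier[OF x] I_carrier[OF a] ideal_power_carrier[OF b] by (simp add: smult_assoc1)
      qed
      then show ?thesis using K_carrier[OF x] I_carrier[OF a] by auto
    qed
    ultimately show ?case using n[of "n + j"] I_span_least[of ?H "K (n + j)"] by simp
  qed
  have KZ: "K m \<subseteq> Z m" if m: "m \<ge> n + k" for m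
  proof
    fix x assume x: "x \<in> K m"
    have "k \<le> m - n + 0" using m by simp
    from step[OF this] have "\<one> \<bullet> x \<in> Z m" using m x by auto
    then show "x \<in> Z m" using K_carrier[OF x] by simp
  qed
  have "Z m \<inter> X (Suc m) \<subseteq> K (Suc m)" for m
    using Z_mult_I by (auto simp: K_def)
  then have "\<forall>m\<ge>n + k. Z m \<inter> X (Suc m) \<subseteq> Z (Suc m)"
    using KZ by (meson le_SucI subset_trans)
  then show False using assms by blast
qed

text \<open>The homogeneous ideal, as a family of its components, of the elements of \<open>B(R)\<close> which send
  \<open>y\<close> to torsion.\<close>

definition torsion_ideal :: "nat \<Rightarrow> 'b \<Rightarrow> nat \<Rightarrow> 'a set" where
  "torsion_ideal d y e = {a \<in> ipow e. torsion (d + e) (a \<bullet> y)}"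

lemma ideal_torsion_ideal:
  assumes "y \<in> carrier M" shows "ideal (torsion_ideal d y e) R"
proof (rule idealI[OF R.ring_axioms])
  note P = R.ideal_ideal_power[OF I, of e]
  have cl: "x \<otimes> a \<in> torsion_ideal d y e" if "a \<in> torsion_ideal d y e" "x \<in> carrier R" for a x
    using that ideal.I_l_closed[OF P] torsion_mult[of "d + e" "a \<bullet> y" x 0] assms
      ideal_power_carrier[of a e]
    by (simp add: torsion_ideal_def smult_assoc1)
  then show "\<And>a x. \<lbrakk>a \<in> torsion_ideal d y e; x \<in> carrier R\<rbrakk> \<Longrightarrow> x \<otimes> a \<in> torsion_ideal d y e" .
  show "a \<otimes> x \<in> torsion_ideal d y e" if "a \<in> torsion_ideal d y e" "x \<in> carrier R" for a x
    using cl[OF that] that ideal_power_carrier[of a e] by (simp add: torsion_ideal_def R.m_comm)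
  have "\<zero> \<in> torsion_ideal d y e"
    using additive_subgroup.zero_closed[OF ideal.axioms(1)[OF P]] assms killed_by_zero
    by (auto simp: torsion_ideal_def torsion_def)
  moreover have "\<ominus> a \<in> torsion_ideal d y e" if "a \<in> torsion_ideal d y e" for a
    using cl[OF that, of "\<ominus> \<one>"] that ideal_power_carrier[of a e] by (simp add: torsion_ideal_def R.l_minus)
  moreover have "a \<oplus> b \<in> torsion_ideal d y e"
    if "a \<in> torsion_ideal d y e" "b \<in> torsion_ideal d y e" for a b
    using that additive_subgroup.a_closed[OF ideal.axioms(1)[OF P]] assms torsion_add
      ideal_power_carrier[of a e] ideal_power_carrier[of b e]
    by (simp add: torsion_ideal_def smult_l_distr)
  ultimately show "subgroup (torsion_ideal d y e) (add_monoid R)"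
    using ideal_power_carrier
    by (intro R.add.subgroupI) (auto simp: torsion_ideal_def a_inv_def[symmetric])
qed

lemma torsion_ideal_mult:
  assumes "y \<in> carrier M" "a \<in> torsion_ideal d y e" "b \<in> ipow e'"
  shows "b \<otimes> a \<in> torsion_ideal d y (e + e')"
  using assms R.ideal_power_mult[OF I assms(3), of a e] torsion_mult[of "d + e" "a \<bullet> y" b e']
    ideal_power_carrier[of a e] ideal_power_carrier[of b e']
  by (simp add: torsion_ideal_def smult_assoc1 ac_simps)

text \<open>The ideals in question are homogeneous ideals of \<open>B(R)\<close>, given by their components; \<open>B(R)\<close> is noetherian by
  the chain condition for \<open>M = R\<close>.\<close>

lemma ex_maximal_torsion_ideal:
  assumes "\<exists>d y. y \<in> K d \<and> \<not> torsion d y"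
  shows "\<exists>d y. y \<in> K d \<and> \<not> torsion d y \<and>
    (\<forall>d' y'. y' \<in> K d' \<and> \<not> torsion d' y' \<and> (\<forall>e. torsion_ideal d y e \<subseteq> torsion_ideal d' y' e) \<longrightarrow>
      torsion_ideal d' y' = torsion_ideal d y)"
proof (rule ccontr)
  assume contra: "\<not> ?thesis"
  define P where "P = (\<lambda>(d, y). y \<in> K d \<and> \<not> torsion d y)"
  define J where "J = (\<lambda>(d, y). torsion_ideal d y)"
  have "\<exists>p. P p" using assms by (auto simp: P_def)
  moreover have "\<exists>p'. P p' \<and> (\<forall>e. J p e \<subseteq> J p' e) \<and> J p' \<noteq> J p" if "P p" for p
    using contra that unfolding P_def J_def by (cases p) fastforce
  ultimately obtain \<pi> where \<pi>: "\<And>n. P (\<pi> n)" "\<And>n. (\<forall>e. J (\<pi> n) e \<subseteq> J (\<pi> (Suc n)) e) \<and> J (\<pi> (Suc n)) \<noteq> J (\<pi> n)"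
    using dependent_nat_choice[of "\<lambda>_. P" "\<lambda>_ p p'. (\<forall>e. J p e \<subseteq> J p' e) \<and> J p' \<noteq> J p"] by blast
  interpret reg: ideal_module R "reg_module R" I
    using I by (intro ideal_module.intro R.module_reg_module ideal_module_axioms.intro)
  have fam: "reg.graded_family (J (\<pi> n))" for n
    unfolding reg.graded_family_def
  proof (intro allI conjI ballI)
    fix e
    obtain d y where dy: "\<pi> n = (d, y)" by (cases "\<pi> n")
    have y: "y \<in> carrier M" using \<pi>(1)[of n] dy K_carrier by (auto simp: P_def)
    have J: "J (\<pi> n) = torsion_ideal d y" by (simp add: J_def dy)
    note id = ideal_torsion_ideal[OF y, of d]
    show "submodule (J (\<pi> n) e) R (reg_module R)"
      using additive_subgroup.a_closed[OF ideal.axioms(1)[OF id]] ideal.I_l_closed[OF id]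
        additive_subgroup.zero_closed[OF ideal.axioms(1)[OF id]] ideal.Icarr[OF id]
      by (intro reg.submodule_intro) (auto simp: reg_module_def J)
    show "J (\<pi> n) e \<subseteq> reg.X e"
      by (auto simp: R.power_submodule_reg_module[OF I] J torsion_ideal_def)
    show "a \<odot>\<^bsub>reg_module R\<^esub> x \<in> J (\<pi> n) (Suc e)" if "a \<in> I" "x \<in> J (\<pi> n) e" for a x
      using torsion_ideal_mult[OF y, of x d e a "Suc 0"] that R.ideal_power_1[OF I]
      by (simp add: reg_module_def J)
  qed
  have suc: "J (\<pi> n) e \<subseteq> J (\<pi> (Suc n)) e" for n e using \<pi>(2) by blast
  have "\<exists>n. \<forall>i\<ge>n. \<forall>e. J (\<pi> i) e = J (\<pi> n) e"
    by (rule reg.graded_families_stabilize[OF noeth R.finitely_generated_reg_module,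
          where K = "\<lambda>n. J (\<pi> n)", OF fam suc])
  then obtain n where "\<forall>i\<ge>n. \<forall>e. J (\<pi> i) e = J (\<pi> n) e"
    by blast
  then have "J (\<pi> (Suc n)) e = J (\<pi> n) e" for e using le_SucI[OF order_refl] by blast
  then have "J (\<pi> (Suc n)) = J (\<pi> n)" by (rule ext)
  then show False using \<pi>(2) by blast
qed

text \<open>A maximal annihilator is prime, modulo torsion: if \<open>b y\<close> is not torsion, then it belongs to \<open>K\<close> again and its ideal
  contains that of \<open>y\<close>, so the two are equal, and \<open>a b y\<close> torsion implies \<open>a y\<close> torsion. The ideal of \<open>y\<close> contains
  \<open>I\<close> in degree zero because \<open>y\<close> is in \<open>K\<close>. It does not contain \<open>I t\<close>: otherwise a fixed power of \<open>I t\<close> would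
  kill all of \<open>I t y\<close>, and \<open>y\<close> would be torsion.\<close>

lemma ex_torsion_prime:
  assumes "\<not> (\<exists>n0. \<forall>n\<ge>n0. Z n \<inter> X (Suc n) \<subseteq> Z (Suc n))"
  shows "\<exists>d y. y \<in> X d \<and> I \<subseteq> torsion_ideal d y 0 \<and> \<not> I \<subseteq> torsion_ideal d y 1 \<and> \<one> \<notin> torsion_ideal d y 0 \<and>
    (\<forall>e e' a b. a \<in> ipow e \<and> b \<in> ipow e' \<and> a \<otimes> b \<in> torsion_ideal d y (e + e') \<longrightarrow>
       a \<in> torsion_ideal d y e \<or> b \<in> torsion_ideal d y e')"
proof -
  obtain d y where y: "y \<in> K d" "\<not> torsion d y" and max: "\<And>d' y'. \<lbrakk>y' \<in> K d'; \<not> torsion d' y';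
      \<And>e. torsion_ideal d y e \<subseteq> torsion_ideal d' y' e\<rbrakk> \<Longrightarrow> torsion_ideal d' y' = torsion_ideal d y"
    using ex_maximal_torsion_ideal[OF ex_nontorsion[OF assms]] by metis
  have yc: "y \<in> carrier M" using y(1) by (rule K_carrier)
  have one: "\<one> \<notin> torsion_ideal d y 0" using y yc by (simp add: torsion_ideal_def)
  have I0: "I \<subseteq> torsion_ideal d y 0"
  proof
    fix b assume b: "b \<in> I"
    then have "b \<bullet> y \<in> Z d" using y(1) by (simp add: K_def)
    then have "killed_by 0 d (b \<bullet> y)" by (simp add: killed_by_def Z_smult)
    then show "b \<in> torsion_ideal d y 0" using I_carrier[OF b] by (auto simp: torsion_ideal_def torsion_def)
  qed
  have I1: "\<not> I \<subseteq> torsion_ideal d y 1"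
  proof
    assume tor: "I \<subseteq> torsion_ideal d y 1"
    obtain k where k: "\<And>d x. x \<in> K d \<Longrightarrow> torsion d x \<Longrightarrow> killed_by k d x" using torsion_uniform by blast
    have "killed_by (Suc k) d y"
      unfolding killed_by_def
    proof
      fix b assume b: "b \<in> ipow (Suc k)"
      show "b \<bullet> y \<in> Z (d + Suc k)"
      proof (rule ideal_power_Suc_least[OF submodule_Z, of "{y}", OF _ _ b])
        fix i j z assume i: "i \<in> ipow k" and j: "j \<in> I" and z: "z \<in> {y}"
        have "torsion (Suc d) (j \<bullet> y)" using tor j by (auto simp: torsion_ideal_def)
        moreover have "j \<bullet> y \<in> K (Suc d)"
          using graded_familyD(3)[OF graded_family_K j y(1)] .
        ultimately show "i \<bullet> (j \<bullet> z) \<in> Z (d + Suc k)"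
          using k[of "j \<bullet> y" "Suc d"] i z by (auto simp: killed_by_def)
      qed (use yc in auto)
    qed
    then show False using y(2) by (auto simp: torsion_def)
  qed
  have "a \<in> torsion_ideal d y e"
    if a: "a \<in> ipow e" and b: "b \<in> ipow e'"
      and ab: "a \<otimes> b \<in> torsion_ideal d y (e + e')" and nb: "b \<notin> torsion_ideal d y e'" for e e' a b
  proof -
    have "torsion_ideal (d + e') (b \<bullet> y) = torsion_ideal d y"
    proof (rule max)
      show "b \<bullet> y \<in> K (d + e')" using K_mult[OF y(1) b] .
      show "\<not> torsion (d + e') (b \<bullet> y)" using nb b by (simp add: torsion_ideal_def)
      show "torsion_ideal d y i \<subseteq> torsion_ideal (d + e') (b \<bullet> y) i" for i
      proof
        fix c assume c: "c \<in> torsion_ideal d y i"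
        then have cc: "c \<in> carrier R" "c \<in> ipow i"
          using ideal_power_carrier by (auto simp: torsion_ideal_def)
        have "torsion (d + i + e') (b \<bullet> (c \<bullet> y))"
          using c b cc yc by (intro torsion_mult[of "d + i" _ b e']) (auto simp: torsion_ideal_def)
        moreover have "b \<bullet> (c \<bullet> y) = c \<bullet> (b \<bullet> y)"
          using cc yc ideal_power_carrier[OF b] by (simp add: smult_assoc1[symmetric] R.m_comm)
        ultimately show "c \<in> torsion_ideal (d + e') (b \<bullet> y) i"
          using cc by (simp add: torsion_ideal_def ac_simps)
      qed
    qed
    moreover have "a \<in> torsion_ideal (d + e') (b \<bullet> y) e"
      using ab a yc ideal_power_carrier[OF a] ideal_power_carrier[OF b]
      by (simp add: torsion_ideal_def smult_assoc1 ac_simps)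
    ultimately show ?thesis by simp
  qed
  then show ?thesis using y(1) I0 I1 one by (intro exI[of _ d] exI[of _ y]) (auto simp: K_def)
qed

end


section \<open>Homogeneous localization\<close>

locale graded_module = module B N for B (structure) and N :: "('b, 'n, 'm) module_scheme" (structure) +
  fixes gr :: "nat \<Rightarrow> 'b set" and ngr :: "nat \<Rightarrow> 'n set"
  assumes gr_carrier: "a \<in> gr d \<Longrightarrow> a \<in> carrier B"
    and gr_zero: "\<zero> \<in> gr d"
    and gr_add: "\<lbrakk>a \<in> gr d; b \<in> gr d\<rbrakk> \<Longrightarrow> a \<oplus> b \<in> gr d"
    and gr_minus: "a \<in> gr d \<Longrightarrow> \<ominus> a \<in> gr d"
    and gr_mult: "\<lbrakk>a \<in> gr d; b \<in> gr e\<rbrakk> \<Longrightarrow> a \<otimes> b \<in> gr (d + e)"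
    and gr_one: "\<one> \<in> gr 0"
    and ngr_carrier: "x \<in> ngr d \<Longrightarrow> x \<in> carrier N"
    and ngr_zero: "\<zero>\<^bsub>N\<^esub> \<in> ngr d"
    and ngr_add: "\<lbrakk>x \<in> ngr d; y \<in> ngr d\<rbrakk> \<Longrightarrow> x \<oplus>\<^bsub>N\<^esub> y \<in> ngr d"
    and ngr_minus: "x \<in> ngr d \<Longrightarrow> \<ominus>\<^bsub>N\<^esub> x \<in> ngr d"
    and ngr_smult: "\<lbrakk>a \<in> gr d; x \<in> ngr e\<rbrakk> \<Longrightarrow> a \<odot>\<^bsub>N\<^esub> x \<in> ngr (d + e)"
begin

abbreviation smult_N (infixl "\<bullet>" 70) where "a \<bullet> x \<equiv> a \<odot>\<^bsub>N\<^esub> x"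
abbreviation fracs where "fracs q \<equiv> hfracs gr ngr q"
abbreviation frac where "frac q x h \<equiv> hfrac gr N ngr q x h"
abbreviation LN where "LN q \<equiv> hlocalization B gr N ngr q"

text \<open>Complements of multiplicatively closed sets; the elements outside such a set serve as denominators.\<close>

definition avoidable :: "'b set \<Rightarrow> bool" where
  "avoidable q \<longleftrightarrow> \<one> \<notin> q \<and> (\<forall>a\<in>carrier B - q. \<forall>b\<in>carrier B - q. a \<otimes> b \<notin> q)"

lemma avoidable_one: "avoidable q \<Longrightarrow> \<one> \<notin> q"
  by (simp add: avoidable_def)

lemma avoidable_mult:
  "\<lbrakk>avoidable q; a \<notin> q; b \<notin> q; a \<in> carrier B; b \<in> carrier B\<rbrakk> \<Longrightarrow> a \<otimes> b \<notin> q"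
  by (simp add: avoidable_def)

lemma fracsD:
  assumes "(x, h) \<in> fracs q"
  shows "x \<in> carrier N" "h \<in> carrier B" "h \<notin> q"
  using assms by (auto simp: hfracs_def ngr_carrier gr_carrier)

lemma fracsI: "\<lbrakk>x \<in> ngr d; h \<in> gr d; h \<notin> q\<rbrakk> \<Longrightarrow> (x, h) \<in> fracs q"
  by (auto simp: hfracs_def)

lemma fracs_cross:
  assumes "avoidable q" "(x, h) \<in> fracs q" "(y, k) \<in> fracs q"
  shows "(k \<bullet> x \<oplus>\<^bsub>N\<^esub> h \<bullet> y, h \<otimes> k) \<in> fracs q"
proof -
  obtain d e where "x \<in> ngr d" "h \<in> gr d" "h \<notin> q" "y \<in> ngr e" "k \<in> gr e" "k \<notin> q"
    using assms by (auto simp: hfracs_def)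
  then show ?thesis
    using ngr_smult[of k e x d] ngr_smult[of h d y e] gr_mult[of h d k e] avoidable_mult[OF assms(1)]
    by (intro fracsI[of _ "d + e"] ngr_add) (auto simp: add.commute gr_carrier)
qed

lemma mem_fracI:
  "\<lbrakk>(y, k) \<in> fracs q; u \<in> gr e; u \<notin> q; u \<bullet> (k \<bullet> x) = u \<bullet> (h \<bullet> y)\<rbrakk>
    \<Longrightarrow> (y, k) \<in> frac q x h"
  by (auto simp: hfrac_def)

lemma frac_self: "\<lbrakk>avoidable q; (x, h) \<in> fracs q\<rbrakk> \<Longrightarrow> (x, h) \<in> frac q x h"
  by (rule mem_fracI[of _ _ _ \<one> 0]) (auto simp: gr_one avoidable_one)

lemma mem_frac_trans:
  assumes q: "avoidable q" and xh: "(x, h) \<in> fracs q"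
    and yk: "(y, k) \<in> frac q x h" and zl: "(z, l) \<in> frac q y k"
  shows "(z, l) \<in> frac q x h"
proof -
  obtain u e where u: "u \<in> gr e" "u \<notin> q" "u \<bullet> (k \<bullet> x) = u \<bullet> (h \<bullet> y)" and ykf: "(y, k) \<in> fracs q"
    using yk by (auto simp: hfrac_def)
  obtain v e' where v: "v \<in> gr e'" "v \<notin> q" "v \<bullet> (l \<bullet> y) = v \<bullet> (k \<bullet> z)" and zlf: "(z, l) \<in> fracs q"
    using zl by (auto simp: hfrac_def)
  obtain d where d: "y \<in> ngr d" "k \<in> gr d" using ykf by (auto simp: hfracs_def)
  note c = fracsD[OF xh] fracsD[OF ykf] fracsD[OF zlf] gr_carrier[OF u(1)] gr_carrier[OF v(1)]
  have "(u \<otimes> v \<otimes> k) \<bullet> (l \<bullet> x) = (v \<otimes> l) \<bullet> (u \<bullet> (k \<bullet> x))"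
    using c by (simp add: smult_assoc1[symmetric] R.m_ac)
  also have "\<dots> = (u \<otimes> h) \<bullet> (v \<bullet> (l \<bullet> y))"
    using c by (simp only: u(3)) (simp add: smult_assoc1[symmetric] R.m_ac)
  also have "\<dots> = (u \<otimes> v \<otimes> k) \<bullet> (h \<bullet> z)"
    using c by (simp only: v(3)) (simp add: smult_assoc1[symmetric] R.m_ac)
  finally show ?thesis
    using zlf c q u v d gr_mult[OF gr_mult[OF u(1) v(1)] d(2)]
    by (intro mem_fracI[of _ _ _ "u \<otimes> v \<otimes> k"]) (auto simp: avoidable_mult[OF q])
qed

lemma mem_frac_sym:
  assumes "(x, h) \<in> fracs q" "(y, k) \<in> frac q x h"
  shows "(x, h) \<in> frac q y k"
  using assms by (force simp: hfrac_def)

lemma frac_eqI: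
  assumes q: "avoidable q" and xh: "(x, h) \<in> fracs q" and yk: "(y, k) \<in> fracs q"
    and u: "u \<in> gr e" "u \<notin> q" "u \<bullet> (k \<bullet> x) = u \<bullet> (h \<bullet> y)"
  shows "frac q x h = frac q y k"
proof -
  have "(y, k) \<in> frac q x h" using yk u by (intro mem_fracI)
  then show ?thesis
    using mem_frac_trans[OF q xh] mem_frac_trans[OF q yk] mem_frac_sym[OF xh]
    by (intro subset_antisym subrelI) blast+
qed

lemma frac_eqI_cross:
  assumes "avoidable q" "(x, h) \<in> fracs q" "(y, k) \<in> fracs q" "k \<bullet> x = h \<bullet> y"
  shows "frac q x h = frac q y k"
  using assms by (intro frac_eqI[of q x h y k \<one> 0]) (auto simp: gr_one avoidable_one fracsD)

lemma frac_eqD: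
  assumes "avoidable q" "(x, h) \<in> fracs q" "(y, k) \<in> fracs q" "frac q x h = frac q y k"
  obtains u e where "u \<in> gr e" "u \<notin> q" "u \<bullet> (k \<bullet> x) = u \<bullet> (h \<bullet> y)"
proof -
  have "(y, k) \<in> frac q x h" using frac_self[OF assms(1,3)] assms(4) by simp
  then show ?thesis using that by (auto simp: hfrac_def)
qed

lemma mem_frac_eq:
  assumes "avoidable q" "(x, h) \<in> fracs q" "(y, k) \<in> frac q x h"
  shows "frac q y k = frac q x h" "(y, k) \<in> fracs q"
proof -
  show yk: "(y, k) \<in> fracs q" using assms(3) by (auto simp: hfrac_def)
  obtain u e where "u \<in> gr e" "u \<notin> q" "u \<bullet> (k \<bullet> x) = u \<bullet> (h \<bullet> y)"
    using assms(3) by (auto simp: hfrac_def)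
  then show "frac q y k = frac q x h" using frac_eqI[OF assms(1,2) yk] by simp
qed

text \<open>The operations on fractions are unions over representatives; this evaluates such a union when
  the value does not depend on the representative.\<close>

lemma UN_frac:
  assumes q: "avoidable q" and xh: "(x, h) \<in> fracs q"
    and F: "\<And>y k. \<lbrakk>(y, k) \<in> fracs q; frac q y k = frac q x h\<rbrakk> \<Longrightarrow> F y k = F x h"
  shows "(\<Union>(y, k)\<in>frac q x h. F y k) = F x h"
proof (rule UN_eq_const)
  show "frac q x h \<noteq> {}" using frac_self[OF q xh] by blast
  show "(case p of (y, k) \<Rightarrow> F y k) = F x h" if "p \<in> frac q x h" for p
    using that mem_frac_eq[OF q xh] F by (cases p) auto
qed

lemma carrier_LN: "carrier (LN q) = {frac q x h | x h. (x, h) \<in> fracs q}"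
  by (simp add: hlocalization_def)

lemma frac_in_LN: "(x, h) \<in> fracs q \<Longrightarrow> frac q x h \<in> carrier (LN q)"
  by (auto simp: carrier_LN)

lemma LN_cases:
  assumes "A \<in> carrier (LN q)"
  obtains x h where "(x, h) \<in> fracs q" "A = frac q x h"
  using assms by (auto simp: carrier_LN)

lemma zero_fracs: "avoidable q \<Longrightarrow> (\<zero>\<^bsub>N\<^esub>, \<one>) \<in> fracs q"
  by (intro fracsI[of _ 0] ngr_zero gr_one avoidable_one)

lemma zero_LN: "\<zero>\<^bsub>LN q\<^esub> = frac q \<zero>\<^bsub>N\<^esub> \<one>"
  by (simp add: hlocalization_def)

text \<open>Both sums become equal after multiplication by the product of the two elements that witness the equalities.\<close>

lemma frac_add_cong:
  assumes q: "avoidable q" and f: "(x, h) \<in> fracs q" "(y, k) \<in> fracs q" "(x', h') \<in> fracs q" "(y', k') \<in> fracs q"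
    and eq: "frac q x' h' = frac q x h" "frac q y' k' = frac q y k"
  shows "frac q (k' \<bullet> x' \<oplus>\<^bsub>N\<^esub> h' \<bullet> y') (h' \<otimes> k') = frac q (k \<bullet> x \<oplus>\<^bsub>N\<^esub> h \<bullet> y) (h \<otimes> k)"
proof -
  obtain u d where u: "u \<in> gr d" "u \<notin> q" "u \<bullet> (h \<bullet> x') = u \<bullet> (h' \<bullet> x)"
    using frac_eqD[OF q f(3,1) eq(1)] by blast
  obtain v e where v: "v \<in> gr e" "v \<notin> q" "v \<bullet> (k \<bullet> y') = v \<bullet> (k' \<bullet> y)"
    using frac_eqD[OF q f(4,2) eq(2)] by blast
  note c = fracsD[OF f(1)] fracsD[OF f(2)] fracsD[OF f(3)] fracsD[OF f(4)] gr_carrier[OF u(1)] gr_carrier[OF v(1)]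
  have "(u \<otimes> v) \<bullet> ((h \<otimes> k) \<bullet> (k' \<bullet> x' \<oplus>\<^bsub>N\<^esub> h' \<bullet> y'))
      = (v \<otimes> k \<otimes> k') \<bullet> (u \<bullet> (h \<bullet> x')) \<oplus>\<^bsub>N\<^esub> (u \<otimes> h \<otimes> h') \<bullet> (v \<bullet> (k \<bullet> y'))"
    using c by (simp add: smult_r_distr smult_assoc1[symmetric] R.m_ac)
  also have "\<dots> = (u \<otimes> v) \<bullet> ((h' \<otimes> k') \<bullet> (k \<bullet> x \<oplus>\<^bsub>N\<^esub> h \<bullet> y))"
    unfolding u(3) v(3) using c by (simp add: smult_r_distr smult_assoc1[symmetric] R.m_ac)
  finally show ?thesis
    using c u v q gr_mult[OF u(1) v(1)]
    by (intro frac_eqI[OF q fracs_cross[OF q f(3,4)] fracs_cross[OF q f(1,2)], of "u \<otimes> v" "d + e"])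
      (auto simp: avoidable_mult[OF q])
qed

lemma LN_add:
  assumes q: "avoidable q" and f: "(x, h) \<in> fracs q" "(y, k) \<in> fracs q"
  shows "frac q x h \<oplus>\<^bsub>LN q\<^esub> frac q y k = frac q (k \<bullet> x \<oplus>\<^bsub>N\<^esub> h \<bullet> y) (h \<otimes> k)"
proof -
  have inner: "(\<Union>(y', k')\<in>frac q y k. frac q (k' \<bullet> x' \<oplus>\<^bsub>N\<^esub> h' \<bullet> y') (h' \<otimes> k'))
      = frac q (k \<bullet> x' \<oplus>\<^bsub>N\<^esub> h' \<bullet> y) (h' \<otimes> k)" if "(x', h') \<in> fracs q" for x' h'
    using that by (intro UN_frac[OF q f(2)] frac_add_cong[OF q that f(2)]) auto
  have "(\<Union>(x', h')\<in>frac q x h. \<Union>(y', k')\<in>frac q y k. frac q (k' \<bullet> x' \<oplus>\<^bsub>N\<^esub> h' \<bullet> y') (h' \<otimes> k'))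
      = (\<Union>(y', k')\<in>frac q y k. frac q (k' \<bullet> x \<oplus>\<^bsub>N\<^esub> h \<bullet> y') (h \<otimes> k'))"
  proof (rule UN_frac[OF q f(1)])
    fix x' h' assume a: "(x', h') \<in> fracs q" "frac q x' h' = frac q x h"
    show "(\<Union>(y', k')\<in>frac q y k. frac q (k' \<bullet> x' \<oplus>\<^bsub>N\<^esub> h' \<bullet> y') (h' \<otimes> k'))
      = (\<Union>(y', k')\<in>frac q y k. frac q (k' \<bullet> x \<oplus>\<^bsub>N\<^esub> h \<bullet> y') (h \<otimes> k'))"
      unfolding inner[OF a(1)] inner[OF f(1)]
      by (rule frac_add_cong[OF q f a(1) f(2) a(2) refl])
  qed
  then show ?thesis using inner[OF f(1)] by (simp add: hlocalization_def)
qed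

lemma frac_add_same:
  assumes q: "avoidable q" and f: "(x, h) \<in> fracs q" "(y, h) \<in> fracs q"
    and d: "x \<in> ngr d" "y \<in> ngr d" "h \<in> gr d"
  shows "frac q x h \<oplus>\<^bsub>LN q\<^esub> frac q y h = frac q (x \<oplus>\<^bsub>N\<^esub> y) h"
proof -
  note c = fracsD[OF f(1)] fracsD[OF f(2)]
  show ?thesis
    unfolding LN_add[OF q f] using c d
    by (intro frac_eqI_cross[OF q fracs_cross[OF q f]] fracsI[of _ d] ngr_add)
      (auto simp: smult_r_distr smult_assoc1)
qed

lemma frac_cancel:
  assumes q: "avoidable q" and f: "(x, h) \<in> fracs q" and w: "w \<in> gr e" "w \<notin> q"
  shows "frac q (w \<bullet> x) (w \<otimes> h) = frac q x h" "(w \<bullet> x, w \<otimes> h) \<in> fracs q"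
proof -
  obtain d where d: "x \<in> ngr d" "h \<in> gr d" using f by (auto simp: hfracs_def)
  note c = fracsD[OF f] gr_carrier[OF w(1)]
  show wf: "(w \<bullet> x, w \<otimes> h) \<in> fracs q"
    using c d w by (intro fracsI[of _ "e + d"] ngr_smult gr_mult avoidable_mult[OF q]) auto
  show "frac q (w \<bullet> x) (w \<otimes> h) = frac q x h"
    using c by (intro frac_eqI_cross[OF q wf f]) (simp add: smult_assoc1[symmetric] R.m_ac)
qed

lemma frac_zero:
  assumes q: "avoidable q" and h: "h \<in> gr d" "h \<notin> q"
  shows "frac q \<zero>\<^bsub>N\<^esub> h = \<zero>\<^bsub>LN q\<^esub>"
  unfolding zero_LN using h gr_carrier[OF h(1)]
  by (intro frac_eqI_cross[OF q _ zero_fracs[OF q]] fracsI[of _ d]) (auto simp: ngr_zero)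

lemma frac_eq_zero_iff:
  assumes q: "avoidable q" and f: "(x, h) \<in> fracs q"
  shows "frac q x h = \<zero>\<^bsub>LN q\<^esub> \<longleftrightarrow> (\<exists>e. \<exists>u\<in>gr e - q. u \<bullet> x = \<zero>\<^bsub>N\<^esub>)"
proof
  note c = fracsD[OF f]
  assume "frac q x h = \<zero>\<^bsub>LN q\<^esub>"
  then obtain u e where "u \<in> gr e" "u \<notin> q" "u \<bullet> (\<one> \<bullet> x) = u \<bullet> (h \<bullet> \<zero>\<^bsub>N\<^esub>)"
    unfolding zero_LN using frac_eqD[OF q f zero_fracs[OF q]] by blast
  then show "\<exists>e. \<exists>u\<in>gr e - q. u \<bullet> x = \<zero>\<^bsub>N\<^esub>"
    using c gr_carrier[of u e] by auto
next
  note c = fracsD[OF f]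
  assume "\<exists>e. \<exists>u\<in>gr e - q. u \<bullet> x = \<zero>\<^bsub>N\<^esub>"
  then obtain u e where u: "u \<in> gr e" "u \<notin> q" "u \<bullet> x = \<zero>\<^bsub>N\<^esub>" by blast
  then show "frac q x h = \<zero>\<^bsub>LN q\<^esub>"
    unfolding zero_LN using c gr_carrier[of u e]
    by (intro frac_eqI[OF q f zero_fracs[OF q] u(1,2)]) simp
qed

lemma abelian_group_LN:
  assumes q: "avoidable q" shows "abelian_group (LN q)"
proof (rule abelian_groupI)
  show "\<zero>\<^bsub>LN q\<^esub> \<in> carrier (LN q)" using zero_fracs[OF q] by (auto simp: zero_LN intro: frac_in_LN)
  fix A assume "A \<in> carrier (LN q)"
  then obtain x h where x: "(x, h) \<in> fracs q" "A = frac q x h" by (rule LN_cases)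
  note cx = fracsD[OF x(1)]
  show "\<zero>\<^bsub>LN q\<^esub> \<oplus>\<^bsub>LN q\<^esub> A = A"
    using x cx by (simp add: zero_LN LN_add[OF q zero_fracs[OF q]])
  obtain d where d: "x \<in> ngr d" "h \<in> gr d" using x by (auto simp: hfracs_def)
  have mx: "(\<ominus>\<^bsub>N\<^esub> x, h) \<in> fracs q" using d cx by (intro fracsI[of _ d] ngr_minus)
  have "frac q (\<ominus>\<^bsub>N\<^esub> x) h \<oplus>\<^bsub>LN q\<^esub> A = \<zero>\<^bsub>LN q\<^esub>"
    using frac_add_same[OF q mx x(1) ngr_minus[OF d(1)] d] cx frac_zero[OF q d(2) cx(3)] x
    by (simp add: M.l_neg)
  then show "\<exists>C\<in>carrier (LN q). C \<oplus>\<^bsub>LN q\<^esub> A = \<zero>\<^bsub>LN q\<^esub>" using frac_in_LN[OF mx] by blast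
  fix C assume "C \<in> carrier (LN q)"
  then obtain y k where y: "(y, k) \<in> fracs q" "C = frac q y k" by (rule LN_cases)
  note cy = fracsD[OF y(1)]
  show "A \<oplus>\<^bsub>LN q\<^esub> C \<in> carrier (LN q)"
    using x y by (simp add: LN_add[OF q] frac_in_LN fracs_cross[OF q])
  show "A \<oplus>\<^bsub>LN q\<^esub> C = C \<oplus>\<^bsub>LN q\<^esub> A"
    using x y cx cy by (simp add: LN_add[OF q] R.m_comm M.a_comm)
  fix D assume "D \<in> carrier (LN q)"
  then obtain z l where z: "(z, l) \<in> fracs q" "D = frac q z l" by (rule LN_cases)
  note cz = fracsD[OF z(1)]
  show "A \<oplus>\<^bsub>LN q\<^esub> C \<oplus>\<^bsub>LN q\<^esub> D = A \<oplus>\<^bsub>LN q\<^esub> (C \<oplus>\<^bsub>LN q\<^esub> D)"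
    using cx cy cz
    by (simp only: x y z LN_add[OF q] fracs_cross[OF q])
      (simp add: R.m_ac M.a_ac smult_r_distr smult_assoc1[symmetric])
qed


lemma graded_module_reg_module: "graded_module B (reg_module B) gr gr"
proof (intro graded_module.intro R.module_reg_module graded_module_axioms.intro)
  fix a d assume a: "a \<in> gr d"
  have "\<ominus>\<^bsub>reg_module B\<^esub> a = \<ominus> a"
    by (simp add: a_inv_def reg_module_def m_inv_def)
  then show "\<ominus>\<^bsub>reg_module B\<^esub> a \<in> gr d" using gr_minus[OF a] by simp
qed (auto simp: reg_module_def gr_carrier gr_zero gr_add gr_minus gr_mult gr_one)

abbreviation bfrac where "bfrac q a g \<equiv> hfrac gr (reg_module B) gr q a g"
abbreviation bfracs where "bfracs q \<equiv> hfracs gr gr q"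
abbreviation LB where "LB q \<equiv> hlocalization B gr (reg_module B) gr q"

lemma bfracsD:
  assumes "(a, g) \<in> bfracs q"
  shows "a \<in> carrier B" "g \<in> carrier B" "g \<notin> q"
  using assms by (auto simp: hfracs_def gr_carrier)

lemma smult_fracs:
  assumes "avoidable q" "(a, g) \<in> bfracs q" "(x, h) \<in> fracs q"
  shows "(a \<bullet> x, g \<otimes> h) \<in> fracs q"
proof -
  obtain d e where "a \<in> gr d" "g \<in> gr d" "g \<notin> q" "x \<in> ngr e" "h \<in> gr e" "h \<notin> q"
    using assms by (auto simp: hfracs_def)
  then show ?thesis
    by (intro fracsI[of _ "d + e"] ngr_smult gr_mult avoidable_mult[OF assms(1)]) (auto simp: gr_carrier)
qed

lemma frac_smult_cong:
  assumes q: "avoidable q" and f: "(a, g) \<in> bfracs q" "(x, h) \<in> fracs q" "(a', g') \<in> bfracs q" "(x', h') \<in> fracs q"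
    and eq: "bfrac q a' g' = bfrac q a g" "frac q x' h' = frac q x h"
  shows "frac q (a' \<bullet> x') (g' \<otimes> h') = frac q (a \<bullet> x) (g \<otimes> h)"
proof -
  interpret reg: graded_module B "reg_module B" gr gr by (rule graded_module_reg_module)
  obtain u d where u: "u \<in> gr d" "u \<notin> q" "u \<otimes> (g \<otimes> a') = u \<otimes> (g' \<otimes> a)"
    using reg.frac_eqD[OF q f(3,1) eq(1)] by (auto simp: reg_module_def)
  obtain v e where v: "v \<in> gr e" "v \<notin> q" "v \<bullet> (h \<bullet> x') = v \<bullet> (h' \<bullet> x)"
    using frac_eqD[OF q f(4,2) eq(2)] by blast
  note c = bfracsD[OF f(1)] fracsD[OF f(2)] bfracsD[OF f(3)] fracsD[OF f(4)] gr_carrier[OF u(1)] gr_carrier[OF v(1)]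
  have "(u \<otimes> v) \<bullet> ((g \<otimes> h) \<bullet> (a' \<bullet> x')) = (u \<otimes> (g \<otimes> a')) \<bullet> (v \<bullet> (h \<bullet> x'))"
    using c by (simp add: smult_assoc1[symmetric] R.m_ac)
  also have "\<dots> = (u \<otimes> v) \<bullet> ((g' \<otimes> h') \<bullet> (a \<bullet> x))"
    unfolding u(3) v(3) using c by (simp add: smult_assoc1[symmetric] R.m_ac)
  finally show ?thesis
    using c u v gr_mult[OF u(1) v(1)]
    by (intro frac_eqI[OF q smult_fracs[OF q f(3,4)] smult_fracs[OF q f(1,2)], of "u \<otimes> v" "d + e"])
      (auto simp: avoidable_mult[OF q])
qed

lemma LN_smult:
  assumes q: "avoidable q" and f: "(a, g) \<in> bfracs q" "(x, h) \<in> fracs q"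
  shows "bfrac q a g \<odot>\<^bsub>LN q\<^esub> frac q x h = frac q (a \<bullet> x) (g \<otimes> h)"
proof -
  interpret reg: graded_module B "reg_module B" gr gr by (rule graded_module_reg_module)
  have inner: "(\<Union>(x', h')\<in>frac q x h. frac q (a' \<bullet> x') (g' \<otimes> h')) = frac q (a' \<bullet> x) (g' \<otimes> h)"
    if "(a', g') \<in> bfracs q" for a' g'
    using that by (intro UN_frac[OF q f(2)] frac_smult_cong[OF q that f(2)]) auto
  have "(\<Union>(a', g')\<in>bfrac q a g. \<Union>(x', h')\<in>frac q x h. frac q (a' \<bullet> x') (g' \<otimes> h'))
      = (\<Union>(x', h')\<in>frac q x h. frac q (a \<bullet> x') (g \<otimes> h'))"
  proof (rule reg.UN_frac[OF q f(1)])
    fix a' g' assume a: "(a', g') \<in> bfracs q" "bfrac q a' g' = bfrac q a g"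
    show "(\<Union>(x', h')\<in>frac q x h. frac q (a' \<bullet> x') (g' \<otimes> h'))
      = (\<Union>(x', h')\<in>frac q x h. frac q (a \<bullet> x') (g \<otimes> h'))"
      unfolding inner[OF a(1)] inner[OF f(1)]
      by (rule frac_smult_cong[OF q f a(1) f(2) a(2) refl])
  qed
  then show ?thesis using inner[OF f(1)] by (simp add: hlocalization_def)
qed

lemma LN_smult_axioms:
  assumes q: "avoidable q" and ag: "(a, g) \<in> bfracs q" and bk: "(b, k) \<in> bfracs q"
    and xh: "(x, h) \<in> fracs q" and yl: "(y, l) \<in> fracs q"
  shows "frac q ((k \<otimes> a \<oplus> g \<otimes> b) \<bullet> x) (g \<otimes> k \<otimes> h)
      = frac q (a \<bullet> x) (g \<otimes> h) \<oplus>\<^bsub>LN q\<^esub> frac q (b \<bullet> x) (k \<otimes> h)"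
    and "frac q (a \<bullet> (l \<bullet> x \<oplus>\<^bsub>N\<^esub> h \<bullet> y)) (g \<otimes> (h \<otimes> l))
      = frac q (a \<bullet> x) (g \<otimes> h) \<oplus>\<^bsub>LN q\<^esub> frac q (a \<bullet> y) (g \<otimes> l)"
proof -
  interpret reg: graded_module B "reg_module B" gr gr by (rule graded_module_reg_module)
  note c = bfracsD[OF ag] bfracsD[OF bk] fracsD[OF xh] fracsD[OF yl]
  have s: "(k \<otimes> a \<oplus> g \<otimes> b, g \<otimes> k) \<in> bfracs q"
    using reg.fracs_cross[OF q ag bk] by (simp add: reg_module_def)
  note f = smult_fracs[OF q ag xh] smult_fracs[OF q bk xh] smult_fracs[OF q ag yl]
  show "frac q ((k \<otimes> a \<oplus> g \<otimes> b) \<bullet> x) (g \<otimes> k \<otimes> h)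
      = frac q (a \<bullet> x) (g \<otimes> h) \<oplus>\<^bsub>LN q\<^esub> frac q (b \<bullet> x) (k \<otimes> h)"
    unfolding LN_add[OF q f(1,2)] using c
    by (intro frac_eqI_cross[OF q smult_fracs[OF q s xh] fracs_cross[OF q f(1,2)]])
      (simp add: smult_l_distr smult_r_distr R.r_distr smult_assoc1[symmetric] R.m_ac)
  show "frac q (a \<bullet> (l \<bullet> x \<oplus>\<^bsub>N\<^esub> h \<bullet> y)) (g \<otimes> (h \<otimes> l))
      = frac q (a \<bullet> x) (g \<otimes> h) \<oplus>\<^bsub>LN q\<^esub> frac q (a \<bullet> y) (g \<otimes> l)"
    unfolding LN_add[OF q f(1,3)] using c
    by (intro frac_eqI_cross[OF q smult_fracs[OF q ag fracs_cross[OF q xh yl]] fracs_cross[OF q f(1,3)]])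
      (simp add: smult_r_distr smult_assoc1[symmetric] R.m_ac)
qed

lemma LB_mult_eq_smult: "A \<otimes>\<^bsub>LB q\<^esub> C = A \<odot>\<^bsub>LB q\<^esub> C"
  by (simp add: hlocalization_def reg_module_def)

lemma one_LB: "\<one>\<^bsub>LB q\<^esub> = bfrac q \<one> \<one>"
  by (simp add: hlocalization_def reg_module_def)

lemma zero_LB: "\<zero>\<^bsub>LB q\<^esub> = bfrac q \<zero> \<one>"
  by (simp add: hlocalization_def reg_module_def)

lemma one_bfracs: "avoidable q \<Longrightarrow> (\<one>, \<one>) \<in> bfracs q"
  using gr_one avoidable_one by (auto simp: hfracs_def)

lemma bfrac_in_LB: "(a, g) \<in> bfracs q \<Longrightarrow> bfrac q a g \<in> carrier (LB q)"
  by (auto simp: hlocalization_def)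

lemma LB_cases:
  assumes "A \<in> carrier (LB q)"
  obtains a g where "(a, g) \<in> bfracs q" "A = bfrac q a g"
  using assms by (auto simp: hlocalization_def)

lemma LB_mult:
  assumes q: "avoidable q" and f: "(a, g) \<in> bfracs q" "(b, k) \<in> bfracs q"
  shows "bfrac q a g \<otimes>\<^bsub>LB q\<^esub> bfrac q b k = bfrac q (a \<otimes> b) (g \<otimes> k)" "(a \<otimes> b, g \<otimes> k) \<in> bfracs q"
proof -
  interpret reg: graded_module B "reg_module B" gr gr by (rule graded_module_reg_module)
  show "bfrac q a g \<otimes>\<^bsub>LB q\<^esub> bfrac q b k = bfrac q (a \<otimes> b) (g \<otimes> k)"
    using reg.LN_smult[OF q f] by (simp only: LB_mult_eq_smult) (simp add: reg_module_def)
  show "(a \<otimes> b, g \<otimes> k) \<in> bfracs q"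
    using reg.smult_fracs[OF q f] by (simp add: reg_module_def)
qed

lemma LB_add:
  assumes q: "avoidable q" and f: "(a, g) \<in> bfracs q" "(b, k) \<in> bfracs q"
  shows "bfrac q a g \<oplus>\<^bsub>LB q\<^esub> bfrac q b k = bfrac q (k \<otimes> a \<oplus> g \<otimes> b) (g \<otimes> k)"
    "(k \<otimes> a \<oplus> g \<otimes> b, g \<otimes> k) \<in> bfracs q"
proof -
  interpret reg: graded_module B "reg_module B" gr gr by (rule graded_module_reg_module)
  show "bfrac q a g \<oplus>\<^bsub>LB q\<^esub> bfrac q b k = bfrac q (k \<otimes> a \<oplus> g \<otimes> b) (g \<otimes> k)"
    using reg.LN_add[OF q f] by (simp add: reg_module_def)
  show "(k \<otimes> a \<oplus> g \<otimes> b, g \<otimes> k) \<in> bfracs q"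
    using reg.fracs_cross[OF q f] by (simp add: reg_module_def)
qed

text \<open>The localization of \<open>B\<close> is the case \<open>N = B\<close>, in which the product of two fractions is the
  scalar multiple; the laws of a module give most of those of a ring.\<close>

lemma cring_LB:
  assumes q: "avoidable q" shows "cring (LB q)"
proof (rule cringI)
  interpret reg: graded_module B "reg_module B" gr gr by (rule graded_module_reg_module)
  show "abelian_group (LB q)" by (rule reg.abelian_group_LN[OF q])
  show "comm_monoid (LB q)"
  proof (rule comm_monoidI)
    show "\<one>\<^bsub>LB q\<^esub> \<in> carrier (LB q)" using one_bfracs[OF q] by (simp add: one_LB bfrac_in_LB)
    fix A assume "A \<in> carrier (LB q)"
    then obtain a g where a: "(a, g) \<in> bfracs q" "A = bfrac q a g" by (rule LB_cases)
    show "\<one>\<^bsub>LB q\<^esub> \<otimes>\<^bsub>LB q\<^esub> A = A"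
      using a bfracsD[OF a(1)] by (simp add: one_LB LB_mult[OF q one_bfracs[OF q]])
    fix C assume "C \<in> carrier (LB q)"
    then obtain b k where b: "(b, k) \<in> bfracs q" "C = bfrac q b k" by (rule LB_cases)
    show "A \<otimes>\<^bsub>LB q\<^esub> C \<in> carrier (LB q)"
      using a b by (simp add: LB_mult[OF q] bfrac_in_LB)
    show "A \<otimes>\<^bsub>LB q\<^esub> C = C \<otimes>\<^bsub>LB q\<^esub> A"
      using a b bfracsD[OF a(1)] bfracsD[OF b(1)] by (simp add: LB_mult[OF q] R.m_comm)
    fix D assume "D \<in> carrier (LB q)"
    then obtain c l where c: "(c, l) \<in> bfracs q" "D = bfrac q c l" by (rule LB_cases)
    show "A \<otimes>\<^bsub>LB q\<^esub> C \<otimes>\<^bsub>LB q\<^esub> D = A \<otimes>\<^bsub>LB q\<^esub> (C \<otimes>\<^bsub>LB q\<^esub> D)"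
      using a b c bfracsD[OF a(1)] bfracsD[OF b(1)] bfracsD[OF c(1)]
      by (simp add: LB_mult[OF q] R.m_assoc)
  qed
  fix A C D assume "A \<in> carrier (LB q)" "C \<in> carrier (LB q)" "D \<in> carrier (LB q)"
  then obtain a g b k c l where f: "(a, g) \<in> bfracs q" "A = bfrac q a g" "(b, k) \<in> bfracs q" "C = bfrac q b k"
    "(c, l) \<in> bfracs q" "D = bfrac q c l" by (metis LB_cases)
  have "(A \<oplus>\<^bsub>LB q\<^esub> C) \<otimes>\<^bsub>LB q\<^esub> D = bfrac q ((k \<otimes> a \<oplus> g \<otimes> b) \<otimes> c) (g \<otimes> k \<otimes> l)"
    using f by (simp add: LB_add[OF q] LB_mult[OF q])
  also have "\<dots> = A \<otimes>\<^bsub>LB q\<^esub> D \<oplus>\<^bsub>LB q\<^esub> C \<otimes>\<^bsub>LB q\<^esub> D"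
    using reg.LN_smult_axioms(1)[OF q f(1,3,5,5)] f by (simp add: LB_mult[OF q]) (simp add: reg_module_def)
  finally show "(A \<oplus>\<^bsub>LB q\<^esub> C) \<otimes>\<^bsub>LB q\<^esub> D = A \<otimes>\<^bsub>LB q\<^esub> D \<oplus>\<^bsub>LB q\<^esub> C \<otimes>\<^bsub>LB q\<^esub> D" .
qed

lemma module_LN:
  assumes q: "avoidable q" shows "module (LB q) (LN q)"
proof (rule moduleI[OF cring_LB[OF q] abelian_group_LN[OF q]])
  fix A X assume "A \<in> carrier (LB q)" "X \<in> carrier (LN q)"
  then obtain a g x h where f: "(a, g) \<in> bfracs q" "A = bfrac q a g" "(x, h) \<in> fracs q" "X = frac q x h"
    by (metis LB_cases LN_cases)
  show "A \<odot>\<^bsub>LN q\<^esub> X \<in> carrier (LN q)"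
    using f by (simp add: LN_smult[OF q] frac_in_LN smult_fracs[OF q])
  fix C assume "C \<in> carrier (LB q)"
  then obtain b k where b: "(b, k) \<in> bfracs q" "C = bfrac q b k" by (rule LB_cases)
  show "(A \<oplus>\<^bsub>LB q\<^esub> C) \<odot>\<^bsub>LN q\<^esub> X = A \<odot>\<^bsub>LN q\<^esub> X \<oplus>\<^bsub>LN q\<^esub> C \<odot>\<^bsub>LN q\<^esub> X"
    using f b LN_smult_axioms(1)[OF q f(1) b(1) f(3) f(3)] by (simp add: LB_add[OF q] LN_smult[OF q])
  show "A \<otimes>\<^bsub>LB q\<^esub> C \<odot>\<^bsub>LN q\<^esub> X = A \<odot>\<^bsub>LN q\<^esub> (C \<odot>\<^bsub>LN q\<^esub> X)"
    using f b bfracsD[OF f(1)] bfracsD[OF b(1)] fracsD[OF f(3)]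
    by (simp add: LB_mult[OF q] LN_smult[OF q] smult_fracs[OF q] smult_assoc1 R.m_assoc)
next
  fix A X Y assume "A \<in> carrier (LB q)" "X \<in> carrier (LN q)" "Y \<in> carrier (LN q)"
  then obtain a g x h y l where f: "(a, g) \<in> bfracs q" "A = bfrac q a g" "(x, h) \<in> fracs q" "X = frac q x h"
    "(y, l) \<in> fracs q" "Y = frac q y l" by (metis LB_cases LN_cases)
  show "A \<odot>\<^bsub>LN q\<^esub> (X \<oplus>\<^bsub>LN q\<^esub> Y) = A \<odot>\<^bsub>LN q\<^esub> X \<oplus>\<^bsub>LN q\<^esub> A \<odot>\<^bsub>LN q\<^esub> Y"
    using f LN_smult_axioms(2)[OF q f(1) f(1) f(3) f(5)]
    by (simp add: LN_add[OF q] LN_smult[OF q] fracs_cross[OF q])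
next
  fix X assume "X \<in> carrier (LN q)"
  then obtain x h where f: "(x, h) \<in> fracs q" "X = frac q x h" by (rule LN_cases)
  then show "\<one>\<^bsub>LB q\<^esub> \<odot>\<^bsub>LN q\<^esub> X = X"
    using fracsD[OF f(1)] by (simp add: one_LB LN_smult[OF q one_bfracs[OF q]])
qed

lemma graded_module_quot_module:
  assumes Z: "submodule Z B N"
  shows "graded_module B (quot_module N Z) gr (\<lambda>d. (\<lambda>x. Z +>\<^bsub>N\<^esub> x) ` ngr d)"
proof -
  interpret Z: subgroup_of_module Z N by (rule subgroup_of_module_submodule[OF Z])
  interpret Q: module B "quot_module N Z" by (rule module_quot_module[OF Z])
  have minus: "\<ominus>\<^bsub>quot_module N Z\<^esub> (Z +>\<^bsub>N\<^esub> x) = Z +>\<^bsub>N\<^esub> (\<ominus>\<^bsub>N\<^esub> x)" if "x \<in> carrier N" for x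
    using that by (intro Q.M.minus_equality)
      (auto simp: Z.quot_module_add M.l_neg Z.a_rcos_const carrier_quot_module)
  have "Z \<in> (\<lambda>x. Z +>\<^bsub>N\<^esub> x) ` ngr d" for d
    using Z.a_rcos_const[of "\<zero>\<^bsub>N\<^esub>"] ngr_zero by force
  then show ?thesis
    by (intro graded_module.intro Q.module_axioms graded_module_axioms.intro)
      (auto simp: gr_carrier gr_zero gr_add gr_minus gr_mult gr_one Z.quot_module_add ngr_carrier minus
        quot_module_smult_submodule[OF Z] carrier_quot_module ngr_add ngr_minus ngr_smult)
qed

end


lemma the_elem_image_const:
  assumes "A \<noteq> {}" "\<And>x. x \<in> A \<Longrightarrow> f x = c" shows "the_elem (f ` A) = c"
proof -
  have "f ` A = {c}" using assms by auto
  then show ?thesis by simp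
qed

section \<open>Presheaves of modules, stalks and sheafification\<close>

text \<open>These are the properties that pass to quotients, tensor products and sheafifications.\<close>

locale module_presheaf =
  fixes T :: "'p topology" and \<O> :: "('p, 'c, 'a) presheaf" and F :: "('p, 'a, 'b) presheaf"
  assumes scalar_res_closed: "\<lbrakk>openin T U; openin T V; V \<subseteq> U; a \<in> carrier (sections \<O> U)\<rbrakk>
      \<Longrightarrow> res \<O> U V a \<in> carrier (sections \<O> V)"
    and scalar_res_res: "\<lbrakk>openin T U; openin T V; openin T W; V \<subseteq> U; W \<subseteq> V; a \<in> carrier (sections \<O> U)\<rbrakk>
      \<Longrightarrow> res \<O> V W (res \<O> U V a) = res \<O> U W a"
    and res_closed: "\<lbrakk>openin T U; openin T V; V \<subseteq> U; s \<in> carrier (sections F U)\<rbrakk>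
      \<Longrightarrow> res F U V s \<in> carrier (sections F V)"
    and res_res: "\<lbrakk>openin T U; openin T V; openin T W; V \<subseteq> U; W \<subseteq> V; s \<in> carrier (sections F U)\<rbrakk>
      \<Longrightarrow> res F V W (res F U V s) = res F U W s"
    and zero_closed: "openin T U \<Longrightarrow> \<zero>\<^bsub>sections F U\<^esub> \<in> carrier (sections F U)"
    and add_closed: "\<lbrakk>openin T U; s \<in> carrier (sections F U); t \<in> carrier (sections F U)\<rbrakk>
      \<Longrightarrow> s \<oplus>\<^bsub>sections F U\<^esub> t \<in> carrier (sections F U)"
    and smult_closed: "\<lbrakk>openin T U; a \<in> carrier (sections \<O> U); s \<in> carrier (sections F U)\<rbrakk>
      \<Longrightarrow> a \<odot>\<^bsub>sections F U\<^esub> s \<in> carrier (sections F U)"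
    and res_zero: "\<lbrakk>openin T U; openin T V; V \<subseteq> U\<rbrakk>
      \<Longrightarrow> res F U V \<zero>\<^bsub>sections F U\<^esub> = \<zero>\<^bsub>sections F V\<^esub>"
    and res_add: "\<lbrakk>openin T U; openin T V; V \<subseteq> U; s \<in> carrier (sections F U); t \<in> carrier (sections F U)\<rbrakk>
      \<Longrightarrow> res F U V (s \<oplus>\<^bsub>sections F U\<^esub> t) = res F U V s \<oplus>\<^bsub>sections F V\<^esub> res F U V t"
    and res_smult: "\<lbrakk>openin T U; openin T V; V \<subseteq> U; a \<in> carrier (sections \<O> U); s \<in> carrier (sections F U)\<rbrakk>
      \<Longrightarrow> res F U V (a \<odot>\<^bsub>sections F U\<^esub> s) = res \<O> U V a \<odot>\<^bsub>sections F V\<^esub> res F U V s"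

text \<open>The part of the structure that germs depend on, common to a presheaf of modules and its
  presheaf of scalars.\<close>

locale restriction_system =
  fixes T :: "'p topology" and F :: "('p, 'a, 'b) presheaf"
  assumes res_closed: "\<lbrakk>openin T U; openin T V; V \<subseteq> U; s \<in> carrier (sections F U)\<rbrakk>
      \<Longrightarrow> res F U V s \<in> carrier (sections F V)"
    and res_res: "\<lbrakk>openin T U; openin T V; openin T W; V \<subseteq> U; W \<subseteq> V; s \<in> carrier (sections F U)\<rbrakk>
      \<Longrightarrow> res F V W (res F U V s) = res F U W s"
begin

abbreviation section_at :: "'p \<Rightarrow> 'p set \<Rightarrow> 'b \<Rightarrow> bool" where
  "section_at p U s \<equiv> openin T U \<and> p \<in> U \<and> s \<in> carrier (sections F U)"

lemma germ_subset:
  assumes s: "section_at p U s" and t: "section_at p V t"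
    and W: "openin T W" "p \<in> W" "W \<subseteq> U \<inter> V" and eq: "res F U W s = res F V W t"
  shows "germ T F p U s \<subseteq> germ T F p V t"
proof clarify
  fix V' t' assume "(V', t') \<in> germ T F p U s"
  then obtain W' where V': "section_at p V' t'" and W': "openin T W'" "p \<in> W'" "W' \<subseteq> U \<inter> V'"
    and eq': "res F U W' s = res F V' W' t'"
    by (auto simp: germ_def)
  let ?W = "W \<inter> W'"
  have o: "openin T ?W" using W W' by blast
  have "res F V ?W t = res F W ?W (res F V W t)"
    using t W o by (intro res_res[symmetric]) auto
  also have "\<dots> = res F U ?W s"
    unfolding eq[symmetric] using s W o by (intro res_res) auto
  also have "\<dots> = res F W' ?W (res F U W' s)"
    using s W' o by (intro res_res[symmetric]) auto
  also have "\<dots> = res F V' ?W t'"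
    unfolding eq' using V' W' o by (intro res_res) auto
  finally show "(V', t') \<in> germ T F p V t"
    using V' o W W' by (auto simp: germ_def)
qed

lemma germ_eqI:
  assumes "section_at p U s" "section_at p V t"
    and "openin T W" "p \<in> W" "W \<subseteq> U \<inter> V" "res F U W s = res F V W t"
  shows "germ T F p U s = germ T F p V t"
  using assms by (intro subset_antisym germ_subset[where W = W]) auto

lemma germ_self: "section_at p U s \<Longrightarrow> (U, s) \<in> germ T F p U s"
  by (auto simp: germ_def)

lemma mem_germ:
  assumes s: "section_at p U s" and t: "(V, t) \<in> germ T F p U s"
  shows "section_at p V t" "germ T F p V t = germ T F p U s"
    "\<exists>W. openin T W \<and> p \<in> W \<and> W \<subseteq> U \<inter> V \<and> res F U W s = res F V W t"
proof -
  show V: "section_at p V t" and W: "\<exists>W. openin T W \<and> p \<in> W \<and> W \<subseteq> U \<inter> V \<and> res F U W s = res F V W t"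
    using t by (auto simp: germ_def)
  then obtain W where "openin T W" "p \<in> W" "W \<subseteq> U \<inter> V" "res F U W s = res F V W t" by blast
  then show "germ T F p V t = germ T F p U s" using germ_eqI[OF s V] by simp
qed

lemma germ_res:
  assumes "section_at p U s" "openin T V" "p \<in> V" "V \<subseteq> U"
  shows "germ T F p V (res F U V s) = germ T F p U s"
  using assms by (intro germ_eqI[where W = V]) (auto intro: res_closed simp: res_res)

text \<open>As for fractions: a union over the representatives of a germ whose value is always the same.\<close>

lemma UN_germ:
  assumes "section_at p U s"
    and "\<And>V t W. \<lbrakk>section_at p V t; openin T W; p \<in> W; W \<subseteq> U \<inter> V; res F V W t = res F U W s\<rbrakk> \<Longrightarrow> G V t = G U s"
  shows "(\<Union>(V, t)\<in>germ T F p U s. G V t) = G U s"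
proof (rule UN_eq_const)
  show "germ T F p U s \<noteq> {}" using germ_self[OF assms(1)] by blast
  fix v assume v: "v \<in> germ T F p U s"
  obtain V t where Vt: "v = (V, t)" by (cases v)
  then obtain W where "openin T W" "p \<in> W" "W \<subseteq> U \<inter> V" "res F U W s = res F V W t" "section_at p V t"
    using mem_germ[OF assms(1)] v by metis
  then show "(case v of (V, t) \<Rightarrow> G V t) = G U s" using assms(2) Vt by simp
qed

end

sublocale module_presheaf \<subseteq> scalar: restriction_system T \<O>
  by unfold_locales (auto intro: scalar_res_closed scalar_res_res)

sublocale module_presheaf \<subseteq> restriction_system T F
  by unfold_locales (auto intro: res_closed res_res)

context module_presheaf
begin

abbreviation Stalk where "Stalk p \<equiv> stalk T \<O> F p"

lemma Stalk_cases:
  assumes "X \<in> carrier (Stalk p)"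
  obtains U s where "section_at p U s" "X = germ T F p U s"
  using assms by (auto simp: stalk_def)

lemma germ_in_Stalk: "section_at p U s \<Longrightarrow> germ T F p U s \<in> carrier (Stalk p)"
  by (auto simp: stalk_def)

lemma Stalk_zero:
  assumes "openin T U" "p \<in> U"
  shows "\<zero>\<^bsub>Stalk p\<^esub> = germ T F p U \<zero>\<^bsub>sections F U\<^esub>"
proof -
  have U: "U \<subseteq> topspace T" using assms(1) by (rule openin_subset)
  have "germ T F p U (res F (topspace T) U \<zero>\<^bsub>sections F (topspace T)\<^esub>)
      = germ T F p (topspace T) \<zero>\<^bsub>sections F (topspace T)\<^esub>"
    using assms U by (intro germ_res) (auto intro: zero_closed)
  then show ?thesis using assms U by (simp add: stalk_def res_zero)
qed

lemma germ_add_cong: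
  assumes s: "section_at p U s" and t: "section_at p V t" and s': "section_at p U' s'" and t': "section_at p V' t'"
    and W: "openin T W" "p \<in> W" "W \<subseteq> U \<inter> U'" "res F U' W s' = res F U W s"
    and W': "openin T W'" "p \<in> W'" "W' \<subseteq> V \<inter> V'" "res F V' W' t' = res F V W' t"
  shows "germ T F p (U' \<inter> V') (res F U' (U' \<inter> V') s' \<oplus>\<^bsub>sections F (U' \<inter> V')\<^esub> res F V' (U' \<inter> V') t')
    = germ T F p (U \<inter> V) (res F U (U \<inter> V) s \<oplus>\<^bsub>sections F (U \<inter> V)\<^esub> res F V (U \<inter> V) t)"
proof -
  let ?W = "W \<inter> W'"
  have o: "openin T ?W" "openin T (U \<inter> V)" "openin T (U' \<inter> V')"
    using W W' s t s' t' by blast+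
  have shrink: "res F U1 ?W (x) = res F U2 ?W y"
    if "section_at p U1 x" "section_at p U2 y" "openin T W1" "W1 \<subseteq> U1 \<inter> U2" "?W \<subseteq> W1" "res F U1 W1 x = res F U2 W1 y" for U1 U2 x y W1
    using res_res[of U1 W1 ?W x] res_res[of U2 W1 ?W y] that o by auto
  have split: "res F (U1 \<inter> U2) ?W (res F U1 (U1 \<inter> U2) x \<oplus>\<^bsub>sections F (U1 \<inter> U2)\<^esub> res F U2 (U1 \<inter> U2) y)
      = res F U1 ?W x \<oplus>\<^bsub>sections F ?W\<^esub> res F U2 ?W y"
    if "section_at p U1 x" "section_at p U2 y" "?W \<subseteq> U1 \<inter> U2" "openin T (U1 \<inter> U2)" for U1 U2 x y
    using that o by (simp add: res_add res_closed res_res)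
  show ?thesis
  proof (rule germ_eqI[where W = ?W])
    have "res F U' ?W s' = res F U ?W s" "res F V' ?W t' = res F V ?W t"
      using shrink[OF s' s, of W] shrink[OF t' t, of W'] W W' by auto
    then show "res F (U' \<inter> V') ?W (res F U' (U' \<inter> V') s' \<oplus>\<^bsub>sections F (U' \<inter> V')\<^esub> res F V' (U' \<inter> V') t')
        = res F (U \<inter> V) ?W (res F U (U \<inter> V) s \<oplus>\<^bsub>sections F (U \<inter> V)\<^esub> res F V (U \<inter> V) t)"
      using split[OF s t] split[OF s' t'] W W' o by fastforce
  qed (use o s t s' t' W W' in \<open>auto intro!: add_closed res_closed\<close>)
qed

lemma Stalk_add:
  assumes s: "section_at p U s" and t: "section_at p V t"
  shows "germ T F p U s \<oplus>\<^bsub>Stalk p\<^esub> germ T F p V t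
    = germ T F p (U \<inter> V) (res F U (U \<inter> V) s \<oplus>\<^bsub>sections F (U \<inter> V)\<^esub> res F V (U \<inter> V) t)"
proof -
  let ?G = "\<lambda>U s V t. germ T F p (U \<inter> V) (res F U (U \<inter> V) s \<oplus>\<^bsub>sections F (U \<inter> V)\<^esub> res F V (U \<inter> V) t)"
  have inner: "(\<Union>(V', t')\<in>germ T F p V t. ?G U' s' V' t') = ?G U' s' V t" if "section_at p U' s'" for U' s'
    using that t by (intro UN_germ[OF t] germ_add_cong[where W = U']) auto
  have "(\<Union>(U', s')\<in>germ T F p U s. \<Union>(V', t')\<in>germ T F p V t. ?G U' s' V' t')
      = (\<Union>(V', t')\<in>germ T F p V t. ?G U s V' t')"
  proof (rule UN_germ[OF s])
    fix U' s' W assume a: "section_at p U' s'" "openin T W" "p \<in> W" "W \<subseteq> U \<inter> U'" "res F U' W s' = res F U W s"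
    have "?G U' s' V t = ?G U s V t"
      using a t by (intro germ_add_cong[OF s t a(1) t a(2-5), where W' = V]) auto
    then show "(\<Union>(V', t')\<in>germ T F p V t. ?G U' s' V' t') = (\<Union>(V', t')\<in>germ T F p V t. ?G U s V' t')"
      by (simp only: inner[OF a(1)] inner[OF s])
  qed
  then show ?thesis using inner[OF s] by (simp add: stalk_def)
qed

lemma Stalk_add_same:
  assumes s: "section_at p U s" and t: "section_at p U t"
  shows "germ T F p U s \<oplus>\<^bsub>Stalk p\<^esub> germ T F p U t = germ T F p U (s \<oplus>\<^bsub>sections F U\<^esub> t)"
proof -
  have "germ T F p U (res F U U s \<oplus>\<^bsub>sections F U\<^esub> res F U U t) = germ T F p U (s \<oplus>\<^bsub>sections F U\<^esub> t)"
    using s t by (intro germ_eqI[where W = U]) (auto intro!: add_closed res_closed simp: res_add res_res res_closed)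
  then show ?thesis using Stalk_add[OF s t] by simp
qed

lemma germ_smult_cong:
  assumes a: "scalar.section_at p U a" and t: "section_at p V t"
    and a': "scalar.section_at p U' a'" and t': "section_at p V' t'"
    and W: "openin T W" "p \<in> W" "W \<subseteq> U \<inter> U'" "res \<O> U' W a' = res \<O> U W a"
    and W': "openin T W'" "p \<in> W'" "W' \<subseteq> V \<inter> V'" "res F V' W' t' = res F V W' t"
  shows "germ T F p (U' \<inter> V') (res \<O> U' (U' \<inter> V') a' \<odot>\<^bsub>sections F (U' \<inter> V')\<^esub> res F V' (U' \<inter> V') t')
    = germ T F p (U \<inter> V) (res \<O> U (U \<inter> V) a \<odot>\<^bsub>sections F (U \<inter> V)\<^esub> res F V (U \<inter> V) t)"
proof -
  let ?W = "W \<inter> W'"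
  have o: "openin T ?W" "openin T (U \<inter> V)" "openin T (U' \<inter> V')"
    using W W' a t a' t' by blast+
  have 1: "res \<O> U' ?W a' = res \<O> U ?W a"
    using scalar_res_res[of U' W ?W a'] scalar_res_res[of U W ?W a] a a' W o by auto
  have 2: "res F V' ?W t' = res F V ?W t"
    using res_res[of V' W' ?W t'] res_res[of V W' ?W t] t t' W' o by auto
  have split: "res F (U1 \<inter> U2) ?W (res \<O> U1 (U1 \<inter> U2) x \<odot>\<^bsub>sections F (U1 \<inter> U2)\<^esub> res F U2 (U1 \<inter> U2) y)
      = res \<O> U1 ?W x \<odot>\<^bsub>sections F ?W\<^esub> res F U2 ?W y"
    if "scalar.section_at p U1 x" "section_at p U2 y" "?W \<subseteq> U1 \<inter> U2" "openin T (U1 \<inter> U2)" for U1 U2 x y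
    using that o by (simp add: res_smult res_closed res_res scalar_res_closed scalar_res_res)
  show ?thesis
  proof (rule germ_eqI[where W = ?W])
    show "res F (U' \<inter> V') ?W (res \<O> U' (U' \<inter> V') a' \<odot>\<^bsub>sections F (U' \<inter> V')\<^esub> res F V' (U' \<inter> V') t')
        = res F (U \<inter> V) ?W (res \<O> U (U \<inter> V) a \<odot>\<^bsub>sections F (U \<inter> V)\<^esub> res F V (U \<inter> V) t)"
      using split[OF a t] split[OF a' t'] W W' o 1 2 by fastforce
  qed (use o a t a' t' W W' in \<open>auto intro!: smult_closed res_closed scalar_res_closed\<close>)
qed

lemma Stalk_smult:
  assumes a: "scalar.section_at p U a" and t: "section_at p V t"
  shows "germ T \<O> p U a \<odot>\<^bsub>Stalk p\<^esub> germ T F p V t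
    = germ T F p (U \<inter> V) (res \<O> U (U \<inter> V) a \<odot>\<^bsub>sections F (U \<inter> V)\<^esub> res F V (U \<inter> V) t)"
proof -
  let ?G = "\<lambda>U a V t. germ T F p (U \<inter> V) (res \<O> U (U \<inter> V) a \<odot>\<^bsub>sections F (U \<inter> V)\<^esub> res F V (U \<inter> V) t)"
  have inner: "(\<Union>(V', t')\<in>germ T F p V t. ?G U' a' V' t') = ?G U' a' V t" if "scalar.section_at p U' a'" for U' a'
    using that t by (intro UN_germ[OF t] germ_smult_cong[where W = U']) auto
  have "(\<Union>(U', a')\<in>germ T \<O> p U a. \<Union>(V', t')\<in>germ T F p V t. ?G U' a' V' t')
      = (\<Union>(V', t')\<in>germ T F p V t. ?G U a V' t')"
  proof (rule scalar.UN_germ[OF a])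
    fix U' a' W assume b: "scalar.section_at p U' a'" "openin T W" "p \<in> W" "W \<subseteq> U \<inter> U'" "res \<O> U' W a' = res \<O> U W a"
    have "?G U' a' V t = ?G U a V t"
      using b t by (intro germ_smult_cong[OF a t b(1) t b(2-5), where W' = V]) auto
    then show "(\<Union>(V', t')\<in>germ T F p V t. ?G U' a' V' t') = (\<Union>(V', t')\<in>germ T F p V t. ?G U a V' t')"
      by (simp only: inner[OF b(1)] inner[OF a])
  qed
  then show ?thesis using inner[OF a] by (simp add: stalk_def)
qed

lemma Stalk_smult_sub:
  assumes a: "scalar.section_at p U a" and t: "section_at p V t" and VU: "V \<subseteq> U"
  shows "germ T \<O> p U a \<odot>\<^bsub>Stalk p\<^esub> germ T F p V t = germ T F p V (res \<O> U V a \<odot>\<^bsub>sections F V\<^esub> t)"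
proof -
  have "germ T F p V (res \<O> U V a \<odot>\<^bsub>sections F V\<^esub> res F V V t) = germ T F p V (res \<O> U V a \<odot>\<^bsub>sections F V\<^esub> t)"
    using a t VU by (intro germ_eqI[where W = V])
      (auto intro!: smult_closed res_closed scalar_res_closed simp: res_smult res_res res_closed scalar_res_closed)
  moreover have "U \<inter> V = V" using VU by blast
  ultimately show ?thesis using Stalk_smult[OF a t] by simp
qed

abbreviation Sh where "Sh \<equiv> sheafify T \<O> F"

lemma carrier_Sh:
  "\<sigma> \<in> carrier (sections Sh U) \<longleftrightarrow> \<sigma> \<in> extensional U \<and>
     (\<forall>p\<in>U. \<exists>V t. openin T V \<and> p \<in> V \<and> V \<subseteq> U \<and> t \<in> carrier (sections F V) \<and> (\<forall>q\<in>V. \<sigma> q = germ T F q V t))"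
  by (simp add: sheafify_def pointwise_module_def locally_in_def) blast

lemma ShE:
  assumes "\<sigma> \<in> carrier (sections Sh U)" "p \<in> U"
  obtains V t where "openin T V" "p \<in> V" "V \<subseteq> U" "t \<in> carrier (sections F V)" "\<And>q. q \<in> V \<Longrightarrow> \<sigma> q = germ T F q V t"
  using assms carrier_Sh by metis

lemma section_Sh:
  assumes "openin T U" "t \<in> carrier (sections F U)"
  shows "(\<lambda>q\<in>U. germ T F q U t) \<in> carrier (sections Sh U)"
  using assms by (auto simp: carrier_Sh)

lemma Sh_in_Stalk: "\<lbrakk>\<sigma> \<in> carrier (sections Sh U); p \<in> U\<rbrakk> \<Longrightarrow> \<sigma> p \<in> carrier (Stalk p)"
  by (erule ShE, assumption) (auto intro: germ_in_Stalk)

lemma Sh_simps [simp]: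
  "\<zero>\<^bsub>sections Sh U\<^esub> = (\<lambda>p\<in>U. \<zero>\<^bsub>Stalk p\<^esub>)"
  "\<sigma> \<oplus>\<^bsub>sections Sh U\<^esub> \<tau> = (\<lambda>p\<in>U. \<sigma> p \<oplus>\<^bsub>Stalk p\<^esub> \<tau> p)"
  "a \<odot>\<^bsub>sections Sh U\<^esub> \<sigma> = (\<lambda>p\<in>U. germ T \<O> p U a \<odot>\<^bsub>Stalk p\<^esub> \<sigma> p)"
  "res Sh U V \<sigma> = restrict \<sigma> V"
  by (simp_all add: sheafify_def pointwise_module_def)

lemma module_presheaf_sheafify: "module_presheaf T \<O> Sh"
proof
  fix U V \<sigma> assume o: "openin T U" "openin T V" "V \<subseteq> U" and \<sigma>: "\<sigma> \<in> carrier (sections Sh U)"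
  show "res Sh U V \<sigma> \<in> carrier (sections Sh V)"
    unfolding carrier_Sh
  proof (intro conjI ballI)
    fix p assume p: "p \<in> V"
    then obtain V' t where V': "openin T V'" "p \<in> V'" "V' \<subseteq> U" "t \<in> carrier (sections F V')"
      "\<And>q. q \<in> V' \<Longrightarrow> \<sigma> q = germ T F q V' t"
      using ShE[OF \<sigma>, of p] o by blast
    have o': "openin T (V \<inter> V')" using o V' by blast
    have "germ T F q (V \<inter> V') (res F V' (V \<inter> V') t) = germ T F q V' t" if "q \<in> V \<inter> V'" for q
      using that V' o' by (intro germ_res) auto
    then show "\<exists>V' t. openin T V' \<and> p \<in> V' \<and> V' \<subseteq> V \<and> t \<in> carrier (sections F V') \<and> (\<forall>q\<in>V'. res Sh U V \<sigma> q = germ T F q V' t)"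
      using p V' o' by (intro exI[of _ "V \<inter> V'"] exI[of _ "res F V' (V \<inter> V') t"]) (auto intro: res_closed)
  qed simp
next
  fix U assume o: "openin T U"
  show "\<zero>\<^bsub>sections Sh U\<^esub> \<in> carrier (sections Sh U)"
    using o zero_closed[OF o] by (auto simp: carrier_Sh Stalk_zero[OF o] intro!: exI[of _ U])
next
  fix U \<sigma> \<tau> assume o: "openin T U" and \<sigma>: "\<sigma> \<in> carrier (sections Sh U)" and \<tau>: "\<tau> \<in> carrier (sections Sh U)"
  show "\<sigma> \<oplus>\<^bsub>sections Sh U\<^esub> \<tau> \<in> carrier (sections Sh U)"
    unfolding carrier_Sh
  proof (intro conjI ballI)
    fix p assume p: "p \<in> U"
    obtain V t where V: "openin T V" "p \<in> V" "V \<subseteq> U" "t \<in> carrier (sections F V)"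
      "\<And>q. q \<in> V \<Longrightarrow> \<sigma> q = germ T F q V t" using ShE[OF \<sigma> p] by blast
    obtain V' t' where V': "openin T V'" "p \<in> V'" "V' \<subseteq> U" "t' \<in> carrier (sections F V')"
      "\<And>q. q \<in> V' \<Longrightarrow> \<tau> q = germ T F q V' t'" using ShE[OF \<tau> p] by blast
    have o': "openin T (V \<inter> V')" using V V' by blast
    let ?t = "res F V (V \<inter> V') t \<oplus>\<^bsub>sections F (V \<inter> V')\<^esub> res F V' (V \<inter> V') t'"
    have "?t \<in> carrier (sections F (V \<inter> V'))" using V V' o' by (intro add_closed res_closed) auto
    moreover have "(\<sigma> \<oplus>\<^bsub>sections Sh U\<^esub> \<tau>) q = germ T F q (V \<inter> V') ?t" if "q \<in> V \<inter> V'" for q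
      using that V V' by (auto simp: Stalk_add)
    ultimately show "\<exists>V t. openin T V \<and> p \<in> V \<and> V \<subseteq> U \<and> t \<in> carrier (sections F V) \<and>
        (\<forall>q\<in>V. (\<sigma> \<oplus>\<^bsub>sections Sh U\<^esub> \<tau>) q = germ T F q V t)"
      using V V' o' by (intro exI[of _ "V \<inter> V'"] exI[of _ ?t]) auto
  qed simp
next
  fix U a \<sigma> assume o: "openin T U" and a: "a \<in> carrier (sections \<O> U)" and \<sigma>: "\<sigma> \<in> carrier (sections Sh U)"
  show "a \<odot>\<^bsub>sections Sh U\<^esub> \<sigma> \<in> carrier (sections Sh U)"
    unfolding carrier_Sh
  proof (intro conjI ballI)
    fix p assume p: "p \<in> U"
    obtain V t where V: "openin T V" "p \<in> V" "V \<subseteq> U" "t \<in> carrier (sections F V)"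
      "\<And>q. q \<in> V \<Longrightarrow> \<sigma> q = germ T F q V t" using ShE[OF \<sigma> p] by blast
    let ?t = "res \<O> U V a \<odot>\<^bsub>sections F V\<^esub> t"
    have "?t \<in> carrier (sections F V)" using V o a by (intro smult_closed scalar_res_closed) auto
    moreover have "(a \<odot>\<^bsub>sections Sh U\<^esub> \<sigma>) q = germ T F q V ?t" if "q \<in> V" for q
      using that V o a by (auto simp: Stalk_smult_sub)
    ultimately show "\<exists>V t. openin T V \<and> p \<in> V \<and> V \<subseteq> U \<and> t \<in> carrier (sections F V) \<and>
        (\<forall>q\<in>V. (a \<odot>\<^bsub>sections Sh U\<^esub> \<sigma>) q = germ T F q V t)"
      using V by (intro exI[of _ V] exI[of _ ?t]) auto
  qed simp
next
  fix U V a \<sigma> assume "openin T U" "openin T V" "V \<subseteq> U" "a \<in> carrier (sections \<O> U)" "\<sigma> \<in> carrier (sections Sh U)"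
  then show "res Sh U V (a \<odot>\<^bsub>sections Sh U\<^esub> \<sigma>) = res \<O> U V a \<odot>\<^bsub>sections Sh V\<^esub> res Sh U V \<sigma>"
    by (auto simp: fun_eq_iff restrict_def scalar.germ_res subset_iff)
qed (auto simp: scalar_res_closed scalar_res_res fun_eq_iff restrict_def subset_iff)

end

section \<open>Evaluation at a point\<close>

text \<open>A compatible family of maps from the sections of \<open>F\<close> around \<open>p\<close> to a set \<open>L\<close> with operations.
  It is the same as a map from the stalk, but is easier to construct and to extend to the sheaf
  associated to \<open>F\<close>.\<close>

locale presheaf_evaluation = module_presheaf T \<O> F
  for T :: "'p topology" and \<O> :: "('p, 'c, 'a) presheaf" and F :: "('p, 'a, 'b) presheaf" +
  fixes p :: 'p and L :: "('k, 'l, 'm) module_scheme" and scalar_ev :: "'p set \<Rightarrow> 'a \<Rightarrow> 'k"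
    and ev :: "'p set \<Rightarrow> 'b \<Rightarrow> 'l"
  assumes scalar_ev_res: "\<lbrakk>openin T U; openin T V; V \<subseteq> U; p \<in> V; a \<in> carrier (sections \<O> U)\<rbrakk>
      \<Longrightarrow> scalar_ev V (res \<O> U V a) = scalar_ev U a"
    and ev_closed: "\<lbrakk>openin T U; p \<in> U; s \<in> carrier (sections F U)\<rbrakk> \<Longrightarrow> ev U s \<in> carrier L"
    and ev_res: "\<lbrakk>openin T U; openin T V; V \<subseteq> U; p \<in> V; s \<in> carrier (sections F U)\<rbrakk>
      \<Longrightarrow> ev V (res F U V s) = ev U s"
    and ev_zero: "\<lbrakk>openin T U; p \<in> U\<rbrakk> \<Longrightarrow> ev U \<zero>\<^bsub>sections F U\<^esub> = \<zero>\<^bsub>L\<^esub>"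
    and ev_add: "\<lbrakk>openin T U; p \<in> U; s \<in> carrier (sections F U); t \<in> carrier (sections F U)\<rbrakk>
      \<Longrightarrow> ev U (s \<oplus>\<^bsub>sections F U\<^esub> t) = ev U s \<oplus>\<^bsub>L\<^esub> ev U t"
    and ev_smult: "\<lbrakk>openin T U; p \<in> U; a \<in> carrier (sections \<O> U); s \<in> carrier (sections F U)\<rbrakk>
      \<Longrightarrow> ev U (a \<odot>\<^bsub>sections F U\<^esub> s) = scalar_ev U a \<odot>\<^bsub>L\<^esub> ev U s"
begin

definition stalk_ev :: "('p set \<times> 'b) set \<Rightarrow> 'l" where
  "stalk_ev X = the_elem ((\<lambda>(U, s). ev U s) ` X)"

lemma stalk_ev_germ:
  assumes s: "section_at p U s" shows "stalk_ev (germ T F p U s) = ev U s"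
proof -
  have "(\<lambda>(U, s). ev U s) ` germ T F p U s = {ev U s}"
  proof (intro subset_antisym subsetI)
    fix y assume "y \<in> (\<lambda>(U, s). ev U s) ` germ T F p U s"
    then obtain V t where t: "(V, t) \<in> germ T F p U s" "y = ev V t" by auto
    obtain W where W: "openin T W" "p \<in> W" "W \<subseteq> U \<inter> V" "res F U W s = res F V W t"
      using mem_germ(3)[OF s t(1)] by blast
    have "section_at p V t" using mem_germ(1)[OF s t(1)] .
    then show "y \<in> {ev U s}"
      using ev_res[of U W s] ev_res[of V W t] s W t(2) by simp
  qed (use germ_self[OF s] in force)
  then show ?thesis by (simp add: stalk_ev_def)
qed

lemma stalk_ev_closed: "X \<in> carrier (Stalk p) \<Longrightarrow> stalk_ev X \<in> carrier L"
  by (erule Stalk_cases) (simp add: stalk_ev_germ ev_closed)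

lemma stalk_ev_add:
  assumes "X \<in> carrier (Stalk p)" "Y \<in> carrier (Stalk p)"
  shows "stalk_ev (X \<oplus>\<^bsub>Stalk p\<^esub> Y) = stalk_ev X \<oplus>\<^bsub>L\<^esub> stalk_ev Y"
proof -
  obtain U s V t where s: "section_at p U s" "X = germ T F p U s" and t: "section_at p V t" "Y = germ T F p V t"
    using assms by (metis Stalk_cases)
  have o: "openin T (U \<inter> V)" using s t by blast
  then show ?thesis
    using s t by (simp add: Stalk_add stalk_ev_germ add_closed res_closed ev_add ev_res)
qed

lemma stalk_ev_smult:
  assumes "scalar.section_at p U a" "X \<in> carrier (Stalk p)"
  shows "stalk_ev (germ T \<O> p U a \<odot>\<^bsub>Stalk p\<^esub> X) = scalar_ev U a \<odot>\<^bsub>L\<^esub> stalk_ev X"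
proof -
  obtain V t where t: "section_at p V t" "X = germ T F p V t"
    using assms by (metis Stalk_cases)
  have o: "openin T (U \<inter> V)" using assms t by blast
  then show ?thesis
    using assms t
    by (simp add: Stalk_smult stalk_ev_germ smult_closed res_closed scalar_res_closed ev_smult ev_res scalar_ev_res)
qed

lemma stalk_ev_zero: "p \<in> topspace T \<Longrightarrow> stalk_ev \<zero>\<^bsub>Stalk p\<^esub> = \<zero>\<^bsub>L\<^esub>"
  by (simp add: Stalk_zero[OF openin_topspace] stalk_ev_germ zero_closed ev_zero)

text \<open>The condition says that the induced map on the stalk has zero kernel.\<close>

definition faithful :: bool where
  "faithful \<longleftrightarrow> (\<forall>U s. section_at p U s \<and> ev U s = \<zero>\<^bsub>L\<^esub> \<longrightarrow>
     (\<exists>W. openin T W \<and> p \<in> W \<and> W \<subseteq> U \<and> res F U W s = \<zero>\<^bsub>sections F W\<^esub>))"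

lemma faithful_stalk_ev:
  assumes "faithful" "X \<in> carrier (Stalk p)" "stalk_ev X = \<zero>\<^bsub>L\<^esub>"
  shows "X = \<zero>\<^bsub>Stalk p\<^esub>"
proof -
  obtain U s where s: "section_at p U s" "X = germ T F p U s"
    using assms by (metis Stalk_cases)
  then have "ev U s = \<zero>\<^bsub>L\<^esub>" using assms(3) by (simp add: stalk_ev_germ)
  then obtain W where W: "openin T W" "p \<in> W" "W \<subseteq> U" "res F U W s = \<zero>\<^bsub>sections F W\<^esub>"
    using assms(1) s(1) unfolding faithful_def by blast
  have "X = germ T F p W (res F U W s)"
    unfolding s(2) by (rule germ_res[symmetric]) (use s W in auto)
  then show ?thesis using W by (simp add: Stalk_zero)
qed

lemma presheaf_evaluation_sheafify: "presheaf_evaluation T \<O> Sh p L scalar_ev (\<lambda>U \<sigma>. stalk_ev (\<sigma> p))"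
proof -
  interpret Sh: module_presheaf T \<O> Sh by (rule module_presheaf_sheafify)
  have top: "p \<in> U \<Longrightarrow> openin T U \<Longrightarrow> p \<in> topspace T" for U using openin_subset by blast
  show ?thesis
  proof
  qed (auto simp: scalar_ev_res stalk_ev_closed Sh_in_Stalk stalk_ev_add stalk_ev_smult stalk_ev_zero dest: top)
qed

text \<open>A section of the sheaf is near \<open>p\<close> the family of germs of one section \<open>t\<close> of \<open>F\<close>. If it evaluates to
  zero, then so does \<open>t\<close>, and \<open>t\<close> vanishes on a neighbourhood of \<open>p\<close>.\<close>

lemma faithful_sheafify:
  assumes "faithful"
  shows "presheaf_evaluation.faithful T Sh p L (\<lambda>U \<sigma>. stalk_ev (\<sigma> p))"
proof -
  interpret Sh: presheaf_evaluation T \<O> Sh p L scalar_ev "\<lambda>U \<sigma>. stalk_ev (\<sigma> p)"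
    by (rule presheaf_evaluation_sheafify)
  show ?thesis
    unfolding Sh.faithful_def
  proof (intro allI impI)
    fix U \<sigma> assume a: "Sh.section_at p U \<sigma> \<and> stalk_ev (\<sigma> p) = \<zero>\<^bsub>L\<^esub>"
    then obtain V t where V: "openin T V" "p \<in> V" "V \<subseteq> U" "t \<in> carrier (sections F V)"
      "\<And>q. q \<in> V \<Longrightarrow> \<sigma> q = germ T F q V t" using ShE[of \<sigma> U p] by blast
    then have "section_at p V t \<and> ev V t = \<zero>\<^bsub>L\<^esub>" using a by (simp add: stalk_ev_germ)
    from assms[unfolded faithful_def, rule_format, OF this]
    obtain W where W: "openin T W" "p \<in> W" "W \<subseteq> V" "res F V W t = \<zero>\<^bsub>sections F W\<^esub>"
      by blast
    have "\<sigma> q = \<zero>\<^bsub>Stalk q\<^esub>" if q: "q \<in> W" for q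
    proof -
      have "q \<in> V" using q W(3) by blast
      then have "\<sigma> q = germ T F q V t" by (rule V(5))
      also have "\<dots> = germ T F q W (res F V W t)"
        by (rule germ_res[symmetric]) (use V(1,4) W q in auto)
      finally show ?thesis using W q by (simp add: Stalk_zero[of W q])
    qed
    moreover have "W \<subseteq> U" using V(3) W(3) by blast
    ultimately show "\<exists>W. openin T W \<and> p \<in> W \<and> W \<subseteq> U \<and> res Sh U W \<sigma> = \<zero>\<^bsub>sections Sh W\<^esub>"
      using W(1,2) by (intro exI[of _ W]) (simp add: fun_eq_iff restrict_def)
  qed
qed

end


section \<open>Tensor products of presheaves\<close>

lemma tensor_free_simps [simp]:
  "\<zero>\<^bsub>tensor_free M N\<^esub> = 0" "c \<oplus>\<^bsub>tensor_free M N\<^esub> d = c + d"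
  "r \<odot>\<^bsub>tensor_free M N\<^esub> c = frag_extend (\<lambda>(x, y). frag_of (r \<odot>\<^bsub>M\<^esub> x, y)) c"
  by (simp_all add: tensor_free_def)

lemma carrier_tensor_free [simp]:
  "c \<in> carrier (tensor_free M N) \<longleftrightarrow> Poly_Mapping.keys c \<subseteq> carrier M \<times> carrier N"
  by (simp add: tensor_free_def)

lemma abelian_group_tensor_free: "abelian_group (tensor_free M N)"
proof (rule abelian_groupI)
  fix c assume "c \<in> carrier (tensor_free M N)"
  then show "\<exists>d\<in>carrier (tensor_free M N). d \<oplus>\<^bsub>tensor_free M N\<^esub> c = \<zero>\<^bsub>tensor_free M N\<^esub>"
    by (intro bexI[of _ "- c"]) auto
qed (auto simp: dest: subsetD[OF keys_add])

lemma a_inv_tensor_free: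
  assumes "c \<in> carrier (tensor_free M N)" shows "\<ominus>\<^bsub>tensor_free M N\<^esub> c = - c"
proof -
  interpret abelian_group "tensor_free M N" by (rule abelian_group_tensor_free)
  show ?thesis using assms by (intro minus_equality) auto
qed

lemmas frag_set_induct = free_Abelian_group_induct [consumes 1, case_names zero diff one]

lemma keys_frag_extend_of:
  assumes "Poly_Mapping.keys c \<subseteq> S" "\<And>x. x \<in> S \<Longrightarrow> g x \<in> S'"
  shows "Poly_Mapping.keys (frag_extend (\<lambda>x. frag_of (g x)) c) \<subseteq> S'"
  using assms(1)
proof (induction c rule: frag_set_induct)
  case (diff x y)
  then show ?case using keys_diff[of "frag_extend (\<lambda>x. frag_of (g x)) x" "frag_extend (\<lambda>x. frag_of (g x)) y"]
    by (simp add: frag_extend_diff) blast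
qed (use assms(2) in auto)

lemma frag_extend_of_comp:
  "frag_extend (\<lambda>x. frag_of (g x)) (frag_extend (\<lambda>x. frag_of (h x)) c) = frag_extend (\<lambda>x. frag_of (g (h x))) c"
proof -
  have "Poly_Mapping.keys c \<subseteq> UNIV" by simp
  then show ?thesis
    by (induction c rule: frag_set_induct) (simp_all add: frag_extend_diff)
qed

lemma frag_extend_eq_on:
  assumes "Poly_Mapping.keys c \<subseteq> S" "\<And>x. x \<in> S \<Longrightarrow> g x = h x"
  shows "frag_extend g c = frag_extend h c"
  using assms(1)
  by (induction c rule: frag_set_induct) (simp_all add: frag_extend_diff assms(2))

text \<open>Closure under the operations makes the relations a subgroup of the free group on the pairs.\<close>

locale tensor_pair =
  fixes A :: "('a, 'r) ring_scheme" and M :: "('a, 'b, 'm) module_scheme" and N :: "('a, 'c, 'n) module_scheme"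
  assumes M_add: "\<lbrakk>x \<in> carrier M; x' \<in> carrier M\<rbrakk> \<Longrightarrow> x \<oplus>\<^bsub>M\<^esub> x' \<in> carrier M"
    and N_add: "\<lbrakk>y \<in> carrier N; y' \<in> carrier N\<rbrakk> \<Longrightarrow> y \<oplus>\<^bsub>N\<^esub> y' \<in> carrier N"
    and M_smult: "\<lbrakk>r \<in> carrier A; x \<in> carrier M\<rbrakk> \<Longrightarrow> r \<odot>\<^bsub>M\<^esub> x \<in> carrier M"
    and N_smult: "\<lbrakk>r \<in> carrier A; y \<in> carrier N\<rbrakk> \<Longrightarrow> r \<odot>\<^bsub>N\<^esub> y \<in> carrier N"
begin

abbreviation rel where "rel \<equiv> tensor_rel A M N"
abbreviation free where "free \<equiv> tensor_free M N"

definition rel_gens where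
  "rel_gens = {frag_of (x \<oplus>\<^bsub>M\<^esub> x', y) - frag_of (x, y) - frag_of (x', y) | x x' y.
         x \<in> carrier M \<and> x' \<in> carrier M \<and> y \<in> carrier N} \<union>
      {frag_of (x, y \<oplus>\<^bsub>N\<^esub> y') - frag_of (x, y) - frag_of (x, y') | x y y'.
         x \<in> carrier M \<and> y \<in> carrier N \<and> y' \<in> carrier N} \<union>
      {frag_of (r \<odot>\<^bsub>M\<^esub> x, y) - frag_of (x, r \<odot>\<^bsub>N\<^esub> y) | r x y.
         r \<in> carrier A \<and> x \<in> carrier M \<and> y \<in> carrier N}"

lemma rel_eq: "rel = generate (add_monoid free) rel_gens"
  by (simp add: tensor_rel_def rel_gens_def)

lemma keys_diff_subset:
  "\<lbrakk>Poly_Mapping.keys c \<subseteq> S; Poly_Mapping.keys d \<subseteq> S\<rbrakk> \<Longrightarrow> Poly_Mapping.keys (c - d :: 'x \<Rightarrow>\<^sub>0 int) \<subseteq> S"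
  using keys_diff[of c d] by blast

lemma rel_gens_free: "rel_gens \<subseteq> carrier free"
proof
  fix c assume "c \<in> rel_gens"
  then show "c \<in> carrier free"
    unfolding rel_gens_def carrier_tensor_free
    using M_add N_add M_smult N_smult
    by (elim UnE CollectE exE conjE; hypsubst; intro keys_diff_subset; simp)
qed

lemma subgroup_rel: "subgroup rel (add_monoid free)"
  unfolding rel_eq
  using abelian_group.axioms(2)[OF abelian_group_tensor_free] rel_gens_free
  by (intro group.generate_is_subgroup) (auto simp: abelian_group_axioms_def comm_group_def)

lemma subgroup_of_module_rel: "subgroup_of_module rel free"
  using subgroup_rel abelian_group_tensor_free
  by (intro subgroup_of_module.intro abelian_subgroupI3 additive_subgroupI)

lemma rel_zero: "0 \<in> rel"
  using subgroup.one_closed[OF subgroup_rel] by simp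

lemma rel_add: "c \<in> rel \<Longrightarrow> d \<in> rel \<Longrightarrow> c + d \<in> rel"
  using subgroup.m_closed[OF subgroup_rel] by simp

lemma rel_free: "c \<in> rel \<Longrightarrow> c \<in> carrier free"
  using subsetD[OF subgroup.subset[OF subgroup_rel]] by simp

lemma mem_coset_rel: "d \<in> rel +>\<^bsub>free\<^esub> c \<Longrightarrow> \<exists>k\<in>rel. d = k + c"
  by (auto simp: a_r_coset_def')

lemma rel_uminus: "c \<in> rel \<Longrightarrow> - c \<in> rel"
  using subgroup.m_inv_closed[OF subgroup_rel, of c] a_inv_tensor_free[OF rel_free, of c]
  by (simp add: a_inv_def)

lemma rel_minus: "c \<in> rel \<Longrightarrow> d \<in> rel \<Longrightarrow> c - d \<in> rel"
  using rel_add[OF _ rel_uminus] by simp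

lemma rel_induct [consumes 1, case_names gen zero uminus add]:
  assumes "c \<in> rel" and "\<And>c. c \<in> rel_gens \<Longrightarrow> P c" and "P 0"
    and "\<And>c. c \<in> carrier free \<Longrightarrow> P c \<Longrightarrow> P (- c)"
    and "\<And>c d. c \<in> carrier free \<Longrightarrow> d \<in> carrier free \<Longrightarrow> P c \<Longrightarrow> P d \<Longrightarrow> P (c + d)"
  shows "P c"
  using assms(1)[unfolded rel_eq]
proof (induction c rule: generate.induct)
  case (inv h)
  then show ?case
    using assms(2,4)[of h] rel_gens_free a_inv_tensor_free[of h M N] by (auto simp: a_inv_def)
next
  case (eng c d)
  then have "c \<in> rel" "d \<in> rel" by (auto simp: rel_eq)
  then show ?case using eng assms(5) rel_free by (metis monoid.simps(1) tensor_free_simps(2) monoid_record_simps(1))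
qed (use assms in auto)

lemma rel_I:
  "\<lbrakk>x \<in> carrier M; x' \<in> carrier M; y \<in> carrier N\<rbrakk> \<Longrightarrow> frag_of (x \<oplus>\<^bsub>M\<^esub> x', y) - frag_of (x, y) - frag_of (x', y) \<in> rel"
  "\<lbrakk>x \<in> carrier M; y \<in> carrier N; y' \<in> carrier N\<rbrakk> \<Longrightarrow> frag_of (x, y \<oplus>\<^bsub>N\<^esub> y') - frag_of (x, y) - frag_of (x, y') \<in> rel"
  "\<lbrakk>r \<in> carrier A; x \<in> carrier M; y \<in> carrier N\<rbrakk> \<Longrightarrow> frag_of (r \<odot>\<^bsub>M\<^esub> x, y) - frag_of (x, r \<odot>\<^bsub>N\<^esub> y) \<in> rel"
  unfolding rel_eq by (rule generate.incl; unfold rel_gens_def; blast)+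

lemma rel_zero_left:
  assumes "x \<in> carrier M" "x \<oplus>\<^bsub>M\<^esub> x = x" "y \<in> carrier N" shows "frag_of (x, y) \<in> rel"
  using rel_uminus[OF rel_I(1)[OF assms(1,1,3)]] assms(2) by simp

lemma rel_zero_right:
  assumes "x \<in> carrier M" "y \<in> carrier N" "y \<oplus>\<^bsub>N\<^esub> y = y" shows "frag_of (x, y) \<in> rel"
  using rel_uminus[OF rel_I(2)[OF assms(1,2,2)]] assms(3) by simp

end

text \<open>Functoriality of the tensor product, used for restriction maps: generators of the relations go to generators.\<close>

lemma tensor_rel_map:
  assumes P: "tensor_pair A M N" and P': "tensor_pair A' M' N'"
    and g: "\<And>x. x \<in> carrier M \<Longrightarrow> g x \<in> carrier M'" "\<And>y. y \<in> carrier N \<Longrightarrow> h y \<in> carrier N'"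
      "\<And>r. r \<in> carrier A \<Longrightarrow> \<rho> r \<in> carrier A'"
    and g_add: "\<And>x x'. \<lbrakk>x \<in> carrier M; x' \<in> carrier M\<rbrakk> \<Longrightarrow> g (x \<oplus>\<^bsub>M\<^esub> x') = g x \<oplus>\<^bsub>M'\<^esub> g x'"
    and h_add: "\<And>y y'. \<lbrakk>y \<in> carrier N; y' \<in> carrier N\<rbrakk> \<Longrightarrow> h (y \<oplus>\<^bsub>N\<^esub> y') = h y \<oplus>\<^bsub>N'\<^esub> h y'"
    and g_smult: "\<And>r x. \<lbrakk>r \<in> carrier A; x \<in> carrier M\<rbrakk> \<Longrightarrow> g (r \<odot>\<^bsub>M\<^esub> x) = \<rho> r \<odot>\<^bsub>M'\<^esub> g x"
    and h_smult: "\<And>r y. \<lbrakk>r \<in> carrier A; y \<in> carrier N\<rbrakk> \<Longrightarrow> h (r \<odot>\<^bsub>N\<^esub> y) = \<rho> r \<odot>\<^bsub>N'\<^esub> h y"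
    and c: "c \<in> tensor_rel A M N"
  shows "frag_extend (\<lambda>(x, y). frag_of (g x, h y)) c \<in> tensor_rel A' M' N'"
proof -
  interpret P: tensor_pair A M N by (rule P)
  interpret P': tensor_pair A' M' N' by (rule P')
  show ?thesis
    using c
  proof (induction rule: P.rel_induct)
    case (gen c)
    then consider (a) x x' y where "c = frag_of (x \<oplus>\<^bsub>M\<^esub> x', y) - frag_of (x, y) - frag_of (x', y)"
        "x \<in> carrier M" "x' \<in> carrier M" "y \<in> carrier N"
      | (b) x y y' where "c = frag_of (x, y \<oplus>\<^bsub>N\<^esub> y') - frag_of (x, y) - frag_of (x, y')"
        "x \<in> carrier M" "y \<in> carrier N" "y' \<in> carrier N"
      | (c) r x y where "c = frag_of (r \<odot>\<^bsub>M\<^esub> x, y) - frag_of (x, r \<odot>\<^bsub>N\<^esub> y)"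
        "r \<in> carrier A" "x \<in> carrier M" "y \<in> carrier N"
      unfolding P.rel_gens_def by blast
    then show ?case
    proof cases
      case a
      then show ?thesis using P'.rel_I(1)[of "g x" "g x'" "h y"] by (simp add: frag_extend_diff g g_add)
    next
      case b
      then show ?thesis using P'.rel_I(2)[of "g x" "h y" "h y'"] by (simp add: frag_extend_diff g h_add)
    next
      case c
      then show ?thesis using P'.rel_I(3)[of "\<rho> r" "g x" "h y"] by (simp add: frag_extend_diff g g_smult h_smult)
    qed
  qed (auto simp: P'.rel_zero frag_extend_minus P'.rel_uminus frag_extend_add P'.rel_add)
qed

locale presheaf_pair = F: module_presheaf T \<O> F + G: module_presheaf T \<O> G
  for T :: "'p topology" and \<O> :: "('p, 'a, 'a) presheaf" and F :: "('p, 'a, 'b) presheaf"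
    and G :: "('p, 'a, 'c) presheaf" +
  assumes F_smult_add: "\<lbrakk>openin T U; r \<in> carrier (sections \<O> U); x \<in> carrier (sections F U); y \<in> carrier (sections F U)\<rbrakk>
      \<Longrightarrow> r \<odot>\<^bsub>sections F U\<^esub> (x \<oplus>\<^bsub>sections F U\<^esub> y) = r \<odot>\<^bsub>sections F U\<^esub> x \<oplus>\<^bsub>sections F U\<^esub> r \<odot>\<^bsub>sections F U\<^esub> y"
    and F_smult_comm: "\<lbrakk>openin T U; r \<in> carrier (sections \<O> U); t \<in> carrier (sections \<O> U); x \<in> carrier (sections F U)\<rbrakk>
      \<Longrightarrow> r \<odot>\<^bsub>sections F U\<^esub> (t \<odot>\<^bsub>sections F U\<^esub> x) = t \<odot>\<^bsub>sections F U\<^esub> (r \<odot>\<^bsub>sections F U\<^esub> x)"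
begin

abbreviation "frel U \<equiv> tensor_rel (sections \<O> U) (sections F U) (sections G U)"
abbreviation "ffree U \<equiv> tensor_free (sections F U) (sections G U)"
abbreviation "fres U V \<equiv> frag_extend (\<lambda>(s, t). frag_of (res F U V s, res G U V t))"

definition tensor_presheaf :: "('p, 'a, ('b \<times> 'c \<Rightarrow>\<^sub>0 int) set) presheaf" where
  "tensor_presheaf =
     \<lparr>sections = (\<lambda>U. tensor_module (sections \<O> U) (sections F U) (sections G U)),
      res = (\<lambda>U V X. \<Union>c\<in>X. frel V +>\<^bsub>ffree V\<^esub> fres U V c)\<rparr>"

lemma tensor_sheaf_eq: "tensor_sheaf T \<O> F G = sheafify T \<O> tensor_presheaf"
  by (simp add: tensor_sheaf_def tensor_presheaf_def)

lemma sections_tensor_presheaf: "sections tensor_presheaf U = quot_module (ffree U) (frel U)"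
  by (simp add: tensor_presheaf_def tensor_module_def)

lemma tensor_pair_sections: "openin T U \<Longrightarrow> tensor_pair (sections \<O> U) (sections F U) (sections G U)"
  by unfold_locales (auto intro: F.add_closed G.add_closed F.smult_closed G.smult_closed)

lemma fres_closed:
  "\<lbrakk>openin T U; openin T V; V \<subseteq> U; c \<in> carrier (ffree U)\<rbrakk> \<Longrightarrow> fres U V c \<in> carrier (ffree V)"
  unfolding carrier_tensor_free case_prod_beta
  by (rule keys_frag_extend_of) (auto intro: F.res_closed G.res_closed)

lemma fres_rel:
  assumes "openin T U" "openin T V" "V \<subseteq> U" "c \<in> frel U"
  shows "fres U V c \<in> frel V"
  using assms
  by (intro tensor_rel_map[OF tensor_pair_sections[OF assms(1)] tensor_pair_sections[OF assms(2)],
        where \<rho> = "res \<O> U V"])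
    (auto intro: F.res_closed G.res_closed F.scalar_res_closed simp: F.res_add G.res_add F.res_smult G.res_smult)

lemma fres_fres:
  assumes "openin T U" "openin T V" "openin T W" "V \<subseteq> U" "W \<subseteq> V" "c \<in> carrier (ffree U)"
  shows "fres V W (fres U V c) = fres U W c"
  unfolding case_prod_beta frag_extend_of_comp
  by (rule frag_extend_eq_on[where S = "carrier (sections F U) \<times> carrier (sections G U)"])
    (use assms in \<open>auto simp: F.res_res G.res_res\<close>)

lemma tensor_cases:
  assumes "X \<in> carrier (sections tensor_presheaf U)"
  obtains c where "c \<in> carrier (ffree U)" "X = frel U +>\<^bsub>ffree U\<^esub> c"
  using assms by (auto simp: sections_tensor_presheaf carrier_quot_module)

lemma coset_in_tensor: "c \<in> carrier (ffree U) \<Longrightarrow> frel U +>\<^bsub>ffree U\<^esub> c \<in> carrier (sections tensor_presheaf U)"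
  by (auto simp: sections_tensor_presheaf carrier_quot_module)

lemma coset_eq_iff:
  assumes "openin T U" "c \<in> carrier (ffree U)" "d \<in> carrier (ffree U)"
  shows "frel U +>\<^bsub>ffree U\<^esub> c = frel U +>\<^bsub>ffree U\<^esub> d \<longleftrightarrow> c - d \<in> frel U"
proof -
  interpret P: tensor_pair "sections \<O> U" "sections F U" "sections G U" by (rule tensor_pair_sections[OF assms(1)])
  interpret S: subgroup_of_module "frel U" "ffree U" by (rule P.subgroup_of_module_rel)
  show ?thesis
    using S.coset_eq_iff[OF assms(2,3)] a_inv_tensor_free[OF assms(3)] by (simp add: a_minus_def)
qed

lemma res_tensor:
  assumes o: "openin T U" "openin T V" "V \<subseteq> U" and c: "c \<in> carrier (ffree U)"
  shows "res tensor_presheaf U V (frel U +>\<^bsub>ffree U\<^esub> c) = frel V +>\<^bsub>ffree V\<^esub> fres U V c"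
proof -
  interpret P: tensor_pair "sections \<O> U" "sections F U" "sections G U" by (rule tensor_pair_sections[OF o(1)])
  interpret S: subgroup_of_module "frel U" "ffree U" by (rule P.subgroup_of_module_rel)
  have "(\<Union>d\<in>frel U +>\<^bsub>ffree U\<^esub> c. frel V +>\<^bsub>ffree V\<^esub> fres U V d) = frel V +>\<^bsub>ffree V\<^esub> fres U V c"
  proof (rule UN_eq_const)
    show "frel U +>\<^bsub>ffree U\<^esub> c \<noteq> {}" using S.a_rcos_self[OF c] by blast
    fix d assume "d \<in> frel U +>\<^bsub>ffree U\<^esub> c"
    then obtain k where k: "k \<in> frel U" "d = k + c" by (auto simp: a_r_coset_def')
    then have "fres U V d - fres U V c \<in> frel V"
      using fres_rel[OF o k(1)] by (simp add: frag_extend_add)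
    moreover have "d \<in> carrier (ffree U)" using S.a_closed[OF S.a_Hcarr[OF k(1)] c] k(2) by simp
    ultimately show "frel V +>\<^bsub>ffree V\<^esub> fres U V d = frel V +>\<^bsub>ffree V\<^esub> fres U V c"
      using coset_eq_iff[OF o(2)] fres_closed[OF o] c by blast
  qed
  then show ?thesis by (simp add: tensor_presheaf_def)
qed

lemma tensor_zero: "\<zero>\<^bsub>sections tensor_presheaf U\<^esub> = frel U"
  by (simp add: sections_tensor_presheaf)

lemma coset_zero: "openin T U \<Longrightarrow> frel U +>\<^bsub>ffree U\<^esub> 0 = frel U"
  using subgroup_of_module.coset_eq_self_iff[OF tensor_pair.subgroup_of_module_rel[OF tensor_pair_sections], of U 0]
    tensor_pair.rel_zero[OF tensor_pair_sections, of U] by simp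

lemma tensor_add:
  assumes "openin T U" "c \<in> carrier (ffree U)" "d \<in> carrier (ffree U)"
  shows "(frel U +>\<^bsub>ffree U\<^esub> c) \<oplus>\<^bsub>sections tensor_presheaf U\<^esub> (frel U +>\<^bsub>ffree U\<^esub> d) = frel U +>\<^bsub>ffree U\<^esub> (c + d)"
proof -
  interpret P: tensor_pair "sections \<O> U" "sections F U" "sections G U" by (rule tensor_pair_sections[OF assms(1)])
  interpret S: subgroup_of_module "frel U" "ffree U" by (rule P.subgroup_of_module_rel)
  show ?thesis using S.quot_module_add[OF assms(2,3)] by (simp add: sections_tensor_presheaf)
qed

abbreviation "fsmult U r \<equiv> frag_extend (\<lambda>(x, y). frag_of (r \<odot>\<^bsub>sections F U\<^esub> x, y))"

lemma fsmult_closed: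
  "\<lbrakk>openin T U; r \<in> carrier (sections \<O> U); c \<in> carrier (ffree U)\<rbrakk> \<Longrightarrow> fsmult U r c \<in> carrier (ffree U)"
  unfolding carrier_tensor_free case_prod_beta
  by (rule keys_frag_extend_of) (auto intro: F.smult_closed)

lemma tensor_smult:
  assumes "openin T U" "r \<in> carrier (sections \<O> U)" "c \<in> carrier (ffree U)"
  shows "r \<odot>\<^bsub>sections tensor_presheaf U\<^esub> (frel U +>\<^bsub>ffree U\<^esub> c) = frel U +>\<^bsub>ffree U\<^esub> fsmult U r c"
proof -
  interpret P: tensor_pair "sections \<O> U" "sections F U" "sections G U" by (rule tensor_pair_sections[OF assms(1)])
  interpret S: subgroup_of_module "frel U" "ffree U" by (rule P.subgroup_of_module_rel)
  have pres: "fsmult U r n \<in> frel U" if "n \<in> frel U" for n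
    using assms that
    by (intro tensor_rel_map[OF P.tensor_pair_axioms P.tensor_pair_axioms, where \<rho> = "\<lambda>a. a" and h = "\<lambda>y. y"])
      (auto intro: F.smult_closed simp: F_smult_add F_smult_comm)
  have "r \<odot>\<^bsub>quot_module (ffree U) (frel U)\<^esub> (frel U +>\<^bsub>ffree U\<^esub> c) = frel U +>\<^bsub>ffree U\<^esub> (r \<odot>\<^bsub>ffree U\<^esub> c)"
    by (rule S.quot_module_smult[OF assms(3)])
      (use pres fsmult_closed[OF assms] in \<open>auto simp: frag_extend_add\<close>)
  then show ?thesis by (simp add: sections_tensor_presheaf)
qed

lemma module_presheaf_tensor: "module_presheaf T \<O> tensor_presheaf"
proof
  fix U V assume o: "openin T U" "openin T V" "V \<subseteq> U"
  show "res tensor_presheaf U V \<zero>\<^bsub>sections tensor_presheaf U\<^esub> = \<zero>\<^bsub>sections tensor_presheaf V\<^esub>"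
    using res_tensor[OF o, of 0] o by (simp add: tensor_zero coset_zero)
  fix X assume "X \<in> carrier (sections tensor_presheaf U)"
  then obtain c where c: "c \<in> carrier (ffree U)" "X = frel U +>\<^bsub>ffree U\<^esub> c" by (rule tensor_cases)
  show "res tensor_presheaf U V X \<in> carrier (sections tensor_presheaf V)"
    unfolding c(2) res_tensor[OF o c(1)] by (rule coset_in_tensor[OF fres_closed[OF o c(1)]])
  show "res tensor_presheaf V W (res tensor_presheaf U V X) = res tensor_presheaf U W X"
    if "openin T W" "W \<subseteq> V" for W
  proof -
    have "W \<subseteq> U" using that o by blast
    then show ?thesis
      unfolding c(2) res_tensor[OF o c(1)]
      using res_tensor[OF o(2) that fres_closed[OF o c(1)]] res_tensor[OF o(1) that(1) _ c(1)]
        fres_fres[OF o(1,2) that(1) o(3) that(2) c(1)] by simp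
  qed
  show "res tensor_presheaf U V (a \<odot>\<^bsub>sections tensor_presheaf U\<^esub> X)
      = res \<O> U V a \<odot>\<^bsub>sections tensor_presheaf V\<^esub> res tensor_presheaf U V X"
    if a: "a \<in> carrier (sections \<O> U)" for a
  proof -
    have "fres U V (fsmult U a c) = fsmult V (res \<O> U V a) (fres U V c)"
      unfolding case_prod_beta frag_extend_of_comp
      by (rule frag_extend_eq_on[where S = "carrier (sections F U) \<times> carrier (sections G U)"])
        (use o a c in \<open>auto simp: F.res_smult\<close>)
    then show ?thesis
      unfolding c(2) res_tensor[OF o c(1)] tensor_smult[OF o(1) a c(1)]
        tensor_smult[OF o(2) F.scalar_res_closed[OF o a] fres_closed[OF o c(1)]]
        res_tensor[OF o fsmult_closed[OF o(1) a c(1)]] by (rule arg_cong)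
  qed
  fix Y assume "Y \<in> carrier (sections tensor_presheaf U)"
  then obtain d where d: "d \<in> carrier (ffree U)" "Y = frel U +>\<^bsub>ffree U\<^esub> d" by (rule tensor_cases)
  have cd: "c + d \<in> carrier (ffree U)" using c d keys_add[of c d] by auto
  show "res tensor_presheaf U V (X \<oplus>\<^bsub>sections tensor_presheaf U\<^esub> Y)
      = res tensor_presheaf U V X \<oplus>\<^bsub>sections tensor_presheaf V\<^esub> res tensor_presheaf U V Y"
    unfolding c(2) d(2) tensor_add[OF o(1) c(1) d(1)] res_tensor[OF o cd] res_tensor[OF o c(1)] res_tensor[OF o d(1)]
      tensor_add[OF o(2) fres_closed[OF o c(1)] fres_closed[OF o d(1)]]
    by (simp add: frag_extend_add)
next
  fix U assume o: "openin T U"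
  show "\<zero>\<^bsub>sections tensor_presheaf U\<^esub> \<in> carrier (sections tensor_presheaf U)"
    using coset_in_tensor[of 0 U] o by (simp add: tensor_zero coset_zero)
  fix X assume "X \<in> carrier (sections tensor_presheaf U)"
  then obtain c where c: "c \<in> carrier (ffree U)" "X = frel U +>\<^bsub>ffree U\<^esub> c" by (rule tensor_cases)
  show "a \<odot>\<^bsub>sections tensor_presheaf U\<^esub> X \<in> carrier (sections tensor_presheaf U)"
    if "a \<in> carrier (sections \<O> U)" for a
    unfolding c(2) tensor_smult[OF o that c(1)] by (rule coset_in_tensor[OF fsmult_closed[OF o that c(1)]])
  fix Y assume "Y \<in> carrier (sections tensor_presheaf U)"
  then obtain d where d: "d \<in> carrier (ffree U)" "Y = frel U +>\<^bsub>ffree U\<^esub> d" by (rule tensor_cases)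
  have cd: "c + d \<in> carrier (ffree U)" using c d keys_add[of c d] by auto
  show "X \<oplus>\<^bsub>sections tensor_presheaf U\<^esub> Y \<in> carrier (sections tensor_presheaf U)"
    unfolding c(2) d(2) tensor_add[OF o c(1) d(1)] by (rule coset_in_tensor[OF cd])
qed (auto intro: F.scalar_res_closed F.scalar_res_res)

end

text \<open>A bilinear evaluation of pairs of sections at a point extends additively to formal sums of pairs and kills the
  tensor relations, so it is defined on sections of the tensor product.\<close>

locale tensor_evaluation = presheaf_pair T \<O> F G + L: module K L
  for T :: "'p topology" and \<O> :: "('p, 'a, 'a) presheaf" and F :: "('p, 'a, 'b) presheaf"
    and G :: "('p, 'a, 'c) presheaf" and K :: "('k, 'r) ring_scheme" and L :: "('k, 'l, 'm) module_scheme" +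
  fixes p :: 'p and scalar_ev :: "'p set \<Rightarrow> 'a \<Rightarrow> 'k" and b :: "'p set \<Rightarrow> 'b \<Rightarrow> 'c \<Rightarrow> 'l"
  assumes scalar_ev_closed: "\<lbrakk>openin T U; p \<in> U; r \<in> carrier (sections \<O> U)\<rbrakk> \<Longrightarrow> scalar_ev U r \<in> carrier K"
    and scalar_ev_res: "\<lbrakk>openin T U; openin T V; V \<subseteq> U; p \<in> V; r \<in> carrier (sections \<O> U)\<rbrakk>
      \<Longrightarrow> scalar_ev V (res \<O> U V r) = scalar_ev U r"
    and b_closed: "\<lbrakk>openin T U; p \<in> U; x \<in> carrier (sections F U); y \<in> carrier (sections G U)\<rbrakk> \<Longrightarrow> b U x y \<in> carrier L"
    and b_res: "\<lbrakk>openin T U; openin T V; V \<subseteq> U; p \<in> V; x \<in> carrier (sections F U); y \<in> carrier (sections G U)\<rbrakk>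
      \<Longrightarrow> b V (res F U V x) (res G U V y) = b U x y"
    and b_add_left: "\<lbrakk>openin T U; p \<in> U; x \<in> carrier (sections F U); x' \<in> carrier (sections F U); y \<in> carrier (sections G U)\<rbrakk>
      \<Longrightarrow> b U (x \<oplus>\<^bsub>sections F U\<^esub> x') y = b U x y \<oplus>\<^bsub>L\<^esub> b U x' y"
    and b_add_right: "\<lbrakk>openin T U; p \<in> U; x \<in> carrier (sections F U); y \<in> carrier (sections G U); y' \<in> carrier (sections G U)\<rbrakk>
      \<Longrightarrow> b U x (y \<oplus>\<^bsub>sections G U\<^esub> y') = b U x y \<oplus>\<^bsub>L\<^esub> b U x y'"
    and b_smult_left: "\<lbrakk>openin T U; p \<in> U; r \<in> carrier (sections \<O> U); x \<in> carrier (sections F U); y \<in> carrier (sections G U)\<rbrakk>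
      \<Longrightarrow> b U (r \<odot>\<^bsub>sections F U\<^esub> x) y = scalar_ev U r \<odot>\<^bsub>L\<^esub> b U x y"
    and b_smult_right: "\<lbrakk>openin T U; p \<in> U; r \<in> carrier (sections \<O> U); x \<in> carrier (sections F U); y \<in> carrier (sections G U)\<rbrakk>
      \<Longrightarrow> b U x (r \<odot>\<^bsub>sections G U\<^esub> y) = scalar_ev U r \<odot>\<^bsub>L\<^esub> b U x y"
begin

text \<open>The additive extension, from the universal property of the free abelian group.\<close>

definition lin :: "'p set \<Rightarrow> ('b \<times> 'c \<Rightarrow>\<^sub>0 int) \<Rightarrow> 'l" where
  "lin U = (SOME h. h \<in> hom (free_Abelian_group (carrier (sections F U) \<times> carrier (sections G U))) (add_monoid L) \<and>
     (\<forall>z\<in>carrier (sections F U) \<times> carrier (sections G U). h (frag_of z) = b U (fst z) (snd z)))"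

lemma lin:
  assumes "openin T U" "p \<in> U"
  shows "lin U \<in> hom (free_Abelian_group (carrier (sections F U) \<times> carrier (sections G U))) (add_monoid L)"
    and "\<lbrakk>x \<in> carrier (sections F U); y \<in> carrier (sections G U)\<rbrakk> \<Longrightarrow> lin U (frag_of (x, y)) = b U x y"
proof -
  have "(\<lambda>z. b U (fst z) (snd z)) ` (carrier (sections F U) \<times> carrier (sections G U)) \<subseteq> carrier (add_monoid L)"
    using b_closed assms by auto
  from comm_group.free_Abelian_group_universal[OF L.M.a_comm_group this]
  have "\<exists>h. h \<in> hom (free_Abelian_group (carrier (sections F U) \<times> carrier (sections G U))) (add_monoid L) \<and>
     (\<forall>z\<in>carrier (sections F U) \<times> carrier (sections G U). h (frag_of z) = b U (fst z) (snd z))"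
    by metis
  note * = someI_ex[OF this, folded lin_def]
  from * show "lin U \<in> hom (free_Abelian_group (carrier (sections F U) \<times> carrier (sections G U))) (add_monoid L)"
    by blast
  show "\<lbrakk>x \<in> carrier (sections F U); y \<in> carrier (sections G U)\<rbrakk> \<Longrightarrow> lin U (frag_of (x, y)) = b U x y"
    using * by auto
qed

lemma lin_closed: "\<lbrakk>openin T U; p \<in> U; c \<in> carrier (ffree U)\<rbrakk> \<Longrightarrow> lin U c \<in> carrier L"
  using hom_in_carrier[OF lin(1)[of U], of c] by simp

lemma lin_add:
  "\<lbrakk>openin T U; p \<in> U; c \<in> carrier (ffree U); d \<in> carrier (ffree U)\<rbrakk> \<Longrightarrow> lin U (c + d) = lin U c \<oplus>\<^bsub>L\<^esub> lin U d"
  using hom_mult[OF lin(1)[of U], of c d] by simp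

lemma lin_0: assumes "openin T U" "p \<in> U" shows "lin U 0 = \<zero>\<^bsub>L\<^esub>"
proof -
  have "lin U 0 \<oplus>\<^bsub>L\<^esub> lin U 0 = lin U 0" using lin_add[OF assms, of 0 0] by simp
  then show ?thesis using lin_closed[OF assms, of 0] by simp
qed

lemma lin_uminus:
  assumes "openin T U" "p \<in> U" "c \<in> carrier (ffree U)" shows "lin U (- c) = \<ominus>\<^bsub>L\<^esub> lin U c"
proof -
  have "lin U (- c) \<oplus>\<^bsub>L\<^esub> lin U c = \<zero>\<^bsub>L\<^esub>"
    using lin_add[OF assms(1,2), of "- c" c] assms lin_0 by simp
  then show ?thesis using lin_closed[OF assms] lin_closed[OF assms(1,2), of "- c"] assms(3)
    by (metis L.M.minus_equality carrier_tensor_free keys_minus)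
qed

lemma lin_diff:
  assumes "openin T U" "p \<in> U" "c \<in> carrier (ffree U)" "d \<in> carrier (ffree U)"
  shows "lin U (c - d) = lin U c \<ominus>\<^bsub>L\<^esub> lin U d"
  using lin_add[OF assms(1-3), of "- d"] lin_uminus[OF assms(1,2,4)] assms(4) by (simp add: a_minus_def)

lemma lin_rel:
  assumes o: "openin T U" "p \<in> U" and c: "c \<in> frel U" shows "lin U c = \<zero>\<^bsub>L\<^esub>"
proof -
  interpret P: tensor_pair "sections \<O> U" "sections F U" "sections G U" by (rule tensor_pair_sections[OF o(1)])
  note [simp] = lin(2)[OF o] b_closed[OF o] lin_closed[OF o]
  show ?thesis
    using c
  proof (induction rule: P.rel_induct)
    case (gen c)
    have fr: "x \<in> carrier (sections F U) \<Longrightarrow> y \<in> carrier (sections G U) \<Longrightarrow> frag_of (x, y) \<in> carrier (ffree U)" for x y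
      by simp
    have df: "c \<in> carrier (ffree U) \<Longrightarrow> d \<in> carrier (ffree U) \<Longrightarrow> c - d \<in> carrier (ffree U)" for c d
      using P.keys_diff_subset[of c _ d] by simp
    have minus: "l \<oplus>\<^bsub>L\<^esub> k \<ominus>\<^bsub>L\<^esub> l \<ominus>\<^bsub>L\<^esub> k = \<zero>\<^bsub>L\<^esub>" if "l \<in> carrier L" "k \<in> carrier L" for l k
      using that by (simp add: a_minus_def L.M.a_ac L.M.r_neg L.M.r_neg1 L.M.r_neg2)
    from gen consider (a) x x' y where "c = frag_of (x \<oplus>\<^bsub>sections F U\<^esub> x', y) - frag_of (x, y) - frag_of (x', y)"
        "x \<in> carrier (sections F U)" "x' \<in> carrier (sections F U)" "y \<in> carrier (sections G U)"
      | (b) x y y' where "c = frag_of (x, y \<oplus>\<^bsub>sections G U\<^esub> y') - frag_of (x, y) - frag_of (x, y')"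
        "x \<in> carrier (sections F U)" "y \<in> carrier (sections G U)" "y' \<in> carrier (sections G U)"
      | (c) r x y where "c = frag_of (r \<odot>\<^bsub>sections F U\<^esub> x, y) - frag_of (x, r \<odot>\<^bsub>sections G U\<^esub> y)"
        "r \<in> carrier (sections \<O> U)" "x \<in> carrier (sections F U)" "y \<in> carrier (sections G U)"
      unfolding P.rel_gens_def by blast
    then show ?case
    proof cases
      case a
      then show ?thesis
        using P.M_add[of x x'] by (simp only: lin_diff[OF o] fr df) (simp add: b_add_left[OF o] minus)
    next
      case b
      then show ?thesis
        using P.N_add[of y y'] by (simp only: lin_diff[OF o] fr df) (simp add: b_add_right[OF o] minus)
    next
      case c
      then show ?thesis
        using P.M_smult[of r x] P.N_smult[of r y] scalar_ev_closed[OF o, of r]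
        by (simp only: lin_diff[OF o] fr df)
          (simp add: b_smult_left[OF o] b_smult_right[OF o] a_minus_def L.M.r_neg)
    qed
  next
    case zero
    show ?case by (rule lin_0[OF o])
  next
    case (uminus c)
    have "\<ominus>\<^bsub>L\<^esub> \<zero>\<^bsub>L\<^esub> = \<zero>\<^bsub>L\<^esub>" by (rule L.M.minus_equality) simp_all
    then show ?case using uminus by (simp only: lin_uminus[OF o])
  next
    case (add c d)
    then show ?case by (simp only: lin_add[OF o]) simp
  qed
qed

definition tensor_ev :: "'p set \<Rightarrow> ('b \<times> 'c \<Rightarrow>\<^sub>0 int) set \<Rightarrow> 'l" where
  "tensor_ev U X = the_elem (lin U ` X)"

lemma tensor_ev_coset:
  assumes o: "openin T U" "p \<in> U" and c: "c \<in> carrier (ffree U)"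
  shows "tensor_ev U (frel U +>\<^bsub>ffree U\<^esub> c) = lin U c"
proof -
  interpret P: tensor_pair "sections \<O> U" "sections F U" "sections G U" by (rule tensor_pair_sections[OF o(1)])
  interpret S: subgroup_of_module "frel U" "ffree U" by (rule P.subgroup_of_module_rel)
  have "lin U d = lin U c" if d: "d \<in> frel U +>\<^bsub>ffree U\<^esub> c" for d
  proof -
    obtain k where k: "k \<in> frel U" "d = k + c" using P.mem_coset_rel[OF d] by blast
    then show ?thesis
      using lin_add[OF o P.rel_free[OF k(1)] c] lin_rel[OF o k(1)] lin_closed[OF o c] by simp
  qed
  moreover have "frel U +>\<^bsub>ffree U\<^esub> c \<noteq> {}" using S.a_rcos_self[OF c] by blast
  ultimately show ?thesis unfolding tensor_ev_def by (intro the_elem_image_const)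
qed

lemma lin_fres:
  assumes o: "openin T U" "openin T V" "V \<subseteq> U" "p \<in> V" and c: "c \<in> carrier (ffree U)"
  shows "lin V (fres U V c) = lin U c"
proof -
  have pU: "p \<in> U" using o by blast
  from c have "Poly_Mapping.keys c \<subseteq> carrier (sections F U) \<times> carrier (sections G U)" by simp
  then show ?thesis
  proof (induction c rule: frag_set_induct)
    case zero
    show ?case by (simp add: lin_0 o pU)
  next
    case (diff c d)
    then have cd: "c \<in> carrier (ffree U)" "d \<in> carrier (ffree U)" by auto
    show ?case
      unfolding frag_extend_diff lin_diff[OF o(1) pU cd]
        lin_diff[OF o(2,4) fres_closed[OF o(1-3) cd(1)] fres_closed[OF o(1-3) cd(2)]]
      using diff by simp
  next
    case (one z)
    then show ?case
      using o pU by (cases z) (simp add: lin(2) F.res_closed G.res_closed b_res)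
  qed
qed

lemma lin_fsmult:
  assumes o: "openin T U" "p \<in> U" and r: "r \<in> carrier (sections \<O> U)" and c: "c \<in> carrier (ffree U)"
  shows "lin U (fsmult U r c) = scalar_ev U r \<odot>\<^bsub>L\<^esub> lin U c"
proof -
  note rk = scalar_ev_closed[OF o r]
  from c have "Poly_Mapping.keys c \<subseteq> carrier (sections F U) \<times> carrier (sections G U)" by simp
  then show ?thesis
  proof (induction c rule: frag_set_induct)
    case zero
    show ?case using rk by (simp add: lin_0[OF o])
  next
    case (diff c d)
    then have cd: "c \<in> carrier (ffree U)" "d \<in> carrier (ffree U)" by auto
    show ?case
      unfolding frag_extend_diff lin_diff[OF o cd]
        lin_diff[OF o fsmult_closed[OF o(1) r cd(1)] fsmult_closed[OF o(1) r cd(2)]]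
      using diff rk lin_closed[OF o cd(1)] lin_closed[OF o cd(2)]
      by (simp add: a_minus_def L.smult_r_distr L.smult_r_minus)
  next
    case (one z)
    then show ?case
      using o r by (cases z) (simp add: lin(2) F.smult_closed b_smult_left)
  qed
qed

lemma presheaf_evaluation_tensor: "presheaf_evaluation T \<O> tensor_presheaf p L scalar_ev tensor_ev"
proof -
  interpret TP: module_presheaf T \<O> tensor_presheaf by (rule module_presheaf_tensor)
  show ?thesis
  proof
    fix U assume o: "openin T U" "p \<in> U"
    show "tensor_ev U \<zero>\<^bsub>sections tensor_presheaf U\<^esub> = \<zero>\<^bsub>L\<^esub>"
      using tensor_ev_coset[OF o, of 0] by (simp add: tensor_zero coset_zero o lin_0)
    fix X assume "X \<in> carrier (sections tensor_presheaf U)"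
    then obtain c where c: "c \<in> carrier (ffree U)" "X = frel U +>\<^bsub>ffree U\<^esub> c" by (rule tensor_cases)
    show "tensor_ev U X \<in> carrier L" unfolding c(2) tensor_ev_coset[OF o c(1)] by (rule lin_closed[OF o c(1)])
    show "tensor_ev U (a \<odot>\<^bsub>sections tensor_presheaf U\<^esub> X) = scalar_ev U a \<odot>\<^bsub>L\<^esub> tensor_ev U X"
      if a: "a \<in> carrier (sections \<O> U)" for a
      unfolding c(2) tensor_smult[OF o(1) a c(1)] tensor_ev_coset[OF o c(1)]
        tensor_ev_coset[OF o fsmult_closed[OF o(1) a c(1)]] by (rule lin_fsmult[OF o a c(1)])
    fix Y assume "Y \<in> carrier (sections tensor_presheaf U)"
    then obtain d where d: "d \<in> carrier (ffree U)" "Y = frel U +>\<^bsub>ffree U\<^esub> d" by (rule tensor_cases)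
    have cd: "c + d \<in> carrier (ffree U)" using c d keys_add[of c d] by auto
    show "tensor_ev U (X \<oplus>\<^bsub>sections tensor_presheaf U\<^esub> Y) = tensor_ev U X \<oplus>\<^bsub>L\<^esub> tensor_ev U Y"
      unfolding c(2) d(2) tensor_add[OF o(1) c(1) d(1)] tensor_ev_coset[OF o cd] tensor_ev_coset[OF o c(1)]
        tensor_ev_coset[OF o d(1)] by (rule lin_add[OF o c(1) d(1)])
  next
    fix U V X assume o: "openin T U" "openin T V" "V \<subseteq> U" "p \<in> V" and "X \<in> carrier (sections tensor_presheaf U)"
    then obtain c where c: "c \<in> carrier (ffree U)" "X = frel U +>\<^bsub>ffree U\<^esub> c" by (metis tensor_cases)
    have "p \<in> U" using o by blast
    then show "tensor_ev V (res tensor_presheaf U V X) = tensor_ev U X"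
      unfolding c(2) res_tensor[OF o(1-3) c(1)] tensor_ev_coset[OF o(2,4) fres_closed[OF o(1-3) c(1)]]
      using tensor_ev_coset[OF o(1) _ c(1)] lin_fres[OF o c(1)] by simp
  qed (auto intro: scalar_ev_res)
qed

end


section \<open>Quotient presheaves\<close>

locale submodule_presheaf = module_presheaf T \<O> F
  for T :: "'p topology" and \<O> :: "('p, 'c, 'a) presheaf" and F :: "('p, 'a, 'b) presheaf" +
  fixes N :: "'p set \<Rightarrow> 'b set"
  assumes module_sections: "openin T U \<Longrightarrow> module (sections \<O> U) (sections F U)"
    and submodule_N: "openin T U \<Longrightarrow> submodule (N U) (sections \<O> U) (sections F U)"
    and N_res: "\<lbrakk>openin T U; openin T V; V \<subseteq> U; x \<in> N U\<rbrakk> \<Longrightarrow> res F U V x \<in> N V"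
begin

definition quot_presheaf :: "('p, 'a, 'b set) presheaf" where
  "quot_presheaf =
     \<lparr>sections = (\<lambda>U. quot_module (sections F U) (N U)),
      res = (\<lambda>U V X. \<Union>s\<in>X. N V +>\<^bsub>sections F V\<^esub> res F U V s)\<rparr>"

lemma quot_sheaf_eq: "quot_sheaf T \<O> F N = sheafify T \<O> quot_presheaf"
  by (simp add: quot_sheaf_def quot_presheaf_def)

lemma sections_quot: "sections quot_presheaf U = quot_module (sections F U) (N U)"
  by (simp add: quot_presheaf_def)

lemma subgroup_N: "openin T U \<Longrightarrow> subgroup_of_module (N U) (sections F U)"
  using module.subgroup_of_module_submodule[OF module_sections submodule_N] .

lemma quot_cases:
  assumes "X \<in> carrier (sections quot_presheaf U)"
  obtains s where "s \<in> carrier (sections F U)" "X = N U +>\<^bsub>sections F U\<^esub> s"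
  using assms by (auto simp: sections_quot carrier_quot_module)

lemma coset_in_quot: "s \<in> carrier (sections F U) \<Longrightarrow> N U +>\<^bsub>sections F U\<^esub> s \<in> carrier (sections quot_presheaf U)"
  by (auto simp: sections_quot carrier_quot_module)

lemma N_carrier: "openin T U \<Longrightarrow> x \<in> N U \<Longrightarrow> x \<in> carrier (sections F U)"
  using module.submoduleE(1)[OF module_sections submodule_N] by blast

lemma quot_add:
  "\<lbrakk>openin T U; s \<in> carrier (sections F U); t \<in> carrier (sections F U)\<rbrakk> \<Longrightarrow>
    (N U +>\<^bsub>sections F U\<^esub> s) \<oplus>\<^bsub>sections quot_presheaf U\<^esub> (N U +>\<^bsub>sections F U\<^esub> t)
    = N U +>\<^bsub>sections F U\<^esub> (s \<oplus>\<^bsub>sections F U\<^esub> t)"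
  unfolding sections_quot by (rule subgroup_of_module.quot_module_add[OF subgroup_N])

lemma quot_smult:
  "\<lbrakk>openin T U; r \<in> carrier (sections \<O> U); s \<in> carrier (sections F U)\<rbrakk> \<Longrightarrow>
    r \<odot>\<^bsub>sections quot_presheaf U\<^esub> (N U +>\<^bsub>sections F U\<^esub> s) = N U +>\<^bsub>sections F U\<^esub> (r \<odot>\<^bsub>sections F U\<^esub> s)"
  unfolding sections_quot by (rule module.quot_module_smult_submodule[OF module_sections submodule_N])

lemma quot_zero: "\<zero>\<^bsub>sections quot_presheaf U\<^esub> = N U"
  by (simp add: sections_quot)

lemma coset_eq_N_iff:
  "\<lbrakk>openin T U; s \<in> carrier (sections F U)\<rbrakk> \<Longrightarrow> N U +>\<^bsub>sections F U\<^esub> s = N U \<longleftrightarrow> s \<in> N U"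
  by (rule subgroup_of_module.coset_eq_self_iff[OF subgroup_N])

lemma coset_zero: "openin T U \<Longrightarrow> N U +>\<^bsub>sections F U\<^esub> \<zero>\<^bsub>sections F U\<^esub> = N U"
  using coset_eq_N_iff[OF _ zero_closed] module.submodule_zero[OF module_sections submodule_N] by blast

lemma mem_coset_N: "t \<in> N U +>\<^bsub>sections F U\<^esub> s \<Longrightarrow> \<exists>n\<in>N U. t = n \<oplus>\<^bsub>sections F U\<^esub> s"
  by (auto simp: a_r_coset_def')

lemma coset_nonempty: "\<lbrakk>openin T U; s \<in> carrier (sections F U)\<rbrakk> \<Longrightarrow> s \<in> N U +>\<^bsub>sections F U\<^esub> s"
  using abelian_subgroup.a_rcos_self[OF subgroup_of_module.axioms[OF subgroup_N]] .

lemma res_quot: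
  assumes o: "openin T U" "openin T V" "V \<subseteq> U" and s: "s \<in> carrier (sections F U)"
  shows "res quot_presheaf U V (N U +>\<^bsub>sections F U\<^esub> s) = N V +>\<^bsub>sections F V\<^esub> res F U V s"
proof -
  interpret V: subgroup_of_module "N V" "sections F V" by (rule subgroup_N[OF o(2)])
  have "(\<Union>t\<in>N U +>\<^bsub>sections F U\<^esub> s. N V +>\<^bsub>sections F V\<^esub> res F U V t) = N V +>\<^bsub>sections F V\<^esub> res F U V s"
  proof (rule UN_eq_const)
    show "N U +>\<^bsub>sections F U\<^esub> s \<noteq> {}" using coset_nonempty[OF o(1) s] by blast
    fix t assume t: "t \<in> N U +>\<^bsub>sections F U\<^esub> s"
    obtain n where n: "n \<in> N U" "t = n \<oplus>\<^bsub>sections F U\<^esub> s" using mem_coset_N[OF t] by blast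
    have "res F U V t = res F U V n \<oplus>\<^bsub>sections F V\<^esub> res F U V s"
      using n res_add[OF o N_carrier[OF o(1) n(1)] s] by simp
    then have "res F U V t \<in> N V +>\<^bsub>sections F V\<^esub> res F U V s"
      using N_res[OF o n(1)] by (auto simp: a_r_coset_def')
    then show "N V +>\<^bsub>sections F V\<^esub> res F U V t = N V +>\<^bsub>sections F V\<^esub> res F U V s"
      using V.a_repr_independence'[OF _ res_closed[OF o s]] by simp
  qed
  then show ?thesis by (simp add: quot_presheaf_def)
qed

lemma module_presheaf_quot: "module_presheaf T \<O> quot_presheaf"
proof
  fix U V assume o: "openin T U" "openin T V" "V \<subseteq> U"
  show "res quot_presheaf U V \<zero>\<^bsub>sections quot_presheaf U\<^esub> = \<zero>\<^bsub>sections quot_presheaf V\<^esub>"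
    using res_quot[OF o zero_closed[OF o(1)]] o by (simp add: quot_zero coset_zero res_zero)
  fix X assume "X \<in> carrier (sections quot_presheaf U)"
  then obtain s where s: "s \<in> carrier (sections F U)" "X = N U +>\<^bsub>sections F U\<^esub> s" by (rule quot_cases)
  show "res quot_presheaf U V X \<in> carrier (sections quot_presheaf V)"
    unfolding s(2) res_quot[OF o s(1)] by (rule coset_in_quot[OF res_closed[OF o s(1)]])
  show "res quot_presheaf V W (res quot_presheaf U V X) = res quot_presheaf U W X"
    if "openin T W" "W \<subseteq> V" for W
  proof -
    have "W \<subseteq> U" using that o by blast
    then show ?thesis
      unfolding s(2) res_quot[OF o s(1)]
      using res_quot[OF o(2) that res_closed[OF o s(1)]] res_quot[OF o(1) that(1) _ s(1)]
        res_res[OF o(1,2) that(1) o(3) that(2) s(1)] by simp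
  qed
  show "res quot_presheaf U V (a \<odot>\<^bsub>sections quot_presheaf U\<^esub> X)
      = res \<O> U V a \<odot>\<^bsub>sections quot_presheaf V\<^esub> res quot_presheaf U V X"
    if a: "a \<in> carrier (sections \<O> U)" for a
    unfolding s(2) res_quot[OF o s(1)] quot_smult[OF o(1) a s(1)]
      quot_smult[OF o(2) scalar_res_closed[OF o a] res_closed[OF o s(1)]]
      res_quot[OF o smult_closed[OF o(1) a s(1)]] res_smult[OF o a s(1)] ..
  fix Y assume "Y \<in> carrier (sections quot_presheaf U)"
  then obtain t where t: "t \<in> carrier (sections F U)" "Y = N U +>\<^bsub>sections F U\<^esub> t" by (rule quot_cases)
  show "res quot_presheaf U V (X \<oplus>\<^bsub>sections quot_presheaf U\<^esub> Y)
      = res quot_presheaf U V X \<oplus>\<^bsub>sections quot_presheaf V\<^esub> res quot_presheaf U V Y"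
    unfolding s(2) t(2) quot_add[OF o(1) s(1) t(1)] res_quot[OF o add_closed[OF o(1) s(1) t(1)]]
      res_quot[OF o s(1)] res_quot[OF o t(1)] res_add[OF o s(1) t(1)]
      quot_add[OF o(2) res_closed[OF o s(1)] res_closed[OF o t(1)]] ..
next
  fix U assume o: "openin T U"
  show "\<zero>\<^bsub>sections quot_presheaf U\<^esub> \<in> carrier (sections quot_presheaf U)"
    using coset_in_quot[OF zero_closed[OF o]] o by (simp add: quot_zero coset_zero)
  fix X assume "X \<in> carrier (sections quot_presheaf U)"
  then obtain s where s: "s \<in> carrier (sections F U)" "X = N U +>\<^bsub>sections F U\<^esub> s" by (rule quot_cases)
  show "a \<odot>\<^bsub>sections quot_presheaf U\<^esub> X \<in> carrier (sections quot_presheaf U)"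
    if "a \<in> carrier (sections \<O> U)" for a
    unfolding s(2) quot_smult[OF o that s(1)] by (rule coset_in_quot[OF smult_closed[OF o that s(1)]])
  fix Y assume "Y \<in> carrier (sections quot_presheaf U)"
  then obtain t where t: "t \<in> carrier (sections F U)" "Y = N U +>\<^bsub>sections F U\<^esub> t" by (rule quot_cases)
  show "X \<oplus>\<^bsub>sections quot_presheaf U\<^esub> Y \<in> carrier (sections quot_presheaf U)"
    unfolding s(2) t(2) quot_add[OF o s(1) t(1)] by (rule coset_in_quot[OF add_closed[OF o s(1) t(1)]])
qed (auto intro: scalar_res_closed scalar_res_res)

text \<open>Such an evaluation is constant on the cosets of \<open>N\<close>.\<close>

lemma presheaf_evaluation_quot:
  assumes E: "presheaf_evaluation T \<O> F p L sev ev"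
    and kill: "\<And>U x. \<lbrakk>openin T U; p \<in> U; x \<in> N U\<rbrakk> \<Longrightarrow> ev U x = \<zero>\<^bsub>L\<^esub>"
    and l_zero: "\<And>l. l \<in> carrier L \<Longrightarrow> \<zero>\<^bsub>L\<^esub> \<oplus>\<^bsub>L\<^esub> l = l"
  shows "presheaf_evaluation T \<O> quot_presheaf p L sev (\<lambda>U X. the_elem (ev U ` X))"
    and "\<lbrakk>openin T U; p \<in> U; s \<in> carrier (sections F U)\<rbrakk> \<Longrightarrow>
      the_elem (ev U ` (N U +>\<^bsub>sections F U\<^esub> s)) = ev U s"
proof -
  interpret E: presheaf_evaluation T \<O> F p L sev ev by (rule E)
  interpret Q: module_presheaf T \<O> quot_presheaf by (rule module_presheaf_quot)
  have coset: "the_elem (ev U ` (N U +>\<^bsub>sections F U\<^esub> s)) = ev U s"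
    if o: "openin T U" "p \<in> U" and s: "s \<in> carrier (sections F U)" for U s
  proof -
    have "ev U t = ev U s" if t: "t \<in> N U +>\<^bsub>sections F U\<^esub> s" for t
    proof -
      obtain n where n: "n \<in> N U" "t = n \<oplus>\<^bsub>sections F U\<^esub> s" using mem_coset_N[OF t] by blast
      then show ?thesis
        using E.ev_add[OF o N_carrier[OF o(1) n(1)] s] kill[OF o n(1)] l_zero[OF E.ev_closed[OF o s]] by simp
    qed
    moreover have "N U +>\<^bsub>sections F U\<^esub> s \<noteq> {}" using coset_nonempty[OF o(1) s] by blast
    ultimately show ?thesis by (intro the_elem_image_const)
  qed
  then show "\<lbrakk>openin T U; p \<in> U; s \<in> carrier (sections F U)\<rbrakk> \<Longrightarrow>
      the_elem (ev U ` (N U +>\<^bsub>sections F U\<^esub> s)) = ev U s" .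
  show "presheaf_evaluation T \<O> quot_presheaf p L sev (\<lambda>U X. the_elem (ev U ` X))"
  proof
    fix U assume o: "openin T U" "p \<in> U"
    show "the_elem (ev U ` \<zero>\<^bsub>sections quot_presheaf U\<^esub>) = \<zero>\<^bsub>L\<^esub>"
      using coset[OF o zero_closed[OF o(1)]] o by (simp add: quot_zero coset_zero E.ev_zero)
    fix X assume "X \<in> carrier (sections quot_presheaf U)"
    then obtain s where s: "s \<in> carrier (sections F U)" "X = N U +>\<^bsub>sections F U\<^esub> s" by (rule quot_cases)
    show "the_elem (ev U ` X) \<in> carrier L"
      unfolding s(2) coset[OF o s(1)] by (rule E.ev_closed[OF o s(1)])
    show "the_elem (ev U ` (a \<odot>\<^bsub>sections quot_presheaf U\<^esub> X)) = sev U a \<odot>\<^bsub>L\<^esub> the_elem (ev U ` X)"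
      if a: "a \<in> carrier (sections \<O> U)" for a
      unfolding s(2) quot_smult[OF o(1) a s(1)] coset[OF o s(1)] coset[OF o smult_closed[OF o(1) a s(1)]]
      by (rule E.ev_smult[OF o a s(1)])
    fix Y assume "Y \<in> carrier (sections quot_presheaf U)"
    then obtain t where t: "t \<in> carrier (sections F U)" "Y = N U +>\<^bsub>sections F U\<^esub> t" by (rule quot_cases)
    show "the_elem (ev U ` (X \<oplus>\<^bsub>sections quot_presheaf U\<^esub> Y)) = the_elem (ev U ` X) \<oplus>\<^bsub>L\<^esub> the_elem (ev U ` Y)"
      unfolding s(2) t(2) quot_add[OF o(1) s(1) t(1)] coset[OF o s(1)] coset[OF o t(1)]
        coset[OF o add_closed[OF o(1) s(1) t(1)]]
      by (rule E.ev_add[OF o s(1) t(1)])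
  next
    fix U V X assume o: "openin T U" "openin T V" "V \<subseteq> U" "p \<in> V" and "X \<in> carrier (sections quot_presheaf U)"
    then obtain s where s: "s \<in> carrier (sections F U)" "X = N U +>\<^bsub>sections F U\<^esub> s" by (metis quot_cases)
    have pU: "p \<in> U" using o by blast
    show "the_elem (ev V ` res quot_presheaf U V X) = the_elem (ev U ` X)"
      unfolding s(2) res_quot[OF o(1-3) s(1)] coset[OF o(1) pU s(1)] coset[OF o(2,4) res_closed[OF o(1-3) s(1)]]
      by (rule E.ev_res[OF o s(1)])
  qed (auto intro: E.scalar_ev_res)
qed

end


section \<open>The sheaf associated to a graded module\<close>

context graded_module
begin

abbreviation T where "T \<equiv> Proj_topology B gr"
abbreviation SS where "SS \<equiv> structure_sheaf B gr"
abbreviation NN where "NN \<equiv> assoc_sheaf B gr N ngr"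

lemma Proj_ideal: "p \<in> Proj B gr \<Longrightarrow> primeideal p B"
  by (simp add: Proj_def)

lemma Proj_avoidable:
  assumes "p \<in> Proj B gr" shows "avoidable p"
proof -
  interpret p: primeideal p B using Proj_ideal[OF assms] .
  have "\<one> \<notin> p" using p.one_imp_carrier p.I_notcarr by blast
  then show ?thesis using p.I_prime by (auto simp: avoidable_def)
qed

lemma Proj_positive:
  assumes "p \<in> Proj B gr" obtains b e where "b \<in> gr e" "e > 0" "b \<notin> p"
  using assms by (auto simp: Proj_def)

lemma openin_basic: "\<lbrakk>h \<in> gr d; d > 0\<rbrakk> \<Longrightarrow> openin T {p \<in> Proj B gr. h \<notin> p}"
  unfolding Proj_topology_def by (rule topology_generated_by_Basis) auto

lemma topspace_T: "topspace T = Proj B gr"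
  unfolding Proj_topology_def topology_generated_by_topspace
proof (intro subset_antisym subsetI)
  fix p assume p: "p \<in> Proj B gr"
  then obtain b e where "b \<in> gr e" "e > 0" "b \<notin> p" by (rule Proj_positive)
  then show "p \<in> \<Union>{{p \<in> Proj B gr. h \<notin> p} |h. h \<in> (\<Union>n\<in>{0<..}. gr n)}"
    using p by (intro UnionI[of "{p \<in> Proj B gr. b \<notin> p}"]) auto
qed auto

lemma open_Proj: "\<lbrakk>openin T U; p \<in> U\<rbrakk> \<Longrightarrow> p \<in> Proj B gr"
  using openin_subset topspace_T by blast

lemmas open_avoidable = Proj_avoidable[OF open_Proj]

text \<open>The sets where a homogeneous element does not vanish are basic open sets for positive degrees. As \<open>h\<close> may
  have degree zero, it is multiplied by an element \<open>b\<close> of positive degree outside \<open>p\<close>.\<close>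

lemma shrink_denominator:
  assumes U: "openin T U" "p \<in> U" and h: "h \<in> gr d" "h \<notin> p"
  obtains W where "openin T W" "p \<in> W" "W \<subseteq> U" "\<And>q. q \<in> W \<Longrightarrow> h \<notin> q"
proof -
  have p: "p \<in> Proj B gr" using open_Proj[OF U] .
  then obtain b e where b: "b \<in> gr e" "e > 0" "b \<notin> p" by (rule Proj_positive)
  let ?W = "U \<inter> {q \<in> Proj B gr. h \<otimes> b \<notin> q}"
  have "openin T {q \<in> Proj B gr. h \<otimes> b \<notin> q}"
    using gr_mult[OF h(1) b(1)] b(2) by (intro openin_basic[of _ "d + e"]) auto
  then have "openin T ?W" using U(1) by blast
  moreover have "p \<in> ?W"
    using U p avoidable_mult[OF Proj_avoidable[OF p] h(2) b(3)] gr_carrier[OF h(1)] gr_carrier[OF b(1)] by blast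
  moreover have "h \<notin> q" if "q \<in> ?W" for q
  proof -
    interpret q: primeideal q B using Proj_ideal that by blast
    show ?thesis using q.I_r_closed[of h b] gr_carrier[OF b(1)] that by blast
  qed
  ultimately show ?thesis using that by blast
qed

lemma structure_sheaf_eq: "SS = assoc_sheaf B gr (reg_module B) gr"
  by (simp add: structure_sheaf_def)

lemma NN_simps [simp]:
  "\<zero>\<^bsub>sections NN U\<^esub> = (\<lambda>p\<in>U. \<zero>\<^bsub>LN p\<^esub>)"
  "\<sigma> \<oplus>\<^bsub>sections NN U\<^esub> \<tau> = (\<lambda>p\<in>U. \<sigma> p \<oplus>\<^bsub>LN p\<^esub> \<tau> p)"
  "a \<odot>\<^bsub>sections NN U\<^esub> \<sigma> = (\<lambda>p\<in>U. a p \<odot>\<^bsub>LN p\<^esub> \<sigma> p)"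
  "res NN U V \<sigma> = restrict \<sigma> V"
  "carrier (sections NN U) = fraction_sections B gr N ngr ngr U"
  by (simp_all add: assoc_sheaf_def pointwise_module_def)

lemma SS_simps [simp]:
  "\<zero>\<^bsub>sections SS U\<^esub> = (\<lambda>p\<in>U. \<zero>\<^bsub>LB p\<^esub>)"
  "\<one>\<^bsub>sections SS U\<^esub> = (\<lambda>p\<in>U. \<one>\<^bsub>LB p\<^esub>)"
  "\<sigma> \<oplus>\<^bsub>sections SS U\<^esub> \<tau> = (\<lambda>p\<in>U. \<sigma> p \<oplus>\<^bsub>LB p\<^esub> \<tau> p)"
  "\<sigma> \<otimes>\<^bsub>sections SS U\<^esub> \<tau> = (\<lambda>p\<in>U. \<sigma> p \<otimes>\<^bsub>LB p\<^esub> \<tau> p)"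
  "a \<odot>\<^bsub>sections SS U\<^esub> \<sigma> = (\<lambda>p\<in>U. a p \<otimes>\<^bsub>LB p\<^esub> \<sigma> p)"
  "res SS U V \<sigma> = restrict \<sigma> V"
  "carrier (sections SS U) = fraction_sections B gr (reg_module B) gr gr U"
  by (simp_all add: structure_sheaf_def assoc_sheaf_def pointwise_module_def LB_mult_eq_smult)

lemma mem_fraction_sections:
  "\<sigma> \<in> fraction_sections B gr N ngr num U \<longleftrightarrow> \<sigma> \<in> extensional U \<and>
     (\<forall>p\<in>U. \<exists>V. openin T V \<and> p \<in> V \<and> V \<subseteq> U \<and>
        (\<exists>x h. ((\<exists>d. x \<in> num d \<and> h \<in> gr d) \<and> (\<forall>q\<in>V. h \<notin> q)) \<and> (\<forall>q\<in>V. \<sigma> q = frac q x h)))"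
proof -
  have ex: "(\<exists>t\<in>{f x h | x h. P x h}. Q t) \<longleftrightarrow> (\<exists>x h. P x h \<and> Q (f x h))"
    for f :: "'n \<Rightarrow> 'b \<Rightarrow> 'b set \<Rightarrow> ('n \<times> 'b) set" and P Q by blast
  show ?thesis unfolding fraction_sections_def locally_in_def mem_Collect_eq ex ..
qed

lemma fraction_sectionsE:
  assumes \<sigma>: "\<sigma> \<in> fraction_sections B gr N ngr num U" and p: "p \<in> U"
  obtains V x h d where "openin T V" "p \<in> V" "V \<subseteq> U" "x \<in> num d" "h \<in> gr d"
    "\<And>q. q \<in> V \<Longrightarrow> h \<notin> q" "\<And>q. q \<in> V \<Longrightarrow> \<sigma> q = frac q x h"
proof -
  obtain V x h d where "openin T V" "p \<in> V" "V \<subseteq> U" "x \<in> num d" "h \<in> gr d"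
    "\<forall>q\<in>V. h \<notin> q" "\<forall>q\<in>V. \<sigma> q = frac q x h"
    using bspec[OF conjunct2[OF \<sigma>[unfolded mem_fraction_sections]] p] by (elim exE conjE) (rule that)
  then show ?thesis by (intro that) auto
qed

lemma fraction_sectionsI:
  assumes "\<sigma> \<in> extensional U"
    and ex: "\<And>p. p \<in> U \<Longrightarrow> \<exists>V x h d. openin T V \<and> p \<in> V \<and> V \<subseteq> U \<and> x \<in> num d \<and> h \<in> gr d \<and>
        (\<forall>q\<in>V. h \<notin> q \<and> \<sigma> q = frac q x h)"
  shows "\<sigma> \<in> fraction_sections B gr N ngr num U"
  unfolding mem_fraction_sections
proof (intro conjI ballI assms(1))
  fix p assume "p \<in> U"
  from ex[OF this] obtain V x h d where "openin T V" "p \<in> V" "V \<subseteq> U" "x \<in> num d" "h \<in> gr d"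
    "\<forall>q\<in>V. h \<notin> q \<and> \<sigma> q = frac q x h"
    by (elim exE conjE) (rule that)
  then show "\<exists>V. openin T V \<and> p \<in> V \<and> V \<subseteq> U \<and>
        (\<exists>x h. ((\<exists>d. x \<in> num d \<and> h \<in> gr d) \<and> (\<forall>q\<in>V. h \<notin> q)) \<and> (\<forall>q\<in>V. \<sigma> q = frac q x h))"
    by (intro exI[of _ V] exI[of _ x] exI[of _ h] exI[of _ d] conjI) auto
qed

lemma frac_section:
  assumes "openin T U" "x \<in> num d" "h \<in> gr d" "\<And>q. q \<in> U \<Longrightarrow> h \<notin> q"
  shows "(\<lambda>q\<in>U. frac q x h) \<in> fraction_sections B gr N ngr num U"
  using assms
  by (intro fraction_sectionsI exI[of _ U] exI[of _ x] exI[of _ h] exI[of _ d]) auto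

lemma fraction_sections_at:
  assumes "\<sigma> \<in> fraction_sections B gr N ngr ngr U" "p \<in> U" shows "\<sigma> p \<in> carrier (LN p)"
  using assms by (elim fraction_sectionsE) (auto intro!: frac_in_LN fracsI)

lemma restrict_fraction_sections:
  assumes o: "openin T U" "openin T V" "V \<subseteq> U" and \<sigma>: "\<sigma> \<in> fraction_sections B gr N ngr num U"
  shows "restrict \<sigma> V \<in> fraction_sections B gr N ngr num V"
proof (rule fraction_sectionsI)
  fix p assume p: "p \<in> V"
  then have "p \<in> U" using o(3) by blast
  then obtain W x h d where "openin T W" "p \<in> W" "W \<subseteq> U" "x \<in> num d" "h \<in> gr d"
    "\<And>q. q \<in> W \<Longrightarrow> h \<notin> q" "\<And>q. q \<in> W \<Longrightarrow> \<sigma> q = frac q x h"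
    by (rule fraction_sectionsE[OF \<sigma>]) (rule that)
  then show "\<exists>W x h d. openin T W \<and> p \<in> W \<and> W \<subseteq> V \<and> x \<in> num d \<and> h \<in> gr d \<and>
        (\<forall>q\<in>W. h \<notin> q \<and> restrict \<sigma> V q = frac q x h)"
    using o(2) p by (intro exI[of _ "W \<inter> V"] exI[of _ x] exI[of _ h] exI[of _ d]) auto
qed simp

definition graded_sub :: "(nat \<Rightarrow> 'n set) \<Rightarrow> bool" where
  "graded_sub num \<longleftrightarrow> (\<forall>d. \<zero>\<^bsub>N\<^esub> \<in> num d \<and> num d \<subseteq> ngr d \<and> (\<forall>x\<in>num d. \<forall>y\<in>num d. x \<oplus>\<^bsub>N\<^esub> y \<in> num d) \<and>
     (\<forall>e. \<forall>a\<in>gr e. \<forall>x\<in>num d. a \<bullet> x \<in> num (e + d)))"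

lemma graded_sub_ngr: "graded_sub ngr"
  using ngr_zero ngr_add ngr_smult by (auto simp: graded_sub_def)

lemma fraction_sections_zero:
  assumes "graded_sub num" "openin T U"
  shows "(\<lambda>p\<in>U. \<zero>\<^bsub>LN p\<^esub>) \<in> fraction_sections B gr N ngr num U"
proof -
  have "(\<lambda>p\<in>U. \<zero>\<^bsub>LN p\<^esub>) = (\<lambda>p\<in>U. frac p \<zero>\<^bsub>N\<^esub> \<one>)" by (simp add: zero_LN)
  moreover have "\<dots> \<in> fraction_sections B gr N ngr num U"
    using assms avoidable_one[OF open_avoidable[OF assms(2)]] gr_one
    by (intro frac_section[of _ _ _ 0]) (auto simp: graded_sub_def)
  ultimately show ?thesis by simp
qed

lemma fraction_sections_add:
  assumes num: "graded_sub num" and o: "openin T U"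
    and \<sigma>: "\<sigma> \<in> fraction_sections B gr N ngr num U" and \<tau>: "\<tau> \<in> fraction_sections B gr N ngr num U"
  shows "(\<lambda>p\<in>U. \<sigma> p \<oplus>\<^bsub>LN p\<^esub> \<tau> p) \<in> fraction_sections B gr N ngr num U"
proof (rule fraction_sectionsI)
  fix p assume p: "p \<in> U"
  obtain V x h d where V: "openin T V" "p \<in> V" "V \<subseteq> U" "x \<in> num d" "h \<in> gr d"
    "\<And>q. q \<in> V \<Longrightarrow> h \<notin> q" "\<And>q. q \<in> V \<Longrightarrow> \<sigma> q = frac q x h"
    by (rule fraction_sectionsE[OF \<sigma> p]) (rule that)
  obtain W y k e where W: "openin T W" "p \<in> W" "W \<subseteq> U" "y \<in> num e" "k \<in> gr e"
    "\<And>q. q \<in> W \<Longrightarrow> k \<notin> q" "\<And>q. q \<in> W \<Longrightarrow> \<tau> q = frac q y k"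
    by (rule fraction_sectionsE[OF \<tau> p]) (rule that)
  have xy: "x \<in> ngr d" "y \<in> ngr e" using num V(4) W(4) by (auto simp: graded_sub_def)
  have "k \<bullet> x \<in> num (e + d)" "h \<bullet> y \<in> num (d + e)"
    using num V W unfolding graded_sub_def by blast+
  then have "k \<bullet> x \<oplus>\<^bsub>N\<^esub> h \<bullet> y \<in> num (d + e)"
    using num by (auto simp: graded_sub_def add.commute)
  moreover have "h \<otimes> k \<notin> q \<and> \<sigma> q \<oplus>\<^bsub>LN q\<^esub> \<tau> q = frac q (k \<bullet> x \<oplus>\<^bsub>N\<^esub> h \<bullet> y) (h \<otimes> k)"
    if q: "q \<in> V \<inter> W" for q
  proof -
    have av: "avoidable q" using q V(1) by (intro open_avoidable[of V]) auto
    have "(x, h) \<in> fracs q" "(y, k) \<in> fracs q" using q V(5,6) W(5,6) xy by (auto intro: fracsI)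
    then show ?thesis
      using q V(7) W(7) V(6) W(6) LN_add[OF av] avoidable_mult[OF av] gr_carrier[OF V(5)] gr_carrier[OF W(5)] by simp
  qed
  ultimately show "\<exists>V x h d. openin T V \<and> p \<in> V \<and> V \<subseteq> U \<and> x \<in> num d \<and> h \<in> gr d \<and>
        (\<forall>q\<in>V. h \<notin> q \<and> (\<lambda>p\<in>U. \<sigma> p \<oplus>\<^bsub>LN p\<^esub> \<tau> p) q = frac q x h)"
    using V(1-3) W(1-3) gr_mult[OF V(5) W(5)]
    by (intro exI[of _ "V \<inter> W"] exI[of _ "k \<bullet> x \<oplus>\<^bsub>N\<^esub> h \<bullet> y"] exI[of _ "h \<otimes> k"] exI[of _ "d + e"]) auto
qed simp

lemma fraction_sections_smult:
  assumes num: "graded_sub num" and o: "openin T U"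
    and a: "a \<in> fraction_sections B gr (reg_module B) gr gr U" and \<sigma>: "\<sigma> \<in> fraction_sections B gr N ngr num U"
  shows "(\<lambda>p\<in>U. a p \<odot>\<^bsub>LN p\<^esub> \<sigma> p) \<in> fraction_sections B gr N ngr num U"
proof (rule fraction_sectionsI)
  interpret reg: graded_module B "reg_module B" gr gr by (rule graded_module_reg_module)
  fix p assume p: "p \<in> U"
  obtain V x h d where V: "openin T V" "p \<in> V" "V \<subseteq> U" "x \<in> num d" "h \<in> gr d"
    "\<And>q. q \<in> V \<Longrightarrow> h \<notin> q" "\<And>q. q \<in> V \<Longrightarrow> \<sigma> q = frac q x h"
    by (rule fraction_sectionsE[OF \<sigma> p]) (rule that)
  obtain W c k e where W: "openin T W" "p \<in> W" "W \<subseteq> U" "c \<in> gr e" "k \<in> gr e"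
    "\<And>q. q \<in> W \<Longrightarrow> k \<notin> q" "\<And>q. q \<in> W \<Longrightarrow> a q = bfrac q c k"
    by (rule reg.fraction_sectionsE[OF a p]) (rule that)
  have x: "x \<in> ngr d" using num V(4) by (auto simp: graded_sub_def)
  have cx: "c \<bullet> x \<in> num (e + d)" using num V(4) W(4) unfolding graded_sub_def by blast
  moreover have "k \<otimes> h \<notin> q \<and> a q \<odot>\<^bsub>LN q\<^esub> \<sigma> q = frac q (c \<bullet> x) (k \<otimes> h)"
    if q: "q \<in> V \<inter> W" for q
  proof -
    have av: "avoidable q" using q V(1) by (intro open_avoidable[of V]) auto
    have "(x, h) \<in> fracs q" "(c, k) \<in> bfracs q" using q V(5,6) W(4-6) x by (auto intro: fracsI reg.fracsI)
    then show ?thesis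
      using q V(7) W(7) V(6) W(6) LN_smult[OF av] avoidable_mult[OF av] gr_carrier[OF V(5)] gr_carrier[OF W(5)] by simp
  qed
  ultimately show "\<exists>V x h d. openin T V \<and> p \<in> V \<and> V \<subseteq> U \<and> x \<in> num d \<and> h \<in> gr d \<and>
        (\<forall>q\<in>V. h \<notin> q \<and> (\<lambda>p\<in>U. a p \<odot>\<^bsub>LN p\<^esub> \<sigma> p) q = frac q x h)"
    using V(1-3) W(1-3) gr_mult[OF W(5) V(5)]
    by (intro exI[of _ "V \<inter> W"] exI[of _ "c \<bullet> x"] exI[of _ "k \<otimes> h"] exI[of _ "e + d"]) auto
qed simp

lemma fraction_sections_mono:
  assumes num: "graded_sub num" and \<sigma>: "\<sigma> \<in> fraction_sections B gr N ngr num U"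
  shows "\<sigma> \<in> fraction_sections B gr N ngr ngr U"
proof (rule fraction_sectionsI)
  show "\<sigma> \<in> extensional U" using \<sigma> by (simp add: mem_fraction_sections)
  fix p assume "p \<in> U"
  with \<sigma> obtain V x h d where V: "openin T V" "p \<in> V" "V \<subseteq> U" "x \<in> num d" "h \<in> gr d"
    "\<And>q. q \<in> V \<Longrightarrow> h \<notin> q" "\<And>q. q \<in> V \<Longrightarrow> \<sigma> q = frac q x h"
    by (rule fraction_sectionsE) (rule that)
  have "x \<in> ngr d" using num V(4) by (auto simp: graded_sub_def)
  then show "\<exists>V x h d. openin T V \<and> p \<in> V \<and> V \<subseteq> U \<and> x \<in> ngr d \<and> h \<in> gr d \<and>
      (\<forall>q\<in>V. h \<notin> q \<and> \<sigma> q = frac q x h)"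
    using V by (intro exI[of _ V] exI[of _ x] exI[of _ h] exI[of _ d]) auto
qed

lemma LB_one_section:
  assumes "openin T U" shows "(\<lambda>p\<in>U. \<one>\<^bsub>LB p\<^esub>) \<in> fraction_sections B gr (reg_module B) gr gr U"
proof -
  interpret reg: graded_module B "reg_module B" gr gr by (rule graded_module_reg_module)
  show ?thesis
    unfolding one_LB using avoidable_one[OF open_avoidable[OF assms]] gr_one
    by (intro reg.frac_section[OF assms, of _ _ 0])
qed

lemma SS_value: "a \<in> fraction_sections B gr (reg_module B) gr gr U \<Longrightarrow> p \<in> U \<Longrightarrow> a p \<in> carrier (LB p)"
  using graded_module.fraction_sections_at[OF graded_module_reg_module] .

lemma restrict_fun_eq: "\<sigma> \<in> extensional U \<Longrightarrow> (\<And>p. p \<in> U \<Longrightarrow> f p = \<sigma> p) \<Longrightarrow> (\<lambda>p\<in>U. f p) = \<sigma>"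
  by (auto simp: fun_eq_iff extensional_def)

lemma fraction_sections_extensional: "\<sigma> \<in> fraction_sections B gr N ngr num U \<Longrightarrow> \<sigma> \<in> extensional U"
  by (simp add: mem_fraction_sections)

lemma abelian_group_NN:
  assumes o: "openin T U" shows "abelian_group (sections NN U)"
proof (rule abelian_groupI)
  note av = open_avoidable[OF o]
  note at = fraction_sections_at[of _ U]
  show "\<zero>\<^bsub>sections NN U\<^esub> \<in> carrier (sections NN U)"
    using fraction_sections_zero[OF graded_sub_ngr o] by simp
  fix \<sigma> assume \<sigma>: "\<sigma> \<in> carrier (sections NN U)"
  show "\<zero>\<^bsub>sections NN U\<^esub> \<oplus>\<^bsub>sections NN U\<^esub> \<sigma> = \<sigma>"
  proof -
    have "\<zero>\<^bsub>LN p\<^esub> \<oplus>\<^bsub>LN p\<^esub> \<sigma> p = \<sigma> p" if "p \<in> U" for p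
      using \<sigma> at[of \<sigma> p] that abelian_monoid.l_zero[OF abelian_group.axioms(1)[OF abelian_group_LN[OF av[OF that]]]]
      by simp
    then show ?thesis using \<sigma> by (auto intro!: restrict_fun_eq dest: fraction_sections_extensional)
  qed
  have "\<exists>\<tau>\<in>carrier (sections NN U). \<tau> \<oplus>\<^bsub>sections NN U\<^esub> \<sigma> = \<zero>\<^bsub>sections NN U\<^esub>"
  proof (rule bexI)
    interpret reg: graded_module B "reg_module B" gr gr by (rule graded_module_reg_module)
    let ?m = "\<lambda>p\<in>U. bfrac p (\<ominus> \<one>) \<one>"
    have m: "?m \<in> fraction_sections B gr (reg_module B) gr gr U"
      using avoidable_one[OF open_avoidable[OF o]] gr_one gr_minus[OF gr_one]
      by (intro reg.frac_section[OF o, of _ _ 0]) auto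
    show "(\<lambda>p\<in>U. ?m p \<odot>\<^bsub>LN p\<^esub> \<sigma> p) \<in> carrier (sections NN U)"
      using fraction_sections_smult[OF graded_sub_ngr o m] \<sigma> by simp
    have "bfrac p (\<ominus> \<one>) \<one> \<odot>\<^bsub>LN p\<^esub> \<sigma> p \<oplus>\<^bsub>LN p\<^esub> \<sigma> p = \<zero>\<^bsub>LN p\<^esub>" if p: "p \<in> U" for p
    proof -
      have "\<sigma> p \<in> carrier (LN p)" using \<sigma> at p by simp
      then obtain x h where x: "(x, h) \<in> fracs p" "\<sigma> p = frac p x h" by (rule LN_cases)
      obtain d where d: "x \<in> ngr d" "h \<in> gr d" "h \<notin> p" using x(1) by (auto simp: hfracs_def)
      have mo: "(\<ominus> \<one>, \<one>) \<in> bfracs p"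
        using avoidable_one[OF av[OF p]] gr_one gr_minus[OF gr_one] by (intro reg.fracsI[of _ 0]) auto
      have "bfrac p (\<ominus> \<one>) \<one> \<odot>\<^bsub>LN p\<^esub> \<sigma> p = frac p (\<ominus>\<^bsub>N\<^esub> x) h"
        using LN_smult[OF av[OF p] mo x(1)] x fracsD[OF x(1)] by (simp add: smult_l_minus)
      then show ?thesis
        using frac_add_same[OF av[OF p] fracsI[OF ngr_minus[OF d(1)] d(2,3)] x(1) ngr_minus[OF d(1)] d(1,2)]
          frac_zero[OF av[OF p] d(2,3)] x fracsD[OF x(1)] by (simp add: M.l_neg)
    qed
    then show "(\<lambda>p\<in>U. ?m p \<odot>\<^bsub>LN p\<^esub> \<sigma> p) \<oplus>\<^bsub>sections NN U\<^esub> \<sigma> = \<zero>\<^bsub>sections NN U\<^esub>"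
      by (auto intro!: restrict_ext)
  qed
  then show "\<exists>\<tau>\<in>carrier (sections NN U). \<tau> \<oplus>\<^bsub>sections NN U\<^esub> \<sigma> = \<zero>\<^bsub>sections NN U\<^esub>" .
  fix \<tau> assume \<tau>: "\<tau> \<in> carrier (sections NN U)"
  show "\<sigma> \<oplus>\<^bsub>sections NN U\<^esub> \<tau> \<in> carrier (sections NN U)"
    using fraction_sections_add[OF graded_sub_ngr o] \<sigma> \<tau> by simp
  show "\<sigma> \<oplus>\<^bsub>sections NN U\<^esub> \<tau> = \<tau> \<oplus>\<^bsub>sections NN U\<^esub> \<sigma>"
    using \<sigma> \<tau> at abelian_monoid.a_comm[OF abelian_group.axioms(1)[OF abelian_group_LN[OF av]]]
    by (auto intro!: restrict_ext)
  fix \<upsilon> assume \<upsilon>: "\<upsilon> \<in> carrier (sections NN U)"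
  show "\<sigma> \<oplus>\<^bsub>sections NN U\<^esub> \<tau> \<oplus>\<^bsub>sections NN U\<^esub> \<upsilon> = \<sigma> \<oplus>\<^bsub>sections NN U\<^esub> (\<tau> \<oplus>\<^bsub>sections NN U\<^esub> \<upsilon>)"
    using \<sigma> \<tau> \<upsilon> at abelian_monoid.a_assoc[OF abelian_group.axioms(1)[OF abelian_group_LN[OF av]]]
    by (auto intro!: restrict_ext)
qed

lemma cring_SS:
  assumes o: "openin T U" shows "cring (sections SS U)"
proof (rule cringI)
  interpret reg: graded_module B "reg_module B" gr gr by (rule graded_module_reg_module)
  note av = open_avoidable[OF o]
  note C = cring_LB[OF av]
  note at = SS_value[of _ U]
  show "abelian_group (sections SS U)" using reg.abelian_group_NN[OF o] by (simp add: structure_sheaf_eq)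
  have mult: "a \<otimes>\<^bsub>sections SS U\<^esub> b \<in> carrier (sections SS U)"
    if "a \<in> carrier (sections SS U)" "b \<in> carrier (sections SS U)" for a b
    using reg.fraction_sections_smult[OF reg.graded_sub_ngr o, of a b] that
    by (simp add: LB_mult_eq_smult)
  show "comm_monoid (sections SS U)"
  proof (rule comm_monoidI)
    show "\<one>\<^bsub>sections SS U\<^esub> \<in> carrier (sections SS U)" using LB_one_section[OF o] by simp
    fix a assume a: "a \<in> carrier (sections SS U)"
    have "\<one>\<^bsub>LB p\<^esub> \<otimes>\<^bsub>LB p\<^esub> a p = a p" if "p \<in> U" for p
      using a at[of a p] that monoid.l_one[OF ring.is_monoid[OF cring.axioms(1)[OF C[OF that]]]] by simp
    then show "\<one>\<^bsub>sections SS U\<^esub> \<otimes>\<^bsub>sections SS U\<^esub> a = a"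
      using a by (auto intro!: restrict_fun_eq dest: reg.fraction_sections_extensional)
    fix b assume b: "b \<in> carrier (sections SS U)"
    show "a \<otimes>\<^bsub>sections SS U\<^esub> b \<in> carrier (sections SS U)" by (rule mult[OF a b])
    show "a \<otimes>\<^bsub>sections SS U\<^esub> b = b \<otimes>\<^bsub>sections SS U\<^esub> a"
      using a b at cring.cring_simprules(14)[OF C] by (auto intro!: restrict_ext)
    fix c assume c: "c \<in> carrier (sections SS U)"
    show "a \<otimes>\<^bsub>sections SS U\<^esub> b \<otimes>\<^bsub>sections SS U\<^esub> c = a \<otimes>\<^bsub>sections SS U\<^esub> (b \<otimes>\<^bsub>sections SS U\<^esub> c)"
      using a b c at cring.cring_simprules(11)[OF C] by (auto intro!: restrict_ext)
  qed
  fix a b c assume "a \<in> carrier (sections SS U)" "b \<in> carrier (sections SS U)" "c \<in> carrier (sections SS U)"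
  then show "(a \<oplus>\<^bsub>sections SS U\<^esub> b) \<otimes>\<^bsub>sections SS U\<^esub> c
      = a \<otimes>\<^bsub>sections SS U\<^esub> c \<oplus>\<^bsub>sections SS U\<^esub> b \<otimes>\<^bsub>sections SS U\<^esub> c"
    using at ring.ring_simprules(13)[OF cring.axioms(1)[OF C]] by (auto intro!: restrict_ext)
qed

lemma module_NN:
  assumes o: "openin T U" shows "module (sections SS U) (sections NN U)"
proof (rule moduleI[OF cring_SS[OF o] abelian_group_NN[OF o]])
  note av = open_avoidable[OF o]
  note L = module_LN[OF av]
  note at = SS_value[of _ U] fraction_sections_at[of _ U]
  fix a \<sigma> assume a: "a \<in> carrier (sections SS U)" and \<sigma>: "\<sigma> \<in> carrier (sections NN U)"
  show "a \<odot>\<^bsub>sections NN U\<^esub> \<sigma> \<in> carrier (sections NN U)"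
    using fraction_sections_smult[OF graded_sub_ngr o] a \<sigma> by simp
  show "a \<odot>\<^bsub>sections NN U\<^esub> (\<sigma> \<oplus>\<^bsub>sections NN U\<^esub> \<tau>) = a \<odot>\<^bsub>sections NN U\<^esub> \<sigma> \<oplus>\<^bsub>sections NN U\<^esub> a \<odot>\<^bsub>sections NN U\<^esub> \<tau>"
    if "\<tau> \<in> carrier (sections NN U)" for \<tau>
    using that a \<sigma> at module.smult_r_distr[OF L] by (auto intro!: restrict_ext)
  fix b assume b: "b \<in> carrier (sections SS U)"
  show "(a \<oplus>\<^bsub>sections SS U\<^esub> b) \<odot>\<^bsub>sections NN U\<^esub> \<sigma> = a \<odot>\<^bsub>sections NN U\<^esub> \<sigma> \<oplus>\<^bsub>sections NN U\<^esub> b \<odot>\<^bsub>sections NN U\<^esub> \<sigma>"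
    using a b \<sigma> at module.smult_l_distr[OF L] by (auto intro!: restrict_ext)
  show "a \<otimes>\<^bsub>sections SS U\<^esub> b \<odot>\<^bsub>sections NN U\<^esub> \<sigma> = a \<odot>\<^bsub>sections NN U\<^esub> (b \<odot>\<^bsub>sections NN U\<^esub> \<sigma>)"
    using a b \<sigma> at module.smult_assoc1[OF L] by (auto intro!: restrict_ext)
next
  fix \<sigma> assume \<sigma>: "\<sigma> \<in> carrier (sections NN U)"
  have "\<one>\<^bsub>LB p\<^esub> \<odot>\<^bsub>LN p\<^esub> \<sigma> p = \<sigma> p" if "p \<in> U" for p
    using \<sigma> fraction_sections_at[of \<sigma> U p] that module.smult_one[OF module_LN[OF open_avoidable[OF o that]]] by simp
  then show "\<one>\<^bsub>sections SS U\<^esub> \<odot>\<^bsub>sections NN U\<^esub> \<sigma> = \<sigma>"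
    using \<sigma> by (auto intro!: restrict_fun_eq dest: fraction_sections_extensional)
qed

lemma module_presheaf_NN: "module_presheaf T SS NN"
proof
  interpret reg: graded_module B "reg_module B" gr gr by (rule graded_module_reg_module)
  fix U V assume o: "openin T U" "openin T V" "V \<subseteq> U"
  show "res SS U V a \<in> carrier (sections SS V)" if "a \<in> carrier (sections SS U)" for a
    using reg.restrict_fraction_sections[OF o] that by simp
  show "res NN U V a \<in> carrier (sections NN V)" if "a \<in> carrier (sections NN U)" for a
    using restrict_fraction_sections[OF o] that by simp
  show "res SS V W (res SS U V a) = res SS U W a" if "W \<subseteq> V" for W a
    using that by (auto simp: fun_eq_iff restrict_def)
  show "res NN V W (res NN U V a) = res NN U W a" if "W \<subseteq> V" for W a
    using that by (auto simp: fun_eq_iff restrict_def)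
next
  fix U assume o: "openin T U"
  show "\<zero>\<^bsub>sections NN U\<^esub> \<in> carrier (sections NN U)"
    using fraction_sections_zero[OF graded_sub_ngr o] by simp
  fix \<sigma> assume \<sigma>: "\<sigma> \<in> carrier (sections NN U)"
  show "\<sigma> \<oplus>\<^bsub>sections NN U\<^esub> \<tau> \<in> carrier (sections NN U)" if "\<tau> \<in> carrier (sections NN U)" for \<tau>
    using fraction_sections_add[OF graded_sub_ngr o] \<sigma> that by simp
  show "a \<odot>\<^bsub>sections NN U\<^esub> \<sigma> \<in> carrier (sections NN U)" if "a \<in> carrier (sections SS U)" for a
    using fraction_sections_smult[OF graded_sub_ngr o] \<sigma> that by simp
qed (auto simp: fun_eq_iff restrict_def subset_iff)

text \<open>Two fractions that are equal at \<open>p\<close> are equal near \<open>p\<close>: the witness \<open>u\<close> of their equality is outside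
  all points of a neighbourhood.\<close>

lemma sections_agree_near:
  assumes o: "openin T U" "p \<in> U" and \<sigma>: "\<sigma> \<in> fraction_sections B gr N ngr ngr U"
    and \<tau>: "\<tau> \<in> fraction_sections B gr N ngr ngr U" and eq: "\<sigma> p = \<tau> p"
  obtains W where "openin T W" "p \<in> W" "W \<subseteq> U" "restrict \<sigma> W = restrict \<tau> W"
proof -
  note av = open_avoidable[OF o]
  obtain V x h d where V: "openin T V" "p \<in> V" "V \<subseteq> U" "x \<in> ngr d" "h \<in> gr d"
    "\<And>q. q \<in> V \<Longrightarrow> h \<notin> q" "\<And>q. q \<in> V \<Longrightarrow> \<sigma> q = frac q x h"
    by (rule fraction_sectionsE[OF \<sigma> o(2)]) (rule that)
  obtain V' y k e where V': "openin T V'" "p \<in> V'" "V' \<subseteq> U" "y \<in> ngr e" "k \<in> gr e"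
    "\<And>q. q \<in> V' \<Longrightarrow> k \<notin> q" "\<And>q. q \<in> V' \<Longrightarrow> \<tau> q = frac q y k"
    by (rule fraction_sectionsE[OF \<tau> o(2)]) (rule that)
  have "frac p x h = frac p y k" using eq V(2,7) V'(2,7) by simp
  then obtain u i where u: "u \<in> gr i" "u \<notin> p" "u \<bullet> (k \<bullet> x) = u \<bullet> (h \<bullet> y)"
    using frac_eqD[OF av fracsI[OF V(4,5) V(6)[OF V(2)]] fracsI[OF V'(4,5) V'(6)[OF V'(2)]]] by blast
  have "openin T (V \<inter> V')" "p \<in> V \<inter> V'" using V(1,2) V'(1,2) by auto
  then obtain W where W: "openin T W" "p \<in> W" "W \<subseteq> V \<inter> V'" "\<And>q. q \<in> W \<Longrightarrow> u \<notin> q"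
    using shrink_denominator[OF _ _ u(1,2)] by metis
  have "\<sigma> q = \<tau> q" if q: "q \<in> W" for q
  proof -
    have qV: "q \<in> V" "q \<in> V'" using q W(3) by auto
    show ?thesis
      unfolding V(7)[OF qV(1)] V'(7)[OF qV(2)]
      using fracsI[OF V(4,5) V(6)[OF qV(1)]] fracsI[OF V'(4,5) V'(6)[OF qV(2)]] u W(4)[OF q]
      by (intro frac_eqI[OF open_avoidable[OF V(1) qV(1)]])
  qed
  then show ?thesis using W V(3) by (intro that[of W]) (auto intro: restrict_ext)
qed

end


section \<open>Associated points of the restriction to a hypersurface\<close>

text \<open>The Rees ring, the Rees module and \<open>F = f t\<^sup>s\<close> are the intended instance. Elements of degree one
  outside \<open>p\<close> provide denominators of every degree. The last assumption says that a homogeneous element of \<open>F N\<close> is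
  \<open>F\<close> times a homogeneous element.\<close>

locale graded_hypersurface = graded_module B N gr ngr
  for B (structure) and N :: "('b, 'n, 'm) module_scheme" (structure) and gr ngr +
  fixes F :: 'b and s :: nat
  assumes F: "F \<in> gr s"
    and generated: "p \<in> Proj B gr \<Longrightarrow> \<exists>b\<in>gr 1. b \<notin> p"
    and F_component: "\<lbrakk>y \<in> carrier N; F \<bullet> y \<in> ngr (s + d)\<rbrakk> \<Longrightarrow> \<exists>y'\<in>ngr d. F \<bullet> y' = F \<bullet> y"
begin

abbreviation Z where "Z \<equiv> multiples N F"
abbreviation J where "J \<equiv> genideal B {F}"

lemma F_carrier: "F \<in> carrier B" using gr_carrier[OF F] .

lemma submodule_Z: "submodule Z B N"
proof (rule submodule_intro)
  show "\<zero>\<^bsub>N\<^esub> \<in> Z" using F_carrier unfolding multiples_def by (intro image_eqI[of _ _ "\<zero>\<^bsub>N\<^esub>"]) simp_all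
  show "Z \<subseteq> carrier N" using F_carrier by (auto simp: multiples_def)
  show "a \<oplus>\<^bsub>N\<^esub> b \<in> Z" if "a \<in> Z" "b \<in> Z" for a b
    using that F_carrier by (auto simp: multiples_def smult_r_distr[symmetric])
  show "a \<bullet> x \<in> Z" if a: "a \<in> carrier B" and "x \<in> Z" for a x
  proof -
    obtain y where y: "y \<in> carrier N" "x = F \<bullet> y" using \<open>x \<in> Z\<close> by (auto simp: multiples_def)
    then have "a \<bullet> x = F \<bullet> (a \<bullet> y)"
      using a F_carrier by (simp add: smult_assoc1[symmetric] R.m_comm)
    then show ?thesis using a y by (auto simp: multiples_def)
  qed
qed

abbreviation QN where "QN \<equiv> quot_module N Z"
abbreviation qgr where "qgr d \<equiv> (\<lambda>x. Z +>\<^bsub>N\<^esub> x) ` ngr d"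

sublocale Z: subgroup_of_module Z N by (rule subgroup_of_module_submodule[OF submodule_Z])
sublocale Q: graded_module B QN gr qgr by (rule graded_module_quot_module[OF submodule_Z])
sublocale reg: graded_module B "reg_module B" gr gr by (rule graded_module_reg_module)

lemma J_Z: "\<lbrakk>j \<in> J; x \<in> carrier N\<rbrakk> \<Longrightarrow> j \<bullet> x \<in> Z"
proof -
  assume j: "j \<in> J" and x: "x \<in> carrier N"
  have "J \<subseteq> {a \<in> carrier B. \<forall>x\<in>carrier N. a \<bullet> x \<in> Z}"
    using F_carrier by (intro R.genideal_minimal ideal_into_submodule submodule_Z) (auto simp: multiples_def)
  then show ?thesis using j x by blast
qed

lemma ideal_J: "ideal J B" using F_carrier by (intro R.genideal_ideal) auto

lemma F_J: "F \<in> J" using R.genideal_self[of "{F}"] F_carrier by auto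

lemma graded_sub_J: "reg.graded_sub (\<lambda>d. J \<inter> gr d)"
proof -
  interpret J: ideal J B by (rule ideal_J)
  show ?thesis
    unfolding reg.graded_sub_def
    using J.zero_closed J.a_closed J.I_l_closed gr_zero gr_add gr_mult gr_carrier
    by (auto simp: reg_module_def)
qed

abbreviation JJ where "JJ \<equiv> ideal_sheaf B gr J"

lemma module_SS: "openin T U \<Longrightarrow> module (sections SS U) (sections SS U)"
  using reg.module_NN by (simp add: structure_sheaf_eq)

lemma module_presheaf_SS: "module_presheaf T SS SS"
  using reg.module_presheaf_NN by (simp add: structure_sheaf_eq)

lemma submodule_JJ:
  assumes o: "openin T U" shows "submodule (JJ U) (sections SS U) (sections SS U)"
proof -
  interpret O: module "sections SS U" "sections SS U" by (rule module_SS[OF o])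
  show ?thesis
    unfolding ideal_sheaf_def
    using reg.fraction_sections_mono[OF graded_sub_J] reg.fraction_sections_zero[OF graded_sub_J o]
      reg.fraction_sections_add[OF graded_sub_J o] reg.fraction_sections_smult[OF graded_sub_J o]
    by (intro O.submodule_intro) (auto simp: LB_mult_eq_smult)
qed

sublocale PQ: submodule_presheaf T SS SS JJ
proof (intro submodule_presheaf.intro submodule_presheaf_axioms.intro module_presheaf_SS module_SS submodule_JJ)
  fix U V x assume "openin T U" "openin T V" "V \<subseteq> U" "x \<in> JJ U"
  then show "res SS U V x \<in> JJ V"
    using reg.restrict_fraction_sections by (simp add: ideal_sheaf_def)
qed

abbreviation PQ where "PQ \<equiv> PQ.quot_presheaf"
sublocale PQP: module_presheaf T SS PQ by (rule PQ.module_presheaf_quot)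

abbreviation QQ where "QQ \<equiv> sheafify T SS PQ"
sublocale QQ: module_presheaf T SS QQ by (rule PQP.module_presheaf_sheafify)

lemma subscheme_sheaf_eq: "subscheme_sheaf B gr J = QQ"
  by (simp add: subscheme_sheaf_def PQ.quot_sheaf_eq)

sublocale TP: presheaf_pair T SS NN QQ
proof (intro presheaf_pair.intro module_presheaf_NN QQ.module_presheaf_axioms presheaf_pair_axioms.intro)
  fix U r x y assume "openin T U" "r \<in> carrier (sections SS U)" "x \<in> carrier (sections NN U)"
  then show "y \<in> carrier (sections NN U) \<Longrightarrow> r \<odot>\<^bsub>sections NN U\<^esub> (x \<oplus>\<^bsub>sections NN U\<^esub> y)
      = r \<odot>\<^bsub>sections NN U\<^esub> x \<oplus>\<^bsub>sections NN U\<^esub> r \<odot>\<^bsub>sections NN U\<^esub> y"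
    using module.smult_r_distr[OF module_NN] by blast
  fix t assume t: "t \<in> carrier (sections SS U)"
  interpret O: module "sections SS U" "sections NN U" by (rule module_NN) fact
  show "r \<odot>\<^bsub>sections NN U\<^esub> (t \<odot>\<^bsub>sections NN U\<^esub> x) = t \<odot>\<^bsub>sections NN U\<^esub> (r \<odot>\<^bsub>sections NN U\<^esub> x)"
    using O.smult_assoc1[OF \<open>r \<in> _\<close> t \<open>x \<in> _\<close>] O.smult_assoc1[OF t \<open>r \<in> _\<close> \<open>x \<in> _\<close>] O.R.m_comm[OF \<open>r \<in> _\<close> t]
    by metis
qed

abbreviation TP where "TP \<equiv> TP.tensor_presheaf"
sublocale TPP: module_presheaf T SS TP by (rule TP.module_presheaf_tensor)

lemma restrict_to_subscheme_eq: "restrict_to_subscheme B gr NN J = sheafify T SS TP"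
  by (simp add: restrict_to_subscheme_def subscheme_sheaf_eq TP.tensor_sheaf_eq)

subsection \<open>Evaluation at a point\<close>

abbreviation qfrac where "qfrac p x h \<equiv> hfrac gr QN qgr p (Z +>\<^bsub>N\<^esub> x) h"
abbreviation LQ where "LQ p \<equiv> hlocalization B gr QN qgr p"

lemma qfracs: "(x, h) \<in> fracs p \<Longrightarrow> (Z +>\<^bsub>N\<^esub> x, h) \<in> hfracs gr qgr p"
  by (auto simp: hfracs_def)

lemma LQ_cases:
  assumes "y \<in> carrier (LQ p)"
  obtains x h d where "x \<in> ngr d" "h \<in> gr d" "h \<notin> p" "y = qfrac p x h"
  using assms by (elim Q.LN_cases) (auto simp: hfracs_def)

lemma qfrac_zero_iff:
  assumes p: "avoidable p" and f: "(x, h) \<in> fracs p"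
  shows "qfrac p x h = \<zero>\<^bsub>LQ p\<^esub> \<longleftrightarrow> (\<exists>i. \<exists>u\<in>gr i - p. u \<bullet> x \<in> Z)"
proof -
  have "u \<odot>\<^bsub>QN\<^esub> (Z +>\<^bsub>N\<^esub> x) = \<zero>\<^bsub>QN\<^esub> \<longleftrightarrow> u \<bullet> x \<in> Z" if "u \<in> gr i" for u i
    using that gr_carrier[OF that] fracsD[OF f] Z.coset_eq_self_iff[of "u \<bullet> x"]
    by (simp add: quot_module_smult_submodule[OF submodule_Z])
  then show ?thesis unfolding Q.frac_eq_zero_iff[OF p qfracs[OF f]] by blast
qed

lemma LQ_smult:
  assumes p: "avoidable p" and a: "(a, g) \<in> bfracs p" and f: "(x, h) \<in> fracs p"
  shows "bfrac p a g \<odot>\<^bsub>LQ p\<^esub> qfrac p x h = qfrac p (a \<bullet> x) (g \<otimes> h)"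
  using Q.LN_smult[OF p a qfracs[OF f]] fracsD[OF f] bfracsD[OF a]
  by (simp add: quot_module_smult_submodule[OF submodule_Z])

text \<open>The localization at \<open>p\<close> of the projection from \<open>N\<close> to \<open>N / F N\<close>.\<close>

definition \<nu> :: "'b set \<Rightarrow> ('n \<times> 'b) set \<Rightarrow> ('n set \<times> 'b) set" where
  "\<nu> p X = (\<Union>(x, h)\<in>X. qfrac p x h)"

lemma \<nu>_frac:
  assumes p: "avoidable p" and f: "(x, h) \<in> fracs p"
  shows "\<nu> p (frac p x h) = qfrac p x h"
  unfolding \<nu>_def
proof (rule UN_frac[OF p f])
  fix y k assume g: "(y, k) \<in> fracs p" "frac p y k = frac p x h"
  obtain u i where u: "u \<in> gr i" "u \<notin> p" "u \<bullet> (h \<bullet> y) = u \<bullet> (k \<bullet> x)"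
    using frac_eqD[OF p g(1) f g(2)] by blast
  show "qfrac p y k = qfrac p x h"
    using u fracsD[OF f] fracsD[OF g(1)] gr_carrier[OF u(1)]
    by (intro Q.frac_eqI[OF p qfracs[OF g(1)] qfracs[OF f] u(1,2)])
      (simp add: quot_module_smult_submodule[OF submodule_Z])
qed

lemma \<nu>_closed: "\<lbrakk>avoidable p; X \<in> carrier (LN p)\<rbrakk> \<Longrightarrow> \<nu> p X \<in> carrier (LQ p)"
  by (elim LN_cases) (auto simp: \<nu>_frac intro!: Q.frac_in_LN qfracs)

lemma \<nu>_add:
  assumes p: "avoidable p" and X: "X \<in> carrier (LN p)" "Y \<in> carrier (LN p)"
  shows "\<nu> p (X \<oplus>\<^bsub>LN p\<^esub> Y) = \<nu> p X \<oplus>\<^bsub>LQ p\<^esub> \<nu> p Y"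
proof -
  obtain x h y k where f: "(x, h) \<in> fracs p" "X = frac p x h" "(y, k) \<in> fracs p" "Y = frac p y k"
    using X by (metis LN_cases)
  show ?thesis
    unfolding f(2,4) LN_add[OF p f(1,3)] \<nu>_frac[OF p f(1)] \<nu>_frac[OF p f(3)] \<nu>_frac[OF p fracs_cross[OF p f(1,3)]]
      Q.LN_add[OF p qfracs[OF f(1)] qfracs[OF f(3)]]
    using fracsD[OF f(1)] fracsD[OF f(3)]
    by (simp add: quot_module_smult_submodule[OF submodule_Z] Z.quot_module_add)
qed

lemma \<nu>_smult:
  assumes p: "avoidable p" and A: "A \<in> carrier (LB p)" and X: "X \<in> carrier (LN p)"
  shows "\<nu> p (A \<odot>\<^bsub>LN p\<^esub> X) = A \<odot>\<^bsub>LQ p\<^esub> \<nu> p X"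
proof -
  obtain a g where a: "(a, g) \<in> bfracs p" "A = bfrac p a g" using A by (rule LB_cases)
  obtain x h where f: "(x, h) \<in> fracs p" "X = frac p x h" using X by (rule LN_cases)
  show ?thesis
    unfolding a(2) f(2) LN_smult[OF p a(1) f(1)] \<nu>_frac[OF p f(1)] \<nu>_frac[OF p smult_fracs[OF p a(1) f(1)]]
    by (simp add: LQ_smult[OF p a(1) f(1)])
qed

text \<open>Sections of the structure sheaf of the hypersurface are evaluated at \<open>p\<close> as endomorphisms of the localization
  of \<open>N / F N\<close>; only their action matters for the tensor product with the sheaf of \<open>N\<close>.\<close>

definition End :: "'b set \<Rightarrow> (('b \<times> 'b) set, ('n set \<times> 'b) set \<Rightarrow> ('n set \<times> 'b) set) module" where
  "End p = pointwise_module (carrier (LQ p)) (\<lambda>_. LQ p) (\<lambda>A _. A)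
     {\<lambda>y\<in>carrier (LQ p). A \<odot>\<^bsub>LQ p\<^esub> y | A. A \<in> carrier (LB p)}"

lemma End_simps [simp]:
  "\<zero>\<^bsub>End p\<^esub> = (\<lambda>y\<in>carrier (LQ p). \<zero>\<^bsub>LQ p\<^esub>)"
  "\<phi> \<oplus>\<^bsub>End p\<^esub> \<psi> = (\<lambda>y\<in>carrier (LQ p). \<phi> y \<oplus>\<^bsub>LQ p\<^esub> \<psi> y)"
  "A \<odot>\<^bsub>End p\<^esub> \<phi> = (\<lambda>y\<in>carrier (LQ p). A \<odot>\<^bsub>LQ p\<^esub> \<phi> y)"
  "carrier (End p) = {\<lambda>y\<in>carrier (LQ p). A \<odot>\<^bsub>LQ p\<^esub> y | A. A \<in> carrier (LB p)}"
  by (simp_all add: End_def pointwise_module_def)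

definition act :: "'b set \<Rightarrow> ('b \<times> 'b) set \<Rightarrow> ('n set \<times> 'b) set \<Rightarrow> ('n set \<times> 'b) set" where
  "act p A = (\<lambda>y\<in>carrier (LQ p). A \<odot>\<^bsub>LQ p\<^esub> y)"

lemma SS_at: "\<sigma> \<in> carrier (sections SS U) \<Longrightarrow> p \<in> U \<Longrightarrow> \<sigma> p \<in> carrier (LB p)"
  by (simp add: SS_value)

lemma JJ_act:
  assumes o: "openin T U" "p \<in> U" and x: "x \<in> JJ U" and y: "y \<in> carrier (LQ p)"
  shows "x p \<odot>\<^bsub>LQ p\<^esub> y = \<zero>\<^bsub>LQ p\<^esub>"
proof -
  note p = open_avoidable[OF o]
  obtain V j g d where V: "p \<in> V" "j \<in> J \<inter> gr d" "g \<in> gr d" "\<And>q. q \<in> V \<Longrightarrow> g \<notin> q" "\<And>q. q \<in> V \<Longrightarrow> x q = bfrac q j g"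
    using x o(2) unfolding ideal_sheaf_def by (rule reg.fraction_sectionsE) (rule that)
  obtain z h e where z: "z \<in> ngr e" "h \<in> gr e" "h \<notin> p" "y = qfrac p z h" using y by (rule LQ_cases)
  have j: "(j, g) \<in> bfracs p" using V(2,3) V(4)[OF V(1)] by (auto simp: hfracs_def)
  have zf: "(z, h) \<in> fracs p" using z by (intro fracsI)
  have "j \<bullet> z \<in> Z" using V(2) z(1) by (intro J_Z) (auto simp: ngr_carrier)
  then have "\<one> \<bullet> (j \<bullet> z) \<in> Z" using submoduleE(1)[OF submodule_Z] by auto
  then have "qfrac p (j \<bullet> z) (g \<otimes> h) = \<zero>\<^bsub>LQ p\<^esub>"
    unfolding qfrac_zero_iff[OF p smult_fracs[OF p j zf]] using gr_one avoidable_one[OF p] by blast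
  then show ?thesis unfolding V(5)[OF V(1)] z(4) LQ_smult[OF p j zf] .
qed

lemma presheaf_evaluation_act:
  assumes p: "p \<in> Proj B gr"
  shows "presheaf_evaluation T SS SS p (End p) (\<lambda>U a. a p) (\<lambda>U \<sigma>. act p (\<sigma> p))"
proof (intro presheaf_evaluation.intro module_presheaf_SS presheaf_evaluation_axioms.intro)
  interpret L: module "LB p" "LQ p" using p by (intro Q.module_LN Proj_avoidable)
  fix U assume o: "openin T U" "p \<in> U"
  show "act p (\<zero>\<^bsub>sections SS U\<^esub> p) = \<zero>\<^bsub>End p\<^esub>"
    using o by (auto simp: act_def intro!: restrict_ext)
  fix \<sigma> assume \<sigma>: "\<sigma> \<in> carrier (sections SS U)"
  show "act p (\<sigma> p) \<in> carrier (End p)" using SS_at[OF \<sigma> o(2)] by (auto simp: act_def)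
  fix \<tau> assume \<tau>: "\<tau> \<in> carrier (sections SS U)"
  show "act p ((\<sigma> \<oplus>\<^bsub>sections SS U\<^esub> \<tau>) p) = act p (\<sigma> p) \<oplus>\<^bsub>End p\<^esub> act p (\<tau> p)"
    using o SS_at[OF \<sigma> o(2)] SS_at[OF \<tau> o(2)] by (auto simp: act_def L.smult_l_distr intro!: restrict_ext)
  show "act p ((\<sigma> \<odot>\<^bsub>sections SS U\<^esub> \<tau>) p) = \<sigma> p \<odot>\<^bsub>End p\<^esub> act p (\<tau> p)"
    using o SS_at[OF \<sigma> o(2)] SS_at[OF \<tau> o(2)] by (auto simp: act_def L.smult_assoc1 intro!: restrict_ext)
qed auto

definition qev :: "'b set \<Rightarrow> 'b set set \<Rightarrow> ('b set \<Rightarrow> ('b \<times> 'b) set) set \<Rightarrow> ('n set \<times> 'b) set \<Rightarrow> ('n set \<times> 'b) set" where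
  "qev p U X = the_elem ((\<lambda>\<sigma>. act p (\<sigma> p)) ` X)"

lemma presheaf_evaluation_qev:
  assumes p: "p \<in> Proj B gr"
  shows "presheaf_evaluation T SS PQ p (End p) (\<lambda>U a. a p) (qev p)"
    and "\<lbrakk>openin T U; p \<in> U; \<sigma> \<in> carrier (sections SS U)\<rbrakk> \<Longrightarrow>
      qev p U (JJ U +>\<^bsub>sections SS U\<^esub> \<sigma>) = act p (\<sigma> p)"
proof -
  interpret L: module "LB p" "LQ p" using p by (intro Q.module_LN Proj_avoidable)
  have kill: "act p (x p) = \<zero>\<^bsub>End p\<^esub>" if "openin T U" "p \<in> U" "x \<in> JJ U" for U x
    using JJ_act[OF that] by (auto simp: act_def intro!: restrict_ext)
  have lz: "\<zero>\<^bsub>End p\<^esub> \<oplus>\<^bsub>End p\<^esub> \<phi> = \<phi>" if "\<phi> \<in> carrier (End p)" for \<phi>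
    using that by (auto intro!: restrict_ext)
  have *: "presheaf_evaluation T SS PQ p (End p) (\<lambda>U a. a p) (\<lambda>U X. the_elem ((\<lambda>\<sigma>. act p (\<sigma> p)) ` X))"
    by (rule PQ.presheaf_evaluation_quot(1)[OF presheaf_evaluation_act[OF p]];
        ((rule kill; assumption) | (rule lz; assumption)))
  have "qev p = (\<lambda>U X. the_elem ((\<lambda>\<sigma>. act p (\<sigma> p)) ` X))" by (intro ext) (simp add: qev_def)
  then show "presheaf_evaluation T SS PQ p (End p) (\<lambda>U a. a p) (qev p)" using * by simp
  show "qev p U (JJ U +>\<^bsub>sections SS U\<^esub> \<sigma>) = act p (\<sigma> p)"
    if o: "openin T U" "p \<in> U" and \<sigma>: "\<sigma> \<in> carrier (sections SS U)"
    unfolding qev_def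
    by (rule PQ.presheaf_evaluation_quot(2)[OF presheaf_evaluation_act[OF p]];
        (rule o \<sigma> | (rule kill; assumption) | (rule lz; assumption)))
qed

definition sev :: "'b set \<Rightarrow> ('b set set \<times> ('b set \<Rightarrow> ('b \<times> 'b) set) set) set \<Rightarrow> ('n set \<times> 'b) set \<Rightarrow> ('n set \<times> 'b) set" where
  "sev p = presheaf_evaluation.stalk_ev (qev p)"

text \<open>A section \<open>n\<close> of the sheaf of \<open>N\<close> and a section \<open>q\<close> of the structure sheaf of the hypersurface are sent to the
  element \<open>q \<cdot> n\<close> of the localization of \<open>N / F N\<close> at \<open>p\<close>.\<close>

definition pairing :: "'b set \<Rightarrow> 'b set set \<Rightarrow> ('b set \<Rightarrow> ('n \<times> 'b) set) \<Rightarrow>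
    ('b set \<Rightarrow> ('b set set \<times> ('b set \<Rightarrow> ('b \<times> 'b) set) set) set) \<Rightarrow> ('n set \<times> 'b) set" where
  "pairing p U n q = sev p (q p) (\<nu> p (n p))"

lemma presheaf_evaluation_sev:
  assumes p: "p \<in> Proj B gr"
  shows "presheaf_evaluation T SS QQ p (End p) (\<lambda>U a. a p) (\<lambda>U \<sigma>. sev p (\<sigma> p))"
  unfolding sev_def by (rule presheaf_evaluation.presheaf_evaluation_sheafify[OF presheaf_evaluation_qev(1)[OF p]])

lemma NN_at: "n \<in> carrier (sections NN U) \<Longrightarrow> p \<in> U \<Longrightarrow> n p \<in> carrier (LN p)"
  by (simp add: fraction_sections_at)

lemma tensor_evaluation_pairing:
  assumes p: "p \<in> Proj B gr"
  shows "tensor_evaluation T SS NN QQ (LB p) (LQ p) p (\<lambda>U a. a p) (pairing p)"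
proof -
  have av: "avoidable p" by (rule Proj_avoidable[OF p])
  interpret L: module "LB p" "LQ p" by (rule Q.module_LN[OF av])
  interpret E: presheaf_evaluation T SS QQ p "End p" "\<lambda>U a. a p" "\<lambda>U \<sigma>. sev p (\<sigma> p)"
    by (rule presheaf_evaluation_sev[OF p])
  have ex: "\<exists>A\<in>carrier (LB p). \<forall>l\<in>carrier (LQ p). sev p (q p) l = A \<odot>\<^bsub>LQ p\<^esub> l"
    if "openin T U" "p \<in> U" "q \<in> carrier (sections QQ U)" for U q
    using E.ev_closed[OF that] by auto
  show ?thesis
  proof (intro tensor_evaluation.intro TP.presheaf_pair_axioms L.module_axioms tensor_evaluation_axioms.intro)
    fix U assume o: "openin T U" "p \<in> U"
    show "a p \<in> carrier (LB p)" if "a \<in> carrier (sections SS U)" for a using SS_at[OF that o(2)] .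
    fix n assume n: "n \<in> carrier (sections NN U)"
    note np = NN_at[OF n o(2)] and \<nu>n = \<nu>_closed[OF av NN_at[OF n o(2)]]
    fix q assume q: "q \<in> carrier (sections QQ U)"
    obtain A where A: "A \<in> carrier (LB p)" "\<And>l. l \<in> carrier (LQ p) \<Longrightarrow> sev p (q p) l = A \<odot>\<^bsub>LQ p\<^esub> l"
      using ex[OF o q] by blast
    show "pairing p U n q \<in> carrier (LQ p)"
      unfolding pairing_def A(2)[OF \<nu>n] using A(1) \<nu>n by (rule L.smult_closed)
    show "pairing p U n (q \<oplus>\<^bsub>sections QQ U\<^esub> q') = pairing p U n q \<oplus>\<^bsub>LQ p\<^esub> pairing p U n q'"
      if "q' \<in> carrier (sections QQ U)" for q'
      using E.ev_add[OF o q that] \<nu>n by (simp add: pairing_def)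
    show "pairing p U (n \<oplus>\<^bsub>sections NN U\<^esub> n') q = pairing p U n q \<oplus>\<^bsub>LQ p\<^esub> pairing p U n' q"
      if n': "n' \<in> carrier (sections NN U)" for n'
      using A \<nu>n \<nu>_closed[OF av NN_at[OF n' o(2)]] \<nu>_add[OF av np NN_at[OF n' o(2)]] o(2)
      by (simp add: pairing_def L.smult_r_distr)
    fix r assume r: "r \<in> carrier (sections SS U)"
    note rp = SS_at[OF r o(2)]
    show "pairing p U n (r \<odot>\<^bsub>sections QQ U\<^esub> q) = r p \<odot>\<^bsub>LQ p\<^esub> pairing p U n q"
      using E.ev_smult[OF o r q] \<nu>n by (simp add: pairing_def)
    have "A \<odot>\<^bsub>LQ p\<^esub> (r p \<odot>\<^bsub>LQ p\<^esub> \<nu> p (n p)) = r p \<odot>\<^bsub>LQ p\<^esub> (A \<odot>\<^bsub>LQ p\<^esub> \<nu> p (n p))"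
      using A(1) rp \<nu>n by (simp add: L.smult_assoc1[symmetric] L.R.m_comm)
    then show "pairing p U (r \<odot>\<^bsub>sections NN U\<^esub> n) q = r p \<odot>\<^bsub>LQ p\<^esub> pairing p U n q"
      using A rp \<nu>n \<nu>_smult[OF av rp np] o(2) by (simp add: pairing_def)
  next
    fix U V n q assume o: "openin T U" "openin T V" "V \<subseteq> U" "p \<in> V"
      and "n \<in> carrier (sections NN U)" and q: "q \<in> carrier (sections QQ U)"
    show "pairing p V (res NN U V n) (res QQ U V q) = pairing p U n q"
      using E.ev_res[OF o q] o(4) by (simp add: pairing_def)
  qed auto
qed


subsection \<open>Every local section of the tensor product is a section of the module tensored with one\<close>

definition one_section :: "'b set set \<Rightarrow> 'b set \<Rightarrow> ('b set set \<times> ('b set \<Rightarrow> ('b \<times> 'b) set) set) set" where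
  "one_section U = (\<lambda>q\<in>U. germ T PQ q U (JJ U +>\<^bsub>sections SS U\<^esub> \<one>\<^bsub>sections SS U\<^esub>))"

lemma SS_one: "openin T U \<Longrightarrow> \<one>\<^bsub>sections SS U\<^esub> \<in> carrier (sections SS U)"
  using LB_one_section by simp

lemma coset_one: "openin T U \<Longrightarrow> JJ U +>\<^bsub>sections SS U\<^esub> \<one>\<^bsub>sections SS U\<^esub> \<in> carrier (sections PQ U)"
  by (rule PQ.coset_in_quot[OF SS_one])

lemma one_section: "openin T U \<Longrightarrow> one_section U \<in> carrier (sections QQ U)"
  unfolding one_section_def by (rule PQP.section_Sh[OF _ coset_one])

lemma res_one_section:
  assumes o: "openin T U" "openin T V" "V \<subseteq> U"
  shows "res QQ U V (one_section U) = one_section V"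
proof -
  have "germ T PQ q U (JJ U +>\<^bsub>sections SS U\<^esub> \<one>\<^bsub>sections SS U\<^esub>)
      = germ T PQ q V (JJ V +>\<^bsub>sections SS V\<^esub> \<one>\<^bsub>sections SS V\<^esub>)" if q: "q \<in> V" for q
  proof -
    have "res SS U V \<one>\<^bsub>sections SS U\<^esub> = \<one>\<^bsub>sections SS V\<^esub>"
      using o(3) by (auto simp: fun_eq_iff restrict_def)
    then have "res PQ U V (JJ U +>\<^bsub>sections SS U\<^esub> \<one>\<^bsub>sections SS U\<^esub>) = JJ V +>\<^bsub>sections SS V\<^esub> \<one>\<^bsub>sections SS V\<^esub>"
      using PQ.res_quot[OF o SS_one[OF o(1)]] by simp
    then show ?thesis
      using PQP.germ_res[where p = q and U = U and V = V and s = "JJ U +>\<^bsub>sections SS U\<^esub> \<one>\<^bsub>sections SS U\<^esub>"]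
        o q coset_one[OF o(1)] by auto
  qed
  then show ?thesis using o(3) by (auto simp: one_section_def fun_eq_iff restrict_def)
qed

lemma sev_one:
  assumes p: "p \<in> Proj B gr" and o: "openin T U" "p \<in> U" and l: "l \<in> carrier (LQ p)"
  shows "sev p (one_section U p) l = l"
proof -
  interpret L: module "LB p" "LQ p" using p by (intro Q.module_LN Proj_avoidable)
  interpret E: presheaf_evaluation T SS PQ p "End p" "\<lambda>U a. a p" "qev p" by (rule presheaf_evaluation_qev(1)[OF p])
  have "E.stalk_ev (germ T PQ p U (JJ U +>\<^bsub>sections SS U\<^esub> \<one>\<^bsub>sections SS U\<^esub>))
      = qev p U (JJ U +>\<^bsub>sections SS U\<^esub> \<one>\<^bsub>sections SS U\<^esub>)"
    using o coset_one[OF o(1)] by (intro E.stalk_ev_germ) simp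
  also have "\<dots> = act p (\<one>\<^bsub>sections SS U\<^esub> p)"
    by (rule presheaf_evaluation_qev(2)[OF p o SS_one[OF o(1)]])
  finally show ?thesis using o l by (simp add: sev_def one_section_def act_def)
qed

lemma smult_one_section:
  assumes o: "openin T V" and a: "a \<in> carrier (sections SS V)" and q: "q \<in> V"
  shows "(a \<odot>\<^bsub>sections QQ V\<^esub> one_section V) q = germ T PQ q V (JJ V +>\<^bsub>sections SS V\<^esub> a)"
proof -
  have ra: "res SS V V a = a"
    using a reg.fraction_sections_extensional by (auto intro: extensional_restrict)
  have "a \<odot>\<^bsub>sections SS V\<^esub> \<one>\<^bsub>sections SS V\<^esub> = a \<otimes>\<^bsub>sections SS V\<^esub> \<one>\<^bsub>sections SS V\<^esub>" by simp
  also have "\<dots> = a"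
    using a by (rule monoid.r_one[OF ring.is_monoid[OF cring.axioms(1)[OF cring_SS[OF o]]]])
  finally have a1: "a \<odot>\<^bsub>sections SS V\<^esub> \<one>\<^bsub>sections SS V\<^esub> = a" .
  have "germ T SS q V a \<odot>\<^bsub>stalk T SS PQ q\<^esub> germ T PQ q V (JJ V +>\<^bsub>sections SS V\<^esub> \<one>\<^bsub>sections SS V\<^esub>)
     = germ T PQ q V (res SS V V a \<odot>\<^bsub>sections PQ V\<^esub> (JJ V +>\<^bsub>sections SS V\<^esub> \<one>\<^bsub>sections SS V\<^esub>))"
    using o q a coset_one[OF o] by (intro PQP.Stalk_smult_sub) auto
  then show ?thesis
    using q by (simp only: PQP.Sh_simps ra PQ.quot_smult[OF o a SS_one[OF o]] a1) (simp add: one_section_def)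
qed

text \<open>Near \<open>p\<close> a section \<open>q\<close> of the structure sheaf of the hypersurface lifts to a function \<open>a\<close>, so that
  \<open>n \<otimes> q = n \<otimes> a 1 = a n \<otimes> 1\<close>; sums of such tensors on different neighbourhoods combine on the intersection.\<close>

lemma tensor_section_normal_form:
  assumes o: "openin T U" "p \<in> U" and c: "c \<in> carrier (TP.ffree U)"
  shows "\<exists>W n. openin T W \<and> p \<in> W \<and> W \<subseteq> U \<and> n \<in> carrier (sections NN W) \<and>
    TP.fres U W c - frag_of (n, one_section W) \<in> TP.frel W"
proof -
  from c have "Poly_Mapping.keys c \<subseteq> carrier (sections NN U) \<times> carrier (sections QQ U)" by simp
  then show ?thesis
  proof (induction c rule: frag_set_induct)
    case zero
    interpret P: tensor_pair "sections SS U" "sections NN U" "sections QQ U" by (rule TP.tensor_pair_sections[OF o(1)])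
    interpret O: module "sections SS U" "sections NN U" by (rule module_NN[OF o(1)])
    have "frag_of (\<zero>\<^bsub>sections NN U\<^esub>, one_section U) \<in> TP.frel U"
      using O.M.r_zero[OF O.M.zero_closed] O.M.zero_closed one_section[OF o(1)] by (intro P.rel_zero_left)
    then have "TP.fres U U 0 - frag_of (\<zero>\<^bsub>sections NN U\<^esub>, one_section U) \<in> TP.frel U"
      using P.rel_uminus by simp
    then show ?case using o O.M.zero_closed by blast
  next
    case (one z)
    then obtain n q where z: "z = (n, q)" "n \<in> carrier (sections NN U)" "q \<in> carrier (sections QQ U)" by auto
    from z(3) o(2) obtain V t where V: "openin T V" "p \<in> V" "V \<subseteq> U" "t \<in> carrier (sections PQ V)"
      "\<And>r. r \<in> V \<Longrightarrow> q r = germ T PQ r V t"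
      by (rule PQP.ShE) (rule that)
    obtain a where a: "a \<in> carrier (sections SS V)" "t = JJ V +>\<^bsub>sections SS V\<^esub> a" using V(4) by (rule PQ.quot_cases)
    interpret P: tensor_pair "sections SS V" "sections NN V" "sections QQ V" by (rule TP.tensor_pair_sections[OF V(1)])
    have nV: "res NN U V n \<in> carrier (sections NN V)" by (rule TP.F.res_closed[OF o(1) V(1,3) z(2)])
    have "res QQ U V q = a \<odot>\<^bsub>sections QQ V\<^esub> one_section V"
    proof
      fix r
      show "res QQ U V q r = (a \<odot>\<^bsub>sections QQ V\<^esub> one_section V) r"
      proof (cases "r \<in> V")
        case True
        then show ?thesis
          unfolding smult_one_section[OF V(1) a(1) True] using V(5)[OF True] a(2) by simp
      qed simp
    qed
    then have "TP.fres U V (frag_of z) = frag_of (res NN U V n, a \<odot>\<^bsub>sections QQ V\<^esub> one_section V)"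
      by (simp add: z(1) del: PQP.Sh_simps)
    moreover have "- (frag_of (a \<odot>\<^bsub>sections NN V\<^esub> res NN U V n, one_section V)
        - frag_of (res NN U V n, a \<odot>\<^bsub>sections QQ V\<^esub> one_section V)) \<in> TP.frel V"
      by (intro P.rel_uminus P.rel_I(3) a(1) nV one_section[OF V(1)])
    ultimately have "TP.fres U V (frag_of z) - frag_of (a \<odot>\<^bsub>sections NN V\<^esub> res NN U V n, one_section V) \<in> TP.frel V"
      by (simp del: PQP.Sh_simps NN_simps)
    then show ?case using V(1-3) P.M_smult[OF a(1) nV] by blast
  next
    case (diff c d)
    then have cd: "c \<in> carrier (TP.ffree U)" "d \<in> carrier (TP.ffree U)" by auto
    obtain V n where V: "openin T V" "p \<in> V" "V \<subseteq> U" "n \<in> carrier (sections NN V)"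
      "TP.fres U V c - frag_of (n, one_section V) \<in> TP.frel V"
      using diff(3) by blast
    obtain V' n' where V': "openin T V'" "p \<in> V'" "V' \<subseteq> U" "n' \<in> carrier (sections NN V')"
      "TP.fres U V' d - frag_of (n', one_section V') \<in> TP.frel V'"
      using diff(4) by blast
    let ?W = "V \<inter> V'"
    have W: "openin T ?W" "p \<in> ?W" "?W \<subseteq> V" "?W \<subseteq> V'" "?W \<subseteq> U" using V(1-3) V'(1-3) by auto
    interpret P: tensor_pair "sections SS ?W" "sections NN ?W" "sections QQ ?W" by (rule TP.tensor_pair_sections[OF W(1)])
    interpret O: module "sections SS ?W" "sections NN ?W" by (rule module_NN[OF W(1)])
    let ?n = "res NN V ?W n" and ?n' = "res NN V' ?W n'"
    have n: "?n \<in> carrier (sections NN ?W)" "?n' \<in> carrier (sections NN ?W)"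
      using TP.F.res_closed[OF V(1) W(1,3) V(4)] TP.F.res_closed[OF V'(1) W(1,4) V'(4)] .
    let ?m = "?n \<ominus>\<^bsub>sections NN ?W\<^esub> ?n'"
    have m: "?m \<in> carrier (sections NN ?W)" "?m \<oplus>\<^bsub>sections NN ?W\<^esub> ?n' = ?n"
      using n by (simp_all add: a_minus_def O.M.a_assoc O.M.l_neg del: NN_simps)
    have 1: "TP.fres U ?W c - frag_of (?n, one_section ?W) \<in> TP.frel ?W"
      using TP.fres_rel[OF V(1) W(1,3) V(5)] TP.fres_fres[OF o(1) V(1) W(1) V(3) W(3) cd(1)]
        res_one_section[OF V(1) W(1,3)] by (simp add: frag_extend_diff del: NN_simps PQP.Sh_simps)
    have 2: "TP.fres U ?W d - frag_of (?n', one_section ?W) \<in> TP.frel ?W"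
      using TP.fres_rel[OF V'(1) W(1,4) V'(5)] TP.fres_fres[OF o(1) V'(1) W(1) V'(3) W(4) cd(2)]
        res_one_section[OF V'(1) W(1,4)] by (simp add: frag_extend_diff del: NN_simps PQP.Sh_simps)
    have 3: "frag_of (?n, one_section ?W) - frag_of (?m, one_section ?W) - frag_of (?n', one_section ?W) \<in> TP.frel ?W"
      using P.rel_I(1)[OF m(1) n(2) one_section[OF W(1)]] unfolding m(2) .
    have "TP.fres U ?W (c - d) - frag_of (?m, one_section ?W)
        = (TP.fres U ?W c - frag_of (?n, one_section ?W)) - (TP.fres U ?W d - frag_of (?n', one_section ?W))
          + (frag_of (?n, one_section ?W) - frag_of (?m, one_section ?W) - frag_of (?n', one_section ?W))"
      by (simp add: frag_extend_diff algebra_simps del: NN_simps PQP.Sh_simps)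
    also have "\<dots> \<in> TP.frel ?W" by (intro P.rel_add P.rel_minus 1 2 3)
    finally show ?case using W(1,2,5) m(1) by blast
  qed
qed

lemma power_not_in:
  assumes "p \<in> Proj B gr" shows "\<exists>g\<in>gr e. g \<notin> p"
proof (induction e)
  case 0
  then show ?case using gr_one avoidable_one[OF Proj_avoidable[OF assms]] by blast
next
  case (Suc e)
  then obtain g where "g \<in> gr e" "g \<notin> p" by blast
  moreover obtain b where "b \<in> gr 1" "b \<notin> p" using generated[OF assms] by blast
  ultimately show ?case
    using gr_mult[of g e b 1] avoidable_mult[OF Proj_avoidable[OF assms], of g b] gr_carrier by (intro bexI[of _ "g \<otimes> b"]) auto
qed

lemma germ_coset_JJ:
  assumes "openin T V" "q \<in> V" shows "germ T PQ q V (JJ V) = \<zero>\<^bsub>stalk T SS PQ q\<^esub>"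
  using PQP.Stalk_zero[OF assms] by (simp add: PQ.quot_zero)

lemma QQ_zero_add:
  assumes o: "openin T V"
  shows "\<zero>\<^bsub>sections QQ V\<^esub> \<oplus>\<^bsub>sections QQ V\<^esub> \<zero>\<^bsub>sections QQ V\<^esub> = \<zero>\<^bsub>sections QQ V\<^esub>"
proof -
  interpret A: abelian_group "sections PQ V"
    unfolding PQ.sections_quot by (rule subgroup_of_module.abelian_group_quot_module[OF PQ.subgroup_N[OF o]])
  have "\<zero>\<^bsub>stalk T SS PQ q\<^esub> \<oplus>\<^bsub>stalk T SS PQ q\<^esub> \<zero>\<^bsub>stalk T SS PQ q\<^esub> = \<zero>\<^bsub>stalk T SS PQ q\<^esub>" if q: "q \<in> V" for q
    unfolding PQP.Stalk_zero[OF o q] using o q PQP.zero_closed[OF o] by (subst PQP.Stalk_add_same) auto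
  then show ?thesis by (auto intro!: restrict_ext)
qed

text \<open>The section is \<open>x / h\<close> near \<open>p\<close>, and \<open>u x = F y\<close> for some \<open>u\<close> outside \<open>p\<close>. To write \<open>x / h\<close> as a product of
  fractions of degree zero, take \<open>w\<close> of degree \<open>s\<close> outside \<open>p\<close>. Then \<open>x / h = (F / w) (y' / u h)\<close> with \<open>F y' = w u x\<close>,
  and \<open>F / w\<close> is zero on the hypersurface.\<close>

lemma section_tensor_one_vanishes:
  assumes o: "openin T W" "p \<in> W" and n: "n \<in> carrier (sections NN W)" and zero: "\<nu> p (n p) = \<zero>\<^bsub>LQ p\<^esub>"
  shows "\<exists>V. openin T V \<and> p \<in> V \<and> V \<subseteq> W \<and> frag_of (res NN W V n, one_section V) \<in> TP.frel V"
proof -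
  have p: "p \<in> Proj B gr" using open_Proj[OF o] .
  note av = Proj_avoidable[OF p]
  obtain V0 x h d where V0: "openin T V0" "p \<in> V0" "V0 \<subseteq> W" "x \<in> ngr d" "h \<in> gr d"
    "\<And>q. q \<in> V0 \<Longrightarrow> h \<notin> q" "\<And>q. q \<in> V0 \<Longrightarrow> n q = frac q x h"
    using n[simplified] o(2) by (rule fraction_sectionsE) (rule that)
  have xh: "(x, h) \<in> fracs p" using V0(4,5) V0(6)[OF V0(2)] by (rule fracsI)
  have "qfrac p x h = \<zero>\<^bsub>LQ p\<^esub>" using zero V0(7)[OF V0(2)] \<nu>_frac[OF av xh] by simp
  then obtain u i where u: "u \<in> gr i" "u \<notin> p" "u \<bullet> x \<in> Z"
    unfolding qfrac_zero_iff[OF av xh] by blast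
  then obtain y where y: "y \<in> carrier N" "u \<bullet> x = F \<bullet> y" by (auto simp: multiples_def)
  obtain w where w: "w \<in> gr s" "w \<notin> p" using power_not_in[OF p] by blast
  note c = gr_carrier[OF u(1)] gr_carrier[OF w(1)] gr_carrier[OF V0(5)] ngr_carrier[OF V0(4)] F_carrier y(1)
  have Fwy: "F \<bullet> (w \<bullet> y) = w \<bullet> (u \<bullet> x)"
    unfolding y(2) using c by (simp add: smult_assoc1[symmetric] R.m_comm)
  have "F \<bullet> (w \<bullet> y) \<in> ngr (s + (i + d))"
    unfolding Fwy by (intro ngr_smult w(1) u(1) V0(4))
  then obtain y' where y': "y' \<in> ngr (i + d)" "F \<bullet> y' = w \<bullet> (u \<bullet> x)"
    using F_component[of "w \<bullet> y"] c Fwy by auto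
  obtain V1 where V1: "openin T V1" "p \<in> V1" "V1 \<subseteq> V0" "\<And>q. q \<in> V1 \<Longrightarrow> u \<notin> q"
    using shrink_denominator[OF V0(1,2) u(1,2)] by metis
  obtain V where V: "openin T V" "p \<in> V" "V \<subseteq> V1" "\<And>q. q \<in> V \<Longrightarrow> w \<notin> q"
    using shrink_denominator[OF V1(1,2) w] by metis
  have VW: "V \<subseteq> W" using V(3) V1(3) V0(3) by blast
  have nin: "h \<notin> q" "u \<notin> q" "w \<notin> q" "u \<otimes> h \<notin> q" "avoidable q" if q: "q \<in> V" for q
  proof -
    show av: "avoidable q" using open_avoidable[OF V(1) q] .
    show "h \<notin> q" "u \<notin> q" "w \<notin> q" using V0(6)[of q] V1(4)[of q] V(4)[of q] q V(3) V1(3) by auto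
    then show "u \<otimes> h \<notin> q" using avoidable_mult[OF av] c by blast
  qed
  define a where "a = (\<lambda>q\<in>V. bfrac q F w)"
  define m where "m = (\<lambda>q\<in>V. frac q y' (u \<otimes> h))"
  have m: "m \<in> carrier (sections NN V)"
    unfolding m_def NN_simps
    by (rule frac_section[where x = y' and h = "u \<otimes> h"], rule V(1), rule y'(1),
        rule gr_mult[OF u(1) V0(5)], rule nin(4))
  have aJ: "a \<in> JJ V"
    unfolding a_def ideal_sheaf_def using F F_J w(1) nin(3) by (intro reg.frac_section[OF V(1), of _ _ s]) auto
  then have a: "a \<in> carrier (sections SS V)" using PQ.N_carrier[OF V(1)] by blast
  interpret P: tensor_pair "sections SS V" "sections NN V" "sections QQ V" by (rule TP.tensor_pair_sections[OF V(1)])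
  have nV: "res NN W V n = a \<odot>\<^bsub>sections NN V\<^esub> m"
  proof -
    have "n q = a q \<odot>\<^bsub>LN q\<^esub> m q" if q: "q \<in> V" for q
    proof -
      note nq = nin[OF q]
      note f = reg.fracsI[OF F w(1) nq(3)] fracsI[OF y'(1) gr_mult[OF u(1) V0(5)] nq(4)]
        fracsI[OF V0(4,5) nq(1)]
      have "a q \<odot>\<^bsub>LN q\<^esub> m q = frac q (w \<bullet> (u \<bullet> x)) (w \<otimes> (u \<otimes> h))"
        using q LN_smult[OF nq(5) f(1,2)] y'(2) by (simp add: a_def m_def)
      also have "\<dots> = frac q (u \<bullet> x) (u \<otimes> h)"
        by (rule frac_cancel(1)[OF nq(5) frac_cancel(2)[OF nq(5) f(3) u(1) nq(2)] w(1) nq(3)])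
      also have "\<dots> = frac q x h" by (rule frac_cancel(1)[OF nq(5) f(3) u(1) nq(2)])
      also have "\<dots> = n q" using V0(7)[of q] q V(3) V1(3) by auto
      finally show ?thesis ..
    qed
    then show ?thesis by (auto intro!: restrict_ext)
  qed
  have "a \<odot>\<^bsub>sections QQ V\<^esub> one_section V = \<zero>\<^bsub>sections QQ V\<^esub>"
  proof
    fix q
    show "(a \<odot>\<^bsub>sections QQ V\<^esub> one_section V) q = \<zero>\<^bsub>sections QQ V\<^esub> q"
    proof (cases "q \<in> V")
      case True
      have "JJ V +>\<^bsub>sections SS V\<^esub> a = JJ V" using PQ.coset_eq_N_iff[OF V(1) a] aJ by simp
      then show ?thesis
        unfolding smult_one_section[OF V(1) a True] using germ_coset_JJ[OF V(1) True] True by simp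
    qed simp
  qed
  then have "frag_of (m, a \<odot>\<^bsub>sections QQ V\<^esub> one_section V) \<in> TP.frel V"
    using P.rel_zero_right[OF m QQ.zero_closed[OF V(1)] QQ_zero_add[OF V(1)]] by simp
  from P.rel_add[OF P.rel_I(3)[OF a m one_section[OF V(1)]] this]
  have "frag_of (res NN W V n, one_section V) \<in> TP.frel V"
    unfolding nV by (simp del: PQP.Sh_simps NN_simps)
  then show ?thesis using V(1,2) VW by blast
qed

lemma tensor_evaluation_faithful:
  assumes p: "p \<in> Proj B gr"
  shows "presheaf_evaluation.faithful T TP p (LQ p) (tensor_evaluation.tensor_ev NN QQ (LQ p) (pairing p))"
proof -
  interpret E: tensor_evaluation T SS NN QQ "LB p" "LQ p" p "\<lambda>U a. a p" "pairing p"
    by (rule tensor_evaluation_pairing[OF p])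
  interpret PE: presheaf_evaluation T SS TP p "LQ p" "\<lambda>U a. a p" E.tensor_ev
    by (rule E.presheaf_evaluation_tensor)
  show ?thesis
    unfolding PE.faithful_def
  proof (intro allI impI)
    fix U X assume a: "TPP.section_at p U X \<and> E.tensor_ev U X = \<zero>\<^bsub>LQ p\<^esub>"
    then have o: "openin T U" "p \<in> U" by auto
    from a obtain c where c: "c \<in> carrier (TP.ffree U)" "X = TP.frel U +>\<^bsub>TP.ffree U\<^esub> c" by (auto elim: TP.tensor_cases)
    obtain W n where W: "openin T W" "p \<in> W" "W \<subseteq> U" "n \<in> carrier (sections NN W)"
      "TP.fres U W c - frag_of (n, one_section W) \<in> TP.frel W"
      using tensor_section_normal_form[OF o c(1)] by blast
    note rc = TP.fres_closed[OF o(1) W(1,3) c(1)]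
    have fn: "frag_of (n, one_section W) \<in> carrier (TP.ffree W)"
      using W(4) one_section[OF W(1)] by (simp del: NN_simps PQP.Sh_simps)
    have "E.lin W (frag_of (n, one_section W)) = E.lin W (TP.fres U W c)"
    proof -
      have e: "\<zero>\<^bsub>LQ p\<^esub> = E.lin W (TP.fres U W c) \<ominus>\<^bsub>LQ p\<^esub> E.lin W (frag_of (n, one_section W))"
        using E.lin_rel[OF W(1,2,5)] E.lin_diff[OF W(1,2) rc fn] by simp
      have "E.lin W (TP.fres U W c)
          = (E.lin W (TP.fres U W c) \<ominus>\<^bsub>LQ p\<^esub> E.lin W (frag_of (n, one_section W))) \<oplus>\<^bsub>LQ p\<^esub> E.lin W (frag_of (n, one_section W))"
        using E.lin_closed[OF W(1,2) rc] E.lin_closed[OF W(1,2) fn]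
        by (simp add: a_minus_def E.L.M.a_assoc E.L.M.l_neg)
      then show ?thesis
        unfolding e[symmetric] using E.lin_closed[OF W(1,2) fn] by simp
    qed
    also have "\<dots> = E.tensor_ev U X"
      using E.lin_fres[OF o(1) W(1,3,2) c(1)] E.tensor_ev_coset[OF o c(1)] c(2) by simp
    finally have "pairing p W n (one_section W) = \<zero>\<^bsub>LQ p\<^esub>"
      using E.lin(2)[OF W(1,2,4) one_section[OF W(1)]] a by simp
    then have "\<nu> p (n p) = \<zero>\<^bsub>LQ p\<^esub>"
      unfolding pairing_def sev_one[OF p W(1,2) \<nu>_closed[OF Proj_avoidable[OF p] NN_at[OF W(4,2)]]] .
    from section_tensor_one_vanishes[OF W(1,2,4) this]
    obtain V where V: "openin T V" "p \<in> V" "V \<subseteq> W" "frag_of (res NN W V n, one_section V) \<in> TP.frel V" by blast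
    interpret P: tensor_pair "sections SS V" "sections NN V" "sections QQ V" by (rule TP.tensor_pair_sections[OF V(1)])
    have VU: "V \<subseteq> U" using V(3) W(3) by blast
    have "TP.fres W V (TP.fres U W c - frag_of (n, one_section W)) \<in> TP.frel V"
      by (rule TP.fres_rel[OF W(1) V(1,3) W(5)])
    then have "TP.fres U V c - frag_of (res NN W V n, one_section V) \<in> TP.frel V"
      using TP.fres_fres[OF o(1) W(1) V(1) W(3) V(3) c(1)] res_one_section[OF W(1) V(1,3)]
      by (simp add: frag_extend_diff del: NN_simps PQP.Sh_simps)
    from P.rel_add[OF this V(4)] have "TP.fres U V c \<in> TP.frel V" by simp
    then have "res TP U V X = \<zero>\<^bsub>sections TP V\<^esub>"
      unfolding c(2) TP.res_tensor[OF o(1) V(1) VU c(1)] TP.tensor_zero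
      using subgroup_of_module.coset_eq_self_iff[OF P.subgroup_of_module_rel TP.fres_closed[OF o(1) V(1) VU c(1)]] by simp
    then show "\<exists>W. openin T W \<and> p \<in> W \<and> W \<subseteq> U \<and> res TP U W X = \<zero>\<^bsub>sections TP W\<^esub>"
      using V(1,2) VU by blast
  qed
qed

text \<open>A fraction at \<open>p\<close> extends to a section \<open>n\<close> near \<open>p\<close>, and \<open>n \<otimes> 1\<close> evaluates to it.\<close>

lemma tensor_evaluation_surjective:
  assumes p: "p \<in> Proj B gr" and y: "y \<in> carrier (LQ p)"
  shows "\<exists>W X. openin T W \<and> p \<in> W \<and> X \<in> carrier (sections TP W) \<and>
    tensor_evaluation.tensor_ev NN QQ (LQ p) (pairing p) W X = y"
proof -
  interpret E: tensor_evaluation T SS NN QQ "LB p" "LQ p" p "\<lambda>U a. a p" "pairing p"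
    by (rule tensor_evaluation_pairing[OF p])
  obtain x h d where x: "x \<in> ngr d" "h \<in> gr d" "h \<notin> p" "y = qfrac p x h" using y by (rule LQ_cases)
  have "openin T (topspace T)" by (rule openin_topspace)
  moreover have "p \<in> topspace T" using p topspace_T by blast
  ultimately obtain W where W: "openin T W" "p \<in> W" "\<And>q. q \<in> W \<Longrightarrow> h \<notin> q"
    using shrink_denominator[OF _ _ x(2,3)] by metis
  define n where "n = (\<lambda>q\<in>W. frac q x h)"
  have n: "n \<in> carrier (sections NN W)" 
    unfolding n_def NN_simps by (rule frac_section[where x = x and h = h], rule W(1), rule x(1), rule x(2), rule W(3))
  have fn: "frag_of (n, one_section W) \<in> carrier (TP.ffree W)"
    using n one_section[OF W(1)] by (simp del: NN_simps PQP.Sh_simps)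
  have "\<nu> p (n p) = y"
    using W(2) \<nu>_frac[OF Proj_avoidable[OF p] fracsI[OF x(1-3)]] x(4) by (simp add: n_def)
  then have "E.tensor_ev W (TP.frel W +>\<^bsub>TP.ffree W\<^esub> frag_of (n, one_section W)) = y"
    unfolding E.tensor_ev_coset[OF W(1,2) fn] E.lin(2)[OF W(1,2) n one_section[OF W(1)]] pairing_def
    using sev_one[OF p W(1,2) y] by simp
  then show ?thesis using W(1,2) TP.coset_in_tensor[OF fn] by blast
qed


subsection \<open>Associated points\<close>

abbreviation FF where "FF \<equiv> sheafify T SS TP"
abbreviation SS_section where
  "SS_section p U a \<equiv> openin T U \<and> p \<in> U \<and> a \<in> carrier (sections SS U)"
abbreviation Sp where "Sp p \<equiv> stalk T SS SS p"

lemma presheaf_evaluation_SS: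
  assumes p: "p \<in> Proj B gr"
  shows "presheaf_evaluation T SS SS p (LB p) (\<lambda>U a. a p) (\<lambda>U a. a p)"
  by (intro presheaf_evaluation.intro module_presheaf_SS presheaf_evaluation_axioms.intro)
    (auto simp: SS_value LB_mult_eq_smult)

text \<open>The value at \<open>p\<close> identifies the stalk of the structure sheaf with the local ring \<open>LB p\<close> of fractions, through
  which units and the ring axioms are transferred to the stalk.\<close>

definition val :: "'b set \<Rightarrow> ('b set set \<times> ('b set \<Rightarrow> ('b \<times> 'b) set)) set \<Rightarrow> ('b \<times> 'b) set" where
  "val p = presheaf_evaluation.stalk_ev (\<lambda>U a. a p)"

lemma val_germ:
  assumes "openin T U" "p \<in> U" "a \<in> carrier (sections SS U)"
  shows "val p (germ T SS p U a) = a p"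
  unfolding val_def
  using presheaf_evaluation.stalk_ev_germ[OF presheaf_evaluation_SS[OF open_Proj[OF assms(1,2)]]] assms by blast

lemma val_inj:
  assumes p: "p \<in> Proj B gr" and X: "X \<in> carrier (Sp p)" "Y \<in> carrier (Sp p)" and eq: "val p X = val p Y"
  shows "X = Y"
proof -
  obtain U a where a: "SS_section p U a" "X = germ T SS p U a" using X(1) by (rule PQ.Stalk_cases)
  obtain V b where b: "SS_section p V b" "Y = germ T SS p V b" using X(2) by (rule PQ.Stalk_cases)
  let ?W = "U \<inter> V"
  have W: "openin T ?W" "p \<in> ?W" using a b by auto
  have r: "restrict a ?W \<in> fraction_sections B gr (reg_module B) gr gr ?W"
    "restrict b ?W \<in> fraction_sections B gr (reg_module B) gr gr ?W"
    using a(1) b(1) W(1) by (auto intro: reg.restrict_fraction_sections)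
  have "restrict a ?W p = restrict b ?W p" using eq a b W(2) by (simp add: val_germ)
  from reg.sections_agree_near[OF W r this]
  obtain W' where W': "openin T W'" "p \<in> W'" "W' \<subseteq> ?W" "restrict (restrict a ?W) W' = restrict (restrict b ?W) W'" by metis
  have "restrict a W' = restrict b W'"
    using W'(3,4) by (simp add: Int_absorb1 Int_absorb2 restrict_restrict)
  then show ?thesis unfolding a(2) b(2) using a(1) b(1) W'(1-3) by (intro PQ.scalar.germ_eqI[where W = W']) auto
qed

lemma val_surj:
  assumes p: "p \<in> Proj B gr" and A: "(a, g) \<in> bfracs p"
  shows "\<exists>X\<in>carrier (Sp p). val p X = bfrac p a g"
proof -
  obtain d where d: "a \<in> gr d" "g \<in> gr d" "g \<notin> p" using A by (auto simp: hfracs_def)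
  have "openin T (topspace T)" by (rule openin_topspace)
  moreover have "p \<in> topspace T" using p topspace_T by blast
  ultimately obtain W where W: "openin T W" "p \<in> W" "\<And>q. q \<in> W \<Longrightarrow> g \<notin> q"
    using shrink_denominator[OF _ _ d(2,3)] by metis
  have s: "(\<lambda>q\<in>W. bfrac q a g) \<in> carrier (sections SS W)"
    unfolding SS_simps by (rule reg.frac_section[where x = a and h = g], rule W(1), rule d(1), rule d(2), rule W(3))
  show ?thesis
    using W(1,2) s val_germ[OF W(1,2) s] by (intro bexI[OF _ PQ.germ_in_Stalk[where U = W]]) auto
qed

lemma val_closed: "\<lbrakk>p \<in> Proj B gr; X \<in> carrier (Sp p)\<rbrakk> \<Longrightarrow> val p X \<in> carrier (LB p)"
  by (elim PQ.Stalk_cases) (auto simp: val_germ SS_value)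

lemma Stalk_mult_eq_smult: "X \<otimes>\<^bsub>Sp p\<^esub> Y = X \<odot>\<^bsub>Sp p\<^esub> Y"
  by (simp add: stalk_def)

lemma val_iso:
  assumes p: "p \<in> Proj B gr"
  shows "val p \<in> ring_iso (Sp p) (LB p)" and "val p \<zero>\<^bsub>Sp p\<^esub> = \<zero>\<^bsub>LB p\<^esub>"
proof -
  interpret E: presheaf_evaluation T SS SS p "LB p" "\<lambda>U a. a p" "\<lambda>U a. a p" by (rule presheaf_evaluation_SS[OF p])
  have top: "p \<in> topspace T" using p topspace_T by blast
  show "val p \<zero>\<^bsub>Sp p\<^esub> = \<zero>\<^bsub>LB p\<^esub>" unfolding val_def by (rule E.stalk_ev_zero[OF top])
  show "val p \<in> ring_iso (Sp p) (LB p)"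
  proof (rule ring_iso_memI)
    fix X Y assume X: "X \<in> carrier (Sp p)" and Y: "Y \<in> carrier (Sp p)"
    show "val p X \<in> carrier (LB p)" by (rule val_closed[OF p X])
    show "val p (X \<oplus>\<^bsub>Sp p\<^esub> Y) = val p X \<oplus>\<^bsub>LB p\<^esub> val p Y"
      unfolding val_def by (rule E.stalk_ev_add[OF X Y])
    obtain U a where a: "SS_section p U a" "X = germ T SS p U a" using X by (rule PQ.Stalk_cases)
    have "val p (X \<odot>\<^bsub>Sp p\<^esub> Y) = val p X \<odot>\<^bsub>LB p\<^esub> val p Y"
      using E.stalk_ev_smult[OF a(1) Y] a val_germ[of U p a] by (simp add: val_def)
    then show "val p (X \<otimes>\<^bsub>Sp p\<^esub> Y) = val p X \<otimes>\<^bsub>LB p\<^esub> val p Y"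
      by (simp add: Stalk_mult_eq_smult LB_mult_eq_smult)
  next
    have "\<one>\<^bsub>Sp p\<^esub> = germ T SS p (topspace T) \<one>\<^bsub>sections SS (topspace T)\<^esub>" by (simp add: stalk_def)
    then show "val p \<one>\<^bsub>Sp p\<^esub> = \<one>\<^bsub>LB p\<^esub>"
      using val_germ[OF openin_topspace top SS_one[OF openin_topspace]] top by simp
    show "bij_betw (val p) (carrier (Sp p)) (carrier (LB p))"
    proof (rule bij_betw_imageI)
      show "inj_on (val p) (carrier (Sp p))" using val_inj[OF p] by (auto simp: inj_on_def)
      show "val p ` carrier (Sp p) = carrier (LB p)"
        using val_closed[OF p] val_surj[OF p] by (auto elim!: LB_cases) (metis image_eqI)
    qed
  qed
qed

lemma LB_Units_iff:
  assumes p: "p \<in> Proj B gr" and f: "(a, g) \<in> bfracs p"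
  shows "bfrac p a g \<in> Units (LB p) \<longleftrightarrow> a \<notin> p"
proof
  note av = Proj_avoidable[OF p]
  interpret p: primeideal p B by (rule Proj_ideal[OF p])
  note c = bfracsD[OF f]
  {
    assume "bfrac p a g \<in> Units (LB p)"
    then obtain Y where "Y \<in> carrier (LB p)" "bfrac p a g \<otimes>\<^bsub>LB p\<^esub> Y = \<one>\<^bsub>LB p\<^esub>"
      by (auto simp: Units_def)
    then obtain b k where b: "(b, k) \<in> bfracs p" "bfrac p a g \<otimes>\<^bsub>LB p\<^esub> bfrac p b k = \<one>\<^bsub>LB p\<^esub>"
      by (metis LB_cases)
    note d = bfracsD[OF b(1)]
    have "bfrac p (a \<otimes> b) (g \<otimes> k) = bfrac p \<one> \<one>"
      using b(2) LB_mult(1)[OF av f b(1)] one_LB by simp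
    then obtain u i where u: "u \<in> gr i" "u \<notin> p" "u \<odot>\<^bsub>reg_module B\<^esub> (\<one> \<odot>\<^bsub>reg_module B\<^esub> (a \<otimes> b)) = u \<odot>\<^bsub>reg_module B\<^esub> ((g \<otimes> k) \<odot>\<^bsub>reg_module B\<^esub> \<one>)"
      using reg.frac_eqD[OF av LB_mult(2)[OF av f b(1)] one_bfracs[OF av]] by blast
    have uc: "u \<in> carrier B" using gr_carrier[OF u(1)] .
    have "u \<otimes> (a \<otimes> b) = u \<otimes> (g \<otimes> k)" using u(3) c d by (simp add: reg_module_def)
    moreover have "u \<otimes> (g \<otimes> k) \<notin> p"
      using avoidable_mult[OF av u(2) avoidable_mult[OF av c(3) d(3) c(2) d(2)]] uc c d by simp
    ultimately show "a \<notin> p"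
      using p.I_l_closed[of "a \<otimes> b" u] p.I_r_closed[of a b] uc d by auto
  }
  assume a: "a \<notin> p"
  obtain d where d: "a \<in> gr d" "g \<in> gr d" using f by (auto simp: hfracs_def)
  have ga: "(g, a) \<in> bfracs p" using d a by (auto simp: hfracs_def)
  have "(g \<otimes> a) \<notin> p" using avoidable_mult[OF av c(3) a c(2,1)] .
  have ag1: "bfrac p (a \<otimes> g) (g \<otimes> a) = \<one>\<^bsub>LB p\<^esub>"
    unfolding one_LB using c LB_mult(2)[OF av f ga]
    by (intro reg.frac_eqI_cross[OF av _ one_bfracs[OF av]]) (auto simp: reg_module_def R.m_comm)
  then have "bfrac p a g \<otimes>\<^bsub>LB p\<^esub> bfrac p g a = \<one>\<^bsub>LB p\<^esub>" by (simp add: LB_mult(1)[OF av f ga])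
  moreover have "bfrac p g a \<otimes>\<^bsub>LB p\<^esub> bfrac p a g = \<one>\<^bsub>LB p\<^esub>"
    using ag1 c by (simp add: LB_mult(1)[OF av ga f] R.m_comm)
  ultimately show "bfrac p a g \<in> Units (LB p)"
    using bfrac_in_LB[OF f] bfrac_in_LB[OF ga] by (auto simp: Units_def)
qed

lemma cring_Stalk:
  assumes p: "p \<in> Proj B gr" shows "cring (Sp p)"
proof -
  interpret L: cring "LB p" by (rule cring_LB[OF Proj_avoidable[OF p]])
  note iso = val_iso[OF p]
  have cl: "X \<oplus>\<^bsub>Sp p\<^esub> Y \<in> carrier (Sp p)" "X \<otimes>\<^bsub>Sp p\<^esub> Y \<in> carrier (Sp p)"
    if XY: "X \<in> carrier (Sp p)" "Y \<in> carrier (Sp p)" for X Y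
  proof -
    obtain U a where a: "SS_section p U a" "X = germ T SS p U a" using XY(1) by (rule PQ.Stalk_cases)
    obtain V b where b: "SS_section p V b" "Y = germ T SS p V b" using XY(2) by (rule PQ.Stalk_cases)
    have W: "openin T (U \<inter> V)" using a b by auto
    show "X \<oplus>\<^bsub>Sp p\<^esub> Y \<in> carrier (Sp p)"
      unfolding a(2) b(2) PQ.Stalk_add[OF a(1) b(1)]
      using a(1) b(1) W by (intro PQ.germ_in_Stalk conjI PQ.add_closed PQ.res_closed[of U] PQ.res_closed[of V]) auto
    show "X \<otimes>\<^bsub>Sp p\<^esub> Y \<in> carrier (Sp p)"
      unfolding Stalk_mult_eq_smult a(2) b(2) PQ.Stalk_smult[OF a(1) b(1)]
      using a(1) b(1) W by (intro PQ.germ_in_Stalk conjI PQ.smult_closed PQ.res_closed[of U] PQ.res_closed[of V]) auto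
  qed
  have mult: "val p (X \<otimes>\<^bsub>Sp p\<^esub> Y) = val p X \<otimes>\<^bsub>LB p\<^esub> val p Y"
    and add: "val p (X \<oplus>\<^bsub>Sp p\<^esub> Y) = val p X \<oplus>\<^bsub>LB p\<^esub> val p Y"
    and closed: "val p X \<in> carrier (LB p)"
    if "X \<in> carrier (Sp p)" "Y \<in> carrier (Sp p)" for X Y
    using ring_iso_memE[OF iso(1)] that by auto
  have surj: "\<exists>X\<in>carrier (Sp p). val p X = A" if "A \<in> carrier (LB p)" for A
    using that val_surj[OF p] by (metis LB_cases)
  have one: "\<one>\<^bsub>Sp p\<^esub> \<in> carrier (Sp p)" "val p \<one>\<^bsub>Sp p\<^esub> = \<one>\<^bsub>LB p\<^esub>"
  proof -
    have "p \<in> topspace T" using p topspace_T by blast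
    then show "\<one>\<^bsub>Sp p\<^esub> \<in> carrier (Sp p)"
      using PQ.germ_in_Stalk[where p = p and U = "topspace T" and s = "\<one>\<^bsub>sections SS (topspace T)\<^esub>"] SS_one[of "topspace T"]
      by (simp add: stalk_def)
    show "val p \<one>\<^bsub>Sp p\<^esub> = \<one>\<^bsub>LB p\<^esub>" by (rule ring_iso_memE(4)[OF iso(1)])
  qed
  have zero: "\<zero>\<^bsub>Sp p\<^esub> \<in> carrier (Sp p)"
  proof -
    have "p \<in> topspace T" using p topspace_T by blast
    then show ?thesis
      unfolding PQ.Stalk_zero[OF openin_topspace \<open>p \<in> topspace T\<close>]
      using PQ.zero_closed[of "topspace T"] by (intro PQ.germ_in_Stalk) simp
  qed
  note inj = val_inj[OF p]
  show ?thesis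
  proof (rule cringI)
    show "abelian_group (Sp p)"
    proof (rule abelian_groupI)
      fix X assume X: "X \<in> carrier (Sp p)"
      show "\<zero>\<^bsub>Sp p\<^esub> \<oplus>\<^bsub>Sp p\<^esub> X = X"
        using closed[OF X X] by (intro inj cl zero X) (simp add: add zero X iso(2))
      obtain Y where Y: "Y \<in> carrier (Sp p)" "val p Y = \<ominus>\<^bsub>LB p\<^esub> val p X"
        using surj[OF L.a_inv_closed[OF closed[OF X X]]] by blast
      have "Y \<oplus>\<^bsub>Sp p\<^esub> X = \<zero>\<^bsub>Sp p\<^esub>"
        using closed[OF X X] by (intro inj cl zero X Y(1)) (simp add: add zero X Y iso(2) L.l_neg)
      then show "\<exists>Y\<in>carrier (Sp p). Y \<oplus>\<^bsub>Sp p\<^esub> X = \<zero>\<^bsub>Sp p\<^esub>" using Y(1) by blast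
      fix Y assume Y: "Y \<in> carrier (Sp p)"
      show "X \<oplus>\<^bsub>Sp p\<^esub> Y = Y \<oplus>\<^bsub>Sp p\<^esub> X"
        using closed[OF X X] closed[OF Y Y] by (intro inj cl X Y) (simp add: add X Y L.a_comm)
      fix Z assume Z: "Z \<in> carrier (Sp p)"
      show "X \<oplus>\<^bsub>Sp p\<^esub> Y \<oplus>\<^bsub>Sp p\<^esub> Z = X \<oplus>\<^bsub>Sp p\<^esub> (Y \<oplus>\<^bsub>Sp p\<^esub> Z)"
        using closed[OF X X] closed[OF Y Y] closed[OF Z Z] by (intro inj cl X Y Z) (simp add: add cl X Y Z L.a_assoc)
    qed (auto intro: zero cl)
    show "comm_monoid (Sp p)"
    proof (rule comm_monoidI)
      fix X assume X: "X \<in> carrier (Sp p)"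
      show "\<one>\<^bsub>Sp p\<^esub> \<otimes>\<^bsub>Sp p\<^esub> X = X"
        using closed[OF X X] by (intro inj cl one X) (simp add: mult one X)
      fix Y assume Y: "Y \<in> carrier (Sp p)"
      show "X \<otimes>\<^bsub>Sp p\<^esub> Y = Y \<otimes>\<^bsub>Sp p\<^esub> X"
        using closed[OF X X] closed[OF Y Y] by (intro inj cl X Y) (simp add: mult X Y L.m_comm)
      fix Z assume Z: "Z \<in> carrier (Sp p)"
      show "X \<otimes>\<^bsub>Sp p\<^esub> Y \<otimes>\<^bsub>Sp p\<^esub> Z = X \<otimes>\<^bsub>Sp p\<^esub> (Y \<otimes>\<^bsub>Sp p\<^esub> Z)"
        using closed[OF X X] closed[OF Y Y] closed[OF Z Z] by (intro inj cl X Y Z) (simp add: mult cl X Y Z L.m_assoc)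
    qed (auto intro: one cl)
    fix X Y Z assume X: "X \<in> carrier (Sp p)" and Y: "Y \<in> carrier (Sp p)" and Z: "Z \<in> carrier (Sp p)"
    show "(X \<oplus>\<^bsub>Sp p\<^esub> Y) \<otimes>\<^bsub>Sp p\<^esub> Z = X \<otimes>\<^bsub>Sp p\<^esub> Z \<oplus>\<^bsub>Sp p\<^esub> Y \<otimes>\<^bsub>Sp p\<^esub> Z"
      using closed[OF X X] closed[OF Y Y] closed[OF Z Z] by (intro inj cl X Y Z) (simp add: mult add cl X Y Z L.l_distr)
  qed
qed

lemma Stalk_Units_iff:
  assumes p: "p \<in> Proj B gr" and X: "X \<in> carrier (Sp p)"
  shows "X \<in> Units (Sp p) \<longleftrightarrow> val p X \<in> Units (LB p)"
proof
  note iso = ring_iso_memE[OF val_iso(1)[OF p]]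
  have one: "\<one>\<^bsub>Sp p\<^esub> \<in> carrier (Sp p)"
    using monoid.one_closed[OF ring.is_monoid[OF cring.axioms(1)[OF cring_Stalk[OF p]]]] .
  assume "X \<in> Units (Sp p)"
  then obtain Y where Y: "Y \<in> carrier (Sp p)" "Y \<otimes>\<^bsub>Sp p\<^esub> X = \<one>\<^bsub>Sp p\<^esub>" "X \<otimes>\<^bsub>Sp p\<^esub> Y = \<one>\<^bsub>Sp p\<^esub>"
    by (auto simp: Units_def)
  have "val p Y \<otimes>\<^bsub>LB p\<^esub> val p X = \<one>\<^bsub>LB p\<^esub>" "val p X \<otimes>\<^bsub>LB p\<^esub> val p Y = \<one>\<^bsub>LB p\<^esub>"
    using iso(2)[OF Y(1) X] iso(2)[OF X Y(1)] Y(2,3) iso(4) by simp_all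
  then show "val p X \<in> Units (LB p)" using iso(1)[OF X] iso(1)[OF Y(1)] by (auto simp: Units_def)
next
  note iso = ring_iso_memE[OF val_iso(1)[OF p]]
  interpret S: cring "Sp p" by (rule cring_Stalk[OF p])
  assume "val p X \<in> Units (LB p)"
  then obtain A where A: "A \<in> carrier (LB p)" "A \<otimes>\<^bsub>LB p\<^esub> val p X = \<one>\<^bsub>LB p\<^esub>" by (auto simp: Units_def)
  obtain a g where a: "(a, g) \<in> bfracs p" "A = bfrac p a g" using A(1) by (rule LB_cases)
  then obtain Y where Y: "Y \<in> carrier (Sp p)" "val p Y = A" using val_surj[OF p] by blast
  have "Y \<otimes>\<^bsub>Sp p\<^esub> X = \<one>\<^bsub>Sp p\<^esub>"
    using iso(2)[OF Y(1) X] A(2) Y(2) iso(4) by (intro val_inj[OF p]) (simp_all add: X Y)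
  then show "X \<in> Units (Sp p)" using X Y(1) S.m_comm[OF X Y(1)] by (auto simp: Units_def)
qed

lemma primeideal_nonunits:
  assumes p: "p \<in> Proj B gr" shows "primeideal (carrier (Sp p) - Units (Sp p)) (Sp p)"
proof -
  note av = Proj_avoidable[OF p]
  interpret p: primeideal p B by (rule Proj_ideal[OF p])
  interpret S: cring "Sp p" by (rule cring_Stalk[OF p])
  note iso = ring_iso_memE[OF val_iso(1)[OF p]]
  let ?m = "carrier (Sp p) - Units (Sp p)"
  have add: "X \<oplus>\<^bsub>Sp p\<^esub> Y \<in> ?m" if X: "X \<in> ?m" and Y: "Y \<in> ?m" for X Y
  proof -
    obtain a g where a: "(a, g) \<in> bfracs p" "val p X = bfrac p a g" using X iso(1) by (metis DiffD1 LB_cases)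
    obtain b k where b: "(b, k) \<in> bfracs p" "val p Y = bfrac p b k" using Y iso(1) by (metis DiffD1 LB_cases)
    have ab: "a \<in> p" "b \<in> p"
      using X Y a b Stalk_Units_iff[OF p] LB_Units_iff[OF p] by auto
    then have "k \<otimes> a \<oplus> g \<otimes> b \<in> p"
      using bfracsD[OF a(1)] bfracsD[OF b(1)] p.I_l_closed p.a_closed by blast
    then have "val p (X \<oplus>\<^bsub>Sp p\<^esub> Y) \<notin> Units (LB p)"
      using iso(3)[of X Y] X Y a b LB_Units_iff[OF p LB_add(2)[OF av a(1) b(1)]] LB_add(1)[OF av a(1) b(1)] by simp
    then show ?thesis using X Y Stalk_Units_iff[OF p] by simp
  qed
  have smult: "Y \<otimes>\<^bsub>Sp p\<^esub> X \<in> ?m" if X: "X \<in> ?m" and Y: "Y \<in> carrier (Sp p)" for X Y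
  proof -
    have "Y \<otimes>\<^bsub>Sp p\<^esub> X \<notin> Units (Sp p)"
      using S.unit_factor[of X Y] X Y S.m_comm[of X Y] by auto
    then show ?thesis using X Y by simp
  qed
  have zero: "\<zero>\<^bsub>Sp p\<^esub> \<in> ?m"
  proof -
    have "val p \<zero>\<^bsub>Sp p\<^esub> \<notin> Units (LB p)"
      using val_iso(2)[OF p] zero_LB LB_Units_iff[OF p, of \<zero> \<one>] reg.zero_fracs[OF av] p.zero_closed
      by (simp add: reg_module_def)
    then show ?thesis using Stalk_Units_iff[OF p S.zero_closed] by simp
  qed
  have "ideal ?m (Sp p)"
  proof (rule idealI[OF S.ring_axioms])
    have "\<ominus>\<^bsub>Sp p\<^esub> X \<in> ?m" if "X \<in> ?m" for X
      using smult[OF that, of "\<ominus>\<^bsub>Sp p\<^esub> \<one>\<^bsub>Sp p\<^esub>"] that by (simp add: S.l_minus)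
    then show "subgroup ?m (add_monoid (Sp p))"
      using add zero by (intro S.add.subgroupI) (auto simp: a_inv_def[symmetric])
  next
    fix X Y assume X: "X \<in> ?m" and Y: "Y \<in> carrier (Sp p)"
    show "Y \<otimes>\<^bsub>Sp p\<^esub> X \<in> ?m" by (rule smult[OF X Y])
    then show "X \<otimes>\<^bsub>Sp p\<^esub> Y \<in> ?m" using X Y S.m_comm[of X Y] by simp
  qed
  then show ?thesis
  proof (rule primeidealI[OF _ S.cring_axioms])
    show "carrier (Sp p) \<noteq> ?m" using S.Units_one_closed S.one_closed by blast
    show "\<And>a b. \<lbrakk>a \<in> carrier (Sp p); b \<in> carrier (Sp p); a \<otimes>\<^bsub>Sp p\<^esub> b \<in> ?m\<rbrakk> \<Longrightarrow> a \<in> ?m \<or> b \<in> ?m"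
      using S.Units_m_closed by blast
  qed
qed

text \<open>By the evaluation of tensors, which is faithful and surjective, the stalk of the restricted sheaf is
  the localization \<open>LQ p\<close> of \<open>N / F N\<close>. Its elements have the form \<open>x / h\<close>, and \<open>a / g\<close> annihilates \<open>x / h\<close> if and only
  if \<open>u a x\<close> lies in \<open>F N\<close> for some homogeneous \<open>u\<close> outside \<open>p\<close>.\<close>

theorem associated_points_iff:
  "p \<in> associated_points T SS (restrict_to_subscheme B gr NN J) \<longleftrightarrow>
     p \<in> Proj B gr \<and> (\<exists>d. \<exists>x\<in>ngr d. \<forall>e. \<forall>a\<in>gr e.
       a \<in> p \<longleftrightarrow> (\<exists>i. \<exists>u\<in>gr i - p. u \<bullet> (a \<bullet> x) \<in> Z))"
proof (cases "p \<in> Proj B gr")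
  case False
  then show ?thesis by (simp add: associated_points_def topspace_T)
next
  case p: True
  note av = Proj_avoidable[OF p]
  let ?S = "Sp p" and ?F = "stalk T SS FF p"
  interpret S: cring "Sp p" by (rule cring_Stalk[OF p])
  interpret E: tensor_evaluation T SS NN QQ "LB p" "LQ p" p "\<lambda>U a. a p" "pairing p"
    by (rule tensor_evaluation_pairing[OF p])
  interpret PE: presheaf_evaluation T SS TP p "LQ p" "\<lambda>U a. a p" E.tensor_ev
    by (rule E.presheaf_evaluation_tensor)
  interpret FE: presheaf_evaluation T SS FF p "LQ p" "\<lambda>U a. a p" "\<lambda>U \<sigma>. PE.stalk_ev (\<sigma> p)"
    by (rule PE.presheaf_evaluation_sheafify)
  have top: "p \<in> topspace T" using p topspace_T by blast
  have faithful: "FE.faithful" by (rule PE.faithful_sheafify[OF tensor_evaluation_faithful[OF p]])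
  have fzero: "\<zero>\<^bsub>?F\<^esub> \<in> carrier ?F" "FE.stalk_ev \<zero>\<^bsub>?F\<^esub> = \<zero>\<^bsub>LQ p\<^esub>"
    using top FE.Stalk_zero[OF openin_topspace top] FE.germ_in_Stalk[where p = p and U = "topspace T" and s = "\<zero>\<^bsub>sections FF (topspace T)\<^esub>"]
      FE.zero_closed[OF openin_topspace] FE.stalk_ev_zero[OF top] by auto
  have ann: "X \<odot>\<^bsub>?F\<^esub> \<xi> = \<zero>\<^bsub>?F\<^esub> \<longleftrightarrow> val p X \<odot>\<^bsub>LQ p\<^esub> FE.stalk_ev \<xi> = \<zero>\<^bsub>LQ p\<^esub>"
    if X: "X \<in> carrier ?S" and \<xi>: "\<xi> \<in> carrier ?F" for X \<xi>
  proof -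
    obtain U a where a: "SS_section p U a" "X = germ T SS p U a" using X by (rule PQ.Stalk_cases)
    have ev: "FE.stalk_ev (X \<odot>\<^bsub>?F\<^esub> \<xi>) = val p X \<odot>\<^bsub>LQ p\<^esub> FE.stalk_ev \<xi>"
      using FE.stalk_ev_smult[OF a(1) \<xi>] a val_germ[of U p a] by simp
    obtain V t where t: "FE.section_at p V t" "\<xi> = germ T FF p V t" using \<xi> by (rule FE.Stalk_cases)
    have W: "openin T (U \<inter> V)" using a(1) t(1) by blast
    have "X \<odot>\<^bsub>?F\<^esub> \<xi> \<in> carrier ?F"
      unfolding a(2) t(2) FE.Stalk_smult[OF a(1) t(1)]
      using a(1) t(1) W by (intro FE.germ_in_Stalk conjI FE.smult_closed PQ.res_closed[of U] FE.res_closed[of V]) auto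
    then show ?thesis
      using FE.faithful_stalk_ev[OF faithful] ev fzero(2) by metis
  qed
  have surj: "\<exists>\<xi>\<in>carrier ?F. FE.stalk_ev \<xi> = y" if y: "y \<in> carrier (LQ p)" for y
  proof -
    obtain W X where W: "openin T W" "p \<in> W" "X \<in> carrier (sections TP W)" "E.tensor_ev W X = y"
      using tensor_evaluation_surjective[OF p y] by blast
    let ?\<sigma> = "\<lambda>q\<in>W. germ T TP q W X"
    have \<sigma>: "?\<sigma> \<in> carrier (sections FF W)" by (rule TPP.section_Sh[OF W(1,3)])
    have "FE.stalk_ev (germ T FF p W ?\<sigma>) = y"
      using FE.stalk_ev_germ[where U = W and s = ?\<sigma>] PE.stalk_ev_germ[where U = W and s = X] W \<sigma> by simp
    then show ?thesis using FE.germ_in_Stalk[where p = p and U = W and s = ?\<sigma>] W \<sigma> by blast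
  qed
  have act: "bfrac p a g \<odot>\<^bsub>LQ p\<^esub> qfrac p x h = \<zero>\<^bsub>LQ p\<^esub> \<longleftrightarrow> (\<exists>i. \<exists>u\<in>gr i - p. u \<bullet> (a \<bullet> x) \<in> Z)"
    if "(a, g) \<in> bfracs p" "(x, h) \<in> fracs p" for a g x h
    unfolding LQ_smult[OF av that] by (rule qfrac_zero_iff[OF av smult_fracs[OF av that]])
  have "carrier ?S - Units ?S \<in> associated_primes ?S ?F \<longleftrightarrow>
    (\<exists>\<xi>\<in>carrier ?F. \<forall>X\<in>carrier ?S. X \<notin> Units ?S \<longleftrightarrow> X \<odot>\<^bsub>?F\<^esub> \<xi> = \<zero>\<^bsub>?F\<^esub>)"
    using primeideal_nonunits[OF p] unfolding associated_primes_def annihilator_def by blast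
  also have "\<dots> \<longleftrightarrow> (\<exists>\<xi>\<in>carrier ?F. \<forall>X\<in>carrier ?S. val p X \<notin> Units (LB p) \<longleftrightarrow> val p X \<odot>\<^bsub>LQ p\<^esub> FE.stalk_ev \<xi> = \<zero>\<^bsub>LQ p\<^esub>)"
    using Stalk_Units_iff[OF p] ann by (intro bex_cong ball_cong refl) simp
  also have "\<dots> \<longleftrightarrow> (\<exists>y\<in>carrier (LQ p). \<forall>X\<in>carrier ?S. val p X \<notin> Units (LB p) \<longleftrightarrow> val p X \<odot>\<^bsub>LQ p\<^esub> y = \<zero>\<^bsub>LQ p\<^esub>)"
    (is "?l \<longleftrightarrow> ?r")
  proof
    assume ?l
    then obtain \<xi> where \<xi>: "\<xi> \<in> carrier ?F" and
      "\<forall>X\<in>carrier ?S. val p X \<notin> Units (LB p) \<longleftrightarrow> val p X \<odot>\<^bsub>LQ p\<^esub> FE.stalk_ev \<xi> = \<zero>\<^bsub>LQ p\<^esub>" by (rule bexE)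
    then show ?r by (intro bexI[of _ "FE.stalk_ev \<xi>"] FE.stalk_ev_closed[OF \<xi>])
  next
    assume ?r
    then obtain y where y: "y \<in> carrier (LQ p)" and
      h: "\<forall>X\<in>carrier ?S. val p X \<notin> Units (LB p) \<longleftrightarrow> val p X \<odot>\<^bsub>LQ p\<^esub> y = \<zero>\<^bsub>LQ p\<^esub>" by (rule bexE)
    obtain \<xi> where \<xi>: "\<xi> \<in> carrier ?F" "FE.stalk_ev \<xi> = y" using surj[OF y] by (rule bexE)
    show ?l by (rule bexI[OF _ \<xi>(1)]) (unfold \<xi>(2), rule h)
  qed
  also have "\<dots> \<longleftrightarrow> (\<exists>y\<in>carrier (LQ p). \<forall>(a, g)\<in>bfracs p. a \<in> p \<longleftrightarrow> bfrac p a g \<odot>\<^bsub>LQ p\<^esub> y = \<zero>\<^bsub>LQ p\<^esub>)"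
  proof (rule bex_cong[OF refl])
    fix y
    have img: "val p ` carrier ?S = carrier (LB p)"
      using ring_iso_memE(5)[OF val_iso(1)[OF p]] by (rule bij_betw_imp_surj_on)
    have "(\<forall>X\<in>carrier ?S. val p X \<notin> Units (LB p) \<longleftrightarrow> val p X \<odot>\<^bsub>LQ p\<^esub> y = \<zero>\<^bsub>LQ p\<^esub>)
      \<longleftrightarrow> (\<forall>A\<in>carrier (LB p). A \<notin> Units (LB p) \<longleftrightarrow> A \<odot>\<^bsub>LQ p\<^esub> y = \<zero>\<^bsub>LQ p\<^esub>)"
      unfolding img[symmetric] by blast
    also have "\<dots> \<longleftrightarrow> (\<forall>(a, g)\<in>bfracs p. a \<in> p \<longleftrightarrow> bfrac p a g \<odot>\<^bsub>LQ p\<^esub> y = \<zero>\<^bsub>LQ p\<^esub>)"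
    proof
      assume h: "\<forall>A\<in>carrier (LB p). A \<notin> Units (LB p) \<longleftrightarrow> A \<odot>\<^bsub>LQ p\<^esub> y = \<zero>\<^bsub>LQ p\<^esub>"
      have "a \<in> p \<longleftrightarrow> bfrac p a g \<odot>\<^bsub>LQ p\<^esub> y = \<zero>\<^bsub>LQ p\<^esub>" if "(a, g) \<in> bfracs p" for a g
        using h bfrac_in_LB[OF that] LB_Units_iff[OF p that] by blast
      then show "\<forall>(a, g)\<in>bfracs p. a \<in> p \<longleftrightarrow> bfrac p a g \<odot>\<^bsub>LQ p\<^esub> y = \<zero>\<^bsub>LQ p\<^esub>" by blast
    next
      assume a: "\<forall>(a, g)\<in>bfracs p. a \<in> p \<longleftrightarrow> bfrac p a g \<odot>\<^bsub>LQ p\<^esub> y = \<zero>\<^bsub>LQ p\<^esub>"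
      show "\<forall>A\<in>carrier (LB p). A \<notin> Units (LB p) \<longleftrightarrow> A \<odot>\<^bsub>LQ p\<^esub> y = \<zero>\<^bsub>LQ p\<^esub>"
      proof
        fix A assume "A \<in> carrier (LB p)"
        then obtain b k where bk: "(b, k) \<in> bfracs p" "A = bfrac p b k" by (rule LB_cases)
        show "A \<notin> Units (LB p) \<longleftrightarrow> A \<odot>\<^bsub>LQ p\<^esub> y = \<zero>\<^bsub>LQ p\<^esub>"
          using a bk(1) LB_Units_iff[OF p bk(1)] unfolding bk(2) by blast
      qed
    qed
    finally show "(\<forall>X\<in>carrier ?S. val p X \<notin> Units (LB p) \<longleftrightarrow> val p X \<odot>\<^bsub>LQ p\<^esub> y = \<zero>\<^bsub>LQ p\<^esub>)
      \<longleftrightarrow> (\<forall>(a, g)\<in>bfracs p. a \<in> p \<longleftrightarrow> bfrac p a g \<odot>\<^bsub>LQ p\<^esub> y = \<zero>\<^bsub>LQ p\<^esub>)" .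
  qed
  also have "\<dots> \<longleftrightarrow> (\<exists>d. \<exists>x\<in>ngr d. \<forall>e. \<forall>a\<in>gr e. a \<in> p \<longleftrightarrow> (\<exists>i. \<exists>u\<in>gr i - p. u \<bullet> (a \<bullet> x) \<in> Z))"
    (is "?l \<longleftrightarrow> ?r")
  proof
    assume ?l
    then obtain y where y1: "y \<in> carrier (LQ p)" and h: "\<forall>(a, g)\<in>bfracs p. a \<in> p \<longleftrightarrow> bfrac p a g \<odot>\<^bsub>LQ p\<^esub> y = \<zero>\<^bsub>LQ p\<^esub>"
      by (rule bexE)
    have y2: "a \<in> p \<longleftrightarrow> bfrac p a g \<odot>\<^bsub>LQ p\<^esub> y = \<zero>\<^bsub>LQ p\<^esub>" if "(a, g) \<in> bfracs p" for a g
      using bspec[OF h that] by simp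
    obtain x h d where x: "x \<in> ngr d" "h \<in> gr d" "h \<notin> p" "y = qfrac p x h" using y1 by (rule LQ_cases)
    have "a \<in> p \<longleftrightarrow> (\<exists>i. \<exists>u\<in>gr i - p. u \<bullet> (a \<bullet> x) \<in> Z)" if a: "a \<in> gr e" for e a
    proof -
      obtain g where "g \<in> gr e" "g \<notin> p" using power_not_in[OF p] by blast
      then have ag: "(a, g) \<in> bfracs p" using a by (auto simp: hfracs_def)
      show ?thesis unfolding y2[OF ag] x(4) by (rule act[OF ag fracsI[OF x(1-3)]])
    qed
    then show ?r using x(1) by blast
  next
    assume ?r
    then obtain d x where x: "x \<in> ngr d"
      and x2: "\<forall>e. \<forall>a\<in>gr e. a \<in> p \<longleftrightarrow> (\<exists>i. \<exists>u\<in>gr i - p. u \<bullet> (a \<bullet> x) \<in> Z)"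
      by (elim exE bexE)
    obtain h where h: "h \<in> gr d" "h \<notin> p" using power_not_in[OF p] by blast
    have xh: "(x, h) \<in> fracs p" using x h by (rule fracsI)
    have "a \<in> p \<longleftrightarrow> bfrac p a g \<odot>\<^bsub>LQ p\<^esub> qfrac p x h = \<zero>\<^bsub>LQ p\<^esub>" if ag: "(a, g) \<in> bfracs p" for a g
    proof -
      obtain e where "a \<in> gr e" using ag by (auto simp: hfracs_def)
      then show ?thesis unfolding act[OF ag xh] using x2 by simp
    qed
    then have "\<forall>(a, g)\<in>bfracs p. a \<in> p \<longleftrightarrow> bfrac p a g \<odot>\<^bsub>LQ p\<^esub> qfrac p x h = \<zero>\<^bsub>LQ p\<^esub>"
      by (intro ballI) (simp only: split_paired_all case_prod_conv)
    then show ?l by (intro bexI[OF _ Q.frac_in_LN[OF qfracs[OF xh]]])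
  qed
  finally show ?thesis using p top by (simp add: associated_points_def restrict_to_subscheme_eq)
qed

end


section \<open>The Rees ring and the Rees module\<close>

context ideal_module
begin

abbreviation BB where "BB \<equiv> rees_ring R I"
abbreviation BM where "BM \<equiv> rees_module R I M"
abbreviation bgr where "bgr \<equiv> rees_degree R I"
abbreviation mgr where "mgr \<equiv> rees_module_degree R I M"

lemmas ipow_ideal = R.ideal_ideal_power[OF I]
lemmas ipow_zero = additive_subgroup.zero_closed[OF ideal.axioms(1)[OF ipow_ideal]]
lemmas ipow_add = additive_subgroup.a_closed[OF ideal.axioms(1)[OF ipow_ideal]]
lemmas ipow_minus = additive_subgroup.a_inv_closed[OF ideal.axioms(1)[OF ipow_ideal]]

text \<open>A polynomial is represented by its coefficient function, so elements of the Rees ring are sequences.\<close>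

lemma carrier_BB: "p \<in> carrier BB \<longleftrightarrow> (\<forall>n. p n \<in> ipow n) \<and> (\<exists>n. \<forall>m>n. p m = \<zero>)"
proof
  assume "p \<in> carrier BB"
  then have up: "p \<in> up R" and c: "\<forall>n. coeff (UP R) p n \<in> ipow n"
    by (simp add: rees_ring_def UP_def, simp add: rees_ring_def)
  from c have "\<forall>n. p n \<in> ipow n" using up by (simp add: UP_def)
  moreover have "\<exists>n. \<forall>m>n. p m = \<zero>" using up by (auto simp: up_def bound_def)
  ultimately show "(\<forall>n. p n \<in> ipow n) \<and> (\<exists>n. \<forall>m>n. p m = \<zero>)" ..
next
  assume p: "(\<forall>n. p n \<in> ipow n) \<and> (\<exists>n. \<forall>m>n. p m = \<zero>)"
  then have "p \<in> up R" using ideal_power_carrier by (auto simp: up_def bound_def)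
  then show "p \<in> carrier BB" using p by (simp add: rees_ring_def UP_def)
qed

lemma BB_up: "p \<in> carrier BB \<Longrightarrow> p \<in> up R"
  by (simp add: rees_ring_def UP_def)

lemma BB_coeff: "p \<in> carrier BB \<Longrightarrow> p n \<in> ipow n"
  by (simp add: carrier_BB)

lemma BB_coeff_R: "p \<in> carrier BB \<Longrightarrow> p n \<in> carrier R"
  using BB_coeff ideal_power_carrier by blast

lemma BB_simps:
  "\<zero>\<^bsub>BB\<^esub> = (\<lambda>_. \<zero>)" "\<one>\<^bsub>BB\<^esub> = (\<lambda>n. if n = 0 then \<one> else \<zero>)"
  "\<lbrakk>p \<in> carrier BB; q \<in> carrier BB\<rbrakk> \<Longrightarrow> p \<oplus>\<^bsub>BB\<^esub> q = (\<lambda>n. p n \<oplus> q n)"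
  "\<lbrakk>p \<in> carrier BB; q \<in> carrier BB\<rbrakk> \<Longrightarrow> p \<otimes>\<^bsub>BB\<^esub> q = (\<lambda>n. \<Oplus>i\<in>{..n}. p i \<otimes> q (n - i))"
  by (simp_all add: rees_ring_def UP_def up_def bound_def restrict_def)

lemma finsum_in_ideal:
  assumes J: "ideal J R"
  shows "finite A \<Longrightarrow> (\<And>i. i \<in> A \<Longrightarrow> g i \<in> J) \<Longrightarrow> (\<Oplus>i\<in>A. g i) \<in> J"
proof (induction A rule: finite_induct)
  case (insert x A)
  then show ?case
    using ideal.Icarr[OF J] additive_subgroup.a_closed[OF ideal.axioms(1)[OF J]]
    by (subst R.finsum_insert) auto
qed (simp add: additive_subgroup.zero_closed[OF ideal.axioms(1)[OF J]])

lemma cring_BB: "cring BB"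
proof -
  interpret P: UP_cring R "UP R" by (intro UP_cring.intro) (rule R.cring_axioms, simp add: UP_def)
  have sub: "x \<in> carrier (UP R)" if "x \<in> carrier BB" for x using that by (simp add: rees_ring_def)
  have eqs: "\<zero>\<^bsub>BB\<^esub> = \<zero>\<^bsub>UP R\<^esub>" "\<one>\<^bsub>BB\<^esub> = \<one>\<^bsub>UP R\<^esub>" "p \<oplus>\<^bsub>BB\<^esub> q = p \<oplus>\<^bsub>UP R\<^esub> q" "p \<otimes>\<^bsub>BB\<^esub> q = p \<otimes>\<^bsub>UP R\<^esub> q" for p q
    by (simp_all add: rees_ring_def)
  have mem: "p \<in> carrier BB \<longleftrightarrow> p \<in> carrier (UP R) \<and> (\<forall>n. coeff (UP R) p n \<in> ipow n)" for p
    by (simp add: rees_ring_def)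
  have zero: "\<zero>\<^bsub>BB\<^esub> \<in> carrier BB" by (simp add: mem eqs ipow_zero)
  have one: "\<one>\<^bsub>BB\<^esub> \<in> carrier BB" by (simp add: mem eqs ipow_zero)
  have add: "p \<oplus>\<^bsub>BB\<^esub> q \<in> carrier BB" if "p \<in> carrier BB" "q \<in> carrier BB" for p q
    using that by (simp add: mem eqs ipow_add)
  have mult: "p \<otimes>\<^bsub>BB\<^esub> q \<in> carrier BB" if p: "p \<in> carrier BB" and q: "q \<in> carrier BB" for p q
  proof -
    have "coeff (UP R) p i \<otimes> coeff (UP R) q (n - i) \<in> ipow n" if "i \<in> {..n}" for i n
      using R.ideal_power_mult[OF I, of "coeff (UP R) p i" i "coeff (UP R) q (n - i)" "n - i"] p q that by (simp add: mem)
    then have "(\<Oplus>i\<in>{..n}. coeff (UP R) p i \<otimes> coeff (UP R) q (n - i)) \<in> ipow n" for n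
      by (intro finsum_in_ideal[OF ipow_ideal]) auto
    then show ?thesis using p q by (simp add: mem eqs)
  qed
  show ?thesis
  proof (rule cringI)
    show "abelian_group BB"
    proof (rule abelian_groupI)
      fix p assume p: "p \<in> carrier BB"
      then have pP: "p \<in> carrier (UP R)" by (rule sub)
      show "\<zero>\<^bsub>BB\<^esub> \<oplus>\<^bsub>BB\<^esub> p = p" using pP by (simp add: eqs)
      have "\<ominus>\<^bsub>UP R\<^esub> p \<in> carrier BB"
        using pP p by (simp add: mem ipow_minus)
      then show "\<exists>q\<in>carrier BB. q \<oplus>\<^bsub>BB\<^esub> p = \<zero>\<^bsub>BB\<^esub>"
        using pP by (intro bexI[of _ "\<ominus>\<^bsub>UP R\<^esub> p"]) (auto simp: eqs P.P.l_neg)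
    qed (use zero add in \<open>simp_all add: eqs sub P.P.a_ac\<close>)
    show "comm_monoid BB"
      using one mult by (intro comm_monoidI) (simp_all add: eqs sub P.P.m_ac)
  qed (simp add: eqs sub P.P.l_distr)
qed

lemma carrier_BM: "y \<in> carrier BM \<longleftrightarrow> (\<forall>n. y n \<in> X n) \<and> finite {n. y n \<noteq> \<zero>\<^sub>M}"
  by (simp add: rees_module_def)

lemma BM_coeff: "y \<in> carrier BM \<Longrightarrow> y n \<in> X n"
  by (simp add: carrier_BM)

lemma BM_coeff_M: "y \<in> carrier BM \<Longrightarrow> y n \<in> carrier M"
  using BM_coeff X_carrier by blast

lemma BM_simps:
  "\<zero>\<^bsub>BM\<^esub> = (\<lambda>_. \<zero>\<^sub>M)"
  "y \<oplus>\<^bsub>BM\<^esub> z = (\<lambda>n. y n \<oplus>\<^sub>M z n)"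
  "p \<in> carrier BB \<Longrightarrow> p \<odot>\<^bsub>BM\<^esub> y = (\<lambda>n. \<Oplus>\<^bsub>M\<^esub>i\<in>{..n}. p i \<bullet> y (n - i))"
  using BB_up by (simp_all add: rees_module_def UP_def)

lemma finsum_in_submodule:
  assumes H: "submodule H R M"
  shows "finite A \<Longrightarrow> (\<And>i. i \<in> A \<Longrightarrow> g i \<in> H) \<Longrightarrow> (\<Oplus>\<^bsub>M\<^esub>i\<in>A. g i) \<in> H"
proof (induction A rule: finite_induct)
  case (insert x A)
  then show ?case
    using submoduleE(1)[OF H] by (subst M.finsum_insert) (auto intro!: submoduleE(5)[OF H])
qed (simp add: submodule_zero[OF H])

text \<open>As for the product of polynomials: the partial sums up to \<open>k\<close> of the two double sums over
  \<open>i + j \<le> n\<close> agree, by induction on \<open>k\<close>.\<close>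

lemma BM_smult_assoc:
  assumes p: "p \<in> carrier BB" and q: "q \<in> carrier BB" and y: "y \<in> carrier BM"
  shows "(\<Oplus>\<^bsub>M\<^esub>j\<in>{..n}. (\<Oplus>i\<in>{..j}. p i \<otimes> q (j - i)) \<bullet> y (n - j))
    = (\<Oplus>\<^bsub>M\<^esub>j\<in>{..n}. p j \<bullet> (\<Oplus>\<^bsub>M\<^esub>i\<in>{..n - j}. q i \<bullet> y (n - j - i)))"
proof -
  note c [simp] = BB_coeff_R[OF p] BB_coeff_R[OF q] BM_coeff_M[OF y]
  have "k \<le> n \<Longrightarrow> (\<Oplus>\<^bsub>M\<^esub>j\<in>{..k}. (\<Oplus>i\<in>{..j}. p i \<otimes> q (j - i)) \<bullet> y (n - j))
    = (\<Oplus>\<^bsub>M\<^esub>j\<in>{..k}. p j \<bullet> (\<Oplus>\<^bsub>M\<^esub>i\<in>{..k - j}. q i \<bullet> y (n - j - i)))" for k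
  proof (induction k)
    case 0
    then show ?case by (simp add: Pi_def smult_assoc1)
  next
    case (Suc k)
    have fs: "(\<Oplus>i\<in>{..j}. p i \<otimes> q (j - i)) \<in> carrier R" for j by (intro R.finsum_closed) simp
    have fm: "(\<Oplus>\<^bsub>M\<^esub>i\<in>{..l}. q i \<bullet> y (n - j - i)) \<in> carrier M" for j l by (intro M.finsum_closed) simp
    have smult_sum: "(\<Oplus>i\<in>A. g i) \<bullet> x = (\<Oplus>\<^bsub>M\<^esub>i\<in>A. g i \<bullet> x)"
      if "finite A" "g \<in> A \<rightarrow> carrier R" "x \<in> carrier M" for A :: "nat set" and g x
      using that
    proof (induction A rule: finite_induct)
      case (insert a A)
      then show ?case by (simp add: smult_l_distr Pi_def)
    qed simp
    have "(\<Oplus>i\<in>{..Suc k}. p i \<otimes> q (Suc k - i)) \<bullet> y (n - Suc k)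
        = (\<Oplus>\<^bsub>M\<^esub>i\<in>{..Suc k}. p i \<bullet> (q (Suc k - i) \<bullet> y (n - Suc k)))"
    proof -
      have "(\<Oplus>i\<in>{..Suc k}. p i \<otimes> q (Suc k - i)) \<bullet> y (n - Suc k)
          = (\<Oplus>\<^bsub>M\<^esub>i\<in>{..Suc k}. (p i \<otimes> q (Suc k - i)) \<bullet> y (n - Suc k))"
        by (rule smult_sum) auto
      also have "\<dots> = (\<Oplus>\<^bsub>M\<^esub>i\<in>{..Suc k}. p i \<bullet> (q (Suc k - i) \<bullet> y (n - Suc k)))"
        by (intro M.finsum_cong') (auto simp: smult_assoc1)
      finally show ?thesis .
    qed
    also have "\<dots> = p (Suc k) \<bullet> (q 0 \<bullet> y (n - Suc k))
        \<oplus>\<^sub>M (\<Oplus>\<^bsub>M\<^esub>i\<in>{..k}. p i \<bullet> (q (Suc k - i) \<bullet> y (n - Suc k)))"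
      by (simp add: Pi_def)
    finally have top: "(\<Oplus>i\<in>{..Suc k}. p i \<otimes> q (Suc k - i)) \<bullet> y (n - Suc k)
      = p (Suc k) \<bullet> (q 0 \<bullet> y (n - Suc k))
        \<oplus>\<^sub>M (\<Oplus>\<^bsub>M\<^esub>i\<in>{..k}. p i \<bullet> (q (Suc k - i) \<bullet> y (n - Suc k)))" .
    have inner: "p j \<bullet> (\<Oplus>\<^bsub>M\<^esub>i\<in>{..Suc k - j}. q i \<bullet> y (n - j - i))
        = p j \<bullet> (q (Suc k - j) \<bullet> y (n - Suc k)) \<oplus>\<^sub>M p j \<bullet> (\<Oplus>\<^bsub>M\<^esub>i\<in>{..k - j}. q i \<bullet> y (n - j - i))"
      if j: "j \<le> k" for j
    proof -
      have "Suc k - j = Suc (k - j)" "n - j - Suc (k - j) = n - Suc k" using j by auto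
      then show ?thesis using fm by (simp add: Pi_def smult_r_distr)
    qed
    have "(\<Oplus>\<^bsub>M\<^esub>j\<in>{..k}. p j \<bullet> (\<Oplus>\<^bsub>M\<^esub>i\<in>{..Suc k - j}. q i \<bullet> y (n - j - i)))
        = (\<Oplus>\<^bsub>M\<^esub>j\<in>{..k}. p j \<bullet> (q (Suc k - j) \<bullet> y (n - Suc k))
            \<oplus>\<^sub>M p j \<bullet> (\<Oplus>\<^bsub>M\<^esub>i\<in>{..k - j}. q i \<bullet> y (n - j - i)))"
      using inner fm by (intro M.finsum_cong') auto
    also have "\<dots> = (\<Oplus>\<^bsub>M\<^esub>j\<in>{..k}. p j \<bullet> (q (Suc k - j) \<bullet> y (n - Suc k)))
        \<oplus>\<^sub>M (\<Oplus>\<^bsub>M\<^esub>j\<in>{..k}. p j \<bullet> (\<Oplus>\<^bsub>M\<^esub>i\<in>{..k - j}. q i \<bullet> y (n - j - i)))"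
      using fm by (intro M.finsum_addf) auto
    finally have low: "(\<Oplus>\<^bsub>M\<^esub>j\<in>{..k}. p j \<bullet> (\<Oplus>\<^bsub>M\<^esub>i\<in>{..Suc k - j}. q i \<bullet> y (n - j - i)))
      = (\<Oplus>\<^bsub>M\<^esub>j\<in>{..k}. p j \<bullet> (q (Suc k - j) \<bullet> y (n - Suc k)))
        \<oplus>\<^sub>M (\<Oplus>\<^bsub>M\<^esub>j\<in>{..k}. p j \<bullet> (\<Oplus>\<^bsub>M\<^esub>i\<in>{..k - j}. q i \<bullet> y (n - j - i)))" .
    have IH: "(\<Oplus>\<^bsub>M\<^esub>j\<in>{..k}. (\<Oplus>i\<in>{..j}. p i \<otimes> q (j - i)) \<bullet> y (n - j))
      = (\<Oplus>\<^bsub>M\<^esub>j\<in>{..k}. p j \<bullet> (\<Oplus>\<^bsub>M\<^esub>i\<in>{..k - j}. q i \<bullet> y (n - j - i)))"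
      using Suc by simp
    let ?A = "\<Oplus>\<^bsub>M\<^esub>j\<in>{..k}. p j \<bullet> (\<Oplus>\<^bsub>M\<^esub>i\<in>{..k - j}. q i \<bullet> y (n - j - i))"
    let ?C = "\<Oplus>\<^bsub>M\<^esub>i\<in>{..k}. p i \<bullet> (q (Suc k - i) \<bullet> y (n - Suc k))"
    let ?t = "p (Suc k) \<bullet> (q 0 \<bullet> y (n - Suc k))"
    have cA: "?A \<in> carrier M" "?C \<in> carrier M" "?t \<in> carrier M" using fm by (auto intro!: M.finsum_closed)
    have "(\<Oplus>\<^bsub>M\<^esub>j\<in>{..Suc k}. (\<Oplus>i\<in>{..j}. p i \<otimes> q (j - i)) \<bullet> y (n - j))
       = (\<Oplus>i\<in>{..Suc k}. p i \<otimes> q (Suc k - i)) \<bullet> y (n - Suc k)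
         \<oplus>\<^sub>M (\<Oplus>\<^bsub>M\<^esub>j\<in>{..k}. (\<Oplus>i\<in>{..j}. p i \<otimes> q (j - i)) \<bullet> y (n - j))"
      using fs by (intro M.finsum_Suc) auto
    also have "\<dots> = (?t \<oplus>\<^sub>M ?C) \<oplus>\<^sub>M ?A" by (simp only: top IH)
    also have "\<dots> = ?t \<oplus>\<^sub>M (?C \<oplus>\<^sub>M ?A)" using cA by (simp only: M.a_assoc)
    also have "\<dots> = p (Suc k) \<bullet> (\<Oplus>\<^bsub>M\<^esub>i\<in>{..Suc k - Suc k}. q i \<bullet> y (n - Suc k - i))
         \<oplus>\<^sub>M (\<Oplus>\<^bsub>M\<^esub>j\<in>{..k}. p j \<bullet> (\<Oplus>\<^bsub>M\<^esub>i\<in>{..Suc k - j}. q i \<bullet> y (n - j - i)))"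
      unfolding low by simp
    also have "\<dots> = (\<Oplus>\<^bsub>M\<^esub>j\<in>{..Suc k}. p j \<bullet> (\<Oplus>\<^bsub>M\<^esub>i\<in>{..Suc k - j}. q i \<bullet> y (n - j - i)))"
      using fm by (intro M.finsum_Suc[symmetric]) auto
    finally show ?case .
  qed
  from this[of n] show ?thesis by simp
qed

lemma module_BM: "module BB BM"
proof (rule moduleI[OF cring_BB])
  interpret B: cring BB by (rule cring_BB)
  have supp: "finite {n. y n \<oplus>\<^sub>M z n \<noteq> \<zero>\<^sub>M}" if "y \<in> carrier BM" "z \<in> carrier BM" for y z
  proof (rule finite_subset)
    show "{n. y n \<oplus>\<^sub>M z n \<noteq> \<zero>\<^sub>M} \<subseteq> {n. y n \<noteq> \<zero>\<^sub>M} \<union> {n. z n \<noteq> \<zero>\<^sub>M}" by auto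
  qed (use that in \<open>auto simp: carrier_BM\<close>)
  show "abelian_group BM"
  proof (rule abelian_groupI)
    fix y assume y: "y \<in> carrier BM"
    have "(\<lambda>n. \<ominus>\<^sub>M y n) \<in> carrier BM"
    proof -
      have "{n. \<ominus>\<^sub>M y n \<noteq> \<zero>\<^sub>M} \<subseteq> {n. y n \<noteq> \<zero>\<^sub>M}"
        using M.minus_equality[of "\<zero>\<^sub>M" "\<zero>\<^sub>M"] by auto
      then show ?thesis
        using y submoduleE(3)[OF submodule_X] by (auto simp: carrier_BM intro: finite_subset)
    qed
    then show "\<exists>z\<in>carrier BM. z \<oplus>\<^bsub>BM\<^esub> y = \<zero>\<^bsub>BM\<^esub>"
      using BM_coeff_M[OF y] by (intro bexI[of _ "\<lambda>n. \<ominus>\<^sub>M y n"]) (simp_all add: BM_simps M.l_neg)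
    show "\<zero>\<^bsub>BM\<^esub> \<oplus>\<^bsub>BM\<^esub> y = y" using BM_coeff_M[OF y] by (simp add: BM_simps)
    fix z assume z: "z \<in> carrier BM"
    show "y \<oplus>\<^bsub>BM\<^esub> z \<in> carrier BM"
      using y z supp by (simp add: carrier_BM BM_simps X_add)
    show "y \<oplus>\<^bsub>BM\<^esub> z = z \<oplus>\<^bsub>BM\<^esub> y"
      using BM_coeff_M[OF y] BM_coeff_M[OF z] by (simp add: BM_simps M.a_comm)
    fix w assume w: "w \<in> carrier BM"
    show "y \<oplus>\<^bsub>BM\<^esub> z \<oplus>\<^bsub>BM\<^esub> w = y \<oplus>\<^bsub>BM\<^esub> (z \<oplus>\<^bsub>BM\<^esub> w)"
      using BM_coeff_M[OF y] BM_coeff_M[OF z] BM_coeff_M[OF w] by (simp add: BM_simps M.a_assoc)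
  qed (simp add: carrier_BM BM_simps X_zero)
  fix p y assume p: "p \<in> carrier BB" and y: "y \<in> carrier BM"
  note c = BB_coeff_R[OF p] BM_coeff_M[OF y]
  show "p \<odot>\<^bsub>BM\<^esub> y \<in> carrier BM"
  proof -
    have "(\<Oplus>\<^bsub>M\<^esub>i\<in>{..n}. p i \<bullet> y (n - i)) \<in> X n" for n
      using X_mult[OF BB_coeff[OF p] BM_coeff[OF y], of _ "n - _"]
      by (intro finsum_in_submodule[OF submodule_X]) (auto dest!: le_add_diff_inverse, metis X_mult BB_coeff[OF p] BM_coeff[OF y])
    moreover have "finite {n. (\<Oplus>\<^bsub>M\<^esub>i\<in>{..n}. p i \<bullet> y (n - i)) \<noteq> \<zero>\<^sub>M}"
    proof -
      obtain k where k: "\<And>m. m > k \<Longrightarrow> p m = \<zero>" using p by (auto simp: carrier_BB)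
      have "finite {n. y n \<noteq> \<zero>\<^sub>M}" using y by (simp add: carrier_BM)
      then obtain l where l: "\<And>m. m > l \<Longrightarrow> y m = \<zero>\<^sub>M"
        by (metis (mono_tags, lifting) finite_nat_set_iff_bounded_le mem_Collect_eq not_less)
      have "(\<Oplus>\<^bsub>M\<^esub>i\<in>{..n}. p i \<bullet> y (n - i)) = \<zero>\<^sub>M" if n: "n > k + l" for n
      proof -
        have "p i \<bullet> y (n - i) = \<zero>\<^sub>M" for i
          using k[of i] l[of "n - i"] n c by (cases "i > k") simp_all
        then show ?thesis by simp
      qed
      then have "{n. (\<Oplus>\<^bsub>M\<^esub>i\<in>{..n}. p i \<bullet> y (n - i)) \<noteq> \<zero>\<^sub>M} \<subseteq> {..k + l}"
        by (auto simp: not_less[symmetric])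
      then show ?thesis by (rule finite_subset) simp
    qed
    ultimately show ?thesis by (simp add: carrier_BM BM_simps(3)[OF p])
  qed
  show "p \<odot>\<^bsub>BM\<^esub> (y \<oplus>\<^bsub>BM\<^esub> z) = p \<odot>\<^bsub>BM\<^esub> y \<oplus>\<^bsub>BM\<^esub> p \<odot>\<^bsub>BM\<^esub> z" if z: "z \<in> carrier BM" for z
    using c BM_coeff_M[OF z] by (simp add: BM_simps(2) BM_simps(3)[OF p] smult_r_distr M.finsum_addf Pi_def)
  fix q assume q: "q \<in> carrier BB"
  show "(p \<oplus>\<^bsub>BB\<^esub> q) \<odot>\<^bsub>BM\<^esub> y = p \<odot>\<^bsub>BM\<^esub> y \<oplus>\<^bsub>BM\<^esub> q \<odot>\<^bsub>BM\<^esub> y"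
    using c BB_coeff_R[OF q] BM_simps(3)[OF B.a_closed[OF p q], of y]
    by (simp add: BM_simps(2) BM_simps(3)[OF p] BM_simps(3)[OF q] BB_simps(3)[OF p q] smult_l_distr M.finsum_addf Pi_def)
  show "p \<otimes>\<^bsub>BB\<^esub> q \<odot>\<^bsub>BM\<^esub> y = p \<odot>\<^bsub>BM\<^esub> (q \<odot>\<^bsub>BM\<^esub> y)"
    unfolding BM_simps(3)[OF B.m_closed[OF p q]]
    unfolding BM_simps(3)[OF p] BM_simps(3)[OF q] BB_simps(4)[OF p q]
    using BM_smult_assoc[OF p q y] by (rule ext)
next
  interpret B: cring BB by (rule cring_BB)
  fix y assume y: "y \<in> carrier BM"
  have "(\<Oplus>\<^bsub>M\<^esub>i\<in>{..n}. (if i = 0 then \<one> else \<zero>) \<bullet> y (n - i)) = y n" for n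
  proof -
    have "(\<Oplus>\<^bsub>M\<^esub>i\<in>{..n}. (if i = 0 then \<one> else \<zero>) \<bullet> y (n - i))
      = (\<Oplus>\<^bsub>M\<^esub>i\<in>{..n}. if 0 = i then y n else \<zero>\<^sub>M)"
      using BM_coeff_M[OF y] by (intro M.finsum_cong') auto
    also have "\<dots> = y n" using BM_coeff_M[OF y] by (intro M.finsum_singleton) auto
    finally show ?thesis .
  qed
  then show "\<one>\<^bsub>BB\<^esub> \<odot>\<^bsub>BM\<^esub> y = y" using BM_simps(3)[OF B.one_closed] by (simp add: BB_simps)
qed


subsection \<open>Homogeneous elements\<close>

definition hom_ring :: "nat \<Rightarrow> 'a \<Rightarrow> nat \<Rightarrow> 'a" where
  "hom_ring d a = (\<lambda>n. if n = d then a else \<zero>)"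

definition hom_module :: "nat \<Rightarrow> 'b \<Rightarrow> nat \<Rightarrow> 'b" where
  "hom_module d x = (\<lambda>n. if n = d then x else \<zero>\<^sub>M)"

lemma hom_ring_monom: "a \<in> carrier R \<Longrightarrow> monom (UP R) a d = hom_ring d a"
  by (simp add: UP_def hom_ring_def fun_eq_iff)

lemma hom_ring_BB: "a \<in> ipow d \<Longrightarrow> hom_ring d a \<in> carrier BB"
  by (auto simp: carrier_BB hom_ring_def ipow_zero)

lemma hom_ring_bgr: "a \<in> ipow d \<Longrightarrow> hom_ring d a \<in> bgr d"
  using BB_up[OF hom_ring_BB] hom_ring_BB by (auto simp: rees_degree_def UP_def) (simp add: hom_ring_def)

lemma bgr_cases:
  assumes "p \<in> bgr d" obtains a where "a \<in> ipow d" "p = hom_ring d a"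
proof -
  have p: "p \<in> carrier BB" and "\<forall>k. k \<noteq> d \<longrightarrow> coeff (UP R) p k = \<zero>"
    using assms by (auto simp: rees_degree_def)
  then have "\<forall>k. k \<noteq> d \<longrightarrow> p k = \<zero>" using BB_up[OF p] by (simp add: UP_def)
  then have "p = hom_ring d (p d)" by (auto simp: hom_ring_def)
  then show ?thesis using that BB_coeff[OF p] by blast
qed

lemma hom_module_BM: "x \<in> X d \<Longrightarrow> hom_module d x \<in> carrier BM"
  by (auto simp: carrier_BM hom_module_def X_zero)

lemma hom_module_mgr: "x \<in> X d \<Longrightarrow> hom_module d x \<in> mgr d"
  using hom_module_BM by (auto simp: rees_module_degree_def) (simp add: hom_module_def)

lemma mgr_cases:
  assumes "y \<in> mgr d" obtains x where "x \<in> X d" "y = hom_module d x"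
proof -
  have y: "y \<in> carrier BM" and "\<forall>k. k \<noteq> d \<longrightarrow> y k = \<zero>\<^sub>M"
    using assms by (auto simp: rees_module_degree_def)
  then have "y = hom_module d (y d)" by (auto simp: hom_module_def)
  then show ?thesis using that BM_coeff[OF y] by blast
qed

lemma hom_ring_add: "\<lbrakk>a \<in> ipow d; b \<in> ipow d\<rbrakk> \<Longrightarrow> hom_ring d a \<oplus>\<^bsub>BB\<^esub> hom_ring d b = hom_ring d (a \<oplus> b)"
  by (simp add: BB_simps(3) hom_ring_BB) (auto simp: hom_ring_def)

lemma hom_ring_zero: "hom_ring d \<zero> = \<zero>\<^bsub>BB\<^esub>"
  by (auto simp: BB_simps hom_ring_def)

lemma hom_module_zero: "hom_module d \<zero>\<^sub>M = \<zero>\<^bsub>BM\<^esub>"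
  by (auto simp: BM_simps hom_module_def)

lemma hom_module_add: "\<lbrakk>x \<in> X d; y \<in> X d\<rbrakk> \<Longrightarrow> hom_module d x \<oplus>\<^bsub>BM\<^esub> hom_module d y = hom_module d (x \<oplus>\<^sub>M y)"
  by (auto simp: BM_simps hom_module_def)

text \<open>In the convolution only the summand that belongs to the degree of the homogeneous factor is nonzero.\<close>

lemma hom_ring_smult:
  assumes a: "a \<in> ipow d" and y: "y \<in> carrier BM"
  shows "hom_ring d a \<odot>\<^bsub>BM\<^esub> y = (\<lambda>n. if d \<le> n then a \<bullet> y (n - d) else \<zero>\<^sub>M)"
proof
  fix n
  have ac: "a \<in> carrier R" using ideal_power_carrier[OF a] .
  note yc = BM_coeff_M[OF y]
  have eq: "(hom_ring d a \<odot>\<^bsub>BM\<^esub> y) n = (\<Oplus>\<^bsub>M\<^esub>i\<in>{..n}. hom_ring d a i \<bullet> y (n - i))"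
    by (simp add: BM_simps(3)[OF hom_ring_BB[OF a]])
  show "(hom_ring d a \<odot>\<^bsub>BM\<^esub> y) n = (if d \<le> n then a \<bullet> y (n - d) else \<zero>\<^sub>M)"
  proof (cases "d \<le> n")
    case True
    have "(\<Oplus>\<^bsub>M\<^esub>i\<in>{..n}. hom_ring d a i \<bullet> y (n - i)) = (\<Oplus>\<^bsub>M\<^esub>i\<in>{..n}. if d = i then a \<bullet> y (n - i) else \<zero>\<^sub>M)"
      using ac yc by (intro M.finsum_cong') (auto simp: hom_ring_def)
    also have "\<dots> = a \<bullet> y (n - d)" using True ac yc by (intro M.finsum_singleton) auto
    finally show ?thesis using eq True by simp
  next
    case False
    have "(\<Oplus>\<^bsub>M\<^esub>i\<in>{..n}. hom_ring d a i \<bullet> y (n - i)) = (\<Oplus>\<^bsub>M\<^esub>i\<in>{..n}. \<zero>\<^sub>M)"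
      using False yc by (intro M.finsum_cong') (auto simp: hom_ring_def)
    then show ?thesis using eq False by simp
  qed
qed

lemma hom_smult:
  "\<lbrakk>a \<in> ipow d; x \<in> X e\<rbrakk> \<Longrightarrow> hom_ring d a \<odot>\<^bsub>BM\<^esub> hom_module e x = hom_module (d + e) (a \<bullet> x)"
  using ideal_power_carrier by (auto simp: hom_ring_smult hom_module_BM) (auto simp: hom_module_def fun_eq_iff)

lemma hom_mult:
  assumes a: "a \<in> ipow d" and b: "b \<in> ipow e"
  shows "hom_ring d a \<otimes>\<^bsub>BB\<^esub> hom_ring e b = hom_ring (d + e) (a \<otimes> b)"
proof -
  interpret P: UP_cring R "UP R" by (intro UP_cring.intro) (rule R.cring_axioms, simp add: UP_def)
  have c: "a \<in> carrier R" "b \<in> carrier R" using a b ideal_power_carrier by auto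
  have "hom_ring d a \<otimes>\<^bsub>BB\<^esub> hom_ring e b = monom (UP R) a d \<otimes>\<^bsub>UP R\<^esub> monom (UP R) b e"
    using c by (simp add: hom_ring_monom rees_ring_def)
  also have "\<dots> = monom (UP R) (a \<otimes> b) (d + e)" using P.monom_mult[OF c] by simp
  finally show ?thesis using c by (simp add: hom_ring_monom)
qed

lemma graded_module_Rees: "graded_module BB BM bgr mgr"
proof (intro graded_module.intro module_BM graded_module_axioms.intro)
  interpret B: module BB BM by (rule module_BM)
  show "p \<in> carrier BB" if "p \<in> bgr d" for p d using that by (simp add: rees_degree_def)
  show "y \<in> carrier BM" if "y \<in> mgr d" for y d using that by (simp add: rees_module_degree_def)
  show "\<zero>\<^bsub>BB\<^esub> \<in> bgr d" for d using hom_ring_bgr[OF ipow_zero, of d] by (simp add: hom_ring_zero)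
  show "\<zero>\<^bsub>BM\<^esub> \<in> mgr d" for d using hom_module_mgr[OF X_zero, of d] by (simp add: hom_module_zero)
  show "p \<oplus>\<^bsub>BB\<^esub> q \<in> bgr d" if "p \<in> bgr d" "q \<in> bgr d" for p q d
    using that by (auto elim!: bgr_cases simp: hom_ring_add intro!: hom_ring_bgr ipow_add)
  show "y \<oplus>\<^bsub>BM\<^esub> z \<in> mgr d" if "y \<in> mgr d" "z \<in> mgr d" for y z d
    using that by (auto elim!: mgr_cases simp: hom_module_add intro!: hom_module_mgr X_add)
  show "\<ominus>\<^bsub>BB\<^esub> p \<in> bgr d" if p: "p \<in> bgr d" for p d
  proof -
    obtain a where a: "a \<in> ipow d" "p = hom_ring d a" using p by (rule bgr_cases)
    have m: "\<ominus> a \<in> ipow d" using ipow_minus[OF a(1)] .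
    have "hom_ring d (\<ominus> a) \<oplus>\<^bsub>BB\<^esub> p = \<zero>\<^bsub>BB\<^esub>"
      using a m ideal_power_carrier[OF a(1)] by (simp add: hom_ring_add R.l_neg hom_ring_zero)
    then have "\<ominus>\<^bsub>BB\<^esub> p = hom_ring d (\<ominus> a)"
      using a m hom_ring_BB by (intro B.R.minus_equality) auto
    then show ?thesis using hom_ring_bgr[OF m] by simp
  qed
  show "\<ominus>\<^bsub>BM\<^esub> y \<in> mgr d" if y: "y \<in> mgr d" for y d
  proof -
    obtain x where x: "x \<in> X d" "y = hom_module d x" using y by (rule mgr_cases)
    have m: "\<ominus>\<^sub>M x \<in> X d" using submoduleE(3)[OF submodule_X x(1)] .
    have "hom_module d (\<ominus>\<^sub>M x) \<oplus>\<^bsub>BM\<^esub> y = \<zero>\<^bsub>BM\<^esub>"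
      using x m X_carrier[OF x(1)] by (simp add: hom_module_add M.l_neg hom_module_zero)
    then have "\<ominus>\<^bsub>BM\<^esub> y = hom_module d (\<ominus>\<^sub>M x)"
      using x m hom_module_BM by (intro B.M.minus_equality) auto
    then show ?thesis using hom_module_mgr[OF m] by simp
  qed
  show "p \<otimes>\<^bsub>BB\<^esub> q \<in> bgr (d + e)" if "p \<in> bgr d" "q \<in> bgr e" for p q d e
    using that by (auto elim!: bgr_cases simp: hom_mult intro!: hom_ring_bgr R.ideal_power_mult[OF I])
  show "\<one>\<^bsub>BB\<^esub> \<in> bgr 0" using hom_ring_bgr[of \<one> 0] by (simp add: BB_simps hom_ring_def)
  show "p \<odot>\<^bsub>BM\<^esub> y \<in> mgr (d + e)" if "p \<in> bgr d" "y \<in> mgr e" for p y d e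
    using that by (auto elim!: bgr_cases mgr_cases simp: hom_smult intro!: hom_module_mgr X_mult)
qed

text \<open>Products of elements of \<open>I\<^sup>n\<close> and of \<open>I\<close> span the next power, so a prime that contains \<open>I t\<close> contains all
  elements of positive degree.\<close>

lemma Proj_degree_one:
  assumes p: "p \<in> Proj BB bgr" shows "\<exists>a\<in>I. hom_ring 1 a \<notin> p"
proof (rule ccontr)
  assume contra: "\<not> ?thesis"
  interpret p: primeideal p BB using p by (simp add: Proj_def)
  have "hom_ring (Suc n) a \<in> p" if a: "a \<in> ipow (Suc n)" for n a
  proof -
    have "a \<in> ipow n \<cdot> I" using a by (simp add: R.ideal_power_Suc)
    then have "a \<in> ipow (Suc n) \<and> hom_ring (Suc n) a \<in> p"
    proof (induction a rule: ideal_prod.induct)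
      case (prod i j)
      have j1: "j \<in> ipow 1" using prod R.ideal_power_1[OF I] by simp
      have "hom_ring n i \<otimes>\<^bsub>BB\<^esub> hom_ring 1 j \<in> p"
        using contra prod hom_ring_BB by (intro p.I_l_closed) auto
      then show ?case using prod j1 hom_mult[OF prod(1) j1] R.ideal_power_mult[OF I prod(1) j1] by simp
    next
      case (sum s1 s2)
      then have "s1 \<oplus> s2 \<in> ipow (Suc n)" "hom_ring (Suc n) s1 \<oplus>\<^bsub>BB\<^esub> hom_ring (Suc n) s2 \<in> p"
        using ipow_add p.a_closed by blast+
      then show ?case using hom_ring_add[of s1 "Suc n" s2] sum.IH by metis
    qed
    then show ?thesis by simp
  qed
  then have "(\<Union>n\<in>{0<..}. bgr n) \<subseteq> p" by (auto elim!: bgr_cases dest!: gr0_implies_Suc)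
  then show False using p by (simp add: Proj_def)
qed

end

context form_on_module
begin

abbreviation ft where "ft \<equiv> hom_ring s f"

abbreviation assoc_points where
  "assoc_points \<equiv> associated_points (blowup_topology R I) (blowup_structure_sheaf R I)
     (rees_sheaf_on_weak_transform R I M s f)"

lemma ft_hom_module:
  assumes x: "x \<in> X d"
  shows "hom_module d x \<in> multiples BM ft \<longleftrightarrow> x \<in> Z d"
proof
  assume "hom_module d x \<in> multiples BM ft"
  then obtain y where y: "y \<in> carrier BM" "hom_module d x = ft \<odot>\<^bsub>BM\<^esub> y" by (auto simp: multiples_def)
  have "x = (ft \<odot>\<^bsub>BM\<^esub> y) d" using y(2) unfolding y(2)[symmetric] by (simp add: hom_module_def)
  then show "x \<in> Z d" using BM_coeff[OF y(1)] by (auto simp: hom_ring_smult[OF f y(1)] Z_def)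
next
  assume z: "x \<in> Z d"
  show "hom_module d x \<in> multiples BM ft"
  proof (cases "s \<le> d")
    case True
    then obtain y where y: "y \<in> X (d - s)" "x = f \<bullet> y" using z by (auto simp: Z_def)
    have "hom_module d x = ft \<odot>\<^bsub>BM\<^esub> hom_module (d - s) y" using hom_smult[OF f y(1)] True y(2) by simp
    then show ?thesis using hom_module_BM[OF y(1)] by (auto simp: multiples_def)
  next
    case False
    interpret B: module BB BM by (rule module_BM)
    have "hom_module d x = ft \<odot>\<^bsub>BM\<^esub> \<zero>\<^bsub>BM\<^esub>"
      using z False hom_ring_BB[OF f] by (simp add: Z_def hom_module_zero)
    then show ?thesis using B.M.zero_closed by (auto simp: multiples_def)
  qed
qed

lemma graded_hypersurface_Rees: "graded_hypersurface BB BM bgr mgr ft s"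
proof (intro graded_hypersurface.intro graded_module_Rees graded_hypersurface_axioms.intro)
  show "ft \<in> bgr s" by (rule hom_ring_bgr[OF f])
  show "\<exists>b\<in>bgr 1. b \<notin> p" if "p \<in> Proj BB bgr" for p
    using Proj_degree_one[OF that] hom_ring_bgr[of _ 1] R.ideal_power_1[OF I] by auto
  show "\<exists>y'\<in>mgr d. ft \<odot>\<^bsub>BM\<^esub> y' = ft \<odot>\<^bsub>BM\<^esub> y"
    if y: "y \<in> carrier BM" and h: "ft \<odot>\<^bsub>BM\<^esub> y \<in> mgr (s + d)" for y d
  proof -
    obtain x where x: "x \<in> X (s + d)" "ft \<odot>\<^bsub>BM\<^esub> y = hom_module (s + d) x" using h by (rule mgr_cases)
    have "x = (ft \<odot>\<^bsub>BM\<^esub> y) (s + d)" unfolding x(2) by (simp add: hom_module_def)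
    then have "x = f \<bullet> y d" by (simp add: hom_ring_smult[OF f y])
    then have "ft \<odot>\<^bsub>BM\<^esub> hom_module d (y d) = ft \<odot>\<^bsub>BM\<^esub> y"
      using hom_smult[OF f BM_coeff[OF y]] x(2) by simp
    then show ?thesis using hom_module_mgr[OF BM_coeff[OF y]] by blast
  qed
qed

lemma rees_sheaf_on_weak_transform_eq:
  "rees_sheaf_on_weak_transform R I M s f
    = restrict_to_subscheme BB bgr (rees_sheaf R I M) (genideal BB {ft})"
  by (simp add: rees_sheaf_on_weak_transform_def weak_transform_ideal_def hom_ring_monom f_carrier)

lemma exceptional_support_iff:
  "p \<in> exceptional_support R I \<longleftrightarrow> p \<in> Proj BB bgr \<and> (\<forall>a\<in>I. hom_ring 0 a \<in> p)"
proof -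
  interpret B: cring BB by (rule cring_BB)
  have eq: "(\<lambda>a. monom (UP R) a 0) ` I = hom_ring 0 ` I"
    using I_carrier by (auto simp: hom_ring_monom intro!: image_cong)
  have sub: "hom_ring 0 ` I \<subseteq> carrier BB" using I_carrier by (auto intro!: hom_ring_BB)
  have "genideal BB (hom_ring 0 ` I) \<subseteq> p \<longleftrightarrow> hom_ring 0 ` I \<subseteq> p" if "p \<in> Proj BB bgr"
  proof -
    interpret p: primeideal p BB using that by (simp add: Proj_def)
    show ?thesis using B.genideal_self[OF sub] B.genideal_minimal[OF p.is_ideal] by blast
  qed
  then show ?thesis by (auto simp: exceptional_support_def Proj_zeros_def eq)
qed

text \<open>The general description of associated points, with homogeneous elements of the Rees ring and the Rees
  module replaced by their coefficients.\<close>

lemma associated_point_iff: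
  "p \<in> assoc_points
   \<longleftrightarrow> p \<in> Proj BB bgr \<and> (\<exists>d. \<exists>x\<in>X d. \<forall>e. \<forall>a\<in>ipow e. hom_ring e a \<in> p \<longleftrightarrow>
      (\<exists>i. \<exists>u\<in>ipow i. hom_ring i u \<notin> p \<and> u \<bullet> (a \<bullet> x) \<in> Z (i + (e + d))))"
proof -
  interpret H: graded_hypersurface BB BM bgr mgr ft s by (rule graded_hypersurface_Rees)
  have mem: "(\<exists>u\<in>bgr i - p. u \<odot>\<^bsub>BM\<^esub> (hom_ring e a \<odot>\<^bsub>BM\<^esub> hom_module d x) \<in> multiples BM ft)
      \<longleftrightarrow> (\<exists>u\<in>ipow i. hom_ring i u \<notin> p \<and> u \<bullet> (a \<bullet> x) \<in> Z (i + (e + d)))"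
    if x: "x \<in> X d" and a: "a \<in> ipow e" for x d a e i
  proof -
    have "hom_ring i u \<odot>\<^bsub>BM\<^esub> (hom_ring e a \<odot>\<^bsub>BM\<^esub> hom_module d x) \<in> multiples BM ft
        \<longleftrightarrow> u \<bullet> (a \<bullet> x) \<in> Z (i + (e + d))" if u: "u \<in> ipow i" for u
      using ft_hom_module[OF X_mult[OF u X_mult[OF a x]]] hom_smult[OF a x] hom_smult[OF u X_mult[OF a x]] by simp
    then show ?thesis using hom_ring_bgr by (auto elim!: bgr_cases)
  qed
  have inner: "(\<forall>e. \<forall>a\<in>bgr e. a \<in> p \<longleftrightarrow> (\<exists>i. \<exists>u\<in>bgr i - p. u \<odot>\<^bsub>BM\<^esub> (a \<odot>\<^bsub>BM\<^esub> hom_module d x) \<in> multiples BM ft))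
      \<longleftrightarrow> (\<forall>e. \<forall>a\<in>ipow e. hom_ring e a \<in> p \<longleftrightarrow>
        (\<exists>i. \<exists>u\<in>ipow i. hom_ring i u \<notin> p \<and> u \<bullet> (a \<bullet> x) \<in> Z (i + (e + d))))"
    (is "?l \<longleftrightarrow> ?r") if x: "x \<in> X d" for x d
  proof
    assume l: ?l
    show ?r
    proof (intro allI ballI)
      fix e a assume a: "a \<in> ipow e"
      show "hom_ring e a \<in> p \<longleftrightarrow> (\<exists>i. \<exists>u\<in>ipow i. hom_ring i u \<notin> p \<and> u \<bullet> (a \<bullet> x) \<in> Z (i + (e + d)))"
        using l hom_ring_bgr[OF a] mem[OF x a] by blast
    qed
  next
    assume r: ?r
    show ?l
    proof (intro allI ballI)
      fix e b assume "b \<in> bgr e"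
      then obtain a where a: "a \<in> ipow e" "b = hom_ring e a" by (rule bgr_cases)
      show "b \<in> p \<longleftrightarrow> (\<exists>i. \<exists>u\<in>bgr i - p. u \<odot>\<^bsub>BM\<^esub> (b \<odot>\<^bsub>BM\<^esub> hom_module d x) \<in> multiples BM ft)"
        unfolding a(2) using r a(1) mem[OF x a(1)] by blast
    qed
  qed
  have "(\<exists>y\<in>mgr d. P y) \<longleftrightarrow> (\<exists>x\<in>X d. P (hom_module d x))" for d P
    using hom_module_mgr by (auto elim!: mgr_cases)
  then show ?thesis
    unfolding rees_sheaf_on_weak_transform_eq H.associated_points_iff by (simp only: inner cong: bex_cong)
qed

end


section \<open>Homogeneous primes of the Rees ring\<close>

context ideal_module
begin

lemma hom_ring_mult_in_prime:
  assumes p: "p \<in> Proj BB bgr" and u: "u \<in> ipow i" and v: "v \<in> ipow j"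
  shows "hom_ring (i + j) (u \<otimes> v) \<in> p \<longleftrightarrow> hom_ring i u \<in> p \<or> hom_ring j v \<in> p"
proof -
  interpret p: primeideal p BB using p by (simp add: Proj_def)
  show ?thesis
    unfolding hom_mult[OF u v, symmetric]
    using p.I_prime[OF hom_ring_BB[OF u] hom_ring_BB[OF v]]
      p.I_l_closed[OF _ hom_ring_BB[OF u]] p.I_r_closed[OF _ hom_ring_BB[OF v]] by blast
qed

lemma hom_ring_one: "hom_ring 0 \<one> = \<one>\<^bsub>BB\<^esub>"
  by (simp add: BB_simps hom_ring_def)

lemma hom_ring_one_notin_prime:
  assumes p: "p \<in> Proj BB bgr" shows "hom_ring 0 \<one> \<notin> p"
proof -
  interpret p: primeideal p BB using p by (simp add: Proj_def)
  show ?thesis using p.one_imp_carrier p.I_notcarr by (auto simp: hom_ring_one)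
qed

lemma ex_hom_ring_notin_prime:
  assumes p: "p \<in> Proj BB bgr" shows "\<exists>v\<in>ipow k. hom_ring k v \<notin> p"
proof (induction k)
  case 0
  then show ?case using hom_ring_one_notin_prime[OF p] by (intro bexI[of _ \<one>]) simp_all
next
  case (Suc k)
  then obtain v where v: "v \<in> ipow k" "hom_ring k v \<notin> p" by blast
  obtain h where h: "h \<in> ipow (Suc 0)" "hom_ring (Suc 0) h \<notin> p"
    using Proj_degree_one[OF p] R.ideal_power_1[OF I] by auto
  show ?case
    using hom_ring_mult_in_prime[OF p v(1) h(1)] v h R.ideal_power_mult[OF I v(1) h(1)]
    by (intro bexI[of _ "v \<otimes> h"]) simp_all
qed

text \<open>For a homogeneous ideal, primality can be tested on homogeneous elements: if \<open>a\<close> and \<open>b\<close> are outside the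
  ideal, consider their lowest components outside it.\<close>

lemma Proj_of_components:
  assumes id: "\<And>e. ideal (J e) R" and sub: "\<And>e. J e \<subseteq> ipow e"
    and mult: "\<And>e e' a b. \<lbrakk>a \<in> J e; b \<in> ipow e'\<rbrakk> \<Longrightarrow> b \<otimes> a \<in> J (e + e')"
    and prime: "\<And>e e' a b. \<lbrakk>a \<in> ipow e; b \<in> ipow e'; a \<otimes> b \<in> J (e + e')\<rbrakk> \<Longrightarrow> a \<in> J e \<or> b \<in> J e'"
    and one: "\<one> \<notin> J 0" and relevant: "\<not> I \<subseteq> J 1"
  shows "{q \<in> carrier BB. \<forall>e. q e \<in> J e} \<in> Proj BB bgr" (is "?p \<in> _")
proof -
  interpret B: cring BB by (rule cring_BB)
  note Jz = additive_subgroup.zero_closed[OF ideal.axioms(1)[OF id]]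
  note Ja = additive_subgroup.a_closed[OF ideal.axioms(1)[OF id]]
  have l_closed: "r \<otimes>\<^bsub>BB\<^esub> q \<in> ?p" if q: "q \<in> ?p" and r: "r \<in> carrier BB" for q r
  proof -
    have qB: "q \<in> carrier BB" using q by simp
    have "(r \<otimes>\<^bsub>BB\<^esub> q) n \<in> J n" for n
      unfolding BB_simps(4)[OF r qB]
    proof (rule finsum_in_ideal[OF id])
      fix i assume "i \<in> {..n}"
      then show "r i \<otimes> q (n - i) \<in> J n" using mult[of "q (n - i)" "n - i" "r i" i] q BB_coeff[OF r] by simp
    qed simp
    then show ?thesis using r qB by simp
  qed
  have "ideal ?p BB"
  proof (rule idealI[OF B.ring_axioms])
    show "subgroup ?p (add_monoid BB)"
    proof (rule B.add.subgroupI)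
      show "?p \<noteq> {}" using Jz B.zero_closed by (auto simp: BB_simps intro!: exI[of _ "\<lambda>_. \<zero>"])
    next
      fix q assume q: "q \<in> ?p"
      have "\<ominus>\<^bsub>BB\<^esub> q = (\<ominus>\<^bsub>BB\<^esub> \<one>\<^bsub>BB\<^esub>) \<otimes>\<^bsub>BB\<^esub> q" using q by (simp add: B.l_minus)
      then show "\<ominus>\<^bsub>BB\<^esub> q \<in> ?p" using l_closed[OF q, of "\<ominus>\<^bsub>BB\<^esub> \<one>\<^bsub>BB\<^esub>"] by simp
    next
      fix q r assume q: "q \<in> ?p" and r: "r \<in> ?p"
      show "q \<oplus>\<^bsub>BB\<^esub> r \<in> ?p"
        using q r BB_simps(3)[of q r] B.a_closed[of q r] Ja by simp
    qed auto
  qed (use l_closed B.m_comm in auto)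
  have hom_iff: "hom_ring e a \<in> ?p \<longleftrightarrow> a \<in> J e" if "a \<in> ipow e" for e a
    using hom_ring_BB[OF that] Jz by (auto simp: hom_ring_def)
  have "primeideal ?p BB"
  proof (rule primeidealI[OF \<open>ideal ?p BB\<close> cring_BB])
    show "carrier BB \<noteq> ?p"
      using hom_iff[of \<one> 0] one B.one_closed by (auto simp: hom_ring_one)
    fix a b assume a: "a \<in> carrier BB" and b: "b \<in> carrier BB" and ab: "a \<otimes>\<^bsub>BB\<^esub> b \<in> ?p"
    show "a \<in> ?p \<or> b \<in> ?p"
    proof (rule ccontr)
      assume "\<not> (a \<in> ?p \<or> b \<in> ?p)"
      then have ex: "\<exists>e. a e \<notin> J e" "\<exists>e. b e \<notin> J e" using a b by simp_all
      define i where "i = (LEAST e. a e \<notin> J e)"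
      define j where "j = (LEAST e. b e \<notin> J e)"
      have i': "a i \<notin> J i" using LeastI_ex[OF ex(1)] unfolding i_def .
      have i: "a k \<in> J k" if "k < i" for k
        using not_less_Least[of k "\<lambda>e. a e \<notin> J e"] that unfolding i_def by blast
      have j': "b j \<notin> J j" using LeastI_ex[OF ex(2)] unfolding j_def .
      have j: "b k \<in> J k" if "k < j" for k
        using not_less_Least[of k "\<lambda>e. b e \<notin> J e"] that unfolding j_def by blast
      note c = BB_coeff_R[OF a] BB_coeff_R[OF b]
      \<comment> \<open>All other summands in degree \<open>i + j\<close> involve a lower component of \<open>a\<close> or of \<open>b\<close>.\<close>
      let ?t = "\<lambda>k. a k \<otimes> b (i + j - k)"
      let ?r = "\<Oplus>k\<in>{..i + j} - {i}. ?t k"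
      have rest: "?r \<in> J (i + j)"
      proof (rule finsum_in_ideal[OF id])
        fix k assume k: "k \<in> {..i + j} - {i}"
        show "?t k \<in> J (i + j)"
        proof (cases "k < i")
          case True
          then show ?thesis
            using mult[OF i[OF True] BB_coeff[OF b, of "i + j - k"]] c by (simp add: R.m_comm)
        next
          case False
          then have "i + j - k < j" using k by auto
          then show ?thesis using mult[OF j BB_coeff[OF a, of k], of "i + j - k"] k by simp
        qed
      qed simp
      have "(a \<otimes>\<^bsub>BB\<^esub> b) (i + j) = (\<Oplus>k\<in>insert i ({..i + j} - {i}). ?t k)"
        by (simp add: BB_simps(4)[OF a b] insert_absorb)
      also have "\<dots> = a i \<otimes> b j \<oplus> ?r" using c by (subst R.finsum_insert) auto
      finally have eq: "(a \<otimes>\<^bsub>BB\<^esub> b) (i + j) = a i \<otimes> b j \<oplus> ?r" .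
      have "a i \<otimes> b j \<oplus> ?r \<in> J (i + j)" unfolding eq[symmetric] using ab by blast
      moreover have "\<ominus> ?r \<in> J (i + j)"
        using additive_subgroup.a_inv_closed[OF ideal.axioms(1)[OF id] rest] .
      ultimately have "(a i \<otimes> b j \<oplus> ?r) \<oplus> \<ominus> ?r \<in> J (i + j)" by (rule Ja)
      moreover have "(a i \<otimes> b j \<oplus> ?r) \<oplus> \<ominus> ?r = a i \<otimes> b j"
        using c ideal.Icarr[OF id rest] by (simp add: R.a_assoc R.r_neg)
      ultimately have "a i \<in> J i \<or> b j \<in> J j" using prime[OF BB_coeff[OF a] BB_coeff[OF b]] by simp
      then show False using i' j' by blast
    qed
  qed
  moreover have "homogeneous_ideal BB bgr ?p"
  proof -
    let ?H = "?p \<inter> (\<Union>n. bgr n)"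
    have HB: "?H \<subseteq> carrier BB" by auto
    interpret G: ideal "genideal BB ?H" BB by (rule B.genideal_ideal[OF HB])
    \<comment> \<open>Split off the top component.\<close>
    have in_span: "q \<in> ?p \<Longrightarrow> \<forall>m\<ge>n. q m = \<zero> \<Longrightarrow> q \<in> genideal BB ?H" for n q
    proof (induction n arbitrary: q)
      case 0
      then have "q = \<zero>\<^bsub>BB\<^esub>" by (auto simp: BB_simps)
      then show ?case by simp
    next
      case (Suc n)
      let ?r = "\<lambda>m. if m = n then \<zero> else q m"
      have qB: "q \<in> carrier BB" using Suc.prems(1) by simp
      have r: "?r \<in> ?p" using Suc.prems(1) Jz ipow_zero unfolding carrier_BB mem_Collect_eq by auto
      have "\<forall>m\<ge>n. ?r m = \<zero>" using Suc.prems(2) by auto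
      with r have rG: "?r \<in> genideal BB ?H" by (rule Suc.IH)
      have hn: "hom_ring n (q n) \<in> ?H"
        using Suc.prems(1) BB_coeff[OF qB, of n] hom_iff[of "q n" n] hom_ring_bgr[of "q n" n] by auto
      have "q = hom_ring n (q n) \<oplus>\<^bsub>BB\<^esub> ?r"
      proof -
        have rB: "?r \<in> carrier BB" using r by blast
        show ?thesis
          unfolding BB_simps(3)[OF hom_ring_BB[OF BB_coeff[OF qB]] rB]
          using BB_coeff_R[OF qB] by (auto simp: hom_ring_def)
      qed
      moreover have "hom_ring n (q n) \<oplus>\<^bsub>BB\<^esub> ?r \<in> genideal BB ?H"
        using hn B.genideal_self[OF HB] rG by (intro G.a_closed) auto
      ultimately show ?case by simp
    qed
    have "?p \<subseteq> genideal BB ?H"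
    proof
      fix q assume q: "q \<in> ?p"
      then obtain n where "\<forall>m>n. q m = \<zero>" unfolding carrier_BB by blast
      then have "\<forall>m\<ge>Suc n. q m = \<zero>" by (simp add: Suc_le_eq)
      with q show "q \<in> genideal BB ?H" by (rule in_span)
    qed
    moreover have "genideal BB ?H \<subseteq> ?p" using B.genideal_minimal[OF \<open>ideal ?p BB\<close>, of ?H] by blast
    ultimately show ?thesis using \<open>ideal ?p BB\<close> by (simp add: homogeneous_ideal_def)
  qed
  moreover have "\<not> (\<Union>n\<in>{0<..}. bgr n) \<subseteq> ?p"
  proof -
    obtain h where h: "h \<in> I" "h \<notin> J 1" using relevant by blast
    then have h1: "h \<in> ipow 1" using R.ideal_power_1[OF I] by simp
    have inB: "hom_ring 1 h \<in> (\<Union>n\<in>{0<..}. bgr n)" using hom_ring_bgr[OF h1] by (intro UN_I[of 1]) simp_all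
    have notin: "hom_ring 1 h \<notin> ?p" unfolding hom_iff[OF h1] by (rule h(2))
    show ?thesis
    proof
      assume "(\<Union>n\<in>{0<..}. bgr n) \<subseteq> ?p"
      from notE[OF notin subsetD[OF this inB]] show False .
    qed
  qed
  ultimately show ?thesis by (simp add: Proj_def)
qed

end


section \<open>The criterion for associated points on the exceptional divisor\<close>

context form_on_module
begin

text \<open>With \<open>y = v u x\<close> as constructed below, \<open>y\<close> has large degree \<open>n\<close> and \<open>I y \<subseteq> Z n\<close>. An element \<open>h\<close> of \<open>I\<close> with
  \<open>h t\<close> outside \<open>p\<close> gives \<open>h y \<in> fM \<inter> X (n + 1) \<subseteq> Z (n + 1)\<close>: the product \<open>(h t) y\<close> vanishes modulo
  \<open>f t\<^sup>s B(M)\<close>, although \<open>h t\<close>, \<open>u\<close> and \<open>v\<close> are outside \<open>p\<close>.\<close>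

lemma not_associated_if_initial_forms_generate:
  assumes ev: "\<exists>n0. \<forall>n\<ge>n0. initial_forms_generate n"
    and p: "p \<in> Proj BB bgr" and I0: "\<forall>a\<in>I. hom_ring 0 a \<in> p" and x: "x \<in> X d"
    and ass: "\<forall>e. \<forall>a\<in>ipow e. hom_ring e a \<in> p \<longleftrightarrow>
      (\<exists>i. \<exists>u\<in>ipow i. hom_ring i u \<notin> p \<and> u \<bullet> (a \<bullet> x) \<in> Z (i + (e + d)))"
  shows False
proof -
  obtain n1 where n1: "\<And>n. n \<ge> n1 \<Longrightarrow> fM \<inter> X n \<subseteq> Z n"
    using eventually_Z_if_initial_forms_generate[OF ev] by blast
  have xc: "x \<in> carrier M" using X_carrier[OF x] .
  obtain A where A: "A \<subseteq> carrier R" "finite A" "I = genideal R A"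
    using noetherian_ring.finetely_gen[OF noeth I] by blast
  have AI: "A \<subseteq> I" using R.genideal_self[OF A(1)] A(3) by simp
  \<comment> \<open>One \<open>u\<close> for finitely many elements of \<open>I\<close>, as a product of the individual ones.\<close>
  have "\<exists>i. \<exists>u\<in>ipow i. hom_ring i u \<notin> p \<and> (\<forall>b\<in>S. u \<bullet> (b \<bullet> x) \<in> Z (i + d))"
    if "finite S" "S \<subseteq> I" for S
    using that
  proof (induction S rule: finite_induct)
    case empty
    then show ?case using hom_ring_one_notin_prime[OF p] by (intro exI[of _ 0] bexI[of _ \<one>]) simp_all
  next
    case (insert b S)
    then obtain i u where u: "u \<in> ipow i" "hom_ring i u \<notin> p" "\<forall>c\<in>S. u \<bullet> (c \<bullet> x) \<in> Z (i + d)" by auto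
    have b: "b \<in> I" "b \<in> ipow 0" using insert.prems I_carrier by auto
    then have "hom_ring 0 b \<in> p" using I0 by blast
    from iffD1[OF ass[THEN spec, of 0, THEN bspec, OF b(2)] this] obtain j v where v: "v \<in> ipow j" "hom_ring j v \<notin> p" "v \<bullet> (b \<bullet> x) \<in> Z (j + d)"
      by auto
    note c = ideal_power_carrier[OF u(1)] ideal_power_carrier[OF v(1)] xc
    have "(u \<otimes> v) \<bullet> (a \<bullet> x) \<in> Z (i + j + d)" if a: "a \<in> insert b S" for a
    proof (cases "a = b")
      case True
      then show ?thesis using Z_mult[OF u(1) v(3)] c I_carrier[OF b(1)] by (simp add: smult_assoc1 ac_simps)
    next
      case False
      then have a': "a \<in> S" "a \<in> carrier R" using a insert.prems I_carrier by auto
      then have "v \<bullet> (u \<bullet> (a \<bullet> x)) \<in> Z (i + d + j)" using Z_mult[OF v(1)] u(3) by blast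
      then show ?thesis using c a'(2) by (simp add: smult_assoc1[symmetric] R.m_ac ac_simps)
    qed
    then show ?case
      using R.ideal_power_mult[OF I u(1) v(1)] hom_ring_mult_in_prime[OF p u(1) v(1)] u(2) v(2) by blast
  qed
  from this[OF A(2) AI] obtain i u where u: "u \<in> ipow i" "hom_ring i u \<notin> p"
    "\<forall>b\<in>A. u \<bullet> (b \<bullet> x) \<in> Z (i + d)" by blast
  note uc = ideal_power_carrier[OF u(1)]
  have "A \<subseteq> {a \<in> carrier R. \<forall>w\<in>{u \<bullet> x}. a \<bullet> w \<in> Z (i + d)}"
    using u(3) A(1) xc uc by (auto simp: smult_assoc1[symmetric] R.m_comm subset_iff)
  then have "genideal R A \<subseteq> {a \<in> carrier R. \<forall>w\<in>{u \<bullet> x}. a \<bullet> w \<in> Z (i + d)}"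
    using xc uc by (intro R.genideal_minimal ideal_into_submodule submodule_Z) simp_all
  then have Iy: "b \<bullet> (u \<bullet> x) \<in> Z (i + d)" if "b \<in> I" for b using that A(3) by blast
  \<comment> \<open>Multiplication by \<open>v\<close> makes the degree of \<open>u x\<close> at least \<open>n1\<close>.\<close>
  obtain v where v: "v \<in> ipow n1" "hom_ring n1 v \<notin> p" using ex_hom_ring_notin_prime[OF p] by blast
  note vc = ideal_power_carrier[OF v(1)]
  obtain h where h: "h \<in> I" "hom_ring 1 h \<notin> p" using Proj_degree_one[OF p] by blast
  have h1: "h \<in> ipow 1" using h(1) R.ideal_power_1[OF I] by simp
  note hc = I_carrier[OF h(1)]
  let ?n = "i + d + n1"
  have y: "v \<bullet> (u \<bullet> x) \<in> X ?n"
    using X_mult[OF v(1) X_mult[OF u(1) x]] by (simp add: ac_simps)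
  have "v \<bullet> (h \<bullet> (u \<bullet> x)) \<in> Z ?n" by (rule Z_mult[OF v(1) Iy[OF h(1)]])
  moreover have "v \<bullet> (h \<bullet> (u \<bullet> x)) = h \<bullet> (v \<bullet> (u \<bullet> x))"
    using vc uc hc xc by (simp add: smult_assoc1[symmetric] R.m_ac)
  ultimately have "h \<bullet> (v \<bullet> (u \<bullet> x)) \<in> fM \<inter> X (Suc ?n)"
    using Z_subset_fM X_mult_I[OF h(1) y] by auto
  then have "h \<bullet> (v \<bullet> (u \<bullet> x)) \<in> Z (Suc ?n)" using n1[of "Suc ?n"] by auto
  moreover have "h \<bullet> (v \<bullet> (u \<bullet> x)) = (h \<otimes> (v \<otimes> u)) \<bullet> (\<one> \<bullet> x)"
    using vc uc hc xc by (simp add: smult_assoc1)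
  ultimately have "(h \<otimes> (v \<otimes> u)) \<bullet> (\<one> \<bullet> x) \<in> Z (1 + (n1 + i) + (0 + d))"
    by (simp add: ac_simps)
  note killed = this
  have vu: "v \<otimes> u \<in> ipow (n1 + i)" by (rule R.ideal_power_mult[OF I v(1) u(1)])
  have notin: "hom_ring (1 + (n1 + i)) (h \<otimes> (v \<otimes> u)) \<notin> p"
    unfolding hom_ring_mult_in_prime[OF p h1 vu] hom_ring_mult_in_prime[OF p v(1) u(1)] using h v u by blast
  have "\<one> \<in> ipow 0" by simp
  from ass[THEN spec, THEN bspec, OF this] have "hom_ring 0 \<one> \<in> p"
    by (rule iffD2) (intro exI[of _ "1 + (n1 + i)"] bexI[OF _ R.ideal_power_mult[OF I h1 vu]] conjI notin killed)
  then show False using hom_ring_one_notin_prime[OF p] by blast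
qed

text \<open>The homogeneous prime of elements that send a suitable \<open>y\<close> to torsion is the associated point. Being
  torsion agrees with vanishing at this prime \<open>p\<close>: some power of \<open>I t\<close> kills a torsion element, and contains an
  element outside \<open>p\<close>; conversely, if \<open>u a y\<close> is zero with \<open>u\<close> outside \<open>p\<close>, then \<open>a\<close> is in \<open>p\<close> by primality.\<close>

lemma ex_associated_exceptional:
  assumes "\<not> (\<exists>n0. \<forall>n\<ge>n0. Z n \<inter> X (Suc n) \<subseteq> Z (Suc n))"
  shows "\<exists>p. p \<in> assoc_points \<inter> exceptional_support R I"
proof -
  obtain d y where y: "y \<in> X d" and J: "I \<subseteq> torsion_ideal d y 0" "\<not> I \<subseteq> torsion_ideal d y 1" "\<one> \<notin> torsion_ideal d y 0"
    and prime: "\<And>e e' a b. \<lbrakk>a \<in> ipow e; b \<in> ipow e'; a \<otimes> b \<in> torsion_ideal d y (e + e')\<rbrakk> \<Longrightarrow>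
       a \<in> torsion_ideal d y e \<or> b \<in> torsion_ideal d y e'"
    using ex_torsion_prime[OF assms] by (elim exE conjE) blast
  have yc: "y \<in> carrier M" using X_carrier[OF y] .
  define p where "p = {q \<in> carrier BB. \<forall>e. q e \<in> torsion_ideal d y e}"
  have p: "p \<in> Proj BB bgr"
    unfolding p_def
  proof (rule Proj_of_components[OF ideal_torsion_ideal[OF yc] _ _ _ J(3,2)])
    show "torsion_ideal d y e \<subseteq> ipow e" for e by (auto simp: torsion_ideal_def)
    show "b \<otimes> a \<in> torsion_ideal d y (e + e')" if "a \<in> torsion_ideal d y e" "b \<in> ipow e'" for e e' a b
      using torsion_ideal_mult[OF yc that] .
  qed (rule prime)
  have hom_iff: "hom_ring e a \<in> p \<longleftrightarrow> a \<in> torsion_ideal d y e" if "a \<in> ipow e" for e a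
    using hom_ring_BB[OF that] additive_subgroup.zero_closed[OF ideal.axioms(1)[OF ideal_torsion_ideal[OF yc]]]
    by (auto simp: p_def hom_ring_def)
  have "p \<in> exceptional_support R I"
    using p J(1) I_carrier hom_iff[of _ 0] by (auto simp: exceptional_support_iff)
  moreover have "hom_ring e a \<in> p \<longleftrightarrow>
      (\<exists>i. \<exists>u\<in>ipow i. hom_ring i u \<notin> p \<and> u \<bullet> (a \<bullet> y) \<in> Z (i + (e + d)))" if a: "a \<in> ipow e" for e a
  proof
    assume "hom_ring e a \<in> p"
    then obtain k where "killed_by k (d + e) (a \<bullet> y)"
      using hom_iff[OF a] by (auto simp: torsion_ideal_def torsion_def)
    moreover obtain v where "v \<in> ipow k" "hom_ring k v \<notin> p" using ex_hom_ring_notin_prime[OF p] by blast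
    ultimately show "\<exists>i. \<exists>u\<in>ipow i. hom_ring i u \<notin> p \<and> u \<bullet> (a \<bullet> y) \<in> Z (i + (e + d))"
      by (intro exI[of _ k] bexI[of _ v]) (auto simp: killed_by_def ac_simps)
  next
    assume "\<exists>i. \<exists>u\<in>ipow i. hom_ring i u \<notin> p \<and> u \<bullet> (a \<bullet> y) \<in> Z (i + (e + d))"
    then obtain i u where u: "u \<in> ipow i" "hom_ring i u \<notin> p" "u \<bullet> (a \<bullet> y) \<in> Z (i + (e + d))" by blast
    have "killed_by 0 (i + (e + d)) ((u \<otimes> a) \<bullet> y)"
      using u(3) yc ideal_power_carrier[OF u(1)] ideal_power_carrier[OF a]
      by (simp add: killed_by_def Z_smult smult_assoc1)
    then have "torsion (d + (i + e)) ((u \<otimes> a) \<bullet> y)" by (auto simp: torsion_def ac_simps)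
    then have "u \<otimes> a \<in> torsion_ideal d y (i + e)"
      using R.ideal_power_mult[OF I u(1) a] by (simp add: torsion_ideal_def)
    then show "hom_ring e a \<in> p" using prime[OF u(1) a] u(2) hom_iff[OF u(1)] hom_iff[OF a] by blast
  qed
  ultimately have "p \<in> assoc_points \<inter> exceptional_support R I"
    unfolding Int_iff associated_point_iff using p y by blast
  then show ?thesis by blast
qed

theorem eventually_initial_forms_generate_iff:
  "(\<exists>n0. \<forall>n\<ge>n0. initial_forms_generate n) \<longleftrightarrow>
    assoc_points \<inter> exceptional_support R I = {}" (is "?l \<longleftrightarrow> ?r")
proof
  assume l: ?l
  show ?r
  proof (rule equals0I)
    fix p assume "p \<in> assoc_points \<inter> exceptional_support R I"
    then have p: "p \<in> Proj BB bgr" "\<forall>a\<in>I. hom_ring 0 a \<in> p" and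
      ex: "\<exists>d. \<exists>x\<in>X d. \<forall>e. \<forall>a\<in>ipow e. hom_ring e a \<in> p \<longleftrightarrow>
        (\<exists>i. \<exists>u\<in>ipow i. hom_ring i u \<notin> p \<and> u \<bullet> (a \<bullet> x) \<in> Z (i + (e + d)))"
      unfolding Int_iff associated_point_iff exceptional_support_iff by simp_all
    from ex show False by (elim exE bexE) (rule not_associated_if_initial_forms_generate[OF l p])
  qed
next
  assume r: ?r
  then have "\<exists>n0. \<forall>n\<ge>n0. Z n \<inter> X (Suc n) \<subseteq> Z (Suc n)" using ex_associated_exceptional by blast
  then show ?l using eventually_Z_if_no_jump initial_forms_generate_if_Z by meson
qed

end


section \<open>The associated graded module\<close>

lemma a_r_coset_carrier_update: "a_r_coset (M\<lparr>carrier := C\<rparr>) = a_r_coset M"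
  by (simp add: fun_eq_iff a_r_coset_def')

lemma set_add_carrier_update: "set_add (M\<lparr>carrier := C\<rparr>) = set_add M"
  by (simp add: fun_eq_iff set_add_def')

context ideal_module
begin

lemma subgroup_X: "subgroup_of_module (X n) M"
  by (rule subgroup_of_module_submodule[OF submodule_X])

lemmas X_coset_eq_iff = subgroup_of_module.coset_eq_iff[OF subgroup_X]
lemmas X_coset_eq_self_iff = subgroup_of_module.coset_eq_self_iff[OF subgroup_X]
lemmas X_coset_add = abelian_subgroup.a_rcos_sum[OF subgroup_of_module.axioms[OF subgroup_X]]

lemma X_coset_zero: "X n +>\<^bsub>M\<^esub> \<zero>\<^sub>M = X n"
  using X_coset_eq_self_iff[of "\<zero>\<^sub>M" n] X_zero by simp

lemma X_coset_absorb: "\<lbrakk>u \<in> X n; x \<in> carrier M\<rbrakk> \<Longrightarrow> X n +>\<^bsub>M\<^esub> (u \<oplus>\<^sub>M x) = X n +>\<^bsub>M\<^esub> x"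
  using X_coset_eq_iff[of "u \<oplus>\<^sub>M x" x n] X_carrier by (simp add: a_minus_def M.a_assoc M.r_neg)

lemma X_coset_cases:
  assumes "v \<in> X n +>\<^bsub>M\<^esub> x" obtains w where "w \<in> X n" "v = w \<oplus>\<^sub>M x"
  using assms by (auto simp: a_r_coset_def')

lemma X_coset_nonempty: "x \<in> carrier M \<Longrightarrow> X n +>\<^bsub>M\<^esub> x \<noteq> {}"
  using X_zero by (auto simp: a_r_coset_def')

abbreviation GC where "GC n \<equiv> gr_component R I M n"
abbreviation GM where "GM \<equiv> gr_module R I M"

text \<open>Cosets and sums of cosets in \<open>I\<^sup>nM\<close> are the same as in \<open>M\<close>.\<close>

lemma GC_simps:
  "carrier (GC n) = (\<lambda>x. X (Suc n) +>\<^bsub>M\<^esub> x) ` X n" "\<zero>\<^bsub>GC n\<^esub> = X (Suc n)" "A \<oplus>\<^bsub>GC n\<^esub> B = A <+>\<^bsub>M\<^esub> B"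
  by (auto simp: gr_component_def carrier_quot_module a_r_coset_carrier_update)[2]
    (simp add: gr_component_def quot_module_def set_add_carrier_update)

lemma abelian_group_GC: "abelian_group (GC n)"
proof -
  interpret H: submodule "X n" R M by (rule submodule_X)
  interpret Xn: module R "M\<lparr>carrier := X n\<rparr>" by (rule H.submodule_is_module) (rule module_axioms)
  have "submodule (X (Suc n)) R (M\<lparr>carrier := X n\<rparr>)"
    using X_Suc_subset submoduleE[OF submodule_X] X_zero by (intro Xn.submodule_intro) auto
  then interpret S: subgroup_of_module "X (Suc n)" "M\<lparr>carrier := X n\<rparr>"
    by (rule Xn.subgroup_of_module_submodule)
  show ?thesis unfolding gr_component_def by (rule S.abelian_group_quot_module)
qed

text \<open>The additive map from \<open>B(M)\<close> onto \<open>G(M)\<close> that sends each component to its class. Calculations in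
  \<open>G(M)\<close> are done in \<open>B(M)\<close>.\<close>

definition forms :: "(nat \<Rightarrow> 'b) \<Rightarrow> nat \<Rightarrow> 'b set" where
  "forms x = (\<lambda>n. X (Suc n) +>\<^bsub>M\<^esub> x n)"

lemma forms_GM:
  assumes x: "x \<in> carrier BM" shows "forms x \<in> carrier GM"
proof -
  have "{n. forms x n \<noteq> X (Suc n)} \<subseteq> {n. x n \<noteq> \<zero>\<^sub>M}" by (auto simp: forms_def X_coset_zero)
  moreover have "finite {n. x n \<noteq> \<zero>\<^sub>M}" using x by (simp add: carrier_BM)
  ultimately have "finite {n. forms x n \<noteq> X (Suc n)}" by (rule finite_subset)
  then show ?thesis using BM_coeff[OF x] by (simp add: gr_module_def GC_simps forms_def)
qed

lemma GM_cases:
  assumes y: "y \<in> carrier GM" obtains x where "x \<in> carrier BM" "y = forms x"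
proof -
  have "\<exists>a\<in>X n. y n = X (Suc n) +>\<^bsub>M\<^esub> a" for n using y by (auto simp: gr_module_def GC_simps)
  then obtain a where a: "\<And>n. a n \<in> X n" "\<And>n. y n = X (Suc n) +>\<^bsub>M\<^esub> a n" by metis
  define x where "x n = (if y n = X (Suc n) then \<zero>\<^sub>M else a n)" for n
  have "finite {n. y n \<noteq> X (Suc n)}" using y by (simp add: gr_module_def GC_simps)
  then have "finite {n. x n \<noteq> \<zero>\<^sub>M}" by (rule rev_finite_subset) (auto simp: x_def)
  then have "x \<in> carrier BM" using a X_zero by (simp add: carrier_BM x_def)
  moreover have "y = forms x"
  proof
    fix n show "y n = forms x n" using a(2)[of n] by (cases "y n = X (Suc n)") (simp_all add: forms_def x_def X_coset_zero)
  qed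
  ultimately show ?thesis by (rule that)
qed

lemma carrier_GM: "carrier GM = forms ` carrier BM"
  using forms_GM by (auto elim: GM_cases)

lemma forms_add:
  "\<lbrakk>x \<in> carrier BM; y \<in> carrier BM\<rbrakk> \<Longrightarrow> forms x \<oplus>\<^bsub>GM\<^esub> forms y = forms (x \<oplus>\<^bsub>BM\<^esub> y)"
  using X_coset_add BM_coeff_M by (simp add: gr_module_def GC_simps forms_def BM_simps fun_eq_iff)

lemma forms_zero: "forms \<zero>\<^bsub>BM\<^esub> = \<zero>\<^bsub>GM\<^esub>"
  by (simp add: gr_module_def GC_simps forms_def BM_simps X_coset_zero)

lemma forms_eq_iff:
  "\<lbrakk>x \<in> carrier BM; y \<in> carrier BM\<rbrakk> \<Longrightarrow> forms x = forms y \<longleftrightarrow> (\<forall>n. x n \<ominus>\<^sub>M y n \<in> X (Suc n))"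
  using X_coset_eq_iff BM_coeff_M by (simp add: forms_def fun_eq_iff)

lemma abelian_group_GM: "abelian_group GM"
proof -
  interpret B: module BB BM by (rule module_BM)
  show ?thesis
  proof (rule abelian_groupI)
    fix y assume "y \<in> carrier GM"
    then obtain x where x: "x \<in> carrier BM" "y = forms x" by (rule GM_cases)
    show "\<zero>\<^bsub>GM\<^esub> \<oplus>\<^bsub>GM\<^esub> y = y"
      using x by (simp add: forms_zero[symmetric] forms_add)
    have "forms (\<ominus>\<^bsub>BM\<^esub> x) \<oplus>\<^bsub>GM\<^esub> y = \<zero>\<^bsub>GM\<^esub>" using x by (simp add: forms_add B.M.l_neg forms_zero)
    then show "\<exists>z\<in>carrier GM. z \<oplus>\<^bsub>GM\<^esub> y = \<zero>\<^bsub>GM\<^esub>" using forms_GM[of "\<ominus>\<^bsub>BM\<^esub> x"] x by auto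
  next
    show "\<zero>\<^bsub>GM\<^esub> \<in> carrier GM" using forms_GM[of "\<zero>\<^bsub>BM\<^esub>"] by (simp add: forms_zero)
  qed (auto simp: carrier_GM forms_add B.M.a_ac)
qed

lemma hom_degree: "gr_degree R I M n = (\<lambda>x. forms (hom_module n x)) ` X n"
proof
  show "(\<lambda>x. forms (hom_module n x)) ` X n \<subseteq> gr_degree R I M n"
  proof
    fix y assume "y \<in> (\<lambda>x. forms (hom_module n x)) ` X n"
    then obtain x where x: "x \<in> X n" "y = forms (hom_module n x)" by blast
    have "y k = \<zero>\<^bsub>GC k\<^esub>" if "k \<noteq> n" for k
      using that by (simp add: x(2) forms_def hom_module_def X_coset_zero GC_simps)
    then show "y \<in> gr_degree R I M n" using forms_GM[OF hom_module_BM[OF x(1)]] x(2) by (simp add: gr_degree_def)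
  qed
  show "gr_degree R I M n \<subseteq> (\<lambda>x. forms (hom_module n x)) ` X n"
  proof
    fix y assume y: "y \<in> gr_degree R I M n"
    then have "y \<in> carrier GM" by (simp add: gr_degree_def)
    then obtain x where x: "x \<in> carrier BM" "y = forms x" by (rule GM_cases)
    have "forms x k = X (Suc k)" if "k \<noteq> n" for k
      using y that x(2) by (simp add: gr_degree_def GC_simps)
    then have "y = forms (hom_module n (x n))"
      unfolding x(2) by (intro ext) (simp add: forms_def hom_module_def X_coset_zero)
    then show "y \<in> (\<lambda>x. forms (hom_module n x)) ` X n" using BM_coeff[OF x(1)] by blast
  qed
qed

text \<open>In the convolution the class of \<open>f\<close> is zero in every degree \<open>i\<close> other than \<open>s\<close>. As a set it then is
  \<open>I\<^sup>i\<^sup>+\<^sup>1\<close>, whose products with \<open>I\<^sup>n\<^sup>-\<^sup>iM\<close> lie in \<open>I\<^sup>n\<^sup>+\<^sup>1M\<close>; so only the summand \<open>i = s\<close> contributes.\<close>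

lemma gr_smult_class:
  assumes f: "f \<in> ipow s" and x: "x \<in> carrier BM"
  shows "gr_smult R I M (gr_class R I s f) (forms x) = forms (hom_ring s f \<odot>\<^bsub>BM\<^esub> x)"
proof
  fix n
  note fc = ideal_power_carrier[OF f]
  note xX = BM_coeff[OF x] and xM = BM_coeff_M[OF x]
  have reg: "power_submodule R I (reg_module R) m = ipow m" for m by (rule R.power_submodule_reg_module[OF I])
  have regcos: "a_r_coset (reg_module R) = a_r_coset R" by (simp add: fun_eq_iff a_r_coset_def' reg_module_def)
  let ?c = "\<lambda>i. X (Suc n) +>\<^bsub>M\<^esub> (f \<bullet> x (n - i))"
  have rep: "v \<in> X m \<and> (\<exists>w\<in>X (Suc m). v = w \<oplus>\<^sub>M x m)" if "v \<in> forms x m" for v m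
    using that X_Suc_subset[of m] X_add xX[of m] unfolding forms_def by (auto elim!: X_coset_cases)
  have nonempty: "forms x m \<noteq> {}" for m unfolding forms_def by (rule X_coset_nonempty[OF xM])
  have summand: "(\<Union>r\<in>gr_class R I s f i. \<Union>v\<in>forms x (n - i). X (Suc n) +>\<^bsub>M\<^esub> (r \<bullet> v))
    = (if s = i then ?c i else X (Suc n))" if i: "i \<le> n" for i
  proof (cases "s = i")
    case True
    have ne: "gr_class R I s f i \<noteq> {}"
      using ipow_zero[of "Suc i"] True by (auto simp: gr_class_def reg a_r_coset_def')
    have "X (Suc n) +>\<^bsub>M\<^esub> (r \<bullet> v) = ?c i" if r: "r \<in> gr_class R I s f i" and v: "v \<in> forms x (n - i)" for r v
    proof -
      obtain a where a: "a \<in> ipow (Suc i)" "r = a \<oplus> f"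
        using r True by (auto simp: gr_class_def reg a_r_coset_def')
      obtain w where w: "v \<in> X (n - i)" "w \<in> X (Suc (n - i))" "v = w \<oplus>\<^sub>M x (n - i)" using rep[OF v] by blast
      note c = ideal_power_carrier[OF a(1)] X_carrier[OF w(1)] X_carrier[OF w(2)] fc xM
      have "a \<bullet> v \<in> X (Suc n)" using X_mult[OF a(1) w(1)] i by simp
      moreover have "f \<bullet> w \<in> X (Suc n)" using X_mult[OF f w(2)] i True by simp
      ultimately have "a \<bullet> v \<oplus>\<^sub>M f \<bullet> w \<in> X (Suc n)" by (rule X_add)
      moreover have "r \<bullet> v = (a \<bullet> v \<oplus>\<^sub>M f \<bullet> w) \<oplus>\<^sub>M f \<bullet> x (n - i)"
      proof -
        have "r \<bullet> v = a \<bullet> v \<oplus>\<^sub>M f \<bullet> v" using c a(2) by (simp add: smult_l_distr)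
        also have "f \<bullet> v = f \<bullet> w \<oplus>\<^sub>M f \<bullet> x (n - i)" unfolding w(3) using c by (simp add: smult_r_distr)
        finally show ?thesis using c by (simp add: M.a_assoc)
      qed
      ultimately show ?thesis using X_coset_absorb fc xM by simp
    qed
    then show ?thesis using ne nonempty True by (simp add: UN_eq_const)
  next
    case False
    have cl: "gr_class R I s f i = ipow (Suc i)" using False by (simp add: gr_class_def gr_component_def reg)
    have "X (Suc n) +>\<^bsub>M\<^esub> (r \<bullet> v) = X (Suc n)" if r: "r \<in> ipow (Suc i)" and v: "v \<in> forms x (n - i)" for r v
      using X_mult[OF r, of v "n - i"] rep[OF v] i X_carrier by (intro X_coset_eq_self_iff[THEN iffD2]) auto
    then show ?thesis using nonempty ipow_zero[of "Suc i"] False unfolding cl by (subst UN_eq_const UN_eq_const) auto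
  qed
  interpret C: abelian_group "GC n" by (rule abelian_group_GC)
  have cc: "?c i \<in> carrier (GC n)" if "s = i" "i \<le> n" for i
    using X_mult[OF f xX, of "n - i"] that by (simp add: GC_simps)
  have "gr_smult R I M (gr_class R I s f) (forms x) n
      = (\<Oplus>\<^bsub>GC n\<^esub>i\<in>{..n}. if s = i then ?c s else \<zero>\<^bsub>GC n\<^esub>)"
    unfolding gr_smult_def using cc C.zero_closed summand
    by (intro C.finsum_cong') (auto simp: GC_simps(2))
  also have "\<dots> = (if s \<le> n then ?c s else \<zero>\<^bsub>GC n\<^esub>)"
  proof (cases "s \<le> n")
    case True
    then show ?thesis
      using C.finsum_singleton[of s "{..n}" "\<lambda>_. ?c s"] cc[OF refl True] by simp
  next
    case False
    then have "(\<Oplus>\<^bsub>GC n\<^esub>i\<in>{..n}. if s = i then ?c s else \<zero>\<^bsub>GC n\<^esub>) = (\<Oplus>\<^bsub>GC n\<^esub>i\<in>{..n}. \<zero>\<^bsub>GC n\<^esub>)"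
      by (intro C.finsum_cong') auto
    then show ?thesis using False by simp
  qed
  also have "\<dots> = forms (hom_ring s f \<odot>\<^bsub>BM\<^esub> x) n"
    by (simp add: forms_def hom_ring_smult[OF f x] GC_simps X_coset_zero)
  finally show "gr_smult R I M (gr_class R I s f) (forms x) n = forms (hom_ring s f \<odot>\<^bsub>BM\<^esub> x) n" .
qed

end

context form_on_module
begin

abbreviation GK where "GK \<equiv> gr_multiples R I M s f"

lemma GK_eq: "GK = forms ` multiples BM ft"
proof -
  have "GK = (\<lambda>x. gr_smult R I M (gr_class R I s f) (forms x)) ` carrier BM"
    by (simp add: multiples_def carrier_GM image_image) (simp add: gr_module_def)
  also have "\<dots> = (\<lambda>x. forms (ft \<odot>\<^bsub>BM\<^esub> x)) ` carrier BM"
    using gr_smult_class[OF f] by (intro image_cong) auto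
  finally show ?thesis by (simp add: multiples_def image_image)
qed

lemma GK_cases:
  assumes "y \<in> GK" obtains x where "x \<in> carrier BM" "y = forms (ft \<odot>\<^bsub>BM\<^esub> x)"
  using assms unfolding GK_eq multiples_def[of BM] by blast

lemma GK_memI: "x \<in> carrier BM \<Longrightarrow> forms (ft \<odot>\<^bsub>BM\<^esub> x) \<in> GK"
  unfolding GK_eq multiples_def[of BM] by blast

lemma subgroup_GK: "subgroup_of_module GK GM"
proof -
  interpret B: module BB BM by (rule module_BM)
  interpret G: abelian_group GM by (rule abelian_group_GM)
  note ftB = hom_ring_BB[OF f]
  have mB: "multiples BM ft \<subseteq> carrier BM" using ftB by (auto simp: multiples_def)
  have "subgroup GK (add_monoid GM)"
  proof (rule G.add.subgroupI)
    show "GK \<subseteq> carrier GM" using mB unfolding GK_eq carrier_GM by blast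
    show "GK \<noteq> {}" using GK_memI[OF B.M.zero_closed] by blast
  next
    fix a assume "a \<in> GK"
    then obtain x where x: "x \<in> carrier BM" "a = forms (ft \<odot>\<^bsub>BM\<^esub> x)" by (rule GK_cases)
    have "forms (ft \<odot>\<^bsub>BM\<^esub> (\<ominus>\<^bsub>BM\<^esub> x)) \<oplus>\<^bsub>GM\<^esub> a = \<zero>\<^bsub>GM\<^esub>"
      using x ftB by (simp add: forms_add B.smult_r_distr[symmetric] B.M.l_neg forms_zero)
    then have "\<ominus>\<^bsub>GM\<^esub> a = forms (ft \<odot>\<^bsub>BM\<^esub> (\<ominus>\<^bsub>BM\<^esub> x))"
      using x ftB forms_GM by (intro G.minus_equality) simp_all
    then show "\<ominus>\<^bsub>GM\<^esub> a \<in> GK"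
      using x GK_memI[of "\<ominus>\<^bsub>BM\<^esub> x"] by simp
  next
    fix a b assume "a \<in> GK" "b \<in> GK"
    then obtain x y where xy: "x \<in> carrier BM" "a = forms (ft \<odot>\<^bsub>BM\<^esub> x)" "y \<in> carrier BM" "b = forms (ft \<odot>\<^bsub>BM\<^esub> y)"
      using GK_cases by metis
    then have "a \<oplus>\<^bsub>GM\<^esub> b = forms (ft \<odot>\<^bsub>BM\<^esub> (x \<oplus>\<^bsub>BM\<^esub> y))"
      using ftB by (simp add: forms_add B.smult_r_distr)
    then show "a \<oplus>\<^bsub>GM\<^esub> b \<in> GK" using xy GK_memI[of "x \<oplus>\<^bsub>BM\<^esub> y"] by simp
  qed
  then show ?thesis
    by (intro subgroup_of_module.intro abelian_subgroupI3 additive_subgroupI abelian_group_GM)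
qed

lemma forms_in_GK_iff:
  assumes x: "x \<in> X n"
  shows "forms (hom_module n x) \<in> GK \<longleftrightarrow> (\<exists>z\<in>Z n. x \<ominus>\<^sub>M z \<in> X (Suc n))"
proof
  note ftB = hom_ring_BB[OF f]
  interpret B: module BB BM by (rule module_BM)
  assume "forms (hom_module n x) \<in> GK"
  then obtain w where w: "w \<in> carrier BM" "forms (hom_module n x) = forms (ft \<odot>\<^bsub>BM\<^esub> w)"
    by (rule GK_cases)
  then have "hom_module n x n \<ominus>\<^sub>M (ft \<odot>\<^bsub>BM\<^esub> w) n \<in> X (Suc n)"
    using forms_eq_iff[OF hom_module_BM[OF x], of "ft \<odot>\<^bsub>BM\<^esub> w"] ftB by simp
  moreover have "(ft \<odot>\<^bsub>BM\<^esub> w) n \<in> Z n"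
    using BM_coeff[OF w(1)] by (simp add: hom_ring_smult[OF f w(1)] Z_def)
  ultimately show "\<exists>z\<in>Z n. x \<ominus>\<^sub>M z \<in> X (Suc n)" by (auto simp: hom_module_def)
next
  assume "\<exists>z\<in>Z n. x \<ominus>\<^sub>M z \<in> X (Suc n)"
  then obtain z where z: "z \<in> Z n" "x \<ominus>\<^sub>M z \<in> X (Suc n)" by blast
  have zX: "z \<in> X n" using z(1) Z_subset_X by blast
  have "forms (hom_module n x) = forms (hom_module n z)"
    unfolding forms_eq_iff[OF hom_module_BM[OF x] hom_module_BM[OF zX]]
    using z(2) X_zero by (simp add: hom_module_def a_minus_def M.r_neg)
  then show "forms (hom_module n x) \<in> GK" using z(1) ft_hom_module[OF zX] by (simp add: GK_eq)
qed

abbreviation MQ where "MQ \<equiv> quot_module M fM"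
abbreviation \<pi> where "\<pi> x \<equiv> fM +>\<^bsub>M\<^esub> x"

lemma ideal_module_MQ: "ideal_module R MQ I"
  by (intro ideal_module.intro module_quot_module[OF submodule_fM] ideal_module_axioms.intro I)

lemma \<pi>_simps:
  "x \<in> carrier M \<Longrightarrow> \<pi> x \<in> carrier MQ"
  "\<lbrakk>x \<in> carrier M; y \<in> carrier M\<rbrakk> \<Longrightarrow> \<pi> x \<oplus>\<^bsub>MQ\<^esub> \<pi> y = \<pi> (x \<oplus>\<^sub>M y)"
  "\<lbrakk>r \<in> carrier R; x \<in> carrier M\<rbrakk> \<Longrightarrow> r \<odot>\<^bsub>MQ\<^esub> \<pi> x = \<pi> (r \<bullet> x)"
  "x \<in> fM \<Longrightarrow> \<pi> x = \<zero>\<^bsub>MQ\<^esub>"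
  "\<lbrakk>x \<in> carrier M; y \<in> carrier M\<rbrakk> \<Longrightarrow> \<pi> x \<ominus>\<^bsub>MQ\<^esub> \<pi> y = \<pi> (x \<ominus>\<^sub>M y)"
proof -
  interpret S: subgroup_of_module fM M by (rule subgroup_of_module_submodule[OF submodule_fM])
  interpret Q: module R MQ by (rule module_quot_module[OF submodule_fM])
  show c: "\<pi> x \<in> carrier MQ" if "x \<in> carrier M" for x using that by (auto simp: carrier_quot_module)
  show a: "\<pi> x \<oplus>\<^bsub>MQ\<^esub> \<pi> y = \<pi> (x \<oplus>\<^sub>M y)" if "x \<in> carrier M" "y \<in> carrier M" for x y
    using S.quot_module_add[OF that] .
  show "r \<odot>\<^bsub>MQ\<^esub> \<pi> x = \<pi> (r \<bullet> x)" if "r \<in> carrier R" "x \<in> carrier M" for r x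
    using quot_module_smult_submodule[OF submodule_fM that] .
  show z: "\<pi> x = \<zero>\<^bsub>MQ\<^esub>" if "x \<in> fM" for x
    using S.coset_eq_self_iff[of x] that submoduleE(1)[OF submodule_fM] by auto
  show "\<pi> x \<ominus>\<^bsub>MQ\<^esub> \<pi> y = \<pi> (x \<ominus>\<^sub>M y)" if xy: "x \<in> carrier M" "y \<in> carrier M" for x y
  proof -
    have "\<pi> (\<ominus>\<^sub>M y) \<oplus>\<^bsub>MQ\<^esub> \<pi> y = \<zero>\<^bsub>MQ\<^esub>"
      using xy a[of "\<ominus>\<^sub>M y" y] z[OF submodule_zero[OF submodule_fM]] by (simp add: M.l_neg)
    then have "\<ominus>\<^bsub>MQ\<^esub> \<pi> y = \<pi> (\<ominus>\<^sub>M y)" using xy c by (intro Q.M.minus_equality) simp_all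
    then show ?thesis using xy a[of x "\<ominus>\<^sub>M y"] by (simp add: a_minus_def)
  qed
qed

lemma power_submodule_MQ: "power_submodule R I MQ n = \<pi> ` X n"
proof
  interpret Q: ideal_module R MQ I by (rule ideal_module_MQ)
  show "power_submodule R I MQ n \<subseteq> \<pi> ` X n"
  proof (rule Q.power_submodule_least)
    show "submodule (\<pi> ` X n) R MQ"
    proof (rule Q.submodule_intro)
      show "\<pi> ` X n \<subseteq> carrier MQ" using X_carrier \<pi>_simps(1) by blast
      show "\<zero>\<^bsub>MQ\<^esub> \<in> \<pi> ` X n"
        using \<pi>_simps(4)[OF submodule_zero[OF submodule_fM]] X_zero by (metis imageI)
      show "a \<oplus>\<^bsub>MQ\<^esub> b \<in> \<pi> ` X n" if "a \<in> \<pi> ` X n" "b \<in> \<pi> ` X n" for a b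
        using that X_add X_carrier by (auto simp: \<pi>_simps(2))
      show "r \<odot>\<^bsub>MQ\<^esub> a \<in> \<pi> ` X n" if "r \<in> carrier R" "a \<in> \<pi> ` X n" for r a
        using that X_smult X_carrier by (auto simp: \<pi>_simps(3))
    qed
    fix a x assume a: "a \<in> ipow n" and "x \<in> carrier MQ"
    then obtain y where y: "y \<in> carrier M" "x = \<pi> y" by (auto simp: carrier_quot_module)
    have "a \<odot>\<^bsub>MQ\<^esub> x = \<pi> (a \<bullet> y)" using y a ideal_power_carrier by (simp add: \<pi>_simps(3))
    then show "a \<odot>\<^bsub>MQ\<^esub> x \<in> \<pi> ` X n" using power_submodule_gen[OF a y(1)] by blast
  qed
  have "X n \<subseteq> {x \<in> carrier M. \<pi> x \<in> Q.X n}"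
  proof (rule power_submodule_least)
    show "submodule {x \<in> carrier M. \<pi> x \<in> Q.X n} R M"
      using Q.X_zero Q.X_add Q.X_smult \<pi>_simps(4)[OF submodule_zero[OF submodule_fM]]
      by (intro submodule_intro) (auto simp: \<pi>_simps(2,3)[symmetric])
    show "a \<bullet> x \<in> {x \<in> carrier M. \<pi> x \<in> Q.X n}" if a: "a \<in> ipow n" and x: "x \<in> carrier M" for a x
      using Q.power_submodule_gen[OF a \<pi>_simps(1)[OF x]] x ideal_power_carrier[OF a] by (simp add: \<pi>_simps(3))
  qed
  then show "\<pi> ` X n \<subseteq> power_submodule R I MQ n" by blast
qed

text \<open>The map is additive and surjective, and sends the class of \<open>x \<in> X n\<close> to that of its residue modulo \<open>fM\<close>. So it is an
  isomorphism if and only if it is injective. The residue of \<open>x\<close> has zero class exactly if \<open>x\<close> is congruent modulo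
  \<open>X (n + 1)\<close> to an element of \<open>fM \<inter> X n\<close>, and the class of \<open>x\<close> is a multiple of that of \<open>f\<close> exactly if \<open>x\<close> is
  congruent to an element of \<open>Z n\<close>.\<close>

theorem gr_natural_map_iso_iff:
  "gr_natural_map R I M f \<in> iso (add_monoid (gr_quot_component R I M s f n)) (add_monoid (gr_of_quot_component R I M f n))
    \<longleftrightarrow> initial_forms_generate n"
proof -
  interpret Q: ideal_module R MQ I by (rule ideal_module_MQ)
  interpret B: module BB BM by (rule module_BM)
  interpret GK: subgroup_of_module GK GM by (rule subgroup_GK)
  note ftB = hom_ring_BB[OF f]
  have QX: "Q.X k = \<pi> ` X k" for k by (rule power_submodule_MQ)
  let ?e = "\<lambda>x. forms (hom_module n x)"
  let ?c = "\<lambda>x. GK +>\<^bsub>GM\<^esub> ?e x"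
  let ?e' = "\<lambda>x. Q.forms (Q.hom_module n (\<pi> x))"
  let ?\<phi> = "gr_natural_map R I M f"
  let ?A = "gr_quot_component R I M s f n" and ?B = "gr_of_quot_component R I M f n"
  have A: "carrier ?A = ?c ` X n"
    by (simp add: gr_quot_component_def hom_degree image_image)
  have B: "carrier ?B = ?e' ` X n"
    by (simp add: gr_of_quot_component_def Q.hom_degree image_image QX)
  have eGM: "?e x \<in> carrier GM" if "x \<in> X n" for x by (rule forms_GM[OF hom_module_BM[OF that]])
  have addA: "?c x \<oplus>\<^bsub>?A\<^esub> ?c y = ?c (x \<oplus>\<^sub>M y)" if x: "x \<in> X n" and y: "y \<in> X n" for x y
    using GK.quot_module_add[OF eGM[OF x] eGM[OF y]] hom_module_BM[OF x] hom_module_BM[OF y]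
    by (simp add: gr_quot_component_def forms_add hom_module_add[OF x y])
  have \<pi>X: "\<pi> x \<in> Q.X n" if "x \<in> X n" for x using that QX by blast
  have addB: "?e' x \<oplus>\<^bsub>?B\<^esub> ?e' y = ?e' (x \<oplus>\<^sub>M y)" if x: "x \<in> X n" and y: "y \<in> X n" for x y
    using Q.forms_add[OF Q.hom_module_BM[OF \<pi>X[OF x]] Q.hom_module_BM[OF \<pi>X[OF y]]] Q.hom_module_add[OF \<pi>X[OF x] \<pi>X[OF y]]
      X_carrier[OF x] X_carrier[OF y]
    by (simp add: gr_of_quot_component_def \<pi>_simps(2))
  have gr_map: "gr_map R I MQ \<pi> (forms w) = Q.forms (\<lambda>k. \<pi> (w k))" if w: "w \<in> carrier BM" for w
  proof
    fix k
    have "Q.X (Suc k) +>\<^bsub>MQ\<^esub> \<pi> v = Q.X (Suc k) +>\<^bsub>MQ\<^esub> \<pi> (w k)" if "v \<in> forms w k" for v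
    proof -
      have "v \<in> X (Suc k) +>\<^bsub>M\<^esub> w k" using that by (simp add: forms_def)
      then obtain u where u: "u \<in> X (Suc k)" "v = u \<oplus>\<^sub>M w k" by (rule X_coset_cases)
      have "\<pi> v = \<pi> u \<oplus>\<^bsub>MQ\<^esub> \<pi> (w k)" using u X_carrier[OF u(1)] BM_coeff_M[OF w] by (simp add: \<pi>_simps(2))
      then show ?thesis using Q.X_coset_absorb[of "\<pi> u" "Suc k"] u(1) QX \<pi>_simps(1)[OF BM_coeff_M[OF w]] by simp
    qed
    moreover have "forms w k \<noteq> {}" unfolding forms_def by (rule X_coset_nonempty[OF BM_coeff_M[OF w]])
    ultimately show "gr_map R I MQ \<pi> (forms w) k = Q.forms (\<lambda>k. \<pi> (w k)) k"
      by (simp add: gr_map_def Q.forms_def UN_eq_const)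
  qed
  have \<phi>: "?\<phi> (?c x) = ?e' x" if x: "x \<in> X n" for x
  proof -
    have "gr_map R I MQ \<pi> y = ?e' x" if y: "y \<in> ?c x" for y
    proof -
      obtain g where "g \<in> GK" and g: "y = g \<oplus>\<^bsub>GM\<^esub> ?e x" using y unfolding a_r_coset_def' by blast
      then obtain w where w: "w \<in> carrier BM" "g = forms (ft \<odot>\<^bsub>BM\<^esub> w)" by (elim GK_cases)
      have fw: "ft \<odot>\<^bsub>BM\<^esub> w \<in> carrier BM" using ftB w(1) by simp
      have "y = forms (ft \<odot>\<^bsub>BM\<^esub> w \<oplus>\<^bsub>BM\<^esub> hom_module n x)"
        unfolding g w(2) by (rule forms_add[OF fw hom_module_BM[OF x]])
      then have "gr_map R I MQ \<pi> y = Q.forms (\<lambda>k. \<pi> ((ft \<odot>\<^bsub>BM\<^esub> w \<oplus>\<^bsub>BM\<^esub> hom_module n x) k))"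
        using gr_map fw hom_module_BM[OF x] by simp
      also have "(\<lambda>k. \<pi> ((ft \<odot>\<^bsub>BM\<^esub> w \<oplus>\<^bsub>BM\<^esub> hom_module n x) k)) = Q.hom_module n (\<pi> x)"
      proof
        fix k
        have "(ft \<odot>\<^bsub>BM\<^esub> w) k \<in> fM"
          using BM_coeff_M[OF w(1)] submodule_zero[OF submodule_fM] by (simp add: hom_ring_smult[OF f w(1)] multiples_def)
        then have "\<pi> ((ft \<odot>\<^bsub>BM\<^esub> w) k \<oplus>\<^sub>M hom_module n x k) = \<zero>\<^bsub>MQ\<^esub> \<oplus>\<^bsub>MQ\<^esub> \<pi> (hom_module n x k)"
          using \<pi>_simps(2)[of "(ft \<odot>\<^bsub>BM\<^esub> w) k" "hom_module n x k"] \<pi>_simps(4)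
            BM_coeff_M[OF fw] BM_coeff_M[OF hom_module_BM[OF x]] by simp
        also have "\<dots> = \<pi> (hom_module n x k)" by (intro Q.M.l_zero \<pi>_simps(1) BM_coeff_M[OF hom_module_BM[OF x]])
        also have "\<dots> = Q.hom_module n (\<pi> x) k"
          using \<pi>_simps(4)[OF submodule_zero[OF submodule_fM]] by (simp add: hom_module_def Q.hom_module_def)
        finally show "\<pi> ((ft \<odot>\<^bsub>BM\<^esub> w \<oplus>\<^bsub>BM\<^esub> hom_module n x) k) = Q.hom_module n (\<pi> x) k" by (simp add: BM_simps)
      qed
      finally show ?thesis .
    qed
    moreover have "?c x \<noteq> {}" using GK.a_rcos_self[OF eGM[OF x]] by blast
    ultimately show ?thesis unfolding gr_natural_map_def by (intro the_elem_image_const)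
  qed
  have c_eq: "?c x = ?c y \<longleftrightarrow> (\<exists>z\<in>Z n. (x \<ominus>\<^sub>M y) \<ominus>\<^sub>M z \<in> X (Suc n))" if x: "x \<in> X n" and y: "y \<in> X n" for x y
  proof -
    have my: "\<ominus>\<^sub>M y \<in> X n" using submoduleE(3)[OF submodule_X y] .
    have "?e (\<ominus>\<^sub>M y) \<oplus>\<^bsub>GM\<^esub> ?e y = \<zero>\<^bsub>GM\<^esub>"
      using y my X_carrier[OF y]
      by (simp add: forms_add hom_module_BM hom_module_add M.l_neg hom_module_zero forms_zero)
    then have "\<ominus>\<^bsub>GM\<^esub> ?e y = ?e (\<ominus>\<^sub>M y)" using eGM y my by (intro GK.minus_equality) simp_all
    then have "?e x \<ominus>\<^bsub>GM\<^esub> ?e y = ?e (x \<ominus>\<^sub>M y)"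
      using x my by (simp add: a_minus_def forms_add hom_module_BM hom_module_add)
    then show ?thesis
      using GK.coset_eq_iff[OF eGM[OF x] eGM[OF y]] forms_in_GK_iff[OF X_minus[OF x y]] by simp
  qed
  have e'_eq: "?e' x = ?e' y \<longleftrightarrow> (\<exists>g\<in>fM \<inter> X n. (x \<ominus>\<^sub>M y) \<ominus>\<^sub>M g \<in> X (Suc n))" if x: "x \<in> X n" and y: "y \<in> X n" for x y
  proof -
    note c = X_carrier[OF x] X_carrier[OF y]
    interpret S: subgroup_of_module fM M by (rule subgroup_of_module_submodule[OF submodule_fM])
    have "?e' x = ?e' y \<longleftrightarrow> \<pi> (x \<ominus>\<^sub>M y) \<in> \<pi> ` X (Suc n)"
    proof -
      have "\<zero>\<^bsub>MQ\<^esub> \<ominus>\<^bsub>MQ\<^esub> \<zero>\<^bsub>MQ\<^esub> = \<zero>\<^bsub>MQ\<^esub>"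
        unfolding a_minus_def by (rule Q.M.r_neg[OF Q.M.zero_closed])
      then have "Q.hom_module n (\<pi> x) k \<ominus>\<^bsub>MQ\<^esub> Q.hom_module n (\<pi> y) k
          = (if k = n then \<pi> (x \<ominus>\<^sub>M y) else \<zero>\<^bsub>MQ\<^esub>)" for k
        using \<pi>_simps(5)[OF c] unfolding Q.hom_module_def by (cases "k = n") simp_all
      then show ?thesis
        unfolding Q.forms_eq_iff[OF Q.hom_module_BM[OF \<pi>X[OF x]] Q.hom_module_BM[OF \<pi>X[OF y]]] QX[symmetric]
        using Q.X_zero by (simp del: zero_quot_module)
    qed
    also have "\<dots> \<longleftrightarrow> (\<exists>v\<in>X (Suc n). (x \<ominus>\<^sub>M y) \<ominus>\<^sub>M v \<in> fM)"
      using S.coset_eq_iff[of "x \<ominus>\<^sub>M y"] c X_carrier by (auto simp: image_iff)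
    also have "\<dots> \<longleftrightarrow> (\<exists>g\<in>fM \<inter> X n. (x \<ominus>\<^sub>M y) \<ominus>\<^sub>M g \<in> X (Suc n))" (is "?l \<longleftrightarrow> ?r")
    proof -
      have sub_sub: "t \<ominus>\<^sub>M (t \<ominus>\<^sub>M v) = v" if "t \<in> carrier M" "v \<in> carrier M" for t v
        using that by (simp add: a_minus_def M.minus_add M.a_assoc[symmetric] M.r_neg)
      have t: "x \<ominus>\<^sub>M y \<in> X n" by (rule X_minus[OF x y])
      note tc = X_carrier[OF t]
      show ?thesis
      proof
        assume ?l
        then obtain v where v: "v \<in> X (Suc n)" "(x \<ominus>\<^sub>M y) \<ominus>\<^sub>M v \<in> fM" by blast
        have "v \<in> X n" using v(1) X_Suc_subset by blast
        then show ?r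
          using v X_minus[OF t] sub_sub[OF tc X_carrier[OF v(1)]] by (intro bexI[of _ "(x \<ominus>\<^sub>M y) \<ominus>\<^sub>M v"]) auto
      next
        assume ?r
        then obtain g where g: "g \<in> fM" "g \<in> X n" "(x \<ominus>\<^sub>M y) \<ominus>\<^sub>M g \<in> X (Suc n)" by blast
        then show ?l using sub_sub[OF tc X_carrier[OF g(2)]] by (intro bexI[of _ "(x \<ominus>\<^sub>M y) \<ominus>\<^sub>M g"]) auto
      qed
    qed
    finally show ?thesis .
  qed
  have "?\<phi> \<in> hom (add_monoid ?A) (add_monoid ?B)"
    using \<phi> addA addB X_add by (auto simp: hom_def A B)
  moreover have "?\<phi> ` carrier ?A = carrier ?B" using \<phi> by (simp add: A B image_image)
  ultimately have "?\<phi> \<in> iso (add_monoid ?A) (add_monoid ?B) \<longleftrightarrow> inj_on ?\<phi> (carrier ?A)"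
    by (simp add: iso_def bij_betw_def)
  also have "\<dots> \<longleftrightarrow> (\<forall>x\<in>X n. \<forall>y\<in>X n. ?e' x = ?e' y \<longrightarrow> ?c x = ?c y)"
    using \<phi> by (auto simp: A inj_on_def)
  also have "\<dots> \<longleftrightarrow> (\<forall>t\<in>X n. (\<exists>g\<in>fM \<inter> X n. t \<ominus>\<^sub>M g \<in> X (Suc n)) \<longrightarrow> (\<exists>z\<in>Z n. t \<ominus>\<^sub>M z \<in> X (Suc n)))" (is "?l \<longleftrightarrow> ?r")
  proof
    assume l: ?l
    show ?r
    proof (intro ballI impI)
      fix t assume t: "t \<in> X n" and g: "\<exists>g\<in>fM \<inter> X n. t \<ominus>\<^sub>M g \<in> X (Suc n)"
      have t0: "t \<ominus>\<^sub>M \<zero>\<^sub>M = t" using X_carrier[OF t] by (simp add: a_minus_def)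
      show "\<exists>z\<in>Z n. t \<ominus>\<^sub>M z \<in> X (Suc n)"
        using l[THEN bspec, OF t, THEN bspec, OF X_zero] g unfolding e'_eq[OF t X_zero] c_eq[OF t X_zero] t0 by blast
    qed
  next
    assume r: ?r
    show ?l
    proof (intro ballI impI)
      fix x y assume x: "x \<in> X n" and y: "y \<in> X n" and "?e' x = ?e' y"
      then show "?c x = ?c y"
        using r[THEN bspec, OF X_minus[OF x y]] unfolding e'_eq[OF x y] c_eq[OF x y] by blast
    qed
  qed
  also have "\<dots> \<longleftrightarrow> initial_forms_generate n"
    unfolding initial_forms_generate_def
  proof (intro iffI ballI impI)
    fix x assume h: "\<forall>t\<in>X n. (\<exists>g\<in>fM \<inter> X n. t \<ominus>\<^sub>M g \<in> X (Suc n)) \<longrightarrow> (\<exists>z\<in>Z n. t \<ominus>\<^sub>M z \<in> X (Suc n))"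
      and x: "x \<in> fM \<inter> X n"
    have "x \<ominus>\<^sub>M x \<in> X (Suc n)" using X_carrier[of x n] x X_zero by (simp add: a_minus_def M.r_neg)
    then show "\<exists>z\<in>Z n. x \<ominus>\<^sub>M z \<in> X (Suc n)" using h x by blast
  next
    fix t assume h: "\<forall>x\<in>fM \<inter> X n. \<exists>z\<in>Z n. x \<ominus>\<^sub>M z \<in> X (Suc n)"
      and t: "t \<in> X n" and "\<exists>g\<in>fM \<inter> X n. t \<ominus>\<^sub>M g \<in> X (Suc n)"
    then obtain g where g: "g \<in> fM \<inter> X n" "t \<ominus>\<^sub>M g \<in> X (Suc n)" by blast
    obtain z where z: "z \<in> Z n" "g \<ominus>\<^sub>M z \<in> X (Suc n)" using h g(1) by blast
    have "(t \<ominus>\<^sub>M g) \<oplus>\<^sub>M (g \<ominus>\<^sub>M z) = t \<ominus>\<^sub>M z"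
    proof -
      have c: "t \<in> carrier M" "g \<in> carrier M" "z \<in> carrier M" using X_carrier t g(1) Z_carrier[OF z(1)] by auto
      then have "(t \<ominus>\<^sub>M g) \<oplus>\<^sub>M (g \<ominus>\<^sub>M z) = t \<oplus>\<^sub>M (\<ominus>\<^sub>M g \<oplus>\<^sub>M (g \<oplus>\<^sub>M \<ominus>\<^sub>M z))"
        by (simp add: a_minus_def M.a_assoc)
      also have "\<ominus>\<^sub>M g \<oplus>\<^sub>M (g \<oplus>\<^sub>M \<ominus>\<^sub>M z) = \<ominus>\<^sub>M z" using c by (simp add: M.a_assoc[symmetric] M.l_neg)
      finally show ?thesis by (simp add: a_minus_def)
    qed
    then show "\<exists>z\<in>Z n. t \<ominus>\<^sub>M z \<in> X (Suc n)" using X_add[OF g(2) z(2)] z(1) by auto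
  qed
  finally show ?thesis .
qed

end


text \<open>Both conditions say that the multiples of \<open>f\<close> in \<open>I\<^sup>nM\<close> are generated by those of \<open>f I\<^sup>n\<^sup>-\<^sup>sM\<close> modulo
  \<open>I\<^sup>n\<^sup>+\<^sup>1M\<close> for all large \<open>n\<close>.\<close>

theorem lemma5p2:
  fixes R :: "('a, 'r) ring_scheme"
    and M :: "('a, 'b, 'm) module_scheme"
    and I :: "'a set" and f :: 'a and s :: nat
  assumes "cring R" and "noetherian_ring R"
    and "ideal I R"
    and "Module.module R M" and "finitely_generated_module R M"
    and "f \<in> ideal_power R I s - ideal_power R I (Suc s)"
  shows
    "(\<exists>n0. \<forall>n\<ge>n0. gr_natural_map R I M f
        \<in> iso (add_monoid (gr_quot_component R I M s f n))
              (add_monoid (gr_of_quot_component R I M f n)))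
     \<longleftrightarrow>
     associated_points (blowup_topology R I) (blowup_structure_sheaf R I)
        (rees_sheaf_on_weak_transform R I M s f) \<inter> exceptional_support R I = {}"
proof -
  interpret form_on_module R M I f s
    using assms by (intro form_on_module.intro ideal_module.intro ideal_module_axioms.intro form_on_module_axioms.intro) auto
  show ?thesis
    unfolding gr_natural_map_iso_iff by (rule eventually_initial_forms_generate_iff)
qed

end
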